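(* Let $(\mathbb{C},g)$ be a flat singular Riemann surface with conical singular points $p_1,\dots,p_n$ of orders $-1<\beta_1\le\cdots\le\beta_n<0$, respectively. Let $\gamma\colon[0,1]\to\mathbb{C}$ be a $C^\infty$-smooth closed embedded curve passing through the (distinct) singular points $p_1,\dots,p_m$, $m\le n$, and containing the rest of the singular points in its interior. Then the enclosed areas $\mathcal{A}(t)$ of the evolved curves under the degenerate curve shortening flow starting at $\gamma$ satisfy $$\mathcal{A}_t(t)=-2\pi-\sum_{j=1}^m(\pi-\alpha_j(t))\beta_j+\sum_{j=1}^m\alpha_j(t)-2\pi\sum_{j=m+1}^n\beta_j,$$ where $\alpha_1(t),\dots,\alpha_m(t)$ are the (time dependent) exterior angles of the evolved curves formed at the singular points $p_1,\dots,p_m$.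
   Context: Here $g$ is a metric on $\mathbb{C}$, conformal to the Euclidean metric $|dz|^2$, smooth with zero Gauss curvature away from $p_1,\dots,p_n$, and $p_j$ is a conical singular point of order $\beta_j$: there is a complex coordinate $\zeta$ near $p_j$ with $\zeta(p_j)=0$ and $g=|\zeta|^{2\beta_j}|d\zeta|^2$ (for example $g=|z-p_1|^{2\beta_1}\cdots|z-p_n|^{2\beta_n}|dz|^2$). Areas are measured with respect to $g$; exterior angles are measured with respect to the Euclidean metric (the interior angle at $p_j$ is $\pi-\alpha_j$). Degenerate curve shortening flow starting at $\gamma$: each arc of $\gamma$ joining two consecutive singular points on the curve (or the loop, if $m=1$) is evolved, for a short time, as a graph over itself, keeping its endpoints fixed at the singular points. That is, $\Gamma\colon[0,1]\times[0,T]\to\mathbb{C}$ is continuous with $\Gamma(\cdot,0)=\gamma$ and $\Gamma(s,t)=\gamma(s)$ whenever $\gamma(s)$ is singular; on each such arc it is $C^1$ up to the endpoints and up to $t=0,T$, and $C^\infty$ in the interior of the arc for $0<t<T$; and $(\Gamma_t)^\perp=\mathbf{k}_g$, where $\perp$ is the normal projection and $\mathbf{k}_g=\nabla_{\tau_g}\tau_g$ is the geodesic curvature vector of the evolved curve with respect to $g$ ($\tau_g$ the $g$-unit tangent; at singular points the equation is understood via limits). The statement concerns the times at which this flow exists. *)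

theory Defs
  imports "HOL-Complex_Analysis.Complex_Analysis"
begin

section \<open>Smoothness\<close>

fun Ck_on :: "'a::real_normed_vector set \<Rightarrow> ('a \<Rightarrow> 'b::real_normed_vector) \<Rightarrow> nat \<Rightarrow> bool" where
  "Ck_on S f 0 \<longleftrightarrow> continuous_on S f"
| "Ck_on S f (Suc k) \<longleftrightarrow>
     (\<forall>x\<in>S. f differentiable (at x)) \<and>
     (\<forall>v. Ck_on S (\<lambda>x. frechet_derivative f (at x) v) k)"

text \<open>Meant for open \<open>S\<close>.\<close>

definition smooth_on :: "'a::real_normed_vector set \<Rightarrow> ('a \<Rightarrow> 'b::real_normed_vector) \<Rightarrow> bool" where
  "smooth_on S f \<longleftrightarrow> (\<forall>k. Ck_on S f k)"

text \<open>\<open>C\<^sup>1\<close> up to the boundary; meant for non-degenerate closed rectangles \<open>R\<close>, on which the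
  derivative within \<open>R\<close> is unique.\<close>

definition C1_upto_boundary ::
    "'a::real_normed_vector set \<Rightarrow> ('a \<Rightarrow> 'b::real_normed_vector) \<Rightarrow> bool" where
  "C1_upto_boundary R f \<longleftrightarrow>
     (\<exists>f' :: 'a \<Rightarrow> 'a \<Rightarrow>\<^sub>L 'b.
        (\<forall>x\<in>R. (f has_derivative blinfun_apply (f' x)) (at x within R)) \<and> continuous_on R f')"


section \<open>Conformal metrics on the plane\<close>

text \<open>A metric \<open>g\<close> conformal to the Euclidean one is given by its density \<open>\<rho>\<close>: \<open>g = \<rho> |dz|\<^sup>2\<close>.
  The values of \<open>\<rho>\<close> at the singular points are irrelevant.\<close>

definition g_inner :: "(complex \<Rightarrow> real) \<Rightarrow> complex \<Rightarrow> complex \<Rightarrow> complex \<Rightarrow> real" where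
  "g_inner \<rho> z X Y = \<rho> z * (X \<bullet> Y)"

definition g_norm :: "(complex \<Rightarrow> real) \<Rightarrow> complex \<Rightarrow> complex \<Rightarrow> real" where
  "g_norm \<rho> z X = sqrt (g_inner \<rho> z X X)"

definition g_area :: "(complex \<Rightarrow> real) \<Rightarrow> complex set \<Rightarrow> real" where
  "g_area \<rho> U = (LINT z:U|lborel. \<rho> z)"

definition laplacian :: "(complex \<Rightarrow> real) \<Rightarrow> complex \<Rightarrow> real" where
  "laplacian f z = (\<Sum>b\<in>Basis. frechet_derivative (\<lambda>w. frechet_derivative f (at w) b) (at z) b)"

text \<open>With \<open>\<rho> = e\<^bsup>2u\<^esup>\<close> this is the usual \<open>K = - e\<^bsup>-2u\<^esup> \<Delta>u\<close>.\<close>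

definition gauss_curvature :: "(complex \<Rightarrow> real) \<Rightarrow> complex \<Rightarrow> real" where
  "gauss_curvature \<rho> z = - laplacian (\<lambda>w. ln (\<rho> w)) z / (2 * \<rho> z)"

definition gradient :: "(complex \<Rightarrow> real) \<Rightarrow> complex \<Rightarrow> complex" where
  "gradient f z = Complex (frechet_derivative f (at z) 1) (frechet_derivative f (at z) \<i>)"

text \<open>The Levi-Civita connection of \<open>\<rho> |dz|\<^sup>2\<close> is \<open>\<nabla>\<^sub>X Y = D\<^sub>X Y + christoffel \<rho> z X Y\<close>, since
  \<open>\<Gamma>\<^sup>k\<^sub>i\<^sub>j = (\<partial>\<^sub>i\<rho> \<delta>\<^sub>j\<^sub>k + \<partial>\<^sub>j\<rho> \<delta>\<^sub>i\<^sub>k - \<partial>\<^sub>k\<rho> \<delta>\<^sub>i\<^sub>j) / (2\<rho>)\<close>.\<close>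

definition christoffel :: "(complex \<Rightarrow> real) \<Rightarrow> complex \<Rightarrow> complex \<Rightarrow> complex \<Rightarrow> complex" where
  "christoffel \<rho> z X Y =
     (1 / (2 * \<rho> z)) *\<^sub>R
       ((gradient \<rho> z \<bullet> X) *\<^sub>R Y + (gradient \<rho> z \<bullet> Y) *\<^sub>R X - (X \<bullet> Y) *\<^sub>R gradient \<rho> z)"

text \<open>Covariant derivative \<open>\<nabla>\<close> of a vector field \<open>V\<close> along a curve \<open>c\<close>, in the direction \<open>c'\<close>.\<close>

definition cov_deriv :: "(complex \<Rightarrow> real) \<Rightarrow> (real \<Rightarrow> complex) \<Rightarrow> (real \<Rightarrow> complex) \<Rightarrow> real \<Rightarrow> complex" where
  "cov_deriv \<rho> c V s =
     vector_derivative V (at s) + christoffel \<rho> (c s) (vector_derivative c (at s)) (V s)"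

definition g_tangent :: "(complex \<Rightarrow> real) \<Rightarrow> (real \<Rightarrow> complex) \<Rightarrow> real \<Rightarrow> complex" where
  "g_tangent \<rho> c s =
     (1 / g_norm \<rho> (c s) (vector_derivative c (at s))) *\<^sub>R vector_derivative c (at s)"

text \<open>The factor in front turns the derivative in direction \<open>c'\<close> into that in direction
  \<open>\<tau>\<^sub>g = c' / |c'|\<^sub>g\<close>.\<close>

definition geodesic_curvature_vector ::
    "(complex \<Rightarrow> real) \<Rightarrow> (real \<Rightarrow> complex) \<Rightarrow> real \<Rightarrow> complex" where
  "geodesic_curvature_vector \<rho> c s =
     (1 / g_norm \<rho> (c s) (vector_derivative c (at s))) *\<^sub>R cov_deriv \<rho> c (g_tangent \<rho> c) s"

definition normal_part ::
    "(complex \<Rightarrow> real) \<Rightarrow> (real \<Rightarrow> complex) \<Rightarrow> real \<Rightarrow> complex \<Rightarrow> complex" where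
  "normal_part \<rho> c s V = V - g_inner \<rho> (c s) V (g_tangent \<rho> c s) *\<^sub>R g_tangent \<rho> c s"


section \<open>Flat metrics with conical singularities\<close>

text \<open>A complex coordinate \<open>\<zeta>\<close> centred at \<open>q\<close> in which \<open>g = |\<zeta>|\<^bsup>2b\<^esup> |d\<zeta>|\<^sup>2\<close>.\<close>

definition conical_point :: "(complex \<Rightarrow> real) \<Rightarrow> complex \<Rightarrow> real \<Rightarrow> bool" where
  "conical_point \<rho> q b \<longleftrightarrow>
     (\<exists>U \<zeta>. open U \<and> q \<in> U \<and> \<zeta> holomorphic_on U \<and> inj_on \<zeta> U \<and> \<zeta> q = 0 \<and>
        (\<forall>z\<in>U - {q}. \<rho> z = norm (\<zeta> z) powr (2 * b) * (norm (deriv \<zeta> z))\<^sup>2))"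

definition flat_conical_metric ::
    "(complex \<Rightarrow> real) \<Rightarrow> nat \<Rightarrow> (nat \<Rightarrow> complex) \<Rightarrow> (nat \<Rightarrow> real) \<Rightarrow> bool" where
  "flat_conical_metric \<rho> n p \<beta> \<longleftrightarrow>
     inj_on p {1..n} \<and>
     (\<forall>z. z \<notin> p ` {1..n} \<longrightarrow> \<rho> z > 0) \<and>
     smooth_on (- p ` {1..n}) \<rho> \<and>
     (\<forall>z. z \<notin> p ` {1..n} \<longrightarrow> gauss_curvature \<rho> z = 0) \<and>
     (\<forall>j\<in>{1..n}. conical_point \<rho> (p j) (\<beta> j))"


section \<open>Closed curves\<close>

text \<open>A closed curve on \<open>[0,1]\<close> is represented by its 1-periodic extension to the real line, so
  that smoothness includes the point where the curve closes up.\<close>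

definition smooth_closed_embedded :: "(real \<Rightarrow> complex) \<Rightarrow> bool" where
  "smooth_closed_embedded c \<longleftrightarrow>
     (\<forall>s. c (s + 1) = c s) \<and> smooth_on UNIV c \<and>
     (\<forall>s. vector_derivative c (at s) \<noteq> 0) \<and> simple_path c"

definition enclosed_region :: "(real \<Rightarrow> complex) \<Rightarrow> complex set" where
  "enclosed_region c = inside (path_image c)"

text \<open>For a simple closed curve: \<open>1\<close> if it runs counterclockwise, \<open>-1\<close> otherwise.\<close>

definition orientation_sign :: "(real \<Rightarrow> complex) \<Rightarrow> real" where
  "orientation_sign c = (if \<exists>z\<in>enclosed_region c. winding_number c z = 1 then 1 else - 1)"

text \<open>Quotient of the outgoing by the incoming tangent; its argument is the turning angle.\<close>

definition tangent_quotient :: "(real \<Rightarrow> complex) \<Rightarrow> real \<Rightarrow> complex" where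
  "tangent_quotient c s = vector_derivative c (at_right s) / vector_derivative c (at_left s)"

text \<open>The Euclidean exterior angle of a 1-periodic simple closed curve at its point \<open>q\<close>: the signed
  turning angle when the curve is run through counterclockwise. The sign makes it independent of
  the orientation of the parametrization, and the interior angle is always \<open>\<pi>\<close> minus it.\<close>

definition exterior_angle :: "(real \<Rightarrow> complex) \<Rightarrow> complex \<Rightarrow> real" where
  "exterior_angle c q =
     orientation_sign c * Arg (tangent_quotient c (THE s. s \<in> {0..<1} \<and> c s = q))"


section \<open>Degenerate curve shortening flow\<close>

text \<open>\<open>P\<close> is the set of all singular points of the metric. A parameter interval \<open>[a,b]\<close> is a
  singularity-free piece of \<open>\<gamma>\<close> if its interior avoids \<open>P\<close>; the arcs of \<open>\<gamma>\<close> between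
  consecutive singular points are the maximal ones (if \<open>\<gamma>\<close> avoids \<open>P\<close> altogether, the
  pieces cover the whole closed curve).\<close>

definition regular_piece :: "complex set \<Rightarrow> (real \<Rightarrow> complex) \<Rightarrow> real \<Rightarrow> real \<Rightarrow> bool" where
  "regular_piece P \<gamma> a b \<longleftrightarrow> a < b \<and> (\<forall>s\<in>{a<..<b}. \<gamma> s \<notin> P)"

text \<open>The fifth to eighth conditions are what it takes for the evolved curves to be closed embedded
  curves with corners at the same singular points: they meet no further singular points, they are
  simple, their arcs have non-vanishing (one-sided, at the ends) tangents, and consecutive arcs do
  not form a cusp. All of them hold as long as the arcs are graphs, small in \<open>C\<^sup>1\<close>, over those
  of \<open>\<gamma>\<close>. At a singular point the last condition, read as a limit, says that the curvature
  vector tends to \<open>0\<close>; this is automatic because \<open>\<Gamma>\<^sub>t\<close> is continuous up to there.\<close>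

definition degenerate_csf ::
    "(complex \<Rightarrow> real) \<Rightarrow> complex set \<Rightarrow> (real \<Rightarrow> complex) \<Rightarrow> real \<Rightarrow> (real \<Rightarrow> real \<Rightarrow> complex) \<Rightarrow> bool"
  where
  "degenerate_csf \<rho> P \<gamma> T \<Gamma> \<longleftrightarrow>
     (\<forall>t\<in>{0..T}. \<forall>s. \<Gamma> (s + 1) t = \<Gamma> s t) \<and>
     continuous_on (UNIV \<times> {0..T}) (\<lambda>(s, t). \<Gamma> s t) \<and>
     (\<forall>s. \<Gamma> s 0 = \<gamma> s) \<and>
     (\<forall>t\<in>{0..T}. \<forall>s. \<gamma> s \<in> P \<longrightarrow> \<Gamma> s t = \<gamma> s) \<and>
     (\<forall>t\<in>{0..T}. \<forall>s. \<gamma> s \<notin> P \<longrightarrow> \<Gamma> s t \<notin> P) \<and>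
     (\<forall>t\<in>{0..T}. simple_path (\<lambda>s. \<Gamma> s t)) \<and>
     (\<forall>a b. regular_piece P \<gamma> a b \<longrightarrow>
        (\<forall>t\<in>{0..T}. \<forall>s\<in>{a..b}. vector_derivative (\<lambda>s. \<Gamma> s t) (at s within {a..b}) \<noteq> 0)) \<and>
     (\<forall>t\<in>{0..T}. \<forall>s. \<gamma> s \<in> P \<longrightarrow> tangent_quotient (\<lambda>s. \<Gamma> s t) s \<notin> \<real>\<^sub>\<le>\<^sub>0) \<and>
     (\<forall>a b. regular_piece P \<gamma> a b \<longrightarrow>
        C1_upto_boundary ({a..b} \<times> {0..T}) (\<lambda>(s, t). \<Gamma> s t)) \<and>
     smooth_on ({s. \<gamma> s \<notin> P} \<times> {0<..<T}) (\<lambda>(s, t). \<Gamma> s t) \<and>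
     (\<forall>t\<in>{0<..<T}. \<forall>s. \<gamma> s \<notin> P \<longrightarrow>
        normal_part \<rho> (\<lambda>s. \<Gamma> s t) s (vector_derivative (\<lambda>t. \<Gamma> s t) (at t)) =
        geodesic_curvature_vector \<rho> (\<lambda>s. \<Gamma> s t) s)"

end

theory Submission
  imports Defs
begin

text \<open>Write \<open>\<rho> = e\<^bsup>2u\<^esup>\<close>. Flatness makes \<open>u\<^sub>x - \<i> u\<^sub>y\<close> holomorphic off the singular points, with simple
  poles of residue \<open>\<beta> j\<close> there, so it equals \<open>(\<Sum>j. \<beta> j / (z - p j)) + H'\<close> with \<open>H\<close> entire. The flow
  equation then says that the swept area density \<open>\<rho> Im (cnj \<Gamma>\<^sub>s \<Gamma>\<^sub>t)\<close> is the \<open>s\<close>-derivative of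
  \<open>W = arg \<Gamma>\<^sub>s + (\<Sum>j. \<beta> j arg (\<Gamma> - p j)) + Im H(\<Gamma>)\<close>. Hence \<open>A'\<close> is minus the total increment of \<open>W\<close>
  over the arcs of the positively oriented curve: the tangents contribute \<open>2\<pi>\<close> minus the sum of the
  exterior angles, \<open>arg (\<Gamma> - p j)\<close> contributes the interior angle at a corner and \<open>2\<pi>\<close> at an enclosed
  point, and \<open>Im H(\<Gamma>)\<close> contributes nothing.

  The angle identities hold for \<open>\<gamma>\<close> by Hopf's theorem and for the evolved curves because their
  defects are integer multiples of \<open>2\<pi>\<close> depending continuously on \<open>t\<close>. For a continuous density, the
  first variation of the area follows from Green's formula in the parameter rectangle, applied to
  regularised Cauchy transforms of the density; this needs no control of the second derivatives of
  \<open>\<Gamma>\<close> at the boundary. The actual density is unbounded at the corners, so it is first multiplied by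
  a cut-off, which is removed after integrating by parts along the arcs.\<close>

section \<open>Continuous arguments\<close>

text \<open>Two gaps in regularity shape everything. The flow is only C^1 up to the corners and up
  to \<open>t = 0\<close> and \<open>t = T\<close>, so the usual computation of the area derivative,
  which differentiates the tangent in time, is available in open rectangles only. Writing the area
  as density times winding number turns it into a contour integral of a Cauchy transform; in Green's
  formula for it the mixed second derivatives cancel and leave an integrand that is continuous on
  the closed rectangle. At a corner, \<open>\<rho>\<close> grows like the distance to the power
  \<open>2 * \<beta> j\<close>, possibly faster than the reciprocal distance, against a velocity
  that vanishes without a known rate, so the swept density need not be absolutely integrable along
  an arc. What survives is that its primitive \<open>W\<close> is continuous up to the corner, and
  the cut-off is chosen so that only this is used. Angles are principal arguments, so their
  continuity in \<open>t\<close> rests on the absence of cusps. The curve may run clockwise: the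
  sign \<open>\<sigma>\<close> enters the area variation and all angle sums, and cancels because it
  squares to 1.\<close>

lemma connected_Ints_valued_constant:
  fixes f :: "'a::topological_space \<Rightarrow> real"
  assumes "connected S" "continuous_on S f" "\<And>x. x \<in> S \<Longrightarrow> f x \<in> \<int>" "x \<in> S" "y \<in> S"
  shows "f x = f y"
proof -
  have "f constant_on S"
  proof (rule continuous_discrete_range_constant[OF assms(1,2)])
    fix x assume "x \<in> S"
    show "\<exists>e>0. \<forall>y. y \<in> S \<and> f y \<noteq> f x \<longrightarrow> e \<le> norm (f y - f x)"
    proof (intro exI[of _ 1] conjI allI impI)
      fix y assume y: "y \<in> S \<and> f y \<noteq> f x"
      with assms(3) \<open>x \<in> S\<close> have "f y - f x \<in> \<int>" "f y - f x \<noteq> 0" by auto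
      then show "1 \<le> norm (f y - f x)" using Ints_nonzero_abs_ge1[of "f y - f x"] by simp
    qed simp
  qed
  with assms show ?thesis by (auto simp: constant_on_def)
qed

text \<open>\<open>\<theta>\<close> lifts the direction of \<open>g\<close> on the open interval but is continuous on the closed one, so
  that \<open>g\<close> may vanish at the ends as long as its direction has a limit there.\<close>

definition arg_lift :: "(real \<Rightarrow> complex) \<Rightarrow> real \<Rightarrow> real \<Rightarrow> (real \<Rightarrow> real) \<Rightarrow> bool" where
  "arg_lift g a b \<theta> \<longleftrightarrow> continuous_on {a..b} \<theta> \<and> (\<forall>s\<in>{a<..<b}. sgn (g s) = cis (\<theta> s))"

text \<open>For \<open>a < b\<close> every lift gives the same increment, so the choice is well
  defined whenever a lift exists; otherwise the value is arbitrary.\<close>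

definition arg_inc :: "(real \<Rightarrow> complex) \<Rightarrow> real \<Rightarrow> real \<Rightarrow> real" where
  "arg_inc g a b = (SOME d. \<exists>\<theta>. arg_lift g a b \<theta> \<and> d = \<theta> b - \<theta> a)"

lemma cis_eq_1_Ints: "cis x = 1 \<Longrightarrow> x / (2 * pi) \<in> \<int>"
  by (auto simp: complex_eq_iff cos_one_2pi_int Ints_def)

lemma cis_eq_imp_Ints: "cis x = cis y \<Longrightarrow> (x - y) / (2 * pi) \<in> \<int>"
  by (rule cis_eq_1_Ints) (simp add: cis_divide[symmetric])

text \<open>On the open interval two lifts differ by a constant multiple of 2 pi. At the ends, where
  they are not tied to \<open>g\<close>, the difference is carried over by continuity.\<close>

lemma arg_lift_unique:
  assumes "a < b" "arg_lift g a b \<theta>" "arg_lift g a b \<phi>"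
  shows "\<theta> b - \<theta> a = \<phi> b - \<phi> a"
proof -
  define d where "d s = (\<theta> s - \<phi> s) / (2 * pi)" for s
  have cd: "continuous_on {a..b} d"
    using assms unfolding d_def arg_lift_def by (auto intro!: continuous_intros)
  define c where "c = d ((a + b) / 2)"
  have "d s = c" if "s \<in> {a<..<b}" for s
    unfolding c_def
  proof (rule connected_Ints_valued_constant[of "{a<..<b}" d])
    fix x assume "x \<in> {a<..<b}"
    then show "d x \<in> \<int>"
      unfolding d_def using assms by (intro cis_eq_imp_Ints) (auto simp: arg_lift_def)
  qed (use assms(1) that continuous_on_subset[OF cd, of "{a<..<b}"] greaterThanLessThan_subseteq_atLeastAtMost_iff[of a b a b] in auto)
  then have "d s = c" if "s \<in> closure {a<..<b}" for s
    using continuous_constant_on_closure[of "{a<..<b}" d c s] cd that assms(1)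
    by (auto simp: closure_greaterThanLessThan)
  then have "d a = d b" using assms(1) by auto
  then show ?thesis by (simp add: d_def field_simps)
qed

lemma arg_inc_eq:
  assumes "a < b" "arg_lift g a b \<theta>"
  shows "arg_inc g a b = \<theta> b - \<theta> a"
  unfolding arg_inc_def
  by (rule some_equality) (use assms arg_lift_unique in blast)+

lemma arg_lift_subinterval:
  "arg_lift g a b \<theta> \<Longrightarrow> a \<le> c \<Longrightarrow> d \<le> b \<Longrightarrow> arg_lift g c d \<theta>"
  unfolding arg_lift_def by (auto intro: continuous_on_subset)

lemma sum_arg_inc_partition:
  assumes "arg_lift g (b k) (b l) \<theta>" "strict_mono_on {k..l} b" "k \<le> l"
  shows "(\<Sum>i=k..<l. arg_inc g (b i) (b (Suc i))) = \<theta> (b l) - \<theta> (b k)"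
proof -
  have "arg_inc g (b i) (b (Suc i)) = \<theta> (b (Suc i)) - \<theta> (b i)" if "i \<in> {k..<l}" for i
  proof (rule arg_inc_eq)
    show "b i < b (Suc i)" using that assms(2) by (auto simp: strict_mono_on_def)
    have "mono_on {k..l} b" by (rule strict_mono_on_imp_mono_on[OF assms(2)])
    then show "arg_lift g (b i) (b (Suc i)) \<theta>"
      using that by (intro arg_lift_subinterval[OF assms(1)]) (auto simp: mono_on_def)
  qed
  then have "(\<Sum>i=k..<l. arg_inc g (b i) (b (Suc i))) = (\<Sum>i=k..<l. \<theta> (b (Suc i)) - \<theta> (b i))"
    by (intro sum.cong) auto
  also have "\<dots> = \<theta> (b l) - \<theta> (b k)"
    using sum_Suc_diff'[OF assms(3), of "\<lambda>i. \<theta> (b i)"] by simp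
  finally show ?thesis .
qed

text \<open>A continuous logarithm exists over a contractible set, and its imaginary part is the
  argument. Applied to rectangles it yields arguments continuous in \<open>s\<close> and
  \<open>t\<close> jointly, which is what makes the defects of the angle identities continuous in
  time.\<close>

lemma arg_of_nonzero_on_convex:
  fixes F :: "'a::real_normed_vector \<Rightarrow> complex"
  assumes "convex S" "continuous_on S F" "\<And>x. x \<in> S \<Longrightarrow> F x \<noteq> 0"
  obtains \<theta> where "continuous_on S \<theta>" "\<And>x. x \<in> S \<Longrightarrow> sgn (F x) = cis (\<theta> x)"
proof -
  obtain g where g: "continuous_on S g" "\<And>x. x \<in> S \<Longrightarrow> F x = exp (g x)"
    using continuous_logarithm_on_contractible[OF assms(2) convex_imp_contractible[OF assms(1)] assms(3)]
    by metis
  show ?thesis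
  proof
    show "continuous_on S (\<lambda>x. Im (g x))" by (intro continuous_intros g)
    show "sgn (F x) = cis (Im (g x))" if "x \<in> S" for x
      using g(2)[OF that] by (simp add: exp_eq_polar sgn_mult sgn_of_real)
  qed
qed

lemma arg_lift_exists:
  assumes "continuous_on {a..b} g" "\<And>s. s \<in> {a..b} \<Longrightarrow> g s \<noteq> 0"
  obtains \<theta> where "arg_lift g a b \<theta>" "\<And>s. s \<in> {a..b} \<Longrightarrow> sgn (g s) = cis (\<theta> s)"
  using arg_of_nonzero_on_convex[of "{a..b}" g] assms by (auto simp: arg_lift_def)

lemma cis_diff_eq_divide:
  assumes "sgn z = cis x" "sgn w = cis y"
  shows "cis (x - y) = sgn (z / w)"
  using assms by (simp add: cis_divide[symmetric] sgn_divide)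

text \<open>Near \<open>s\<close> the increment of \<open>\<theta>\<close> is the principal argument
  of \<open>g u / g s\<close>: the quotient is close to 1, away from the branch cut, and
  \<open>\<theta> u - \<theta> s\<close> stays between - pi and pi by continuity.\<close>

lemma arg_lift_has_derivative:
  assumes "arg_lift g a b \<theta>" "s \<in> {a<..<b}" "(g has_vector_derivative g') (at s)"
  shows "(\<theta> has_real_derivative Im (g' / g s)) (at s)"
proof -
  have nz: "g u \<noteq> 0" if "u \<in> {a<..<b}" for u
    using assms(1) that unfolding arg_lift_def by (metis cis_neq_zero sgn_zero)
  define q where "q u = g u / g s" for u
  have q: "(q has_vector_derivative g' / g s) (at s)"
    unfolding q_def by (rule has_vector_derivative_divide[OF assms(3)])
  have q1: "q s = 1" using nz[OF assms(2)] by (simp add: q_def)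
  have "(Ln has_field_derivative inverse (q s)) (at (q s))"
    by (rule has_field_derivative_Ln) (simp add: q1)
  from field_vector_diff_chain_at[OF q this]
  have ln: "((\<lambda>u. Ln (q u)) has_vector_derivative g' / g s) (at s)"
    by (simp only: o_def q1 inverse_1 mult_1_right)
  have im: "((\<lambda>u. Im (Ln (q u))) has_real_derivative Im (g' / g s)) (at s)"
    unfolding has_real_derivative_iff_has_vector_derivative
    by (rule bounded_linear.has_vector_derivative[OF bounded_linear_Im ln])
  have "continuous_on {a<..<b} \<theta>"
    using assms(1) by (auto simp: arg_lift_def intro: continuous_on_subset)
  then have "isCont \<theta> s"
    using assms(2) by (simp add: continuous_on_eq_continuous_at)
  then have c: "(\<theta> \<longlongrightarrow> \<theta> s) (nhds s)" by (simp add: continuous_at tendsto_at_iff_tendsto_nhds)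
  have near: "\<forall>\<^sub>F u in nhds s. u \<in> {a<..<b} \<and> \<bar>\<theta> u - \<theta> s\<bar> < pi"
  proof (rule eventually_conj)
    show "\<forall>\<^sub>F u in nhds s. u \<in> {a<..<b}"
      using assms(2) by (intro eventually_nhds_in_open) auto
    show "\<forall>\<^sub>F u in nhds s. \<bar>\<theta> u - \<theta> s\<bar> < pi"
      using tendstoD[OF c pi_gt_zero] by (simp add: dist_real_def)
  qed
  have "\<forall>\<^sub>F u in nhds s. \<theta> u = \<theta> s + Im (Ln (q u))"
    using near
  proof eventually_elim
    case (elim u)
    have "sgn (q u) = cis (\<theta> u - \<theta> s)"
      using cis_diff_eq_divide[of "g u" "\<theta> u" "g s" "\<theta> s"] assms(1,2) elim
      by (auto simp: arg_lift_def q_def)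
    moreover have "q u \<noteq> 0" using nz elim assms(2) by (auto simp: q_def)
    ultimately have "Arg (q u) = \<theta> u - \<theta> s"
      using elim by (intro cis_Arg_unique) auto
    then show ?case using \<open>q u \<noteq> 0\<close> by (simp add: Arg_eq_Im_Ln)
  qed
  then show ?thesis
    using DERIV_cong_ev[OF refl _ refl, of \<theta> "\<lambda>u. \<theta> s + Im (Ln (q u))" s "Im (g' / g s)"]
      DERIV_add[OF DERIV_const im] by auto
qed

section \<open>Hopf's theorem on turning tangents\<close>

text \<open>Hadamard's form of the difference quotient: as a mean of \<open>g'\<close> over the
  segment it extends continuously across the diagonal \<open>x = y\<close>.\<close>

lemma continuous_divided_difference:
  fixes g' :: "real \<Rightarrow> complex"
  assumes "continuous_on UNIV g'"
  shows "continuous_on UNIV (\<lambda>(x, y). integral {0..1} (\<lambda>\<tau>. g' (x + \<tau> * (y - x))))"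
proof -
  have "continuous_on (UNIV \<times> cbox 0 1) (\<lambda>(z::real\<times>real, \<tau>). g' (fst z + \<tau> * (snd z - fst z)))"
    unfolding case_prod_beta
    by (intro continuous_on_compose2[OF assms]) (auto intro!: continuous_intros)
  from integral_continuous_on_param[OF this]
  show ?thesis by (simp add: case_prod_beta cbox_interval)
qed

text \<open>Derivatives are taken within the segment only, so that the formula also covers arcs with
  one-sided derivatives at their ends.\<close>

lemma divided_difference_eq:
  fixes g :: "real \<Rightarrow> complex"
  assumes "\<And>\<tau>. \<tau> \<in> {0..1} \<Longrightarrow> (g has_vector_derivative g' (x + \<tau> * (y - x))) (at (x + \<tau> * (y - x)) within ((\<lambda>\<tau>. x + \<tau> * (y - x)) ` {0..1}))"
  shows "g y - g x = of_real (y - x) * integral {0..1} (\<lambda>\<tau>. g' (x + \<tau> * (y - x)))"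
proof (cases "x = y")
  case False
  have "((\<lambda>\<tau>. (y - x) *\<^sub>R g' (x + \<tau> * (y - x))) has_integral
          (g (x + 1 * (y - x)) - g (x + 0 * (y - x)))) {0..1}"
  proof (rule fundamental_theorem_of_calculus)
    fix \<tau> :: real assume "\<tau> \<in> {0..1}"
    have "((\<lambda>\<tau>. x + \<tau> * (y - x)) has_vector_derivative (y - x)) (at \<tau> within {0..1})"
      by (auto intro!: derivative_eq_intros simp: has_real_derivative_iff_has_vector_derivative[symmetric])
    from vector_diff_chain_within[OF this assms[OF \<open>\<tau> \<in> _\<close>]]
    show "((\<lambda>\<tau>. g (x + \<tau> * (y - x))) has_vector_derivative (y - x) *\<^sub>R g' (x + \<tau> * (y - x)))
            (at \<tau> within {0..1})"
      by (simp add: o_def)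
  qed simp
  from integral_unique[OF this] show ?thesis by (simp add: scaleR_conv_of_real)
qed simp

text \<open>Were the increment larger, the connected image would contain an interval longer than pi,
  hence two points \<open>x + e\<close> and \<open>x + pi + e\<close>, where \<open>sin\<close>
  takes opposite values.\<close>

lemma sin_nonneg_lift_bound:
  assumes "continuous_on {a..b::real} \<theta>" "a \<le> b" "\<And>s. s \<in> {a..b} \<Longrightarrow> sin (\<theta> s) \<ge> 0"
  shows "\<bar>\<theta> b - \<theta> a\<bar> \<le> pi"
proof (rule ccontr)
  assume "\<not> ?thesis"
  then have far: "\<theta> b - \<theta> a > pi \<or> \<theta> a - \<theta> b > pi" by linarith
  have conn: "connected (\<theta> ` {a..b})"
    by (rule connected_continuous_image[OF assms(1)]) simp
  have key: False if "x \<in> \<theta> ` {a..b}" "y \<in> \<theta> ` {a..b}" "y - x > pi" for x y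
  proof -
    have sub: "{x..y} \<subseteq> \<theta> ` {a..b}"
      using connected_contains_Icc[OF conn that(1,2)] .
    have nn: "sin z \<ge> 0" if "z \<in> {x..y}" for z using sub that assms(3) by auto
    have "sin x \<ge> 0" using that(3) pi_gt_zero by (intro nn) (unfold atLeastAtMost_iff, linarith)
    moreover have "sin (x + pi) \<ge> 0" using that(3) pi_gt_zero by (intro nn) (unfold atLeastAtMost_iff, linarith)
    ultimately have s0: "sin x = 0" by simp
    \<comment> \<open>Half of the excess over pi, capped at \<open>pi / 2\<close> so that
      \<open>sin e\<close> is positive.\<close>
    define e where "e = min (pi / 2) ((y - x - pi) / 2)"
    have e: "0 < e" "e < pi" "x + pi + e \<le> y" using that(3) by (auto simp: e_def field_simps min_def)
    have "sin (x + e) \<ge> 0" using e pi_gt_zero by (intro nn) simp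
    moreover have "sin (x + pi + e) \<ge> 0" using e pi_gt_zero by (intro nn) simp
    moreover have "sin (x + pi + e) = - sin (x + e)" by (simp add: sin_add cos_add)
    ultimately have "sin (x + e) = 0" by simp
    then have "cos x * sin e = 0" using s0 by (simp add: sin_add)
    moreover have "sin e > 0" using e by (simp add: sin_gt_zero)
    moreover have "cos x \<noteq> 0" using s0 sin_cos_squared_add[of x] by auto
    ultimately show False by simp
  qed
  from far key[of "\<theta> a" "\<theta> b"] key[of "\<theta> b" "\<theta> a"] assms(2) show False by auto
qed

text \<open>Hopf's argument: the direction of the secants is lifted over the strip \<open>x \<le> y \<le> x + 1\<close>, whose
  two edges carry the tangent and its opposite.\<close>

theorem turning_tangents:
  fixes g :: "real \<Rightarrow> complex"
  assumes per: "\<And>s. g (s + 1) = g s"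
    and der: "\<And>s. (g has_vector_derivative g' s) (at s)"
    and cont: "continuous_on UNIV g'"
    and nz: "\<And>s. g' s \<noteq> 0"
    and inj: "\<And>x y. x < y \<Longrightarrow> y < x + 1 \<Longrightarrow> g x \<noteq> g y"
  obtains \<sigma> :: real where "\<sigma> = 1 \<or> \<sigma> = - 1"
    "\<And>c. arg_inc (\<lambda>s. g s - g c) c (c + 1) = \<sigma> * pi"
    "arg_inc g' 0 1 = 2 * pi * \<sigma>"
proof -
  define Q where "Q x y = integral {0..1} (\<lambda>\<tau>. g' (x + \<tau> * (y - x)))" for x y
  have Qc: "continuous_on UNIV (\<lambda>(x, y). Q x y)"
    using continuous_divided_difference[OF cont] by (simp add: Q_def)
  have Q: "g y - g x = of_real (y - x) * Q x y" for x y
    unfolding Q_def by (rule divided_difference_eq) (use der has_vector_derivative_at_within in blast)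
  have Qd: "Q x x = g' x" for x by (simp add: Q_def)
  have per': "g' (s + 1) = g' s" for s
  proof -
    have "((\<lambda>s. g (s + 1)) has_vector_derivative g' (s + 1)) (at s)"
      using vector_diff_chain_at[of "\<lambda>s. s + 1" 1 s g "g' (s + 1)"] der[of "s + 1"]
      by (simp add: o_def has_real_derivative_iff_has_vector_derivative[symmetric] DERIV_add[OF DERIV_ident DERIV_const, simplified])
    then show ?thesis using der[of s] per vector_derivative_unique_at by force
  qed
  define S where "S = {z :: real \<times> real. fst z \<le> snd z \<and> snd z \<le> fst z + 1}"
  have S: "convex S"
  proof -
    have "S = {z. (1, -1) \<bullet> z \<le> 0} \<inter> {z. (-1, 1) \<bullet> z \<le> 1}"
      by (auto simp: S_def inner_prod_def)
    then show ?thesis by (auto intro!: convex_Int convex_halfspace_le)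
  qed
  \<comment> \<open>Both branches are \<open>(g y - g x) / ((y - x) * (x + 1 - y))\<close> with the
    zeros on the two edges divided out; by periodicity the edge \<open>y = x + 1\<close> is the
    diagonal for the base point \<open>x + 1\<close>. The branches agree at
    \<open>y - x = 1/2\<close>.\<close>
  define \<Phi> where "\<Phi> z = (if snd z - fst z \<le> 1/2
      then Q (fst z) (snd z) / of_real (fst z + 1 - snd z)
      else - Q (fst z + 1) (snd z) / of_real (snd z - fst z))" for z
  have \<Phi>_eq: "\<Phi> (x, y) * of_real (y - x) * of_real (x + 1 - y) = g y - g x" if "x \<le> y" "y \<le> x + 1" for x y
  proof (cases "y - x \<le> 1/2")
    case True
    then have "complex_of_real (x + 1 - y) \<noteq> 0" unfolding of_real_eq_0_iff by simp
    with True show ?thesis using Q[of y x] by (simp add: \<Phi>_def)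
  next
    case False
    then have "complex_of_real (y - x) \<noteq> 0" unfolding of_real_eq_0_iff by simp
    with False show ?thesis using Q[of y "x + 1"] by (simp add: \<Phi>_def per) (simp add: algebra_simps)
  qed
  have \<Phi>_off: "sgn (\<Phi> (x, y)) = sgn (g y - g x)" if "x < y" "y < x + 1" for x y
    unfolding \<Phi>_eq[of x y, OF less_imp_le less_imp_le, OF that, symmetric] sgn_mult sgn_of_real
    using that by simp
  have \<Phi>_diag: "\<Phi> (x, x) = g' x" "\<Phi> (x, x + 1) = - g' x" for x
    by (auto simp: \<Phi>_def Qd per')
  have \<Phi>nz: "\<Phi> z \<noteq> 0" if zS: "z \<in> S" for z
  proof -
    obtain x y where z: "z = (x, y)" by (cases z)
    have "x \<le> y" "y \<le> x + 1" using zS by (simp_all add: S_def z)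
    then consider "x < y" "y < x + 1" | "y = x" | "y = x + 1" by linarith
    then show ?thesis
    proof cases
      case 1 then show ?thesis using inj[OF 1] \<Phi>_eq[of x y] z by auto
    qed (use \<Phi>_diag nz z in auto)
  qed
  have \<Phi>c: "continuous_on S \<Phi>"
  proof -
    have cQ: "continuous_on T (\<lambda>z. Q (f z) (h z))" if "continuous_on T f" "continuous_on T h"
      for T and f h :: "real \<times> real \<Rightarrow> real"
      using continuous_on_compose2[OF Qc continuous_on_Pair[OF that]] by simp
    have "continuous_on S (\<lambda>z. if snd z - fst z \<le> 1/2
      then Q (fst z) (snd z) / of_real (fst z + 1 - snd z)
      else - Q (fst z + 1) (snd z) / of_real (snd z - fst z))"
    proof (rule continuous_on_cases_le)
      show "continuous_on {z \<in> S. snd z - fst z \<le> 1 / 2} (\<lambda>z. Q (fst z) (snd z) / of_real (fst z + 1 - snd z))"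
      proof (intro continuous_on_divide cQ ballI)
        fix z :: "real \<times> real" assume "z \<in> {z \<in> S. snd z - fst z \<le> 1 / 2}"
        then show "complex_of_real (fst z + 1 - snd z) \<noteq> 0" unfolding of_real_eq_0_iff by simp
      qed (intro continuous_intros)+
      show "continuous_on {z \<in> S. 1 / 2 \<le> snd z - fst z} (\<lambda>z. - Q (fst z + 1) (snd z) / of_real (snd z - fst z))"
      proof (intro continuous_on_divide continuous_on_minus cQ ballI)
        fix z :: "real \<times> real" assume "z \<in> {z \<in> S. 1 / 2 \<le> snd z - fst z}"
        then show "complex_of_real (snd z - fst z) \<noteq> 0" unfolding of_real_eq_0_iff by simp
      qed (intro continuous_intros)+
      fix z :: "real \<times> real" assume "z \<in> S" "snd z - fst z = 1/2"
      then have d: "fst z + 1 - snd z = 1/2" "snd z - fst z = 1/2" "snd z - (fst z + 1) = - (1/2)"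
        by simp_all
      show "Q (fst z) (snd z) / of_real (fst z + 1 - snd z) = - Q (fst z + 1) (snd z) / of_real (snd z - fst z)"
        using Q[of "snd z" "fst z"] Q[of "snd z" "fst z + 1"] unfolding d per by simp
    qed (intro continuous_intros)
    then show ?thesis by (simp add: \<Phi>_def[abs_def])
  qed
  obtain \<theta> where \<theta>: "continuous_on S \<theta>" "\<And>z. z \<in> S \<Longrightarrow> sgn (\<Phi> z) = cis (\<theta> z)"
    using arg_of_nonzero_on_convex[OF S \<Phi>c \<Phi>nz] by metis
  have \<theta>c: "continuous_on T (\<lambda>s. \<theta> (f s, h s))"
    if "continuous_on T f" "continuous_on T h" "\<And>s. s \<in> T \<Longrightarrow> f s \<le> h s \<and> h s \<le> f s + 1"
    for T and f h :: "real \<Rightarrow> real"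
    by (rule continuous_on_compose2[OF \<theta>(1) continuous_on_Pair[OF that(1,2)]])
       (use that(3) in \<open>auto simp: S_def\<close>)
  have inS: "(x, x) \<in> S" "(x, x + 1) \<in> S" for x by (auto simp: S_def)
  \<comment> \<open>The turning of the secants from \<open>x\<close> over one period. The edge
    values of \<open>\<Phi>\<close> are opposite, so it is an odd multiple of pi, and by continuity
    it is the same for all \<open>x\<close>.\<close>
  define D where "D x = \<theta> (x, x + 1) - \<theta> (x, x)" for x
  have D_Ints: "D x / (2 * pi) - 1/2 \<in> \<int>" for x
  proof -
    have "cis (\<theta> (x, x + 1)) = cis (\<theta> (x, x) + pi)"
      using \<theta>(2)[OF inS(1), of x] \<theta>(2)[OF inS(2), of x] \<Phi>_diag[of x]
      by (simp add: sgn_minus cis_mult[symmetric])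
    from cis_eq_imp_Ints[OF this] show ?thesis by (simp add: D_def diff_divide_distrib add_divide_distrib diff_diff_eq)
  qed
  have D_const: "D x = D y" for x y
  proof -
    have "continuous_on UNIV D"
      unfolding D_def
      by (rule continuous_on_diff; rule \<theta>c) (auto intro: continuous_on_add)
    then have "continuous_on UNIV (\<lambda>x. D x / (2 * pi) - 1/2)"
      by (intro continuous_on_diff continuous_on_divide continuous_on_const) auto
    from connected_Ints_valued_constant[OF connected_UNIV this, of x y] D_Ints
    show ?thesis by simp
  qed
  have lift: "arg_lift (\<lambda>s. g s - g c) c (c + 1) (\<lambda>s. \<theta> (c, s))" for c
    unfolding arg_lift_def
  proof (intro conjI ballI \<theta>c)
    fix s assume "s \<in> {c<..<c + 1}"
    then show "sgn (g s - g c) = cis (\<theta> (c, s))" using \<theta>(2)[of "(c, s)"] \<Phi>_off[of c s] by (simp add: S_def)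
  qed auto
  have inc: "arg_inc (\<lambda>s. g s - g c) c (c + 1) = D 0" for c
    using arg_inc_eq[OF _ lift] D_const[of c 0] by (simp add: D_def)
  \<comment> \<open>The diagonal is replaced by the path from (0, 0) to (0, 1) and on to (1, 1). The
    second leg turns as much as the first, because the secants \<open>(0, y)\<close> and
    \<open>(y, 1)\<close> are opposite.\<close>
  have turn: "arg_inc g' 0 1 = 2 * D 0"
  proof -
    have "arg_lift g' 0 1 (\<lambda>s. \<theta> (s, s))"
      unfolding arg_lift_def using \<theta>(2)[OF inS(1)] \<Phi>_diag
      by (intro conjI ballI \<theta>c) auto
    then have "arg_inc g' 0 1 = \<theta> (1, 1) - \<theta> (0, 0)" by (simp add: arg_inc_eq)
    moreover have "(\<theta> (1, 1) - \<theta> (0, 1)) / (2 * pi) - 1/2 = (\<theta> (0, 1) - \<theta> (0, 0)) / (2 * pi) - 1/2"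
    proof -
      define k where "k y = (\<theta> (y, 1) - \<theta> (0, y)) / (2 * pi) - 1/2" for y
      have "k 1 = k 0"
      proof (rule connected_Ints_valued_constant[of "{0..1}" k])
        show "continuous_on {0..1} k" unfolding k_def
          by (intro continuous_on_diff continuous_on_divide \<theta>c continuous_on_const continuous_on_id) auto
        fix y :: real assume y: "y \<in> {0..1}"
        have "\<Phi> (y, 1) = - \<Phi> (0, y)"
        proof (cases "y = 0 \<or> y = 1")
          case True then show ?thesis using \<Phi>_diag[of 0] \<Phi>_diag[of 1] per'[of 0] by auto
        next
          case False
          have "g 1 = g 0" using per[of 0] by simp
          then have "\<Phi> (y, 1) * of_real (1 - y) * of_real y = - \<Phi> (0, y) * of_real y * of_real (1 - y)"
            using \<Phi>_eq[of y 1] \<Phi>_eq[of 0 y] y by simp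
          then have "(\<Phi> (y, 1) + \<Phi> (0, y)) * (of_real (1 - y) * of_real y) = 0"
            by (simp add: algebra_simps)
          then have "\<Phi> (y, 1) + \<Phi> (0, y) = 0" using False by auto
          then show ?thesis by (simp add: eq_neg_iff_add_eq_0)
        qed
        then have "cis (\<theta> (y, 1)) = cis (\<theta> (0, y) + pi)"
          using \<theta>(2)[of "(y, 1)"] \<theta>(2)[of "(0, y)"] y by (simp add: sgn_minus cis_mult[symmetric] S_def)
        from cis_eq_imp_Ints[OF this] show "k y \<in> \<int>" by (simp add: k_def diff_divide_distrib add_divide_distrib diff_diff_eq)
      qed auto
      then show ?thesis by (simp add: k_def)
    qed
    ultimately show ?thesis by (simp add: D_def field_simps)
  qed
  have g_cont: "continuous_on A g" for A
    using has_vector_derivative_continuous[OF der] by (auto intro!: continuous_at_imp_continuous_on)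
  \<comment> \<open>Seen from a lowest point all secants lie in the closed upper half plane, which
    bounds the turning by pi; being an odd multiple of pi, it is pi or - pi.\<close>
  obtain x0 where x0: "\<forall>s\<in>{0..1}. Im (g x0) \<le> Im (g s)"
    using continuous_attains_inf[of "{0..1::real}" "\<lambda>s. Im (g s)"] continuous_on_Im[OF g_cont]
    by auto
  have low: "Im (g x0) \<le> Im (g s)" for s
  proof -
    have "g (s - of_int k) = g s" for k
    proof -
      interpret periodic_fun_simple g "1::real" by standard (rule per)
      show ?thesis by (rule minus_of_int[of s k, simplified])
    qed
    then have "g (s - of_int \<lfloor>s\<rfloor>) = g s" .
    moreover have "s - of_int \<lfloor>s\<rfloor> \<in> {0..1}"
      unfolding atLeastAtMost_iff using floor_correct[of s] by linarith
    ultimately show ?thesis using x0 by metis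
  qed
  have "\<bar>D x0\<bar> \<le> pi"
    unfolding D_def
  proof (rule sin_nonneg_lift_bound[of x0 "x0 + 1" "\<lambda>s. \<theta> (x0, s)"])
    show c: "continuous_on {x0..x0 + 1} (\<lambda>s. \<theta> (x0, s))" by (intro \<theta>c) auto
    have "sin (\<theta> (x0, s)) \<ge> 0" if "s \<in> {x0<..<x0 + 1}" for s
    proof -
      have "sin (\<theta> (x0, s)) = Im (cis (\<theta> (x0, s)))" by simp
      also have "cis (\<theta> (x0, s)) = sgn (g s - g x0)"
        using \<theta>(2)[of "(x0, s)"] \<Phi>_off[of x0 s] that by (simp add: S_def)
      also have "Im (sgn (g s - g x0)) \<ge> 0" using low[of s] by (simp add: Im_sgn)
      finally show ?thesis .
    qed
    moreover have "continuous_on (closure {x0<..<x0 + 1}) (\<lambda>s. sin (\<theta> (x0, s)))"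
      using continuous_on_sin[OF c] by simp
    ultimately show "sin (\<theta> (x0, s)) \<ge> 0" if "s \<in> {x0..x0 + 1}" for s
      using continuous_ge_on_closure[of "{x0<..<x0 + 1}" "\<lambda>s. sin (\<theta> (x0, s))" s 0] that by simp
  qed simp
  then have D0: "\<bar>D 0\<bar> \<le> pi" using D_const[of x0 0] by simp
  obtain k :: int where "D 0 / (2 * pi) - 1/2 = of_int k"
    using D_Ints[of 0] by (elim Ints_cases)
  then have k: "D 0 = (2 * of_int k + 1) * pi" by (simp add: field_simps)
  then have "\<bar>2 * real_of_int k + 1\<bar> * pi \<le> 1 * pi" using D0 by (simp only: abs_mult) simp
  then have "\<bar>2 * real_of_int k + 1\<bar> \<le> 1" by (rule mult_right_le_imp_le) simp
  then have "k = 0 \<or> k = - 1" by linarith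
  then have "D 0 = pi \<or> D 0 = - pi" using k by auto
  then show ?thesis using that[of 1] that[of "- 1"] inc turn by auto
qed

section \<open>Displacements from a point of the moving curve, uniformly in time\<close>

lemma C1_upto_boundary_partial_derivatives:
  fixes \<Gamma> :: "real \<Rightarrow> real \<Rightarrow> 'a::real_normed_vector"
  assumes "C1_upto_boundary ({x..y} \<times> {0..T}) (\<lambda>(s, t). \<Gamma> s t)"
  obtains D E where
    "continuous_on ({x..y} \<times> {0..T}) D" "continuous_on ({x..y} \<times> {0..T}) E"
    "\<And>s t. s \<in> {x..y} \<Longrightarrow> t \<in> {0..T} \<Longrightarrow> ((\<lambda>s. \<Gamma> s t) has_vector_derivative D (s, t)) (at s within {x..y})"
    "\<And>s t. s \<in> {x..y} \<Longrightarrow> t \<in> {0..T} \<Longrightarrow> (\<Gamma> s has_vector_derivative E (s, t)) (at t within {0..T})"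
proof -
  obtain f' where f': "\<And>z. z \<in> {x..y} \<times> {0..T} \<Longrightarrow>
      ((\<lambda>(s, t). \<Gamma> s t) has_derivative blinfun_apply (f' z)) (at z within {x..y} \<times> {0..T})"
    and cf': "continuous_on ({x..y} \<times> {0..T}) f'"
    using assms unfolding C1_upto_boundary_def by blast
  show ?thesis
  proof
    show "continuous_on ({x..y} \<times> {0..T}) (\<lambda>z. blinfun_apply (f' z) (1, 0))"
      by (intro continuous_intros cf')
    show "continuous_on ({x..y} \<times> {0..T}) (\<lambda>z. blinfun_apply (f' z) (0, 1))"
      by (intro continuous_intros cf')
    fix s t assume st: "s \<in> {x..y}" "t \<in> {0..T}"
    have "((\<lambda>s. (s, t)) has_derivative (\<lambda>h. (h, 0))) (at s within {x..y})"
      by (auto intro!: derivative_eq_intros)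
    from has_derivative_in_compose2[OF f' _ st(1) this] st(2)
    have d1: "((\<lambda>s. \<Gamma> s t) has_derivative (\<lambda>h. blinfun_apply (f' (s, t)) (h, 0))) (at s within {x..y})"
      by (auto simp: image_subset_iff)
    have e1: "blinfun_apply (f' (s, t)) (h, 0) = h *\<^sub>R blinfun_apply (f' (s, t)) (1, 0)" for h
      using blinfun.scaleR_right[of "f' (s, t)" h "(1, 0)"] by simp
    show "((\<lambda>s. \<Gamma> s t) has_vector_derivative blinfun_apply (f' (s, t)) (1, 0)) (at s within {x..y})"
      unfolding has_vector_derivative_def by (rule has_derivative_eq_rhs[OF d1 ext[OF e1]])
    have "((\<lambda>t. (s, t)) has_derivative (\<lambda>h. (0, h))) (at t within {0..T})"
      by (auto intro!: derivative_eq_intros)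
    from has_derivative_in_compose2[OF f' _ st(2) this] st(1)
    have d2: "(\<Gamma> s has_derivative (\<lambda>h. blinfun_apply (f' (s, t)) (0, h))) (at t within {0..T})"
      by (auto simp: image_subset_iff)
    have e2: "blinfun_apply (f' (s, t)) (0, h) = h *\<^sub>R blinfun_apply (f' (s, t)) (0, 1)" for h
      using blinfun.scaleR_right[of "f' (s, t)" h "(0, 1)"] by simp
    show "(\<Gamma> s has_vector_derivative blinfun_apply (f' (s, t)) (0, 1)) (at t within {0..T})"
      unfolding has_vector_derivative_def by (rule has_derivative_eq_rhs[OF d2 ext[OF e2]])
  qed
qed

text \<open>The zero at \<open>s = c\<close> is divided out in mean value form, with the time as a
  parameter; at \<open>c\<close> the quotient becomes the tangent.\<close>

lemma divided_difference_param:
  fixes g :: "real \<Rightarrow> real \<Rightarrow> complex"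
  assumes D: "continuous_on ({x..y} \<times> {0..T}) D"
    and der: "\<And>s t. s \<in> {x..y} \<Longrightarrow> t \<in> {0..T} \<Longrightarrow> ((\<lambda>s. g s t) has_vector_derivative D (s, t)) (at s within {x..y})"
    and c: "c \<in> {x..y}"
  obtains Q where "continuous_on ({x..y} \<times> {0..T}) Q"
    "\<And>s t. s \<in> {x..y} \<Longrightarrow> t \<in> {0..T} \<Longrightarrow> g s t - g c t = of_real (s - c) * Q (s, t)"
    "\<And>t. t \<in> {0..T} \<Longrightarrow> Q (c, t) = D (c, t)"
proof -
  define Q where "Q z = integral {0..1} (\<lambda>\<tau>. D (c + \<tau> * (fst z - c), snd z))" for z
  have inI: "c + \<tau> * (s - c) \<in> {x..y}" if "\<tau> \<in> {0..1}" "s \<in> {x..y}" for \<tau> s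
  proof -
    have "(1 - \<tau>) *\<^sub>R c + \<tau> *\<^sub>R s \<in> {x..y}"
      using that c by (intro convexD_alt) auto
    then show ?thesis by (simp add: algebra_simps)
  qed
  show ?thesis
  proof
    have "continuous_on (({x..y} \<times> {0..T}) \<times> cbox 0 1) (\<lambda>p. D (c + snd p * (fst (fst p) - c), snd (fst p)))"
    proof (rule continuous_on_compose2[OF D])
      show "(\<lambda>p. (c + snd p * (fst (fst p) - c), snd (fst p))) ` (({x..y} \<times> {0..T}) \<times> cbox 0 1) \<subseteq> {x..y} \<times> {0..T}"
      proof (rule image_subsetI)
        fix p :: "(real \<times> real) \<times> real" assume p: "p \<in> ({x..y} \<times> {0..T}) \<times> cbox 0 1"
        then have "snd p \<in> {0..1}" "fst (fst p) \<in> {x..y}" "snd (fst p) \<in> {0..T}"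
          by (auto simp: cbox_interval mem_Times_iff)
        with inI show "(c + snd p * (fst (fst p) - c), snd (fst p)) \<in> {x..y} \<times> {0..T}" by blast
      qed
    qed (intro continuous_intros)
    then have "continuous_on (({x..y} \<times> {0..T}) \<times> cbox 0 1) (\<lambda>(z, \<tau>). D (c + \<tau> * (fst z - c), snd z))"
      by (simp add: case_prod_beta)
    from integral_continuous_on_param[OF this]
    show "continuous_on ({x..y} \<times> {0..T}) Q" by (simp add: Q_def[abs_def] cbox_interval)
    show "Q (c, t) = D (c, t)" for t by (simp add: Q_def)
    show "g s t - g c t = of_real (s - c) * Q (s, t)" if "s \<in> {x..y}" "t \<in> {0..T}" for s t
      unfolding Q_def fst_conv snd_conv
      by (rule divided_difference_eq)
         (rule has_vector_derivative_within_subset[OF der], use inI that in auto)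
  qed
qed

text \<open>Divided by \<open>(s - a) * (b - s)\<close> the displacement becomes continuous and
  zero-free on the closed rectangle, and its end values are the tangents up to positive factors; at
  \<open>b\<close> the displacement looks back along the incoming tangent, whence the minus sign.
  Two separate derivatives appear because there may be corners between \<open>a'\<close> and
  \<open>b'\<close>.\<close>

lemma window_arg_lift:
  fixes g :: "real \<Rightarrow> real \<Rightarrow> complex"
  assumes ord: "a < a'" "a' < b'" "b' < b"
    and cont: "continuous_on ({a..b} \<times> {0..T}) (\<lambda>(s, t). g s t)"
    and zero: "\<And>t. t \<in> {0..T} \<Longrightarrow> g a t = 0" "\<And>t. t \<in> {0..T} \<Longrightarrow> g b t = 0"
    and nz: "\<And>s t. s \<in> {a<..<b} \<Longrightarrow> t \<in> {0..T} \<Longrightarrow> g s t \<noteq> 0"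
    and D1: "continuous_on ({a..a'} \<times> {0..T}) D1"
      "\<And>s t. s \<in> {a..a'} \<Longrightarrow> t \<in> {0..T} \<Longrightarrow> ((\<lambda>s. g s t) has_vector_derivative D1 (s, t)) (at s within {a..a'})"
      "\<And>t. t \<in> {0..T} \<Longrightarrow> D1 (a, t) \<noteq> 0"
    and D2: "continuous_on ({b'..b} \<times> {0..T}) D2"
      "\<And>s t. s \<in> {b'..b} \<Longrightarrow> t \<in> {0..T} \<Longrightarrow> ((\<lambda>s. g s t) has_vector_derivative D2 (s, t)) (at s within {b'..b})"
      "\<And>t. t \<in> {0..T} \<Longrightarrow> D2 (b, t) \<noteq> 0"
  obtains \<theta> where "continuous_on ({a..b} \<times> {0..T}) \<theta>"
    "\<And>s t. s \<in> {a<..<b} \<Longrightarrow> t \<in> {0..T} \<Longrightarrow> sgn (g s t) = cis (\<theta> (s, t))"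
    "\<And>t. t \<in> {0..T} \<Longrightarrow> sgn (D1 (a, t)) = cis (\<theta> (a, t))"
    "\<And>t. t \<in> {0..T} \<Longrightarrow> - sgn (D2 (b, t)) = cis (\<theta> (b, t))"
proof -
  obtain Q1 where Q1: "continuous_on ({a..a'} \<times> {0..T}) Q1"
    "\<And>s t. s \<in> {a..a'} \<Longrightarrow> t \<in> {0..T} \<Longrightarrow> g s t - g a t = of_real (s - a) * Q1 (s, t)"
    "\<And>t. t \<in> {0..T} \<Longrightarrow> Q1 (a, t) = D1 (a, t)"
    using divided_difference_param[OF D1(1,2), of a] ord by auto
  obtain Q2 where Q2: "continuous_on ({b'..b} \<times> {0..T}) Q2"
    "\<And>s t. s \<in> {b'..b} \<Longrightarrow> t \<in> {0..T} \<Longrightarrow> g s t - g b t = of_real (s - b) * Q2 (s, t)"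
    "\<And>t. t \<in> {0..T} \<Longrightarrow> Q2 (b, t) = D2 (b, t)"
    using divided_difference_param[OF D2(1,2), of b] ord by auto
  define R where "R = {a..b} \<times> {0..T}"
  define F where "F z = (if fst z \<le> a' then Q1 z / of_real (b - fst z)
     else if fst z \<le> b' then g (fst z) (snd z) / of_real ((fst z - a) * (b - fst z))
     else - Q2 z / of_real (fst z - a))" for z
  have c_of_real: "continuous_on S (\<lambda>z::real\<times>real. complex_of_real (fst z - a))"
    "continuous_on S (\<lambda>z::real\<times>real. complex_of_real (b - fst z))"
    "continuous_on S (\<lambda>z::real\<times>real. complex_of_real ((fst z - a) * (b - fst z)))" for S
    by (intro continuous_intros)+
  have nz_of_real: "complex_of_real x \<noteq> 0" if "x > 0" for x using that by simp
  have "continuous_on R F"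
    unfolding F_def
  proof (rule continuous_on_cases_le)
    show "continuous_on {z \<in> R. fst z \<le> a'} (\<lambda>z. Q1 z / of_real (b - fst z))"
      by (intro continuous_on_divide continuous_on_subset[OF Q1(1)] c_of_real ballI nz_of_real)
         (use ord in \<open>auto simp: R_def\<close>)
    show "continuous_on {z \<in> R. a' \<le> fst z} (\<lambda>z. if fst z \<le> b' then g (fst z) (snd z) / of_real ((fst z - a) * (b - fst z))
       else - Q2 z / of_real (fst z - a))"
    proof (rule continuous_on_cases_le)
      have "continuous_on R (\<lambda>z. g (fst z) (snd z))" using cont by (simp add: R_def case_prod_beta)
      from continuous_on_subset[OF this]
      show "continuous_on {z \<in> {z \<in> R. a' \<le> fst z}. fst z \<le> b'}
         (\<lambda>z. g (fst z) (snd z) / of_real ((fst z - a) * (b - fst z)))"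
        by (intro continuous_on_divide c_of_real ballI nz_of_real mult_pos_pos)
           (use ord in \<open>auto simp: R_def\<close>)
      show "continuous_on {z \<in> {z \<in> R. a' \<le> fst z}. b' \<le> fst z} (\<lambda>z. - Q2 z / of_real (fst z - a))"
        by (intro continuous_on_divide continuous_on_minus continuous_on_subset[OF Q2(1)] c_of_real ballI nz_of_real)
           (use ord in \<open>auto simp: R_def\<close>)
      fix z assume z: "z \<in> {z \<in> R. a' \<le> fst z}" "fst z = b'"
      then have "g (fst z) (snd z) = of_real (fst z - b) * Q2 z"
        using Q2(2)[of "fst z" "snd z"] zero(2)[of "snd z"] ord by (auto simp: R_def)
      then have "g (fst z) (snd z) = - (of_real (b - fst z) * Q2 z)" by (simp add: algebra_simps)
      then show "g (fst z) (snd z) / of_real ((fst z - a) * (b - fst z)) = - Q2 z / of_real (fst z - a)"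
        using nz_of_real[of "b - fst z"] nz_of_real[of "fst z - a"] z ord
        by (simp add: divide_simps del: of_real_diff)
    qed (intro continuous_intros)
    fix z assume z: "z \<in> R" "fst z = a'"
    then have "g (fst z) (snd z) = of_real (fst z - a) * Q1 z"
      using Q1(2)[of "fst z" "snd z"] zero(1)[of "snd z"] ord by (auto simp: R_def)
    then show "Q1 z / of_real (b - fst z) = (if fst z \<le> b' then g (fst z) (snd z) / of_real ((fst z - a) * (b - fst z))
       else - Q2 z / of_real (fst z - a))"
      using nz_of_real[of "b - fst z"] nz_of_real[of "fst z - a"] z ord
      by (simp add: divide_simps del: of_real_diff)
  qed (intro continuous_intros)
  moreover have F_int: "g s t = F (s, t) * of_real ((s - a) * (b - s))" if "s \<in> {a<..<b}" "t \<in> {0..T}" for s t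
  proof -
    have n: "complex_of_real (b - s) \<noteq> 0" "complex_of_real (s - a) \<noteq> 0" using that by auto
    consider "s \<le> a'" | "\<not> s \<le> a'" "s \<le> b'" | "\<not> s \<le> a'" "\<not> s \<le> b'" by blast
    then show ?thesis
    proof cases
      case 1
      then show ?thesis using Q1(2)[of s t] zero(1)[of t] that n ord
        by (simp add: F_def del: of_real_diff)
    next
      case 2
      then show ?thesis using n by (simp add: F_def del: of_real_diff)
    next
      case 3
      then have "g s t = of_real (s - b) * Q2 (s, t)" using Q2(2)[of s t] zero(2)[of t] that by simp
      then have "g s t = - (of_real (b - s) * Q2 (s, t))" by (simp add: algebra_simps)
      with 3 show ?thesis using n by (simp add: F_def del: of_real_diff)
    qed
  qed
  moreover have F_a: "F (a, t) = D1 (a, t) / of_real (b - a)" "F (b, t) = - D2 (b, t) / of_real (b - a)"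
    if "t \<in> {0..T}" for t
    using Q1(3)[OF that] Q2(3)[OF that] ord by (auto simp: F_def)
  moreover have "F z \<noteq> 0" if "z \<in> R" for z
  proof -
    obtain s t where z: "z = (s, t)" by (cases z)
    with that have t: "t \<in> {0..T}" and "s = a \<or> s = b \<or> s \<in> {a<..<b}" by (auto simp: R_def)
    then consider "s = a" | "s = b" | "s \<in> {a<..<b}" by blast
    then show ?thesis
    proof cases
      case 1 then show ?thesis using F_a(1)[OF t] D1(3)[OF t] ord z by simp
    next
      case 2 then show ?thesis using F_a(2)[OF t] D2(3)[OF t] ord z by simp
    next
      case 3 then show ?thesis using F_int[OF 3 t] nz[OF 3 t] z by auto
    qed
  qed
  moreover have "convex R" by (auto simp: R_def intro: convex_Times)
  ultimately obtain \<theta> where \<theta>: "continuous_on R \<theta>" "\<And>x. x \<in> R \<Longrightarrow> sgn (F x) = cis (\<theta> x)"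
    using arg_of_nonzero_on_convex[of R F] by metis
  have ba: "b - a > 0" using ord by simp
  show ?thesis
  proof
    show "continuous_on ({a..b} \<times> {0..T}) \<theta>" using \<theta>(1) by (simp add: R_def)
    show "sgn (g s t) = cis (\<theta> (s, t))" if "s \<in> {a<..<b}" "t \<in> {0..T}" for s t
    proof -
      have "(s - a) * (b - s) > 0" using that by simp
      then show ?thesis
        using \<theta>(2)[of "(s, t)"] that unfolding F_int[OF that] sgn_mult sgn_of_real by (simp add: R_def)
    qed
    show "sgn (D1 (a, t)) = cis (\<theta> (a, t))" if "t \<in> {0..T}" for t
    proof -
      have "sgn (F (a, t)) = sgn (D1 (a, t))"
        unfolding F_a(1)[OF that] sgn_divide sgn_of_real using ba by simp
      then show ?thesis using \<theta>(2)[of "(a, t)"] that ord by (simp add: R_def)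
    qed
    show "- sgn (D2 (b, t)) = cis (\<theta> (b, t))" if "t \<in> {0..T}" for t
    proof -
      have "sgn (F (b, t)) = - sgn (D2 (b, t))"
        unfolding F_a(2)[OF that] sgn_divide sgn_of_real sgn_minus using ba by simp
      then show ?thesis using \<theta>(2)[of "(b, t)"] that ord by (simp add: R_def)
    qed
  qed
qed

section \<open>Winding numbers and orientation\<close>

text \<open>The period may start anywhere: the increment over \<open>[u, u + 1]\<close> is a
  multiple of 2 pi depending continuously on \<open>u\<close>. Over \<open>[0, 1]\<close> a
  logarithm of \<open>c - z\<close> is assembled from modulus and argument.\<close>

lemma winding_number_eq_arg_inc:
  assumes c: "continuous_on UNIV c" and per: "\<And>s. c (s + 1) = c s" and z: "z \<notin> range c"
  shows "winding_number c z = of_real (arg_inc (\<lambda>s. c s - z) s0 (s0 + 1) / (2 * pi))"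
    and "\<exists>\<theta>. arg_lift (\<lambda>s. c s - z) s0 (s0 + 1) \<theta>"
proof -
  have nz: "c s - z \<noteq> 0" for s using z by auto
  define A B where "A = min 0 s0" and "B = max 1 (s0 + 1)"
  have cA: "continuous_on {A..B} (\<lambda>s. c s - z)"
    by (intro continuous_on_diff continuous_on_const continuous_on_subset[OF c]) auto
  obtain \<theta> where \<theta>: "arg_lift (\<lambda>s. c s - z) A B \<theta>" "\<And>s. s \<in> {A..B} \<Longrightarrow> sgn (c s - z) = cis (\<theta> s)"
    using arg_lift_exists[OF cA nz] by metis
  have lift: "arg_lift (\<lambda>s. c s - z) u (u + 1) \<theta>" if "u \<in> {min 0 s0..max 0 s0}" for u
    using that by (intro arg_lift_subinterval[OF \<theta>(1)]) (auto simp: A_def B_def)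
  then show "\<exists>\<theta>. arg_lift (\<lambda>s. c s - z) s0 (s0 + 1) \<theta>" by (intro exI[of _ \<theta>]) auto
  define k where "k u = (\<theta> (u + 1) - \<theta> u) / (2 * pi)" for u
  have "k 0 = k s0"
  proof (rule connected_Ints_valued_constant[of "{min 0 s0..max 0 s0}" k])
    have c\<theta>: "continuous_on {A..B} \<theta>" using \<theta>(1) by (simp add: arg_lift_def)
    have "continuous_on {min 0 s0..max 0 s0} (\<lambda>u. \<theta> (u + 1))"
    proof (rule continuous_on_compose2[OF c\<theta>])
      show "(\<lambda>u. u + 1) ` {min 0 s0..max 0 s0} \<subseteq> {A..B}" by (auto simp: A_def B_def)
    qed (intro continuous_intros)
    moreover have "continuous_on {min 0 s0..max 0 s0} \<theta>"
      by (rule continuous_on_subset[OF c\<theta>]) (auto simp: A_def B_def)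
    ultimately show "continuous_on {min 0 s0..max 0 s0} k"
      unfolding k_def by (intro continuous_on_divide continuous_on_diff continuous_on_const) auto
    fix u assume "u \<in> {min 0 s0..max 0 s0}"
    then have "cis (\<theta> (u + 1)) = cis (\<theta> u)"
      using \<theta>(2)[of u] \<theta>(2)[of "u + 1"] per[of u] by (auto simp: A_def B_def)
    from cis_eq_imp_Ints[OF this] show "k u \<in> \<int>" by (simp add: k_def)
  qed auto
  moreover have "arg_inc (\<lambda>s. c s - z) s0 (s0 + 1) = \<theta> (s0 + 1) - \<theta> s0"
    by (rule arg_inc_eq) (use lift[of s0] in auto)
  ultimately have eq: "arg_inc (\<lambda>s. c s - z) s0 (s0 + 1) / (2 * pi) = (\<theta> 1 - \<theta> 0) / (2 * pi)"
    by (simp add: k_def)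
  define L where "L s = Complex (ln (norm (c s - z))) (\<theta> s)" for s
  have expL: "exp (L s) = c s - z" if "s \<in> {0..1}" for s
  proof -
    have "s \<in> {A..B}" using that by (simp add: A_def B_def min_def max_def)
    then have "cis (\<theta> s) = sgn (c s - z)" using \<theta>(2)[of s] by simp
    then show ?thesis using nz[of s] by (simp add: L_def exp_eq_polar sgn_eq)
  qed
  have pL: "path L"
  proof -
    have "continuous_on {0..1} (\<lambda>s. ln (norm (c s - z)))"
      by (intro continuous_on_ln continuous_on_norm continuous_on_diff continuous_on_const continuous_on_subset[OF c])
         (use nz in auto)
    moreover have "continuous_on {0..1} \<theta>"
      using \<theta>(1) unfolding arg_lift_def
      by (elim conjE continuous_on_subset) (simp add: A_def B_def min_def max_def)
    ultimately show ?thesis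
      unfolding path_def L_def Complex_eq
      by (intro continuous_on_add continuous_on_mult continuous_on_of_real continuous_on_const)
  qed
  have "winding_number c z = winding_number (\<lambda>s. c s - z) 0"
    by (rule winding_number_offset)
  also have "\<dots> = winding_number (exp \<circ> L) 0"
    by (rule winding_number_cong) (simp add: expL)
  also have "\<dots> = (L 1 - L 0) / (2 * of_real pi * \<i>)"
    using winding_number_compose_exp[OF pL] by (simp add: pathstart_def pathfinish_def)
  also have "L 1 - L 0 = of_real (\<theta> 1 - \<theta> 0) * \<i>"
  proof -
    have "c 1 = c 0" using per[of 0] by simp
    then show ?thesis by (auto simp: L_def intro!: complex_eqI)
  qed
  finally show "winding_number c z = of_real (arg_inc (\<lambda>s. c s - z) s0 (s0 + 1) / (2 * pi))"
    unfolding eq by simp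
qed

text \<open>The product of the displacements from two points placed symmetrically on both sides of the
  curve turns twice as much as the displacement from the point of the curve between them.\<close>

lemma orientation_sign_eq_window:
  assumes simple: "simple_path c" and c: "continuous_on UNIV c" and per: "\<And>s. c (s + 1) = c s"
    and \<theta>: "arg_lift (\<lambda>s. c s - c s0) s0 (s0 + 1) \<theta>"
    and inc: "\<theta> (s0 + 1) - \<theta> s0 = \<sigma> * pi" and \<sigma>: "\<sigma> = 1 \<or> \<sigma> = - 1"
  shows "orientation_sign c = \<sigma>"
    and "\<And>z. z \<in> enclosed_region c \<Longrightarrow> winding_number c z = of_real \<sigma>"
proof -
  define q where "q = c s0"
  define I where "I = {s0..s0 + 1}"
  define m where "m s = (norm (c s - q))\<^sup>2" for s
  define \<kappa> where "\<kappa> s = 2 * (\<theta> s0 - \<theta> s)" for s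
  have c\<theta>: "continuous_on I \<theta>" using \<theta> by (simp add: arg_lift_def I_def)
  have cI: "continuous_on I c" by (rule continuous_on_subset[OF c]) auto
  have sq: "(c s - q)\<^sup>2 = of_real (m s) * cis (2 * \<theta> s)" if "s \<in> I" for s
  proof (cases "s = s0 \<or> s = s0 + 1")
    case True then show ?thesis by (auto simp: q_def m_def per)
  next
    case False
    then have "sgn (c s - q) = cis (\<theta> s)" using \<theta> that by (auto simp: arg_lift_def q_def I_def)
    then have "c s - q = of_real (norm (c s - q)) * cis (\<theta> s)"
      by (simp add: sgn_eq flip: \<open>sgn (c s - q) = cis (\<theta> s)\<close>)
    then have "(c s - q)\<^sup>2 = (of_real (norm (c s - q)) * cis (\<theta> s))\<^sup>2"
      by (rule arg_cong)
    moreover have "(cis (\<theta> s))\<^sup>2 = cis (2 * \<theta> s)" by (simp add: power2_eq_square cis_mult)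
    ultimately show ?thesis by (simp add: m_def power_mult_distrib)
  qed
  have m0: "m s > 0" if "s \<in> I" "s \<noteq> s0" "s \<noteq> s0 + 1" for s
  proof -
    have "sgn (c s - q) = cis (\<theta> s)" using \<theta> that by (auto simp: arg_lift_def q_def I_def)
    then have "c s - q \<noteq> 0" by (metis cis_neq_zero sgn_zero)
    then show ?thesis by (simp add: m_def)
  qed
  have cm: "continuous_on I m" unfolding m_def by (intro continuous_intros cI)
  have c\<kappa>: "continuous_on I (\<lambda>s. cos (\<kappa> s))" unfolding \<kappa>_def by (intro continuous_intros c\<theta>)
  have cos_end: "cos (\<kappa> s0) = 1" "cos (\<kappa> (s0 + 1)) = 1" "cis (\<kappa> s0) = 1" "cis (\<kappa> (s0 + 1)) = 1"
  proof -
    have k: "\<kappa> (s0 + 1) = - 2 * \<sigma> * pi" using inc by (simp add: \<kappa>_def algebra_simps)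
    show "cos (\<kappa> s0) = 1" "cis (\<kappa> s0) = 1" by (simp_all add: \<kappa>_def)
    have "- 2 * \<sigma> * pi = 2 * pi \<or> - 2 * \<sigma> * pi = - (2 * pi)" using \<sigma> by auto
    then have "cis (- 2 * \<sigma> * pi) = 1" by (metis cis_2pi cis_cnj complex_cnj_one)
    then show "cis (\<kappa> (s0 + 1)) = 1" using k by metis
    then show "cos (\<kappa> (s0 + 1)) = 1" by (metis cis.sel(1) one_complex.sel(1))
  qed
  \<comment> \<open>\<open>cos \<kappa>\<close> is 1 at both ends of the period, so where it is not
    positive the curve keeps a positive distance from \<open>q\<close>. Halving that distance makes
    the inequality strict.\<close>
  obtain \<epsilon> where \<epsilon>: "\<epsilon> > 0" and \<epsilon>m: "\<And>s. s \<in> I \<Longrightarrow> cos (\<kappa> s) \<le> 0 \<Longrightarrow> \<epsilon>\<^sup>2 < m s"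
  proof -
    define B where "B = {s \<in> I. cos (\<kappa> s) \<le> 0}"
    have "B = I \<inter> (\<lambda>s. cos (\<kappa> s)) -` {..0}" by (auto simp: B_def)
    moreover have "closed I" by (simp add: I_def)
    ultimately have "closed B" using continuous_closed_preimage[OF c\<kappa> _ closed_atMost, of 0] by simp
    moreover have "B \<subseteq> I" by (auto simp: B_def)
    moreover have "compact I" by (simp add: I_def)
    ultimately have "compact B" using compact_Int_closed[of I B] by (simp add: Int_absorb1)
    show ?thesis
    proof (cases "B = {}")
      case True then show ?thesis by (intro that[of 1]) (auto simp: B_def)
    next
      case False
      obtain s1 where s1: "s1 \<in> B" "\<And>s. s \<in> B \<Longrightarrow> m s1 \<le> m s"
        using continuous_attains_inf[OF \<open>compact B\<close> False continuous_on_subset[OF cm \<open>B \<subseteq> I\<close>]] by blast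
      have "m s1 > 0" using s1(1) cos_end by (intro m0) (auto simp: B_def)
      have "(sqrt (m s1) / 2)\<^sup>2 = m s1 / 4" using \<open>m s1 > 0\<close> by (simp add: power_divide)
      then have "(sqrt (m s1) / 2)\<^sup>2 < m s" if "s \<in> B" for s using s1(2)[OF that] \<open>m s1 > 0\<close> by linarith
      then show ?thesis using \<open>m s1 > 0\<close> by (intro that[of "sqrt (m s1) / 2"]) (auto simp: B_def)
    qed
  qed
  define \<tau> where "\<tau> = cis (\<theta> s0)"
  \<comment> \<open>The two points lie on the normal to the limiting direction \<open>\<tau>\<close>
    at \<open>q\<close>, so that \<open>(c s - zp) * (c s - zm) = (c s - q)\<^sup>2 +
    \<epsilon>\<^sup>2 * \<tau>\<^sup>2\<close>.\<close>
  define zp zm where "zp = q + of_real \<epsilon> * \<i> * \<tau>" and "zm = q - of_real \<epsilon> * \<i> * \<tau>"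
  \<comment> \<open>What remains of that product after removing the positive factor
    \<open>m s + \<epsilon>\<^sup>2\<close> and the direction \<open>cis (2 * \<theta> s)\<close>: a
    convex combination of 1 and \<open>cis (\<kappa> s)\<close>, in the right half plane by the
    choice of \<open>\<epsilon>\<close> and equal to 1 at both ends.\<close>
  define h where "h s = of_real (m s / (m s + \<epsilon>\<^sup>2)) + of_real (\<epsilon>\<^sup>2 / (m s + \<epsilon>\<^sup>2)) * cis (\<kappa> s)" for s
  have mpos: "m s + \<epsilon>\<^sup>2 > 0" for s using \<epsilon> by (simp add: m_def add_nonneg_pos)
  have Re_h: "Re (h s) > 0" if "s \<in> I" for s
  proof -
    have "Re (h s) = (m s + \<epsilon>\<^sup>2 * cos (\<kappa> s)) / (m s + \<epsilon>\<^sup>2)"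
      by (simp add: h_def add_divide_distrib)
    moreover have "m s + \<epsilon>\<^sup>2 * cos (\<kappa> s) > 0"
    proof (cases "cos (\<kappa> s) \<le> 0")
      case True
      have "\<epsilon>\<^sup>2 * cos (\<kappa> s) \<ge> \<epsilon>\<^sup>2 * (- 1)" by (intro mult_left_mono) auto
      then show ?thesis using \<epsilon>m[OF that True] by linarith
    next
      case False
      then show ?thesis using \<epsilon> by (auto simp: m_def intro!: add_nonneg_pos)
    qed
    ultimately show ?thesis using mpos by simp
  qed
  have ch: "continuous_on I h"
    unfolding h_def using mpos
    by (intro continuous_intros cm continuous_on_cis \<kappa>_def) (auto simp: \<kappa>_def less_imp_neq[symmetric] intro!: continuous_intros c\<theta>)
  have prod: "(c s - zp) * (c s - zm) = of_real (m s + \<epsilon>\<^sup>2) * (cis (2 * \<theta> s) * h s)" if "s \<in> I" for s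
  proof -
    have "of_real (m s + \<epsilon>\<^sup>2) * h s = of_real (m s) + of_real (\<epsilon>\<^sup>2) * cis (\<kappa> s)"
    proof -
      have "complex_of_real (m s + \<epsilon>\<^sup>2) \<noteq> 0" using mpos[of s] by (metis less_irrefl of_real_eq_0_iff)
      then show ?thesis unfolding h_def by (simp add: distrib_left del: of_real_add)
    qed
    then have "of_real (m s + \<epsilon>\<^sup>2) * h s * cis (2 * \<theta> s) = (of_real (m s) + of_real (\<epsilon>\<^sup>2) * cis (\<kappa> s)) * cis (2 * \<theta> s)"
      by (rule arg_cong)
    then have "of_real (m s + \<epsilon>\<^sup>2) * (cis (2 * \<theta> s) * h s) = of_real (m s) * cis (2 * \<theta> s) + of_real (\<epsilon>\<^sup>2) * (cis (\<kappa> s) * cis (2 * \<theta> s))"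
      by (simp only: distrib_right mult.assoc mult.commute[of "h s"])
    also have "cis (\<kappa> s) * cis (2 * \<theta> s) = \<tau>\<^sup>2"
      by (simp add: cis_mult \<kappa>_def \<tau>_def power2_eq_square)
    finally show ?thesis
      unfolding sq[OF that, symmetric] zp_def zm_def by (simp add: power2_eq_square algebra_simps)
  qed
  have "c s \<noteq> zp \<and> c s \<noteq> zm" if "s \<in> I" for s
    using prod[OF that] mpos[of s] Re_h[OF that] by (auto simp: of_real_eq_0_iff simp del: of_real_add)
  moreover have "\<exists>s'\<in>I. c s = c s'" for s
  proof -
    interpret periodic_fun_simple c "1::real" by standard (rule per)
    have "c (s - of_int \<lfloor>s - s0\<rfloor>) = c s" by (rule minus_of_int[of s "\<lfloor>s - s0\<rfloor>", simplified])
    moreover have "s - of_int \<lfloor>s - s0\<rfloor> \<in> I"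
      unfolding I_def atLeastAtMost_iff using floor_correct[of "s - s0"] by linarith
    ultimately show ?thesis by metis
  qed
  ultimately have off: "zp \<notin> range c" "zm \<notin> range c" by (metis rangeE)+
  obtain \<theta>p \<theta>m where \<theta>pm: "arg_lift (\<lambda>s. c s - zp) s0 (s0 + 1) \<theta>p" "arg_lift (\<lambda>s. c s - zm) s0 (s0 + 1) \<theta>m"
    using winding_number_eq_arg_inc(2)[OF c per off(1)] winding_number_eq_arg_inc(2)[OF c per off(2)] by blast
  have l1: "arg_lift (\<lambda>s. (c s - zp) * (c s - zm)) s0 (s0 + 1) (\<lambda>s. \<theta>p s + \<theta>m s)"
    using \<theta>pm unfolding arg_lift_def by (auto simp: sgn_mult cis_mult[symmetric] intro: continuous_on_add)
  have l2: "arg_lift (\<lambda>s. (c s - zp) * (c s - zm)) s0 (s0 + 1) (\<lambda>s. 2 * \<theta> s + Arg (h s))"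
    unfolding arg_lift_def
  proof (intro conjI ballI)
    have "continuous_on I (\<lambda>s. Arg (h s))"
      by (rule continuous_on_Arg'[OF ch]) (use Re_h in \<open>force simp: complex_nonpos_Reals_iff\<close>)
    then show "continuous_on {s0..s0 + 1} (\<lambda>s. 2 * \<theta> s + Arg (h s))"
      unfolding I_def[symmetric] by (intro continuous_on_add continuous_on_mult continuous_on_const c\<theta>)
    fix s assume "s \<in> {s0<..<s0 + 1}"
    then have s: "s \<in> I" by (auto simp: I_def)
    have "h s \<noteq> 0" using Re_h[OF s] by auto
    then show "sgn ((c s - zp) * (c s - zm)) = cis (2 * \<theta> s + Arg (h s))"
      unfolding prod[OF s] sgn_mult sgn_of_real using mpos[of s]
      by (simp add: cis_mult[symmetric] cis_Arg)
  qed
  have "h s0 = 1" "h (s0 + 1) = 1"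
    using mpos[of s0] \<epsilon> by (simp_all add: h_def cos_end m_def q_def per)
  then have "(\<theta>p (s0 + 1) + \<theta>m (s0 + 1)) - (\<theta>p s0 + \<theta>m s0) = 2 * (\<sigma> * pi)"
    using arg_lift_unique[OF _ l1 l2] inc by simp
  then have "arg_inc (\<lambda>s. c s - zp) s0 (s0 + 1) + arg_inc (\<lambda>s. c s - zm) s0 (s0 + 1) = 2 * (\<sigma> * pi)"
    using arg_inc_eq[OF _ \<theta>pm(1)] arg_inc_eq[OF _ \<theta>pm(2)] by simp
  then have "(arg_inc (\<lambda>s. c s - zp) s0 (s0 + 1) + arg_inc (\<lambda>s. c s - zm) s0 (s0 + 1)) / (2 * pi) = \<sigma>"
    by simp
  then have sum: "winding_number c zp + winding_number c zm = of_real \<sigma>"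
    unfolding winding_number_eq_arg_inc(1)[OF c per off(1), of s0] winding_number_eq_arg_inc(1)[OF c per off(2), of s0]
    by (simp only: add_divide_distrib flip: of_real_add)
  obtain w :: int where w: "w = 1 \<or> w = - 1" "\<And>z. z \<in> inside (path_image c) \<Longrightarrow> winding_number c z = of_int w"
    using simple_closed_path_winding_number_inside[OF simple] by (metis of_int_1 of_int_minus)
  have loop: "pathfinish c = pathstart c" using per[of 0] by (simp add: pathfinish_def pathstart_def)
  have wn: "(z \<in> inside (path_image c) \<and> winding_number c z = of_int w) \<or> winding_number c z = 0" if "z \<notin> range c" for z
  proof (cases "z \<in> inside (path_image c)")
    case False
    have "z \<notin> path_image c" using that by (auto simp: path_image_def)
    with False have "z \<in> outside (path_image c)" by (simp add: outside_inside)
    then show ?thesis using winding_number_zero_in_outside[OF simple_path_imp_path[OF simple] loop] by simp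
  qed (use w in auto)
  \<comment> \<open>Each of the two winding numbers is 0 or \<open>w\<close>, and their sum is
    \<open>\<sigma>\<close>: exactly one of the points lies inside, and
    \<open>w = \<sigma>\<close>.\<close>
  have res: "of_int w = \<sigma> \<and> (\<exists>z. z \<in> inside (path_image c))"
  proof -
    have cx: "complex_of_real \<sigma> \<noteq> 0" "complex_of_real \<sigma> \<noteq> 2 * of_int w" using \<sigma> w(1) by (auto simp: complex_eq_iff)
    have "complex_of_real \<sigma> = of_int w \<and> (\<exists>z. z \<in> inside (path_image c))"
      using wn[OF off(1)] wn[OF off(2)] sum cx by auto
    then show ?thesis by (metis of_real_eq_iff of_real_of_int_eq)
  qed
  show "\<And>z. z \<in> enclosed_region c \<Longrightarrow> winding_number c z = of_real \<sigma>"
    using w(2) res unfolding enclosed_region_def by (metis of_real_of_int_eq)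
  then show "orientation_sign c = \<sigma>"
    using res \<sigma> unfolding orientation_sign_def enclosed_region_def by (auto simp: complex_eq_iff)
qed

section \<open>Radial integrals in the plane\<close>

text \<open>The sublevel sets of the squared norm are discs of area \<open>pi * x\<close>, so in
  this variable the plane measure is \<open>pi\<close> times Lebesgue measure on the half line. This
  serves as polar coordinates for radial integrands.\<close>

lemma distr_norm_power2_complex:
  "distr lborel borel (\<lambda>z::complex. (norm z)\<^sup>2) = density lborel (\<lambda>x. ennreal pi * indicator {0..} x)"
  (is "?M = ?N")
proof (rule measure_eqI_generator_eq[where \<Omega>=UNIV and E="range (\<lambda>x::real. {..x})" and A="\<lambda>n. {..real n}"])
  show "Int_stable (range (\<lambda>x::real. {..x}))"
    by (auto simp: Int_stable_def)
  show "sets ?M = sigma_sets UNIV (range (\<lambda>x::real. {..x}))" "sets ?N = sigma_sets UNIV (range (\<lambda>x::real. {..x}))"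
    by (simp_all add: borel_eq_atMost)
  have M: "emeasure ?M {..x} = ennreal (pi * max 0 x)" for x
  proof -
    have "emeasure ?M {..x} = emeasure lborel {z::complex. (norm z)\<^sup>2 \<le> x}"
      by (simp add: emeasure_distr vimage_def)
    also have "\<dots> = ennreal (pi * max 0 x)"
    proof (cases "x \<ge> 0")
      case True
      then have "{z::complex. (norm z)\<^sup>2 \<le> x} = cball 0 (sqrt x)"
        by (auto simp: real_le_rsqrt real_sqrt_le_iff dest: real_le_rsqrt) (metis norm_ge_zero power2_le_iff_abs_le real_sqrt_ge_zero real_sqrt_pow2 abs_of_nonneg)
      then show ?thesis using True by (simp add: emeasure_cball unit_ball_vol_2)
    next
      case False
      then have "{z::complex. (norm z)\<^sup>2 \<le> x} = {}"
        by (auto simp: not_le intro: less_le_trans)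
      then show ?thesis using False by simp
    qed
    finally show ?thesis .
  qed
  have N: "emeasure ?N {..x} = ennreal (pi * max 0 x)" for x
  proof -
    have "emeasure ?N {..x} = (\<integral>\<^sup>+ u. ennreal pi * indicator {0..x} u \<partial>lborel)"
      by (subst emeasure_density) (auto intro!: nn_integral_cong split: split_indicator)
    also have "\<dots> = ennreal pi * ennreal (max 0 x)"
      by (subst nn_integral_cmult_indicator) (auto simp: emeasure_lborel_Icc_eq max_def)
    finally show ?thesis by (simp add: ennreal_mult)
  qed
  show "emeasure ?M X = emeasure ?N X" if "X \<in> range (\<lambda>x. {..x})" for X
    using that M N by auto
  show "emeasure ?M {..real n} \<noteq> \<infinity>" for n unfolding M by simp
  show "(\<Union>n. {..real n}) = UNIV" by (auto intro: real_arch_simple)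
qed auto

lemma nn_integral_radial_ball:
  fixes w :: complex
  assumes [measurable]: "f \<in> borel_measurable borel" and "R \<ge> 0"
  shows "(\<integral>\<^sup>+ z. f ((norm (z - w))\<^sup>2) * indicator (cball w R) z \<partial>lborel) =
    (\<integral>\<^sup>+ x. ennreal pi * (f x * indicator {0..R\<^sup>2} x) \<partial>lborel)"
proof -
  have [measurable]: "cball w R \<in> sets borel" by simp
  have "(\<integral>\<^sup>+ z. f ((norm (z - w))\<^sup>2) * indicator (cball w R) z \<partial>lborel) =
      (\<integral>\<^sup>+ z. f ((norm (z::complex))\<^sup>2) * indicator {..R\<^sup>2} ((norm z)\<^sup>2) \<partial>lborel)"
  proof -
    have "(\<integral>\<^sup>+ z. f ((norm (z - w))\<^sup>2) * indicator (cball w R) z \<partial>lborel) =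
        (\<integral>\<^sup>+ z. f ((norm (z - w))\<^sup>2) * indicator (cball w R) z \<partial>distr lborel borel ((+) w))"
      by (simp add: lborel_distr_plus)
    also have "\<dots> = (\<integral>\<^sup>+ z. f ((norm z)\<^sup>2) * indicator (cball w R) (w + z) \<partial>lborel)"
      by (subst nn_integral_distr) (auto, measurable)
    also have "\<dots> = (\<integral>\<^sup>+ z. f ((norm (z::complex))\<^sup>2) * indicator {..R\<^sup>2} ((norm z)\<^sup>2) \<partial>lborel)"
    proof (rule nn_integral_cong)
      fix z :: complex
      have "w + z \<in> cball w R \<longleftrightarrow> (norm z)\<^sup>2 \<in> {..R\<^sup>2}"
        using assms(2) by (auto simp: dist_norm power_mono dest: power2_le_imp_le)
      then show "f ((norm z)\<^sup>2) * indicator (cball w R) (w + z) = f ((norm (z::complex))\<^sup>2) * indicator {..R\<^sup>2} ((norm z)\<^sup>2)"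
        by (simp add: indicator_def)
    qed
    finally show ?thesis .
  qed
  also have "\<dots> = (\<integral>\<^sup>+ x. f x * indicator {..R\<^sup>2} x \<partial>distr lborel borel (\<lambda>z::complex. (norm z)\<^sup>2))"
    by (subst nn_integral_distr) auto
  also have "\<dots> = (\<integral>\<^sup>+ x. ennreal pi * (f x * indicator {0..R\<^sup>2} x) \<partial>lborel)"
    unfolding distr_norm_power2_complex
    by (subst nn_integral_density) (auto intro!: nn_integral_cong split: split_indicator)
  finally show ?thesis .
qed

lemma has_integral_radial_ball:
  fixes w :: complex
  assumes [measurable]: "f \<in> borel_measurable borel" and nn: "\<And>x. f x \<ge> 0" and R: "R \<ge> 0"
    and int: "(f has_integral I) {0..R\<^sup>2}"
  shows "((\<lambda>z. f ((norm (z - w))\<^sup>2)) has_integral pi * I) (cball w R)"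
    and "set_integrable lborel (cball w R) (\<lambda>z. f ((norm (z - w))\<^sup>2))"
proof -
  have I: "I \<ge> 0" by (rule has_integral_nonneg[OF int]) (use nn in auto)
  have "(\<integral>\<^sup>+ z. ennreal (f ((norm (z - w))\<^sup>2)) * indicator (cball w R) z \<partial>lborel)
      = (\<integral>\<^sup>+ x. ennreal pi * (ennreal (f x) * indicator {0..R\<^sup>2} x) \<partial>lborel)"
    by (rule nn_integral_radial_ball) (use R in auto)
  also have "\<dots> = ennreal pi * (\<integral>\<^sup>+ x. ennreal (f x) * indicator {0..R\<^sup>2} x \<partial>lborel)"
    by (rule nn_integral_cmult) auto
  also have "(\<integral>\<^sup>+ x. ennreal (f x) * indicator {0..R\<^sup>2} x \<partial>lborel) = ennreal I"
    by (rule nn_integral_has_integral_lebesgue'[OF _ int]) (use nn in auto)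
  finally have *: "(\<integral>\<^sup>+ z. ennreal (f ((norm (z - w))\<^sup>2)) * indicator (cball w R) z \<partial>lborel) = ennreal (pi * I)"
    using I by (simp add: ennreal_mult)
  have "(\<integral>\<^sup>+ z. ennreal (f ((norm (z - w))\<^sup>2) * indicator (cball w R) z) \<partial>lborel)
      = (\<integral>\<^sup>+ z. ennreal (f ((norm (z - w))\<^sup>2)) * indicator (cball w R) z \<partial>lborel)"
    by (intro nn_integral_cong) (simp split: split_indicator)
  with * have nn': "(\<integral>\<^sup>+ z. ennreal (f ((norm (z - w))\<^sup>2) * indicator (cball w R) z) \<partial>lborel) = ennreal (pi * I)"
    by (rule trans[rotated])
  have [measurable]: "cball w R \<in> sets borel" by simp
  have meas: "(\<lambda>z. f ((norm (z - w))\<^sup>2) * indicator (cball w R) z) \<in> borel_measurable borel" by measurable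
  have nonneg: "0 \<le> f ((norm (z - w))\<^sup>2) * indicator (cball w R) z" for z using nn by simp
  have "((\<lambda>z. f ((norm (z - w))\<^sup>2) * indicator (cball w R) z) has_integral pi * I) UNIV"
    by (rule nn_integral_has_integral[OF meas nonneg nn']) (use I in simp)
  moreover have "(\<lambda>z. f ((norm (z - w))\<^sup>2) * indicator (cball w R) z) = (\<lambda>z. if z \<in> cball w R then f ((norm (z - w))\<^sup>2) else 0)"
    by (auto simp: indicator_def)
  ultimately show "((\<lambda>z. f ((norm (z - w))\<^sup>2)) has_integral pi * I) (cball w R)"
    using has_integral_restrict_UNIV[of "cball w R" "\<lambda>z. f ((norm (z - w))\<^sup>2)" "pi * I"] by metis
  have "integrable lborel (\<lambda>z. f ((norm (z - w))\<^sup>2) * indicator (cball w R) z)"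
    by (rule integrableI_nonneg) (use meas nonneg nn' in auto)
  then show "set_integrable lborel (cball w R) (\<lambda>z. f ((norm (z - w))\<^sup>2))"
    by (simp add: set_integrable_def mult.commute)
qed

text \<open>In the squared radius the integrand is a power with exponent \<open>a / 2 > - 1\<close>.
  The case \<open>a = - 1\<close> serves the Cauchy kernel, \<open>a = 2 * \<beta> j\<close> the
  density at a conical point.\<close>

lemma
  fixes w :: complex
  assumes "a > - 2" "R \<ge> 0"
  shows has_integral_norm_powr_cball:
      "((\<lambda>z. norm (z - w) powr a) has_integral pi * ((R\<^sup>2) powr (a / 2 + 1) / (a / 2 + 1))) (cball w R)"
    and set_integrable_norm_powr_cball: "set_integrable lborel (cball w R) (\<lambda>z. norm (z - w) powr a)"
proof -
  have int: "((\<lambda>x. x powr (a / 2)) has_integral ((R\<^sup>2) powr (a / 2 + 1) / (a / 2 + 1))) {0..R\<^sup>2}"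
    by (rule has_integral_powr_from_0) (use assms in auto)
  have eq: "((norm (z - w))\<^sup>2) powr (a / 2) = norm (z - w) powr a" for z
    by (cases "z = w") (simp_all add: powr_realpow[symmetric] powr_powr flip: powr_numeral)
  show "((\<lambda>z. norm (z - w) powr a) has_integral pi * ((R\<^sup>2) powr (a / 2 + 1) / (a / 2 + 1))) (cball w R)"
    using has_integral_radial_ball(1)[OF _ _ assms(2) int, of w] by (simp add: eq)
  show "set_integrable lborel (cball w R) (\<lambda>z. norm (z - w) powr a)"
    using has_integral_radial_ball(2)[OF _ _ assms(2) int, of w] by (simp add: eq)
qed

section \<open>Regularised Cauchy kernel\<close>

text \<open>For \<open>\<epsilon> = 0\<close> this is \<open>1 / z\<close>. With a denominator that
  has no zeros, convolutions with the kernel can be differentiated under the integral along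
  curves.\<close>

definition cauchy_kernel :: "real \<Rightarrow> complex \<Rightarrow> complex" where
  "cauchy_kernel \<epsilon> z = cnj z / of_real ((norm z)\<^sup>2 + \<epsilon>\<^sup>2)"

text \<open>The derivative of \<open>cauchy_kernel \<epsilon>\<close> with respect to \<open>cnj z\<close>.\<close>

definition bump :: "real \<Rightarrow> complex \<Rightarrow> real" where
  "bump \<epsilon> z = \<epsilon>\<^sup>2 / ((norm z)\<^sup>2 + \<epsilon>\<^sup>2)\<^sup>2"

lemma denominator_pos: "\<epsilon> > 0 \<Longrightarrow> (norm z)\<^sup>2 + \<epsilon>\<^sup>2 > (0::real)"
  by (simp add: add_nonneg_pos)

lemma continuous_on_cauchy_kernel:
  "\<epsilon> > 0 \<Longrightarrow> continuous_on S f \<Longrightarrow> continuous_on S (\<lambda>x. cauchy_kernel \<epsilon> (f x))"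
  unfolding cauchy_kernel_def
  by (intro continuous_on_divide continuous_on_cnj continuous_on_of_real continuous_on_add continuous_on_power
      continuous_on_norm continuous_on_const ballI) (auto simp: denominator_pos less_imp_neq[symmetric] simp del: of_real_add)

lemma continuous_on_bump:
  "\<epsilon> > 0 \<Longrightarrow> continuous_on S f \<Longrightarrow> continuous_on S (\<lambda>x. bump \<epsilon> (f x))"
  unfolding bump_def
  by (intro continuous_on_divide continuous_on_add continuous_on_power
      continuous_on_norm continuous_on_const ballI) (auto simp: denominator_pos less_imp_neq[symmetric])

lemma bump_nonneg: "bump \<epsilon> z \<ge> 0"
  by (simp add: bump_def)

text \<open>The antiderivative in the squared radius is
  \<open>- \<epsilon>\<^sup>2 / (x + \<epsilon>\<^sup>2)\<close>. The total mass \<open>pi\<close>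
  is that of the \<open>cnj z\<close>-derivative of \<open>1 / z\<close>, a point mass.\<close>

lemma has_integral_bump_cball:
  assumes "\<epsilon> > 0" "d \<ge> 0"
  shows "((\<lambda>z. bump \<epsilon> (w - z)) has_integral pi * (d\<^sup>2 / (d\<^sup>2 + \<epsilon>\<^sup>2))) (cball w d)"
proof -
  have p: "x + \<epsilon>\<^sup>2 > 0" if "x \<ge> 0" for x using assms(1) that by (simp add: add_nonneg_pos)
  have "((\<lambda>x. \<epsilon>\<^sup>2 / (x + \<epsilon>\<^sup>2)\<^sup>2) has_integral (- \<epsilon>\<^sup>2 / (d\<^sup>2 + \<epsilon>\<^sup>2)) - (- \<epsilon>\<^sup>2 / (0 + \<epsilon>\<^sup>2))) {0..d\<^sup>2}"
  proof (rule fundamental_theorem_of_calculus)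
    fix x assume "x \<in> {0..d\<^sup>2}"
    then have "x + \<epsilon>\<^sup>2 \<noteq> 0" using p[of x] by auto
    then have "((\<lambda>x. - \<epsilon>\<^sup>2 / (x + \<epsilon>\<^sup>2)) has_real_derivative \<epsilon>\<^sup>2 / (x + \<epsilon>\<^sup>2)\<^sup>2) (at x within {0..d\<^sup>2})"
      by (auto intro!: derivative_eq_intros simp: power2_eq_square)
    then show "((\<lambda>x. - \<epsilon>\<^sup>2 / (x + \<epsilon>\<^sup>2)) has_vector_derivative \<epsilon>\<^sup>2 / (x + \<epsilon>\<^sup>2)\<^sup>2) (at x within {0..d\<^sup>2})"
      by (simp add: has_real_derivative_iff_has_vector_derivative)
  qed simp
  moreover have "(- \<epsilon>\<^sup>2 / (d\<^sup>2 + \<epsilon>\<^sup>2)) - (- \<epsilon>\<^sup>2 / (0 + \<epsilon>\<^sup>2)) = d\<^sup>2 / (d\<^sup>2 + \<epsilon>\<^sup>2)"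
    using assms(1) p[of "d\<^sup>2"] by (simp add: field_simps)
  ultimately have "((\<lambda>x. \<epsilon>\<^sup>2 / (x + \<epsilon>\<^sup>2)\<^sup>2) has_integral d\<^sup>2 / (d\<^sup>2 + \<epsilon>\<^sup>2)) {0..d\<^sup>2}" by simp
  from has_integral_radial_ball(1)[OF _ _ assms(2) this, of w]
  show ?thesis by (simp add: bump_def norm_minus_commute)
qed

lemma integrable_on_bump: "\<epsilon> > 0 \<Longrightarrow> (\<lambda>z. bump \<epsilon> (w - z)) integrable_on cbox a b"
  by (intro integrable_continuous continuous_on_bump continuous_intros)

lemma integral_bump_le:
  assumes "\<epsilon> > 0"
  shows "integral (cbox a b) (\<lambda>z. bump \<epsilon> (w - z)) \<le> pi"
proof -
  obtain R where R: "R \<ge> 0" "cbox a b \<subseteq> cball w R"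
  proof -
    obtain R where "cbox a b \<subseteq> cball w R"
      using bounded_cbox[of a b] unfolding bounded_any_center[of _ w] by (auto simp: subset_iff)
    then have "cbox a b \<subseteq> cball w \<bar>R\<bar>" by auto
    then show ?thesis using that[of "\<bar>R\<bar>"] by simp
  qed
  note I = has_integral_bump_cball[OF assms R(1), of w]
  have "integral (cbox a b) (\<lambda>z. bump \<epsilon> (w - z)) \<le> integral (cball w R) (\<lambda>z. bump \<epsilon> (w - z))"
    by (rule integral_subset_le[OF R(2) integrable_on_bump[OF assms]])
       (use I bump_nonneg in \<open>auto simp: integrable_on_def\<close>)
  also have "\<dots> = pi * (R\<^sup>2 / (R\<^sup>2 + \<epsilon>\<^sup>2))" using I by (rule integral_unique)
  also have "\<dots> \<le> pi * 1"
  proof (rule mult_left_mono)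
    have "R\<^sup>2 + \<epsilon>\<^sup>2 > 0" using assms by (simp add: add_nonneg_pos)
    then show "R\<^sup>2 / (R\<^sup>2 + \<epsilon>\<^sup>2) \<le> 1" by (simp add: divide_le_eq_1)
  qed simp
  finally show ?thesis by simp
qed

lemma bump_convolution_bound:
  fixes \<phi> :: "complex \<Rightarrow> real"
  assumes "\<epsilon> > 0" "continuous_on (cbox a b) \<phi>" "\<And>z. z \<in> cbox a b \<Longrightarrow> \<bar>\<phi> z\<bar> \<le> C" "C \<ge> 0"
  shows "\<bar>integral (cbox a b) (\<lambda>z. \<phi> z * bump \<epsilon> (w - z))\<bar> \<le> C * pi"
proof -
  have "norm (integral (cbox a b) (\<lambda>z. \<phi> z * bump \<epsilon> (w - z))) \<le> integral (cbox a b) (\<lambda>z. C * bump \<epsilon> (w - z))"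
  proof (rule integral_norm_bound_integral)
    show "(\<lambda>z. \<phi> z * bump \<epsilon> (w - z)) integrable_on cbox a b"
      by (intro integrable_continuous continuous_on_mult assms continuous_on_bump continuous_intros)
    show "(\<lambda>z. C * bump \<epsilon> (w - z)) integrable_on cbox a b"
      by (intro integrable_continuous continuous_on_mult assms continuous_on_bump continuous_intros)
    show "norm (\<phi> z * bump \<epsilon> (w - z)) \<le> C * bump \<epsilon> (w - z)" if "z \<in> cbox a b" for z
      using assms(3)[OF that] bump_nonneg[of \<epsilon> "w - z"] by (simp add: abs_mult mult_right_mono)
  qed
  also have "\<dots> = C * integral (cbox a b) (\<lambda>z. bump \<epsilon> (w - z))" by simp
  also have "\<dots> \<le> C * pi" by (intro mult_left_mono integral_bump_le assms)
  finally show ?thesis by simp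
qed

text \<open>An approximate identity of mass pi: near \<open>w\<close> continuity decides, and the
  mass outside a disc about \<open>w\<close> tends to 0. The disc fits into the box because
  \<open>w\<close> is an interior point.\<close>

lemma bump_convolution_limit:
  fixes \<phi> :: "complex \<Rightarrow> real"
  assumes \<epsilon>: "\<And>k. \<epsilon> k > 0" "\<epsilon> \<longlonglongrightarrow> 0" and \<phi>: "continuous_on (cbox a b) \<phi>" and w: "w \<in> box a b"
  shows "(\<lambda>k. integral (cbox a b) (\<lambda>z. \<phi> z * bump (\<epsilon> k) (w - z))) \<longlonglongrightarrow> pi * \<phi> w"
proof -
  define B where "B = cbox a b"
  obtain C where C: "\<And>z. z \<in> B \<Longrightarrow> \<bar>\<phi> z\<bar> \<le> C" "C > 0"
  proof -
    have "bounded (\<phi> ` B)" unfolding B_def by (rule compact_imp_bounded[OF compact_continuous_image[OF \<phi>]]) simp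
    then show ?thesis using that unfolding bounded_pos by auto
  qed
  have wB: "w \<in> B" using w box_subset_cbox by (auto simp: B_def)
  have "(\<lambda>k. integral B (\<lambda>z. \<phi> z * bump (\<epsilon> k) (w - z)) - pi * \<phi> w) \<longlonglongrightarrow> 0"
  proof (rule LIMSEQ_I)
    fix r :: real assume "r > 0"
    define \<eta> where "\<eta> = r / (4 * pi)"
    have \<eta>: "\<eta> > 0" using \<open>r > 0\<close> by (simp add: \<eta>_def)
    obtain d1 where d1: "d1 > 0" "\<And>z. z \<in> B \<Longrightarrow> dist z w < d1 \<Longrightarrow> \<bar>\<phi> z - \<phi> w\<bar> < \<eta>"
      using \<phi>[unfolded continuous_on_iff, rule_format, of w \<eta>] wB \<eta> by (auto simp: B_def dist_real_def)
    obtain d2 where d2: "d2 > 0" "cball w d2 \<subseteq> B"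
      using open_contains_cball[of "box a b"] w box_subset_cbox[of a b] by (auto simp: B_def)
    define d where "d = min (d1 / 2) d2"
    have d: "d > 0" "cball w d \<subseteq> B" "\<And>z. z \<in> cball w d \<Longrightarrow> \<bar>\<phi> z - \<phi> w\<bar> < \<eta>"
    proof -
      show "d > 0" using d1 d2 by (simp add: d_def)
      show sub: "cball w d \<subseteq> B" using d2 by (auto simp: d_def)
      fix z assume "z \<in> cball w d"
      then show "\<bar>\<phi> z - \<phi> w\<bar> < \<eta>" using d1(2)[of z] sub d1(1) by (auto simp: d_def dist_commute)
    qed
    \<comment> \<open>The factor 3 collects \<open>2 * C\<close> for the oscillation outside the
      disc and \<open>C\<close> for the mass that the box misses.\<close>
    have bound: "\<bar>integral B (\<lambda>z. \<phi> z * bump e (w - z)) - pi * \<phi> w\<bar> \<le> \<eta> * pi + 3 * C * (pi - pi * (d\<^sup>2 / (d\<^sup>2 + e\<^sup>2)))"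
      if e: "e > 0" for e
    proof -
      define m where "m = integral B (\<lambda>z. bump e (w - z))"
      define md where "md = pi * (d\<^sup>2 / (d\<^sup>2 + e\<^sup>2))"
      have Id: "((\<lambda>z. bump e (w - z)) has_integral md) (cball w d)"
        unfolding md_def by (rule has_integral_bump_cball) (use e d in auto)
      have Idr: "((\<lambda>z. if z \<in> cball w d then bump e (w - z) else 0) has_integral md) B"
        using has_integral_restrict[OF d(2)] Id by metis
      have Ib: "((\<lambda>z. bump e (w - z)) has_integral m) B"
        unfolding m_def B_def using integrable_on_bump[OF e] by (rule integrable_integral)
      have m: "m \<le> pi" "md \<le> m"
        unfolding m_def B_def using integral_bump_le[OF e] apply blast
        using integral_subset_le[OF d(2), of "\<lambda>z. bump e (w - z)"] Id Ib bump_nonneg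
        unfolding integral_unique[OF Id] B_def by (auto simp: integrable_on_def)
      have "norm (integral B (\<lambda>z. (\<phi> z - \<phi> w) * bump e (w - z)))
          \<le> integral B (\<lambda>z. \<eta> * bump e (w - z) + 2 * C * (bump e (w - z) - (if z \<in> cball w d then bump e (w - z) else 0)))"
      proof (rule integral_norm_bound_integral)
        show "(\<lambda>z. (\<phi> z - \<phi> w) * bump e (w - z)) integrable_on B"
          unfolding B_def by (intro integrable_continuous continuous_on_mult continuous_on_diff \<phi> continuous_on_bump e continuous_on_const continuous_on_id)
        show "(\<lambda>z. \<eta> * bump e (w - z) + 2 * C * (bump e (w - z) - (if z \<in> cball w d then bump e (w - z) else 0))) integrable_on B"
          by (intro integrable_add integrable_on_mult_right integrable_diff) (use Ib Idr in \<open>auto simp: integrable_on_def\<close>)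
        fix z assume z: "z \<in> B"
        have b: "bump e (w - z) \<ge> 0" by (rule bump_nonneg)
        show "norm ((\<phi> z - \<phi> w) * bump e (w - z)) \<le> \<eta> * bump e (w - z) + 2 * C * (bump e (w - z) - (if z \<in> cball w d then bump e (w - z) else 0))"
        proof (cases "z \<in> cball w d")
          case True
          then show ?thesis using d(3)[OF True] b by (simp add: abs_mult mult_right_mono)
        next
          case False
          have "\<bar>\<phi> z - \<phi> w\<bar> \<le> 2 * C" using C(1)[OF z] C(1)[OF wB] by linarith
          then have "\<bar>\<phi> z - \<phi> w\<bar> * bump e (w - z) \<le> 2 * C * bump e (w - z)" by (rule mult_right_mono[OF _ b])
          moreover have "0 \<le> \<eta> * bump e (w - z)" using \<eta> b by simp
          ultimately show ?thesis using False b by (simp add: abs_mult)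
        qed
      qed
      also have "\<dots> = \<eta> * m + 2 * C * (m - md)"
        by (rule integral_unique) (intro has_integral_add has_integral_mult_right has_integral_diff Ib Idr)
      also have "\<dots> \<le> \<eta> * pi + 2 * C * (pi - md)"
        using m \<eta> C(2) by (intro add_mono mult_left_mono) auto
      finally have 1: "\<bar>integral B (\<lambda>z. (\<phi> z - \<phi> w) * bump e (w - z))\<bar> \<le> \<eta> * pi + 2 * C * (pi - md)" by simp
      have "(\<lambda>z. \<phi> z * bump e (w - z)) integrable_on B"
        unfolding B_def by (intro integrable_continuous continuous_on_mult continuous_on_diff \<phi> continuous_on_bump e continuous_on_const continuous_on_id)
      from integral_diff[OF this has_integral_integrable[OF has_integral_mult_right[OF Ib, of "\<phi> w"]]]
      have "integral B (\<lambda>z. (\<phi> z - \<phi> w) * bump e (w - z)) = integral B (\<lambda>z. \<phi> z * bump e (w - z)) - \<phi> w * m"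
        unfolding left_diff_distrib integral_unique[OF has_integral_mult_right[OF Ib, of "\<phi> w"]] .
      then have "integral B (\<lambda>z. \<phi> z * bump e (w - z)) - pi * \<phi> w
          = integral B (\<lambda>z. (\<phi> z - \<phi> w) * bump e (w - z)) - \<phi> w * (pi - m)" by (simp add: algebra_simps)
      moreover have "\<bar>\<phi> w * (pi - m)\<bar> \<le> C * (pi - md)"
        unfolding abs_mult using C(1)[OF wB] C(2) m by (intro mult_mono) auto
      ultimately show ?thesis using 1 unfolding md_def[symmetric] by (simp add: algebra_simps)
    qed
    have "(\<lambda>k. \<eta> * pi + 3 * C * (pi - pi * (d\<^sup>2 / (d\<^sup>2 + (\<epsilon> k)\<^sup>2)))) \<longlonglongrightarrow> \<eta> * pi + 3 * C * (pi - pi * (d\<^sup>2 / (d\<^sup>2 + 0\<^sup>2)))"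
      by (intro tendsto_intros \<epsilon>) (use d in auto)
    then have "(\<lambda>k. \<eta> * pi + 3 * C * (pi - pi * (d\<^sup>2 / (d\<^sup>2 + (\<epsilon> k)\<^sup>2)))) \<longlonglongrightarrow> r / 4"
      using d(1) by (simp add: \<eta>_def)
    from order_tendstoD(2)[OF this, of r] \<open>r > 0\<close>
    obtain N where N: "\<And>k. k \<ge> N \<Longrightarrow> \<eta> * pi + 3 * C * (pi - pi * (d\<^sup>2 / (d\<^sup>2 + (\<epsilon> k)\<^sup>2))) < r"
      by (auto simp: eventually_sequentially)
    show "\<exists>N. \<forall>k\<ge>N. norm (integral B (\<lambda>z. \<phi> z * bump (\<epsilon> k) (w - z)) - pi * \<phi> w - 0) < r"
    proof (intro exI allI impI)
      fix k assume "k \<ge> N"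
      from bound[OF \<epsilon>(1), of k] N[OF this]
      show "norm (integral B (\<lambda>z. \<phi> z * bump (\<epsilon> k) (w - z)) - pi * \<phi> w - 0) < r" by simp
    qed
  qed
  then show ?thesis unfolding B_def by (rule LIM_zero_cancel)
qed

text \<open>Uniform in \<open>\<epsilon>\<close>, hence the majorant as \<open>\<epsilon>\<close>
  tends to 0; at \<open>z = 0\<close> both sides vanish, since
  \<open>0 powr (- 1) = 0\<close>.\<close>

lemma norm_cauchy_kernel_le: "norm (cauchy_kernel \<epsilon> z) \<le> norm z powr (- 1)"
proof (cases "z = 0")
  case False
  then have "norm z * norm z \<le> (norm z)\<^sup>2 + \<epsilon>\<^sup>2" by (simp add: power2_eq_square)
  moreover have "(norm z)\<^sup>2 + \<epsilon>\<^sup>2 > 0" using False by (simp add: add_pos_nonneg)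
  ultimately have "norm z / ((norm z)\<^sup>2 + \<epsilon>\<^sup>2) \<le> 1 / norm z"
    using False by (simp add: field_simps)
  moreover have "norm (cauchy_kernel \<epsilon> z) = norm z / ((norm z)\<^sup>2 + \<epsilon>\<^sup>2)"
    unfolding cauchy_kernel_def norm_divide norm_of_real using \<open>(norm z)\<^sup>2 + \<epsilon>\<^sup>2 > 0\<close> by simp
  ultimately show ?thesis using False by (simp add: powr_minus_divide)
qed (simp add: cauchy_kernel_def)

text \<open>Also true at \<open>z = 0\<close>, where the kernel is 0 and
  \<open>1 / 0 = 0\<close>.\<close>

lemma cauchy_kernel_limit:
  assumes "\<epsilon> \<longlonglongrightarrow> 0"
  shows "(\<lambda>k. cauchy_kernel (\<epsilon> k) z) \<longlonglongrightarrow> 1 / z"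
proof (cases "z = 0")
  case False
  have "(\<lambda>k. cauchy_kernel (\<epsilon> k) z) \<longlonglongrightarrow> cnj z / of_real ((norm z)\<^sup>2 + 0\<^sup>2)"
    unfolding cauchy_kernel_def by (intro tendsto_intros assms) (use False in auto)
  moreover have "cnj z / of_real ((norm z)\<^sup>2 + 0\<^sup>2) = 1 / z"
  proof -
    have "complex_of_real ((norm z)\<^sup>2 + 0\<^sup>2) = cnj z * z" using complex_norm_square[of z] by (simp add: mult.commute)
    then show ?thesis using False by (simp only: nonzero_divide_mult_cancel_left complex_cnj_zero_iff not_False_eq_True)
  qed
  ultimately show ?thesis by (simp only:)
qed (simp add: cauchy_kernel_def)

text \<open>\<open>2 * pi * R\<close> is the integral of the reciprocal distance from
  \<open>w\<close> over the disc of radius \<open>R\<close>; the same function dominates the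
  limit.\<close>

lemma
  fixes \<phi> :: "complex \<Rightarrow> real"
  assumes \<phi>: "continuous_on (cbox a b) \<phi>" "\<And>z. z \<in> cbox a b \<Longrightarrow> \<bar>\<phi> z\<bar> \<le> C" "C \<ge> 0"
    and R: "R \<ge> 0" "cbox a b \<subseteq> cball w R"
  shows cauchy_convolution_bound: "\<epsilon> > 0 \<Longrightarrow>
      norm (integral (cbox a b) (\<lambda>z. of_real (\<phi> z) * cauchy_kernel \<epsilon> (w - z))) \<le> C * (2 * pi * R)"
    and cauchy_convolution_limit: "(\<And>k. \<delta> k > 0) \<Longrightarrow> \<delta> \<longlonglongrightarrow> 0 \<Longrightarrow>
      (\<lambda>k. integral (cbox a b) (\<lambda>z. of_real (\<phi> z) * cauchy_kernel (\<delta> k) (w - z)))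
        \<longlonglongrightarrow> integral (cbox a b) (\<lambda>z. of_real (\<phi> z) / (w - z))"
proof -
  have I: "((\<lambda>z. norm (z - w) powr - 1) has_integral (2 * pi * R)) (cball w R)"
  proof -
    have eq: "pi * ((R\<^sup>2) powr (- 1 / 2 + 1) / (- 1 / 2 + 1)) = 2 * pi * R"
      using R(1) by (simp add: powr_half_sqrt)
    show ?thesis
      unfolding eq[symmetric] by (rule has_integral_norm_powr_cball) (use R(1) in auto)
  qed
  have int: "(\<lambda>z. C * norm (z - w) powr - 1) integrable_on cbox a b"
  proof (rule integrable_on_mult_right)
    have "(\<lambda>z. norm (z - w) powr - 1) absolutely_integrable_on cball w R"
      using I by (intro nonnegative_absolutely_integrable_1) (auto simp: integrable_on_def)
    from set_integrable_subset[OF this _ R(2)]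
    show "(\<lambda>z. norm (z - w) powr - 1) integrable_on cbox a b"
      by (simp add: set_lebesgue_integral_eq_integral)
  qed
  have cont: "(\<lambda>z. of_real (\<phi> z) * cauchy_kernel e (w - z)) integrable_on cbox a b" if "e > 0" for e
    by (intro integrable_continuous continuous_on_mult continuous_on_of_real \<phi> continuous_on_cauchy_kernel that continuous_intros)
  have bd: "norm (of_real (\<phi> z) * cauchy_kernel e (w - z)) \<le> C * norm (z - w) powr - 1"
    if "z \<in> cbox a b" for z e
    unfolding norm_mult using \<phi>(2)[OF that] \<phi>(3) norm_cauchy_kernel_le[of e "w - z"]
    by (intro mult_mono) (auto simp: norm_minus_commute)
  show "norm (integral (cbox a b) (\<lambda>z. of_real (\<phi> z) * cauchy_kernel \<epsilon> (w - z))) \<le> C * (2 * pi * R)"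
    if "\<epsilon> > 0"
  proof -
    have "norm (integral (cbox a b) (\<lambda>z. of_real (\<phi> z) * cauchy_kernel \<epsilon> (w - z)))
        \<le> integral (cbox a b) (\<lambda>z. C * norm (z - w) powr - 1)"
      by (rule integral_norm_bound_integral[OF cont[OF that] int bd])
    also have "\<dots> \<le> integral (cball w R) (\<lambda>z. C * norm (z - w) powr - 1)"
      by (rule integral_subset_le[OF R(2) int has_integral_integrable[OF has_integral_mult_right[OF I]]])
         (use \<phi>(3) in auto)
    also have "\<dots> = C * (2 * pi * R)" by (rule integral_unique[OF has_integral_mult_right[OF I]])
    finally show ?thesis .
  qed
  show "(\<lambda>k. integral (cbox a b) (\<lambda>z. of_real (\<phi> z) * cauchy_kernel (\<delta> k) (w - z)))
        \<longlonglongrightarrow> integral (cbox a b) (\<lambda>z. of_real (\<phi> z) / (w - z))" if "\<And>k. \<delta> k > 0" "\<delta> \<longlonglongrightarrow> 0"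
  proof (rule dominated_convergence(2)[OF cont[OF that(1)] int bd])
    show "(\<lambda>k. of_real (\<phi> z) * cauchy_kernel (\<delta> k) (w - z)) \<longlonglongrightarrow> of_real (\<phi> z) / (w - z)" for z
      using tendsto_mult[OF tendsto_const cauchy_kernel_limit[OF that(2), of "w - z"], of "of_real (\<phi> z)"] by simp
  qed
qed

section \<open>Symmetry of second derivatives and Green's formula\<close>

lemma norm_increment_le:
  fixes f :: "real \<Rightarrow> 'b::real_normed_vector"
  assumes "0 \<le> h" "\<And>s. s \<in> {0..h} \<Longrightarrow> (f has_vector_derivative f' s) (at s within {0..h})"
    and "\<And>s. s \<in> {0..h} \<Longrightarrow> norm (f' s) \<le> B"
  shows "norm (f h - f 0) \<le> B * h"
proof -
  have "norm (f h - f 0) \<le> B * norm (h - 0)"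
  proof (rule differentiable_bound[of "{0..h}"])
    fix s assume s: "s \<in> {0..h}"
    show "(f has_derivative (\<lambda>u. u *\<^sub>R f' s)) (at s within {0..h})"
      using assms(2)[OF s] by (simp add: has_vector_derivative_def)
    show "onorm (\<lambda>u. u *\<^sub>R f' s) \<le> B"
    proof (rule onorm_le)
      fix u :: real
      show "norm (u *\<^sub>R f' s) \<le> B * norm u"
        using mult_right_mono[OF assms(3)[OF s], of "\<bar>u\<bar>"] by (simp add: mult.commute)
    qed
  qed (use assms(1) in auto)
  then show ?thesis using assms(1) by simp
qed

lemma has_vector_derivative_along_line:
  assumes "(f has_derivative f') (at (z + s *\<^sub>R a))"
  shows "((\<lambda>s. f (z + s *\<^sub>R a)) has_vector_derivative f' a) (at s within A)"
proof -
  have "((\<lambda>s. z + s *\<^sub>R a) has_derivative (\<lambda>h. h *\<^sub>R a)) (at s within A)"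
    by (auto intro!: derivative_eq_intros)
  from has_derivative_compose[OF this assms]
  have "((\<lambda>s. f (z + s *\<^sub>R a)) has_derivative (\<lambda>h. f' (h *\<^sub>R a))) (at s within A)" .
  moreover have "f' (h *\<^sub>R a) = h *\<^sub>R f' a" for h
    using has_derivative_bounded_linear[OF assms] by (simp add: linear_simps)
  ultimately show ?thesis by (simp add: has_vector_derivative_def)
qed

text \<open>Two mean value estimates: along \<open>b\<close> for the \<open>a\<close>-derivative,
  and along \<open>a\<close> for the difference of \<open>f\<close> over the step
  \<open>h *\<^sub>R b\<close>.\<close>

lemma second_difference_bound:
  fixes f :: "'a::real_normed_vector \<Rightarrow> 'b::real_normed_vector"
  assumes f: "\<And>w. w \<in> ball z r \<Longrightarrow> (f has_derivative F w) (at w)"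
    and Fa: "\<And>w. w \<in> ball z r \<Longrightarrow> ((\<lambda>w. F w a) has_derivative H w) (at w)"
    and H: "\<And>w. w \<in> ball z r \<Longrightarrow> norm (H w b - c) \<le> e"
    and h: "h > 0" "h * (norm a + norm b) < r"
  shows "norm (f (z + h *\<^sub>R a + h *\<^sub>R b) - f (z + h *\<^sub>R a) - f (z + h *\<^sub>R b) + f z - (h * h) *\<^sub>R c) \<le> e * h * h"
proof -
  have inb: "z + s *\<^sub>R a + t *\<^sub>R b \<in> ball z r" if "s \<in> {0..h}" "t \<in> {0..h}" for s t
  proof -
    have "norm (s *\<^sub>R a + t *\<^sub>R b) \<le> s * norm a + t * norm b"
      using that norm_triangle_ineq[of "s *\<^sub>R a" "t *\<^sub>R b"] by simp
    also have "\<dots> \<le> h * norm a + h * norm b" using that by (intro add_mono mult_right_mono) auto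
    also have "\<dots> < r" using h(2) by (simp add: distrib_left)
    finally have "norm (s *\<^sub>R a + t *\<^sub>R b) < r" .
    moreover have "dist z (z + s *\<^sub>R a + t *\<^sub>R b) = norm (s *\<^sub>R a + t *\<^sub>R b)"
      unfolding dist_norm norm_minus_commute[of z] by (simp add: add.assoc)
    ultimately show ?thesis by simp
  qed
  have inner: "norm (F (z + s *\<^sub>R a + h *\<^sub>R b) a - F (z + s *\<^sub>R a) a - h *\<^sub>R c) \<le> e * h" if s: "s \<in> {0..h}" for s
  proof -
    have "norm ((F (z + s *\<^sub>R a + h *\<^sub>R b) a - h *\<^sub>R c) - (F (z + s *\<^sub>R a + 0 *\<^sub>R b) a - 0 *\<^sub>R c)) \<le> e * h"
    proof (rule norm_increment_le)
      fix t assume t: "t \<in> {0..h}"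
      show "((\<lambda>t. F (z + s *\<^sub>R a + t *\<^sub>R b) a - t *\<^sub>R c) has_vector_derivative H (z + s *\<^sub>R a + t *\<^sub>R b) b - c) (at t within {0..h})"
        by (intro has_vector_derivative_diff has_vector_derivative_along_line[OF Fa] inb s t)
           (auto intro!: derivative_eq_intros)
      show "norm (H (z + s *\<^sub>R a + t *\<^sub>R b) b - c) \<le> e" by (intro H inb s t)
    qed (use h in simp)
    then show ?thesis by (simp add: algebra_simps)
  qed
  have h0: "0 \<in> {0..h}" "h \<in> {0..h}" using h by auto
  have "norm ((f (z + h *\<^sub>R b + h *\<^sub>R a) - f (z + h *\<^sub>R a) - h *\<^sub>R (h *\<^sub>R c))
      - (f (z + h *\<^sub>R b + 0 *\<^sub>R a) - f (z + 0 *\<^sub>R a) - 0 *\<^sub>R (h *\<^sub>R c))) \<le> (e * h) * h"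
  proof (rule norm_increment_le)
    fix s assume s: "s \<in> {0..h}"
    have eq: "z + h *\<^sub>R b + s *\<^sub>R a = z + s *\<^sub>R a + h *\<^sub>R b" by simp
    have 1: "z + h *\<^sub>R b + s *\<^sub>R a \<in> ball z r" unfolding eq by (rule inb[OF s h0(2)])
    have 2: "z + s *\<^sub>R a \<in> ball z r" using inb[OF s h0(1)] by simp
    show "((\<lambda>s. f (z + h *\<^sub>R b + s *\<^sub>R a) - f (z + s *\<^sub>R a) - s *\<^sub>R (h *\<^sub>R c)) has_vector_derivative
        F (z + h *\<^sub>R b + s *\<^sub>R a) a - F (z + s *\<^sub>R a) a - h *\<^sub>R c) (at s within {0..h})"
      by (intro has_vector_derivative_diff has_vector_derivative_along_line[OF f[OF 1]] has_vector_derivative_along_line[OF f[OF 2]])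
         (auto intro!: derivative_eq_intros)
    show "norm (F (z + h *\<^sub>R b + s *\<^sub>R a) a - F (z + s *\<^sub>R a) a - h *\<^sub>R c) \<le> e * h"
      unfolding eq by (rule inner[OF s])
  qed (use h in simp)
  then show ?thesis by (simp add: algebra_simps)
qed

lemma Ck_on_has_derivative:
  "Ck_on S f (Suc k) \<Longrightarrow> x \<in> S \<Longrightarrow> (f has_derivative frechet_derivative f (at x)) (at x)"
  by (simp add: frechet_derivative_works)

text \<open>The mixed second difference is symmetric in \<open>a\<close> and \<open>b\<close> and,
  divided by \<open>h * h\<close>, approximates both iterated derivatives.\<close>

lemma symmetric_second_derivative:
  fixes f :: "'a::real_normed_vector \<Rightarrow> 'b::real_normed_vector"
  assumes S: "open S" and f: "Ck_on S f (Suc (Suc 0))" and z: "z \<in> S"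
  shows "frechet_derivative (\<lambda>w. frechet_derivative f (at w) a) (at z) b =
    frechet_derivative (\<lambda>w. frechet_derivative f (at w) b) (at z) a"
proof -
  define F where "F w = frechet_derivative f (at w)" for w
  define H where "H a w = frechet_derivative (\<lambda>w. F w a) (at w)" for a w
  have F: "(f has_derivative F w) (at w)" if "w \<in> S" for w
    using Ck_on_has_derivative[OF f that] by (simp add: F_def)
  have Ck1: "Ck_on S (\<lambda>w. F w a) (Suc 0)" for a using f by (simp add: F_def)
  have H: "((\<lambda>w. F w a) has_derivative H a w) (at w)" if "w \<in> S" for w a
    unfolding H_def by (rule Ck_on_has_derivative[OF Ck1 that])
  have cH: "continuous_on S (\<lambda>w. H a w b)" for a b using Ck1[of a] by (simp add: H_def)
  have "norm (H a z b - H b z a) \<le> 2 * e" if e: "e > 0" for e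
  proof -
    have "\<exists>r>0. ball z r \<subseteq> S \<and> (\<forall>w\<in>ball z r. norm (H a w b - H a z b) \<le> e)" for a b
    proof -
      have "isCont (\<lambda>w. H a w b) z" using cH S z by (simp add: continuous_on_eq_continuous_at)
      then obtain d where "d > 0" "\<And>w. dist w z < d \<Longrightarrow> dist (H a w b) (H a z b) < e"
        using e unfolding continuous_at_eps_delta by blast
      moreover obtain d' where "d' > 0" "ball z d' \<subseteq> S" using S z by (meson openE)
      ultimately show ?thesis
        by (intro exI[of _ "min d d'"]) (auto simp: dist_norm norm_minus_commute less_imp_le)
    qed
    then obtain r1 r2 where r: "r1 > 0" "r2 > 0" "ball z r1 \<subseteq> S" "ball z r2 \<subseteq> S"
      "\<And>w. w \<in> ball z r1 \<Longrightarrow> norm (H a w b - H a z b) \<le> e" "\<And>w. w \<in> ball z r2 \<Longrightarrow> norm (H b w a - H b z a) \<le> e"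
      by meson
    \<comment> \<open>The summand 1 keeps \<open>n\<close> positive when \<open>a\<close> and
      \<open>b\<close> vanish.\<close>
    define n where "n = norm a + norm b + 1"
    have n: "n > 0" by (simp add: n_def add_nonneg_pos)
    define h where "h = min r1 r2 / (2 * n)"
    have h: "h > 0" using r n by (simp add: h_def)
    have "h * (norm a + norm b) \<le> h * n" using h by (intro mult_left_mono) (auto simp: n_def)
    also have "h * n = min r1 r2 / 2" using n by (simp add: h_def)
    also have "\<dots> < min r1 r2" using r(1,2) by (simp add: min_def)
    finally have hr: "h * (norm a + norm b) < r1" "h * (norm b + norm a) < r2" by (simp_all add: add.commute)
    define \<Delta> where "\<Delta> = f (z + h *\<^sub>R a + h *\<^sub>R b) - f (z + h *\<^sub>R a) - f (z + h *\<^sub>R b) + f z"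
    have 1: "norm (\<Delta> - (h * h) *\<^sub>R H a z b) \<le> e * h * h"
      unfolding \<Delta>_def by (rule second_difference_bound[where F=F and H="H a" and r=r1]) (use r F H h hr in auto)
    have "norm (f (z + h *\<^sub>R b + h *\<^sub>R a) - f (z + h *\<^sub>R b) - f (z + h *\<^sub>R a) + f z - (h * h) *\<^sub>R H b z a) \<le> e * h * h"
      by (rule second_difference_bound[where F=F and H="H b" and r=r2]) (use r F H h hr in auto)
    then have 2: "norm (\<Delta> - (h * h) *\<^sub>R H b z a) \<le> e * h * h" by (simp add: \<Delta>_def algebra_simps)
    have "(h * h) * norm (H a z b - H b z a) = norm ((\<Delta> - (h * h) *\<^sub>R H b z a) - (\<Delta> - (h * h) *\<^sub>R H a z b))"
      using h by (simp flip: scaleR_diff_right)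
    also have "\<dots> \<le> e * h * h + e * h * h" by (rule norm_triangle_le_diff) (use 1 2 in simp)
    also have "\<dots> = (h * h) * (2 * e)" by simp
    finally show ?thesis using h by simp
  qed
  from this[OF half_gt_zero] have "norm (H a z b - H b z a) \<le> 0 + e" if "e > 0" for e
    using that by simp
  then have "norm (H a z b - H b z a) \<le> 0" by (rule field_le_epsilon)
  then show ?thesis by (simp add: H_def F_def)
qed

text \<open>\<open>Pt\<close> and \<open>Qs\<close> are controlled only in the open rectangle, their
  difference \<open>G\<close> on the closed one. The time integral \<open>q\<close> of
  \<open>Q\<close> has the \<open>s\<close>-derivative \<open>p\<close>, which is continuous up to
  the ends of the arc; these are reached because \<open>q\<close> is continuous there.\<close>

lemma green_strip:
  fixes P Q G :: "real \<times> real \<Rightarrow> complex"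
  assumes xy: "x < y"
    and P: "continuous_on ({x..y} \<times> {0..T}) P" and Q: "continuous_on ({x..y} \<times> {0..T}) Q"
    and G: "continuous_on ({x..y} \<times> {0..T}) G"
    and Pt: "\<And>s t. s \<in> {x<..<y} \<Longrightarrow> t \<in> {0<..<T} \<Longrightarrow> ((\<lambda>t. P (s, t)) has_vector_derivative Pt (s, t)) (at t)"
    and Qs: "\<And>s t. s \<in> {x<..<y} \<Longrightarrow> t \<in> {0<..<T} \<Longrightarrow> ((\<lambda>s. Q (s, t)) has_vector_derivative Qs (s, t)) (at s)"
    and cQs: "continuous_on ({x<..<y} \<times> {0<..<T}) Qs"
    and eq: "\<And>z. z \<in> {x<..<y} \<times> {0<..<T} \<Longrightarrow> Pt z - Qs z = G z"
    and t: "0 < t1" "t1 \<le> t2" "t2 < T"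
  shows "integral {x..y} (\<lambda>s. P (s, t2)) - integral {x..y} (\<lambda>s. P (s, t1)) =
    integral {t1..t2} (\<lambda>t. Q (y, t) - Q (x, t)) + integral {x..y} (\<lambda>s. integral {t1..t2} (\<lambda>t. G (s, t)))"
proof -
  define p where "p s = P (s, t2) - P (s, t1) - integral {t1..t2} (\<lambda>t. G (s, t))" for s
  define q where "q s = integral {t1..t2} (\<lambda>t. Q (s, t))" for s
  have slice: "continuous_on A (\<lambda>s. F (s, t))" if "continuous_on (A \<times> C) F" "t \<in> C" for A C t and F :: "real \<times> real \<Rightarrow> complex"
    by (rule continuous_on_compose2[OF that(1)]) (use that(2) in \<open>auto intro!: continuous_intros\<close>)
  have slice': "continuous_on C (\<lambda>t. F (s, t))" if "continuous_on (A \<times> C) F" "s \<in> A" for A C s and F :: "real \<times> real \<Rightarrow> complex"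
    by (rule continuous_on_compose2[OF that(1)]) (use that(2) in \<open>auto intro!: continuous_intros\<close>)
  have param: "continuous_on {x..y} (\<lambda>s. integral {t1..t2} (\<lambda>t. F (s, t)))" if "continuous_on ({x..y} \<times> {0..T}) F" for F :: "real \<times> real \<Rightarrow> complex"
  proof -
    have "continuous_on ({x..y} \<times> cbox t1 t2) (\<lambda>(s, t). F (s, t))"
    proof -
      have "continuous_on ({x..y} \<times> {t1..t2}) F"
        by (rule continuous_on_subset[OF that]) (use t in auto)
      then show ?thesis by simp
    qed
    from integral_continuous_on_param[OF this] show ?thesis by simp
  qed
  have cP: "continuous_on {x..y} (\<lambda>s. P (s, t1))" "continuous_on {x..y} (\<lambda>s. P (s, t2))"
    using slice[OF P] t by auto
  have "continuous_on {x..y} p" unfolding p_def by (intro continuous_on_diff cP param[OF G])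
  have cq: "continuous_on {x..y} q" unfolding q_def by (rule param[OF Q])
  have "(p has_integral (q y - q x)) {x..y}"
  proof (rule fundamental_theorem_of_calculus_interior)
    fix s assume s: "s \<in> {x<..<y}"
    have sub: "{t1..t2} \<subseteq> {0<..<T}" using t by auto
    have "((\<lambda>s. integral (cbox t1 t2) (\<lambda>t. Q (s, t))) has_vector_derivative integral (cbox t1 t2) (\<lambda>t. Qs (s, t))) (at s within {x<..<y})"
    proof (rule leibniz_rule_vector_derivative)
      show "((\<lambda>s. Q (s, t)) has_vector_derivative Qs (u, t)) (at u within {x<..<y})" if "u \<in> {x<..<y}" "t \<in> cbox t1 t2" for u t
        by (rule has_vector_derivative_at_within[OF Qs]) (use that sub in auto)
      show "(\<lambda>t. Q (u, t)) integrable_on cbox t1 t2" if "u \<in> {x<..<y}" for u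
        by (rule integrable_continuous[OF continuous_on_subset[OF slice'[OF Q, of u]]]) (use that t in auto)
      show "continuous_on ({x<..<y} \<times> cbox t1 t2) (\<lambda>(s, t). Qs (s, t))"
        using continuous_on_subset[OF cQs, of "{x<..<y} \<times> {t1..t2}"] sub by auto
    qed (use s in auto)
    then have "(q has_vector_derivative integral {t1..t2} (\<lambda>t. Qs (s, t))) (at s)"
      using s by (simp add: q_def[abs_def] at_within_open[of s "{x<..<y}"])
    moreover have "integral {t1..t2} (\<lambda>t. Qs (s, t)) = p s"
    proof -
      have "((\<lambda>t. Pt (s, t)) has_integral (P (s, t2) - P (s, t1))) {t1..t2}"
        by (rule fundamental_theorem_of_calculus) (use t s sub in \<open>auto intro!: has_vector_derivative_at_within[OF Pt]\<close>)
      moreover have "(\<lambda>t. G (s, t)) integrable_on {t1..t2}"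
        by (rule integrable_continuous_interval[OF continuous_on_subset[OF slice'[OF G, of s]]]) (use s t in auto)
      ultimately have "((\<lambda>t. Pt (s, t) - G (s, t)) has_integral p s) {t1..t2}"
        unfolding p_def by (intro has_integral_diff integrable_integral)
      then have "((\<lambda>t. Qs (s, t)) has_integral p s) {t1..t2}"
        by (rule has_integral_eq[rotated]) (use eq s sub in \<open>force simp: algebra_simps\<close>)
      then show ?thesis by (rule integral_unique)
    qed
    ultimately show "(q has_vector_derivative p s) (at s)" by simp
  qed (use xy cq in auto)
  then have "integral {x..y} p = q y - q x" by (rule integral_unique)
  moreover have "integral {x..y} p = integral {x..y} (\<lambda>s. P (s, t2)) - integral {x..y} (\<lambda>s. P (s, t1))
      - integral {x..y} (\<lambda>s. integral {t1..t2} (\<lambda>t. G (s, t)))"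
    unfolding p_def
    by (simp add: integral_diff integrable_diff integrable_continuous_interval cP param[OF G])
  moreover have "q y - q x = integral {t1..t2} (\<lambda>t. Q (y, t) - Q (x, t))"
    unfolding q_def
    by (rule integral_diff[symmetric];
        rule integrable_continuous_interval[OF continuous_on_subset[OF slice'[OF Q]]]) (use xy t in auto)
  ultimately show ?thesis by (simp add: algebra_simps)
qed

text \<open>Up to \<open>t = 0\<close> and \<open>t = T\<close>, where the second derivatives are not controlled.\<close>

lemma green_strip_closed:
  fixes P Q G :: "real \<times> real \<Rightarrow> complex"
  assumes xy: "x < y" and T: "0 < T"
    and P: "continuous_on ({x..y} \<times> {0..T}) P" and Q: "continuous_on ({x..y} \<times> {0..T}) Q"
    and G: "continuous_on ({x..y} \<times> {0..T}) G"
    and Pt: "\<And>s t. s \<in> {x<..<y} \<Longrightarrow> t \<in> {0<..<T} \<Longrightarrow> ((\<lambda>t. P (s, t)) has_vector_derivative Pt (s, t)) (at t)"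
    and Qs: "\<And>s t. s \<in> {x<..<y} \<Longrightarrow> t \<in> {0<..<T} \<Longrightarrow> ((\<lambda>s. Q (s, t)) has_vector_derivative Qs (s, t)) (at s)"
    and cQs: "continuous_on ({x<..<y} \<times> {0<..<T}) Qs"
    and eq: "\<And>z. z \<in> {x<..<y} \<times> {0<..<T} \<Longrightarrow> Pt z - Qs z = G z"
    and t: "0 \<le> t1" "t1 \<le> t2" "t2 \<le> T"
  shows "integral {x..y} (\<lambda>s. P (s, t2)) - integral {x..y} (\<lambda>s. P (s, t1)) =
    integral {t1..t2} (\<lambda>t. Q (y, t) - Q (x, t)) + integral {t1..t2} (\<lambda>t. integral {x..y} (\<lambda>s. G (s, t)))"
proof -
  have slice': "continuous_on {0..T} (\<lambda>t. F (s, t))" if "continuous_on ({x..y} \<times> {0..T}) F" "s \<in> {x..y}" for s and F :: "real \<times> real \<Rightarrow> complex"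
    by (rule continuous_on_compose2[OF that(1)]) (use that(2) in \<open>auto intro!: continuous_intros\<close>)
  have param: "continuous_on {0..T} (\<lambda>t. integral {x..y} (\<lambda>s. F (s, t)))" if "continuous_on ({x..y} \<times> {0..T}) F" for F :: "real \<times> real \<Rightarrow> complex"
  proof -
    have "continuous_on ({0..T} \<times> cbox x y) (\<lambda>z. F (snd z, fst z))"
      by (rule continuous_on_compose2[OF that]) (auto intro!: continuous_intros)
    then have "continuous_on ({0..T} \<times> cbox x y) (\<lambda>(t, s). F (s, t))" by (simp add: case_prod_beta)
    from integral_continuous_on_param[OF this] show ?thesis by simp
  qed
  define I where "I t = integral {x..y} (\<lambda>s. P (s, t))" for t
  define g where "g t = (Q (y, t) - Q (x, t)) + integral {x..y} (\<lambda>s. G (s, t))" for t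
  have cQ: "continuous_on {0..T} (\<lambda>t. Q (y, t) - Q (x, t))"
    using slice'[OF Q, of x] slice'[OF Q, of y] xy by (intro continuous_on_diff) auto
  have cg: "continuous_on {0..T} g" unfolding g_def by (intro continuous_on_add cQ param[OF G])
  have ig: "g integrable_on {c..d}" if "0 \<le> c" "d \<le> T" for c d
    using continuous_on_subset[OF cg, of "{c..d}"] that by (intro integrable_continuous_interval) auto
  have g_eq: "integral {c..d} g = integral {c..d} (\<lambda>t. Q (y, t) - Q (x, t)) + integral {c..d} (\<lambda>t. integral {x..y} (\<lambda>s. G (s, t)))"
    if "0 \<le> c" "d \<le> T" for c d
  proof -
    have "{c..d} \<subseteq> {0..T}" using that by auto
    then show ?thesis unfolding g_def
      by (intro integral_add integrable_continuous_interval continuous_on_subset[OF cQ] continuous_on_subset[OF param[OF G]])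
  qed
  \<comment> \<open>Green's formula makes \<open>Z\<close> constant on the open time interval; being
    continuous on the closed one, it is constant there too.\<close>
  define Z where "Z t = I t - integral {0..t} g" for t
  have Z: "Z d = Z c" if cd: "0 < c" "c \<le> d" "d < T" for c d
  proof -
    have "I d - I c = integral {c..d} (\<lambda>t. Q (y, t) - Q (x, t)) + integral {x..y} (\<lambda>s. integral {c..d} (\<lambda>t. G (s, t)))"
      unfolding I_def by (rule green_strip[OF xy P Q G Pt Qs cQs eq cd])
    also have "integral {x..y} (\<lambda>s. integral {c..d} (\<lambda>t. G (s, t))) = integral {c..d} (\<lambda>t. integral {x..y} (\<lambda>s. G (s, t)))"
    proof -
      have "continuous_on (cbox (x, c) (y, d)) (\<lambda>(s, t). G (s, t))"
      proof -
        have "continuous_on ({x..y} \<times> {c..d}) G"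
          by (rule continuous_on_subset[OF G]) (use cd in auto)
        then show ?thesis by (simp add: cbox_Pair_eq)
      qed
      from integral_swap_continuous[OF this] show ?thesis by simp
    qed
    also have "integral {c..d} (\<lambda>t. Q (y, t) - Q (x, t)) + integral {c..d} (\<lambda>t. integral {x..y} (\<lambda>s. G (s, t))) = integral {c..d} g"
      using g_eq[of c d] cd by simp
    finally have "I d - I c = integral {c..d} g" .
    moreover have "integral {0..c} g + integral {c..d} g = integral {0..d} g"
      by (rule Henstock_Kurzweil_Integration.integral_combine) (use cd ig in auto)
    ultimately show ?thesis by (simp add: Z_def algebra_simps)
  qed
  have cZ: "continuous_on {0..T} Z"
    unfolding Z_def I_def by (intro continuous_on_diff param[OF P] indefinite_integral_continuous_1 ig) (use T in auto)
  have Zc: "Z t = Z (T / 2)" if "t \<in> {0..T}" for t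
  proof (rule continuous_constant_on_closure[of "{0<..<T}" Z])
    show "continuous_on (closure {0<..<T}) Z" using cZ T by simp
    show "Z u = Z (T / 2)" if "u \<in> {0<..<T}" for u
      using Z[of u "T / 2"] Z[of "T / 2" u] that by (cases "u \<le> T / 2") auto
    show "t \<in> closure {0<..<T}" using that T by simp
  qed
  have "Z t1 = Z t2" using Zc[of t1] Zc[of t2] t by simp
  then have "I t2 - I t1 = integral {0..t2} g - integral {0..t1} g"
    by (simp add: Z_def algebra_simps)
  also have "\<dots> = integral {t1..t2} g"
  proof -
    have "integral {0..t1} g + integral {t1..t2} g = integral {0..t2} g"
      by (rule Henstock_Kurzweil_Integration.integral_combine) (use t ig in auto)
    from this[symmetric] show ?thesis by simp
  qed
  finally show ?thesis using g_eq[of t1 t2] t by (simp add: I_def)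
qed

section \<open>First variation of the area\<close>

text \<open>The directional derivative at \<open>u\<close> along \<open>v\<close> in Wirtinger form:
  the coefficient of \<open>cnj v\<close> is \<open>bump \<epsilon> u\<close>, that of
  \<open>v\<close> is the \<open>z\<close>-derivative of the kernel.\<close>

definition cauchy_kernel_deriv :: "real \<Rightarrow> complex \<Rightarrow> complex \<Rightarrow> complex" where
  "cauchy_kernel_deriv \<epsilon> u v = (of_real (\<epsilon>\<^sup>2) * cnj v - (cnj u)\<^sup>2 * v) / (of_real ((norm u)\<^sup>2 + \<epsilon>\<^sup>2))\<^sup>2"

lemma has_vector_derivative_cauchy_kernel:
  assumes "\<epsilon> > 0" and g: "(g has_vector_derivative g') (at t within S)"
  shows "((\<lambda>t. cauchy_kernel \<epsilon> (g t)) has_vector_derivative cauchy_kernel_deriv \<epsilon> (g t) g') (at t within S)"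
proof -
  define d where "d u = u * cnj u + of_real (\<epsilon>\<^sup>2)" for u
  have d: "complex_of_real ((norm u)\<^sup>2 + \<epsilon>\<^sup>2) = d u" for u
    using complex_norm_square[of u] by (simp add: d_def)
  have nz: "d u \<noteq> 0" for u
    unfolding d[symmetric] of_real_eq_0_iff using denominator_pos[OF assms(1), of u] by (rule less_imp_neq[symmetric])
  have g1: "(g has_derivative (\<lambda>h. h *\<^sub>R g')) (at t within S)" using g by (simp add: has_vector_derivative_def)
  have g2: "((\<lambda>t. cnj (g t)) has_derivative (\<lambda>h. h *\<^sub>R cnj g')) (at t within S)"
    using bounded_linear.has_derivative[OF bounded_linear_cnj g1] by simp
  have dd: "((\<lambda>t. d (g t)) has_derivative (\<lambda>h. g t * (h *\<^sub>R cnj g') + h *\<^sub>R g' * cnj (g t))) (at t within S)"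
    unfolding d_def using has_derivative_add[OF has_derivative_mult[OF g1 g2] has_derivative_const] by simp
  have "((\<lambda>t. cnj (g t) / d (g t)) has_derivative
      (\<lambda>h. (h *\<^sub>R cnj g' * d (g t) - cnj (g t) * (g t * (h *\<^sub>R cnj g') + h *\<^sub>R g' * cnj (g t))) / (d (g t) * d (g t)))) (at t within S)"
    by (rule has_derivative_divide'[OF g2 dd nz])
  moreover have "(h *\<^sub>R cnj g' * d (g t) - cnj (g t) * (g t * (h *\<^sub>R cnj g') + h *\<^sub>R g' * cnj (g t))) / (d (g t) * d (g t))
      = h *\<^sub>R ((of_real (\<epsilon>\<^sup>2) * cnj g' - (cnj (g t))\<^sup>2 * g') / (d (g t))\<^sup>2)" for h
  proof -
    have "h *\<^sub>R cnj g' * d (g t) - cnj (g t) * (g t * (h *\<^sub>R cnj g') + h *\<^sub>R g' * cnj (g t))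
        = h *\<^sub>R (of_real (\<epsilon>\<^sup>2) * cnj g' - (cnj (g t))\<^sup>2 * g')"
      by (simp add: d_def power2_eq_square algebra_simps scaleR_conv_of_real)
    then show ?thesis by (simp only: scaleR_conv_of_real times_divide_eq_right power2_eq_square[of "d (g t)"])
  qed
  ultimately show ?thesis
    unfolding has_vector_derivative_def cauchy_kernel_def cauchy_kernel_deriv_def d by simp
qed

text \<open>Stokes for the form kernel times dw: the part linear in \<open>v\<close> contributes a
  product symmetric in \<open>v\<close> and \<open>w\<close> and drops out, while the conjugate part
  leaves the Jacobian \<open>Im (cnj w * v)\<close>.\<close>

lemma cauchy_kernel_deriv_skew:
  "cauchy_kernel_deriv \<epsilon> u v * w - cauchy_kernel_deriv \<epsilon> u w * v = - 2 * \<i> * of_real (bump \<epsilon> u * Im (cnj w * v))"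
proof -
  have "cnj v * w - cnj w * v = - 2 * \<i> * of_real (Im (cnj w * v))"
    by (simp add: complex_eq_iff)
  then have "of_real (\<epsilon>\<^sup>2) * (cnj v * w - cnj w * v) / (of_real ((norm u)\<^sup>2 + \<epsilon>\<^sup>2))\<^sup>2
      = - 2 * \<i> * of_real (bump \<epsilon> u * Im (cnj w * v))"
    by (simp add: bump_def)
  moreover have "cauchy_kernel_deriv \<epsilon> u v * w - cauchy_kernel_deriv \<epsilon> u w * v
      = of_real (\<epsilon>\<^sup>2) * (cnj v * w - cnj w * v) / (of_real ((norm u)\<^sup>2 + \<epsilon>\<^sup>2))\<^sup>2"
    unfolding cauchy_kernel_deriv_def times_divide_eq_left diff_divide_distrib[symmetric]
    by (rule arg_cong2[where f="(/)"]) (simp_all add: algebra_simps)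
  ultimately show ?thesis by simp
qed

lemma continuous_on_cauchy_kernel_deriv:
  assumes "\<epsilon> > 0" "continuous_on S f" "continuous_on S h"
  shows "continuous_on S (\<lambda>x. cauchy_kernel_deriv \<epsilon> (f x) (h x))"
proof -
  have "(complex_of_real ((norm u)\<^sup>2 + \<epsilon>\<^sup>2))\<^sup>2 \<noteq> 0" for u :: complex
    unfolding power_eq_0_iff of_real_eq_0_iff using less_imp_neq[OF denominator_pos[OF assms(1), of u]] by metis
  then show ?thesis
  unfolding cauchy_kernel_deriv_def
  by (intro continuous_on_divide continuous_on_diff continuous_on_mult continuous_on_power continuous_on_cnj
      continuous_on_of_real continuous_on_add continuous_on_norm continuous_on_const assms ballI)
qed

text \<open>Green's formula for the pull-back of \<open>F w\<close> dw under \<open>g\<close>. The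
  terms with \<open>M\<close> occur in both \<open>Pt\<close> and \<open>Qs\<close> and cancel; the
  rest is \<open>cauchy_kernel_deriv_skew\<close> integrated against \<open>\<phi>\<close>.\<close>

lemma strip_cauchy_transform:
  fixes g D E M :: "real \<times> real \<Rightarrow> complex" and \<phi> :: "complex \<Rightarrow> real"
  assumes xy: "x < y" and T: "0 < T" and \<epsilon>: "\<epsilon> > 0"
    and g: "continuous_on ({x..y} \<times> {0..T}) g"
    and D: "continuous_on ({x..y} \<times> {0..T}) D" and E: "continuous_on ({x..y} \<times> {0..T}) E"
    and dD: "\<And>s t. s \<in> {x<..<y} \<Longrightarrow> t \<in> {0<..<T} \<Longrightarrow> ((\<lambda>s. g (s, t)) has_vector_derivative D (s, t)) (at s)"
    and dE: "\<And>s t. s \<in> {x<..<y} \<Longrightarrow> t \<in> {0<..<T} \<Longrightarrow> ((\<lambda>t. g (s, t)) has_vector_derivative E (s, t)) (at t)"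
    and M: "continuous_on ({x<..<y} \<times> {0<..<T}) M"
    and dDM: "\<And>s t. s \<in> {x<..<y} \<Longrightarrow> t \<in> {0<..<T} \<Longrightarrow> ((\<lambda>t. D (s, t)) has_vector_derivative M (s, t)) (at t)"
    and dEM: "\<And>s t. s \<in> {x<..<y} \<Longrightarrow> t \<in> {0<..<T} \<Longrightarrow> ((\<lambda>s. E (s, t)) has_vector_derivative M (s, t)) (at s)"
    and \<phi>: "continuous_on (cbox lo hi) \<phi>"
    and t: "0 \<le> t1" "t1 \<le> t2" "t2 \<le> T"
  defines "F \<equiv> \<lambda>w. integral (cbox lo hi) (\<lambda>z. of_real (\<phi> z) * cauchy_kernel \<epsilon> (w - z))"
    and "J \<equiv> \<lambda>w. integral (cbox lo hi) (\<lambda>z. \<phi> z * bump \<epsilon> (w - z))"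
  shows "integral {x..y} (\<lambda>s. F (g (s, t2)) * D (s, t2)) - integral {x..y} (\<lambda>s. F (g (s, t1)) * D (s, t1)) =
    integral {t1..t2} (\<lambda>t. F (g (y, t)) * E (y, t) - F (g (x, t)) * E (x, t)) +
    integral {t1..t2} (\<lambda>t. integral {x..y} (\<lambda>s. - 2 * \<i> * of_real (J (g (s, t)) * Im (cnj (D (s, t)) * E (s, t)))))"
    and "continuous_on UNIV F" and "continuous_on UNIV J"
proof -
  have c\<phi>: "continuous_on (S \<times> cbox lo hi) (\<lambda>p. \<phi> (snd p))" for S :: "'s::topological_space set"
    by (rule continuous_on_compose2[OF \<phi>]) (auto intro!: continuous_intros)
  have c\<phi>': "continuous_on (S \<times> cbox lo hi) (\<lambda>p. complex_of_real (\<phi> (snd p)))" for S :: "'s::topological_space set"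
    by (intro continuous_on_of_real c\<phi>)
  have "continuous_on (UNIV \<times> cbox lo hi) (\<lambda>(w, z). of_real (\<phi> z) * cauchy_kernel \<epsilon> (w - z))"
    unfolding case_prod_beta
    by (intro continuous_on_mult c\<phi>' continuous_on_cauchy_kernel \<epsilon> continuous_intros)
  from integral_continuous_on_param[OF this] show cF: "continuous_on UNIV F" by (simp add: F_def)
  have "continuous_on (UNIV \<times> cbox lo hi) (\<lambda>(w, z). \<phi> z * bump \<epsilon> (w - z))"
    unfolding case_prod_beta
    by (intro continuous_on_mult c\<phi> continuous_on_bump \<epsilon> continuous_intros)
  from integral_continuous_on_param[OF this] show cJ: "continuous_on UNIV J" by (simp add: J_def)
  define R where "R = {x..y} \<times> {0..T}"
  define R0 where "R0 = {x<..<y} \<times> {0<..<T}"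
  have R0: "R0 \<subseteq> R" by (auto simp: R_def R0_def)
  define dF where "dF v z = integral (cbox lo hi) (\<lambda>\<zeta>. of_real (\<phi> \<zeta>) * cauchy_kernel_deriv \<epsilon> (g z - \<zeta>) (v z))" for v z
  have int_dF: "(\<lambda>\<zeta>. of_real (\<phi> \<zeta>) * cauchy_kernel_deriv \<epsilon> (w - \<zeta>) v) integrable_on cbox lo hi" for v w
    by (intro integrable_continuous continuous_on_mult continuous_on_of_real \<phi> continuous_on_cauchy_kernel_deriv \<epsilon> continuous_intros)
  have cdF: "continuous_on S (dF v)" if "continuous_on S v" "S \<subseteq> R" for S v
  proof -
    have gS: "continuous_on S g" using continuous_on_subset[OF g] that(2) by (simp add: R_def)
    have "continuous_on (S \<times> cbox lo hi) (\<lambda>(z, \<zeta>). of_real (\<phi> \<zeta>) * cauchy_kernel_deriv \<epsilon> (g z - \<zeta>) (v z))"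
      unfolding case_prod_beta
    proof (intro continuous_on_mult c\<phi>' continuous_on_cauchy_kernel_deriv \<epsilon> continuous_on_diff)
      show "continuous_on (S \<times> cbox lo hi) (\<lambda>p. g (fst p))"
        by (rule continuous_on_compose2[OF gS]) (auto intro!: continuous_intros)
      show "continuous_on (S \<times> cbox lo hi) (\<lambda>p. v (fst p))"
        by (rule continuous_on_compose2[OF that(1)]) (auto intro!: continuous_intros)
    qed (intro continuous_intros)
    from integral_continuous_on_param[OF this] show ?thesis by (simp add: dF_def[abs_def])
  qed
  have cFg: "continuous_on R (\<lambda>z. F (g z))"
    by (rule continuous_on_compose2[OF cF]) (use g in \<open>auto simp: R_def\<close>)
  have dFt: "((\<lambda>t. F (g (s, t))) has_vector_derivative dF E (s, t)) (at t)"
    if "s \<in> {x<..<y}" "t \<in> {0<..<T}" for s t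
  proof -
    have "((\<lambda>t. integral (cbox lo hi) (\<lambda>z. of_real (\<phi> z) * cauchy_kernel \<epsilon> (g (s, t) - z))) has_vector_derivative
        integral (cbox lo hi) (\<lambda>\<zeta>. of_real (\<phi> \<zeta>) * cauchy_kernel_deriv \<epsilon> (g (s, t) - \<zeta>) (E (s, t)))) (at t within {0<..<T})"
    proof (rule leibniz_rule_vector_derivative)
      fix u z assume u: "u \<in> {0<..<T}"
      have "((\<lambda>t. g (s, t) - z) has_vector_derivative E (s, u) - 0) (at u within {0<..<T})"
        by (intro has_vector_derivative_diff has_vector_derivative_at_within[OF dE] that u has_vector_derivative_const)
      from has_vector_derivative_mult_right[OF has_vector_derivative_cauchy_kernel[OF \<epsilon> this], of "of_real (\<phi> z)"]
      show "((\<lambda>t. of_real (\<phi> z) * cauchy_kernel \<epsilon> (g (s, t) - z)) has_vector_derivative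
          of_real (\<phi> z) * cauchy_kernel_deriv \<epsilon> (g (s, u) - z) (E (s, u))) (at u within {0<..<T})" by simp
    next
      show "(\<lambda>z. of_real (\<phi> z) * cauchy_kernel \<epsilon> (g (s, u) - z)) integrable_on cbox lo hi" for u
        by (intro integrable_continuous continuous_on_mult continuous_on_of_real \<phi> continuous_on_cauchy_kernel \<epsilon> continuous_intros)
    next
      show "continuous_on ({0<..<T} \<times> cbox lo hi) (\<lambda>(t, z). of_real (\<phi> z) * cauchy_kernel_deriv \<epsilon> (g (s, t) - z) (E (s, t)))"
        unfolding case_prod_beta
      proof (intro continuous_on_mult c\<phi>' continuous_on_cauchy_kernel_deriv \<epsilon> continuous_on_diff)
        show "continuous_on ({0<..<T} \<times> cbox lo hi) (\<lambda>p. g (s, fst p))"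
          by (rule continuous_on_compose2[OF g]) (use that in \<open>auto intro!: continuous_intros\<close>)
        show "continuous_on ({0<..<T} \<times> cbox lo hi) (\<lambda>p. E (s, fst p))"
          by (rule continuous_on_compose2[OF E]) (use that in \<open>auto intro!: continuous_intros\<close>)
      qed (intro continuous_intros)
    qed (use that in auto)
    then show ?thesis using that by (simp add: F_def dF_def at_within_open[of t "{0<..<T}"])
  qed
  have dFs: "((\<lambda>s. F (g (s, t))) has_vector_derivative dF D (s, t)) (at s)"
    if "s \<in> {x<..<y}" "t \<in> {0<..<T}" for s t
  proof -
    have "((\<lambda>s. integral (cbox lo hi) (\<lambda>z. of_real (\<phi> z) * cauchy_kernel \<epsilon> (g (s, t) - z))) has_vector_derivative
        integral (cbox lo hi) (\<lambda>\<zeta>. of_real (\<phi> \<zeta>) * cauchy_kernel_deriv \<epsilon> (g (s, t) - \<zeta>) (D (s, t)))) (at s within {x<..<y})"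
    proof (rule leibniz_rule_vector_derivative)
      fix u z assume u: "u \<in> {x<..<y}"
      have "((\<lambda>s. g (s, t) - z) has_vector_derivative D (u, t) - 0) (at u within {x<..<y})"
        by (intro has_vector_derivative_diff has_vector_derivative_at_within[OF dD] that u has_vector_derivative_const)
      from has_vector_derivative_mult_right[OF has_vector_derivative_cauchy_kernel[OF \<epsilon> this], of "of_real (\<phi> z)"]
      show "((\<lambda>s. of_real (\<phi> z) * cauchy_kernel \<epsilon> (g (s, t) - z)) has_vector_derivative
          of_real (\<phi> z) * cauchy_kernel_deriv \<epsilon> (g (u, t) - z) (D (u, t))) (at u within {x<..<y})" by simp
    next
      show "(\<lambda>z. of_real (\<phi> z) * cauchy_kernel \<epsilon> (g (u, t) - z)) integrable_on cbox lo hi" for u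
        by (intro integrable_continuous continuous_on_mult continuous_on_of_real \<phi> continuous_on_cauchy_kernel \<epsilon> continuous_intros)
    next
      show "continuous_on ({x<..<y} \<times> cbox lo hi) (\<lambda>(s, z). of_real (\<phi> z) * cauchy_kernel_deriv \<epsilon> (g (s, t) - z) (D (s, t)))"
        unfolding case_prod_beta
      proof (intro continuous_on_mult c\<phi>' continuous_on_cauchy_kernel_deriv \<epsilon> continuous_on_diff)
        show "continuous_on ({x<..<y} \<times> cbox lo hi) (\<lambda>p. g (fst p, t))"
          by (rule continuous_on_compose2[OF g]) (use that in \<open>auto intro!: continuous_intros\<close>)
        show "continuous_on ({x<..<y} \<times> cbox lo hi) (\<lambda>p. D (fst p, t))"
          by (rule continuous_on_compose2[OF D]) (use that in \<open>auto intro!: continuous_intros\<close>)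
      qed (intro continuous_intros)
    qed (use that in auto)
    then show ?thesis using that by (simp add: F_def dF_def at_within_open[of s "{x<..<y}"])
  qed
  have cont0: "continuous_on R0 D" "continuous_on R0 E" "continuous_on R0 (\<lambda>z. F (g z))" "continuous_on R0 M"
    using continuous_on_subset[OF D] continuous_on_subset[OF E] continuous_on_subset[OF cFg] R0 M
    by (auto simp: R_def R0_def)
  show "integral {x..y} (\<lambda>s. F (g (s, t2)) * D (s, t2)) - integral {x..y} (\<lambda>s. F (g (s, t1)) * D (s, t1)) =
    integral {t1..t2} (\<lambda>t. F (g (y, t)) * E (y, t) - F (g (x, t)) * E (x, t)) +
    integral {t1..t2} (\<lambda>t. integral {x..y} (\<lambda>s. - 2 * \<i> * of_real (J (g (s, t)) * Im (cnj (D (s, t)) * E (s, t)))))"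
  proof (rule green_strip_closed[OF xy T, where P="\<lambda>z. F (g z) * D z" and Q="\<lambda>z. F (g z) * E z"
        and Pt="\<lambda>z. F (g z) * M z + dF E z * D z" and Qs="\<lambda>z. F (g z) * M z + dF D z * E z"
        and G="\<lambda>z. - 2 * \<i> * of_real (J (g z) * Im (cnj (D z) * E z))"])
    show "continuous_on ({x..y} \<times> {0..T}) (\<lambda>z. F (g z) * D z)" "continuous_on ({x..y} \<times> {0..T}) (\<lambda>z. F (g z) * E z)"
      using cFg D E by (auto simp: R_def intro: continuous_on_mult)
    have "continuous_on ({x..y} \<times> {0..T}) (\<lambda>z. J (g z))"
      by (rule continuous_on_compose2[OF cJ]) (use g in auto)
    then show "continuous_on ({x..y} \<times> {0..T}) (\<lambda>z. - 2 * \<i> * of_real (J (g z) * Im (cnj (D z) * E z)))"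
      by (intro continuous_on_mult continuous_on_const continuous_on_of_real continuous_on_Im continuous_on_cnj D E)
    show "continuous_on ({x<..<y} \<times> {0<..<T}) (\<lambda>z. F (g z) * M z + dF D z * E z)"
      unfolding R0_def[symmetric] by (intro continuous_on_add continuous_on_mult cont0 cdF R0)
    show "((\<lambda>t. F (g (s, t)) * D (s, t)) has_vector_derivative F (g (s, t)) * M (s, t) + dF E (s, t) * D (s, t)) (at t)"
      if "s \<in> {x<..<y}" "t \<in> {0<..<T}" for s t
      by (rule has_vector_derivative_mult[OF dFt dDM]) (use that in auto)
    show "((\<lambda>s. F (g (s, t)) * E (s, t)) has_vector_derivative F (g (s, t)) * M (s, t) + dF D (s, t) * E (s, t)) (at s)"
      if "s \<in> {x<..<y}" "t \<in> {0<..<T}" for s t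
      by (rule has_vector_derivative_mult[OF dFs dEM]) (use that in auto)
    show "F (g z) * M z + dF E z * D z - (F (g z) * M z + dF D z * E z) = - 2 * \<i> * of_real (J (g z) * Im (cnj (D z) * E z))" for z
    proof -
      have "dF E z * D z - dF D z * E z = integral (cbox lo hi) (\<lambda>\<zeta>. of_real (\<phi> \<zeta>) * cauchy_kernel_deriv \<epsilon> (g z - \<zeta>) (E z) * D z
          - of_real (\<phi> \<zeta>) * cauchy_kernel_deriv \<epsilon> (g z - \<zeta>) (D z) * E z)"
        unfolding dF_def by (simp only: integral_mult_left[symmetric] integral_diff[OF integrable_on_mult_left[OF int_dF] integrable_on_mult_left[OF int_dF]])
      also have "\<dots> = integral (cbox lo hi) (\<lambda>\<zeta>. - 2 * \<i> * of_real (Im (cnj (D z) * E z)) * of_real (\<phi> \<zeta> * bump \<epsilon> (g z - \<zeta>)))"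
      proof (rule integral_cong)
        fix \<zeta>
        show "of_real (\<phi> \<zeta>) * cauchy_kernel_deriv \<epsilon> (g z - \<zeta>) (E z) * D z - of_real (\<phi> \<zeta>) * cauchy_kernel_deriv \<epsilon> (g z - \<zeta>) (D z) * E z
          = - 2 * \<i> * of_real (Im (cnj (D z) * E z)) * of_real (\<phi> \<zeta> * bump \<epsilon> (g z - \<zeta>))"
          unfolding mult.assoc right_diff_distrib[symmetric] cauchy_kernel_deriv_skew
          by (simp only: of_real_mult mult.assoc mult.left_commute mult.commute)
      qed
      also have "\<dots> = - 2 * \<i> * of_real (Im (cnj (D z) * E z)) * integral (cbox lo hi) (\<lambda>\<zeta>. of_real (\<phi> \<zeta> * bump \<epsilon> (g z - \<zeta>)))"
        by (rule integral_mult_right)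
      also have "integral (cbox lo hi) (\<lambda>\<zeta>. complex_of_real (\<phi> \<zeta> * bump \<epsilon> (g z - \<zeta>))) = of_real (J (g z))"
        unfolding J_def
        by (intro integral_unique has_integral_of_real integrable_integral integrable_continuous continuous_on_mult \<phi> continuous_on_bump \<epsilon> continuous_intros)
      finally show ?thesis by (simp add: mult_ac)
    qed
  qed (use t in auto)
qed

lemma continuous_on_snd_param:
  assumes "continuous_on (A \<times> C) F" "t \<in> C"
  shows "continuous_on A (\<lambda>s. F (s, t))"
  by (rule continuous_on_compose2[OF assms(1)]) (use assms(2) in \<open>auto intro!: continuous_intros\<close>)

lemma continuous_on_fst_param:
  assumes "continuous_on (A \<times> C) F" "s \<in> A"
  shows "continuous_on C (\<lambda>t. F (s, t))"
  by (rule continuous_on_compose2[OF assms(1)]) (use assms(2) in \<open>auto intro!: continuous_intros\<close>)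

lemma continuous_on_integral_fst:
  fixes F :: "real \<times> real \<Rightarrow> 'a::euclidean_space"
  assumes "continuous_on ({x..y} \<times> C) F"
  shows "continuous_on C (\<lambda>t. integral {x..y} (\<lambda>s. F (s, t)))"
proof -
  have "continuous_on (C \<times> cbox x y) (\<lambda>z. F (snd z, fst z))"
    by (rule continuous_on_compose2[OF assms]) (auto intro!: continuous_intros)
  then have "continuous_on (C \<times> cbox x y) (\<lambda>(t, s). F (s, t))" by (simp add: case_prod_beta)
  from integral_continuous_on_param[OF this] show ?thesis by simp
qed

text \<open>The reciprocal distance is integrable over the box with a bound independent of
  \<open>s\<close>, which makes the kernel integrable on the product.\<close>

lemma cauchy_transform_fubini:
  fixes g d :: "real \<Rightarrow> complex" and \<phi> :: "complex \<Rightarrow> real"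
  assumes xy: "x \<le> y" and g: "continuous_on {x..y} g" and d: "continuous_on {x..y} d"
    and \<phi>: "continuous_on UNIV \<phi>" and R: "R \<ge> 0" "\<And>s. s \<in> {x..y} \<Longrightarrow> cbox lo hi \<subseteq> cball (g s) R"
  defines "k \<equiv> \<lambda>s z. indicator {x..y} s *\<^sub>R (indicator (cbox lo hi) z *\<^sub>R (of_real (\<phi> z) * d s / (g s - z)))"
  shows "integral {x..y} (\<lambda>s. integral (cbox lo hi) (\<lambda>z. of_real (\<phi> z) / (g s - z)) * d s) =
      (LINT z|lborel. LINT s|lborel. k s z)"
    and "integrable lborel (\<lambda>z. LINT s|lborel. k s z)"
proof -
  obtain C where C: "C > 0" "\<And>z. z \<in> cbox lo hi \<Longrightarrow> norm (\<phi> z) \<le> C"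
  proof -
    have "bounded (\<phi> ` cbox lo hi)"
      by (intro compact_imp_bounded compact_continuous_image continuous_on_subset[OF \<phi>]) auto
    then show ?thesis using that unfolding bounded_pos by auto
  qed
  obtain K where K: "K > 0" "\<And>s. s \<in> {x..y} \<Longrightarrow> norm (d s) \<le> K"
  proof -
    have "bounded (d ` {x..y})" by (intro compact_imp_bounded compact_continuous_image d) auto
    then show ?thesis using that unfolding bounded_pos by auto
  qed
  have [measurable]: "\<phi> \<in> borel_measurable borel" by (rule borel_measurable_continuous_onI[OF \<phi>])
  \<comment> \<open>\<open>g\<close> and \<open>d\<close> are continuous on the interval only; set
    to 0 outside they are Borel on the whole line, and \<open>k\<close> is unchanged.\<close>
  define g' where "g' s = indicator {x..y} s *\<^sub>R g s" for s
  define d' where "d' s = indicator {x..y} s *\<^sub>R d s" for s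
  have [measurable]: "g' \<in> borel_measurable borel" "d' \<in> borel_measurable borel"
    unfolding g'_def d'_def by (auto intro!: borel_measurable_continuous_on_indicator g d)
  have [measurable]: "cbox lo hi \<in> sets borel" by simp
  have k': "k s z = indicator (cbox lo hi) z *\<^sub>R (of_real (\<phi> z) * d' s / (g' s - z))" for s z
    by (simp add: k_def g'_def d'_def indicator_def)
  have k_meas: "(\<lambda>p. k (fst p) (snd p)) \<in> borel_measurable (lborel \<Otimes>\<^sub>M lborel)"
    unfolding k' by measurable
  have k_le: "norm (k s z) \<le> indicator {x..y} s * (indicator (cbox lo hi) z * (C * K * norm (z - g s) powr - 1))" for s z
  proof (cases "s \<in> {x..y} \<and> z \<in> cbox lo hi")
    case True
    then have "norm (\<phi> z) * norm (d s) * inverse (norm (z - g s)) \<le> C * K * inverse (norm (z - g s))"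
      using C K by (intro mult_right_mono mult_mono) auto
    then show ?thesis using True
      by (simp add: k_def norm_mult norm_divide norm_minus_commute[of "g s"] divide_inverse powr_minus norm_inverse)
  qed (auto simp: k_def)
  have inner: "(\<integral>\<^sup>+ z. ennreal (norm (k s z)) \<partial>lborel) \<le> ennreal (C * K * (2 * pi * R)) * indicator {x..y} s" for s
  proof (cases "s \<in> {x..y}")
    case True
    have eq: "pi * ((R\<^sup>2) powr (- 1 / 2 + 1) / (- 1 / 2 + 1)) = 2 * pi * R"
      using R(1) by (simp add: powr_half_sqrt)
    have I: "((\<lambda>z. C * K * norm (z - g s) powr - 1) has_integral (C * K * (2 * pi * R))) (cball (g s) R)"
      unfolding eq[symmetric] by (intro has_integral_mult_right has_integral_norm_powr_cball) (use R(1) in auto)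
    have "(\<integral>\<^sup>+ z. ennreal (norm (k s z)) \<partial>lborel) \<le> (\<integral>\<^sup>+ z. ennreal (C * K * norm (z - g s) powr - 1) * indicator (cball (g s) R) z \<partial>lborel)"
    proof (rule nn_integral_mono)
      fix z
      have "norm (k s z) \<le> C * K * norm (z - g s) powr - 1 * indicator (cball (g s) R) z"
      proof (cases "z \<in> cbox lo hi")
        case zB: True
        then have "z \<in> cball (g s) R" using R(2)[OF True] by auto
        then show ?thesis using k_le[of s z] True zB by simp
      next
        case False
        then show ?thesis using C(1) K(1) by (simp add: k_def)
      qed
      then have "ennreal (norm (k s z)) \<le> ennreal (C * K * norm (z - g s) powr - 1 * indicator (cball (g s) R) z)"
        by (rule ennreal_leI)
      then show "ennreal (norm (k s z)) \<le> ennreal (C * K * norm (z - g s) powr - 1) * indicator (cball (g s) R) z"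
        by (cases "z \<in> cball (g s) R") simp_all
    qed
    also have "\<dots> = ennreal (C * K * (2 * pi * R))"
      by (rule nn_integral_has_integral_lebesgue'[OF _ I]) (use C K in auto)
    finally show ?thesis using True by simp
  qed (simp add: k_def)
  have int: "integrable (lborel \<Otimes>\<^sub>M lborel) (\<lambda>(s, z). k s z)"
  proof (rule integrableI_bounded)
    show "(\<lambda>(s, z). k s z) \<in> borel_measurable (lborel \<Otimes>\<^sub>M lborel)" using k_meas by (simp add: case_prod_beta)
    have "(\<integral>\<^sup>+ p. ennreal (norm ((\<lambda>(s, z). k s z) p)) \<partial>(lborel \<Otimes>\<^sub>M lborel)) = (\<integral>\<^sup>+ s. \<integral>\<^sup>+ z. ennreal (norm (k s z)) \<partial>lborel \<partial>lborel)"
      using lborel.nn_integral_fst[of "\<lambda>p. ennreal (norm (k (fst p) (snd p)))" lborel] k_meas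
      by (simp add: case_prod_beta)
    also have "\<dots> \<le> (\<integral>\<^sup>+ s. ennreal (C * K * (2 * pi * R)) * indicator {x..y} s \<partial>lborel)"
      by (rule nn_integral_mono) (rule inner)
    also have "\<dots> < \<infinity>" using xy by (subst nn_integral_cmult_indicator) (auto simp: ennreal_mult_less_top)
    finally show "(\<integral>\<^sup>+ p. ennreal (norm ((\<lambda>(s, z). k s z) p)) \<partial>(lborel \<Otimes>\<^sub>M lborel)) < \<infinity>" .
  qed
  have eq1: "(LINT z|lborel. k s z) = indicator {x..y} s *\<^sub>R (integral (cbox lo hi) (\<lambda>z. of_real (\<phi> z) / (g s - z)) * d s)" for s
  proof (cases "s \<in> {x..y}")
    case True
    have "set_integrable lborel (cbox lo hi) (\<lambda>z. complex_of_real (\<phi> z) * d s / (g s - z))"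
      unfolding set_integrable_def
    proof (rule integrableI_bounded)
      show "(\<lambda>z. indicator (cbox lo hi) z *\<^sub>R (complex_of_real (\<phi> z) * d s / (g s - z))) \<in> borel_measurable lborel"
        by measurable
      have "(\<integral>\<^sup>+ z. ennreal (norm (indicator (cbox lo hi) z *\<^sub>R (complex_of_real (\<phi> z) * d s / (g s - z)))) \<partial>lborel) = (\<integral>\<^sup>+ z. ennreal (norm (k s z)) \<partial>lborel)"
        using True by (simp add: k_def)
      also have "\<dots> < \<infinity>" using inner[of s] True by (auto intro: le_less_trans)
      finally show "(\<integral>\<^sup>+ z. ennreal (norm (indicator (cbox lo hi) z *\<^sub>R (complex_of_real (\<phi> z) * d s / (g s - z)))) \<partial>lborel) < \<infinity>" .
    qed
    from set_borel_integral_eq_integral(2)[OF this]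
    have "(LINT z|lborel. k s z) = integral (cbox lo hi) (\<lambda>z. of_real (\<phi> z) * d s / (g s - z))"
      using True by (simp add: k_def set_lebesgue_integral_def)
    also have "\<dots> = integral (cbox lo hi) (\<lambda>z. of_real (\<phi> z) / (g s - z) * d s)" by (rule integral_cong) simp
    also have "\<dots> = integral (cbox lo hi) (\<lambda>z. of_real (\<phi> z) / (g s - z)) * d s" by (rule integral_mult_left)
    finally show ?thesis using True by simp
  qed (simp add: k_def)
  have int1: "integrable lborel (\<lambda>s. LINT z|lborel. k s z)"
    using lborel_pair.integrable_fst[OF int] by simp
  show "integrable lborel (\<lambda>z. LINT s|lborel. k s z)"
    using lborel_pair.integrable_snd[OF int] by simp
  have "set_integrable lborel {x..y} (\<lambda>s. integral (cbox lo hi) (\<lambda>z. of_real (\<phi> z) / (g s - z)) * d s)"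
    using int1 by (simp add: eq1 set_integrable_def)
  from set_borel_integral_eq_integral(2)[OF this]
  have "integral {x..y} (\<lambda>s. integral (cbox lo hi) (\<lambda>z. of_real (\<phi> z) / (g s - z)) * d s) = (LINT s|lborel. LINT z|lborel. k s z)"
    by (simp add: eq1 set_lebesgue_integral_def)
  also have "\<dots> = (LINT z|lborel. LINT s|lborel. k s z)"
    by (rule lborel_pair.Fubini_integral[OF int, symmetric])
  finally show "integral {x..y} (\<lambda>s. integral (cbox lo hi) (\<lambda>z. of_real (\<phi> z) / (g s - z)) * d s) = (LINT z|lborel. LINT s|lborel. k s z)" .
qed

text \<open>Derivatives are indexed by the arc because they are one-sided at the break points.
  \<open>M\<close> is the mixed second derivative, one function for both orders, and is available on
  open rectangles only. The break points include 0 and 1, whether or not there is a corner.\<close>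

locale piecewise_flow =
  fixes \<Gamma> :: "real \<Rightarrow> real \<Rightarrow> complex" and T :: real and b :: "nat \<Rightarrow> real" and r :: nat
    and D E M :: "nat \<Rightarrow> real \<times> real \<Rightarrow> complex"
  assumes T: "0 < T"
    and b: "strict_mono_on {..r} b" "b 0 = 0" "b r = 1"
    and per: "\<And>s t. t \<in> {0..T} \<Longrightarrow> \<Gamma> (s + 1) t = \<Gamma> s t"
    and cont: "continuous_on (UNIV \<times> {0..T}) (\<lambda>(s, t). \<Gamma> s t)"
    and simple: "\<And>t. t \<in> {0..T} \<Longrightarrow> simple_path (\<lambda>s. \<Gamma> s t)"
    and D: "\<And>i. i < r \<Longrightarrow> continuous_on ({b i..b (Suc i)} \<times> {0..T}) (D i)"
    and E: "\<And>i. i < r \<Longrightarrow> continuous_on ({b i..b (Suc i)} \<times> {0..T}) (E i)"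
    and dD: "\<And>i s t. i < r \<Longrightarrow> s \<in> {b i..b (Suc i)} \<Longrightarrow> t \<in> {0..T} \<Longrightarrow>
      ((\<lambda>s. \<Gamma> s t) has_vector_derivative D i (s, t)) (at s within {b i..b (Suc i)})"
    and dE: "\<And>i s t. i < r \<Longrightarrow> s \<in> {b i..b (Suc i)} \<Longrightarrow> t \<in> {0..T} \<Longrightarrow>
      (\<Gamma> s has_vector_derivative E i (s, t)) (at t within {0..T})"
    and D_nz: "\<And>i s t. i < r \<Longrightarrow> s \<in> {b i..b (Suc i)} \<Longrightarrow> t \<in> {0..T} \<Longrightarrow> D i (s, t) \<noteq> 0"
    and M: "\<And>i. i < r \<Longrightarrow> continuous_on ({b i<..<b (Suc i)} \<times> {0<..<T}) (M i)"
    and dDM: "\<And>i s t. i < r \<Longrightarrow> s \<in> {b i<..<b (Suc i)} \<Longrightarrow> t \<in> {0<..<T} \<Longrightarrow>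
      ((\<lambda>t. D i (s, t)) has_vector_derivative M i (s, t)) (at t)"
    and dEM: "\<And>i s t. i < r \<Longrightarrow> s \<in> {b i<..<b (Suc i)} \<Longrightarrow> t \<in> {0<..<T} \<Longrightarrow>
      ((\<lambda>s. E i (s, t)) has_vector_derivative M i (s, t)) (at s)"
begin

lemma b_less: "i < r \<Longrightarrow> b i < b (Suc i)"
  using b(1) by (auto simp: strict_mono_on_def)

lemma b_mono: "i \<le> j \<Longrightarrow> j \<le> r \<Longrightarrow> b i \<le> b j"
  using strict_mono_on_imp_mono_on[OF b(1)] by (auto simp: mono_on_def)

lemma b_range: "i \<le> r \<Longrightarrow> b i \<in> {0..1}"
  using b_mono[of 0 i] b_mono[of i r] b(2,3) by auto

lemma r_pos: "0 < r"
  using b(2,3) by (cases r) auto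

lemma cover: "s \<in> {0..1} \<Longrightarrow> \<exists>i<r. s \<in> {b i..b (Suc i)}"
proof -
  have "\<exists>i<k. s \<in> {b i..b (Suc i)}" if "0 < k" "k \<le> r" "s \<in> {0..b k}" for k
    using that
  proof (induction k)
    case (Suc k)
    show ?case
    proof (cases "s \<le> b k \<and> 0 < k")
      case True
      with Suc show ?thesis by auto (metis less_SucI)
    next
      case False
      with Suc.prems b(2) show ?thesis by (intro exI[of _ k]) (cases k; auto)
    qed
  qed simp
  from this[of r] show "s \<in> {0..1} \<Longrightarrow> \<exists>i<r. s \<in> {b i..b (Suc i)}" using r_pos b(3) by auto
qed

lemma cont_s: "t \<in> {0..T} \<Longrightarrow> continuous_on A (\<lambda>s. \<Gamma> s t)"
  using continuous_on_snd_param[OF cont, of t] by (auto elim: continuous_on_subset)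

lemma cont_t: "continuous_on {0..T} (\<Gamma> s)"
  using continuous_on_fst_param[OF cont, of s] by auto

lemma cont_on: "B \<subseteq> {0..T} \<Longrightarrow> continuous_on (A \<times> B) (\<lambda>z. \<Gamma> (fst z) (snd z))"
  using continuous_on_subset[OF cont, of "A \<times> B"] by (auto simp: case_prod_beta)

lemma range_eq_path_image: "t \<in> {0..T} \<Longrightarrow> range (\<lambda>s. \<Gamma> s t) = path_image (\<lambda>s. \<Gamma> s t)"
proof -
  assume t: "t \<in> {0..T}"
  interpret periodic_fun_simple "\<lambda>s. \<Gamma> s t" "1::real" by standard (rule per[OF t])
  have "\<Gamma> s t \<in> (\<lambda>s. \<Gamma> s t) ` {0..1}" for s
  proof (rule image_eqI)
    show "\<Gamma> s t = \<Gamma> (s - of_int \<lfloor>s\<rfloor>) t" using minus_of_int[of s "\<lfloor>s\<rfloor>"] by simp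
    show "s - of_int \<lfloor>s\<rfloor> \<in> {0..1}"
      unfolding atLeastAtMost_iff using floor_correct[of s] by linarith
  qed
  then show ?thesis by (auto simp: path_image_def)
qed

lemma bounding_box:
  obtains lo hi R where "\<And>s t. t \<in> {0..T} \<Longrightarrow> \<Gamma> s t \<in> box lo hi" "R \<ge> 0"
    "\<And>s t. t \<in> {0..T} \<Longrightarrow> cbox lo hi \<subseteq> cball (\<Gamma> s t) R"
proof -
  have "compact ((\<lambda>(s, t). \<Gamma> s t) ` ({0..1} \<times> {0..T}))"
    by (intro compact_continuous_image continuous_on_subset[OF cont] compact_Times) auto
  then have "bounded ((\<lambda>(s, t). \<Gamma> s t) ` ({0..1} \<times> {0..T}))" by (rule compact_imp_bounded)
  then obtain c where c: "(\<lambda>(s, t). \<Gamma> s t) ` ({0..1} \<times> {0..T}) \<subseteq> box (- c) c"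
    by (elim bounded_subset_box_symmetric)
  have in_box: "\<Gamma> s t \<in> box (- c) c" if "t \<in> {0..T}" for s t
  proof -
    have "\<Gamma> s t \<in> path_image (\<lambda>s. \<Gamma> s t)" using range_eq_path_image[OF that] by auto
    then show ?thesis using c that by (auto simp: path_image_def image_subset_iff)
  qed
  define R where "R = diameter (cbox (- c) c)"
  show ?thesis
  proof (rule that[OF in_box])
    show "R \<ge> 0" unfolding R_def by (rule diameter_ge_0) simp
    fix s t assume "t \<in> {0..T}"
    from in_box[OF this, of s] show "cbox (- c) c \<subseteq> cball (\<Gamma> s t) R"
      using diameter_bounded_bound[of "cbox (- c) c"] box_subset_cbox[of "- c" c]
      by (auto simp: R_def)
  qed
qed

text \<open>Differentiable images of intervals are null sets in the plane, so it is enough to know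
  winding numbers off the curve when integrating over the plane.\<close>

lemma path_image_null:
  assumes t: "t \<in> {0..T}"
  shows "AE z in lborel. z \<notin> path_image (\<lambda>s. \<Gamma> s t)"
proof -
  have "negligible ((\<lambda>s. \<Gamma> s t) ` {b i..b (Suc i)})" if "i < r" for i
  proof (rule negligible_differentiable_image_lowdim)
    show "(\<lambda>s. \<Gamma> s t) differentiable_on {b i..b (Suc i)}"
      unfolding differentiable_on_def using dD[OF that _ t] by (blast intro: differentiableI_vector)
  qed simp
  then have "negligible (\<Union>i<r. (\<lambda>s. \<Gamma> s t) ` {b i..b (Suc i)})" by (intro negligible_Union) auto
  moreover have "path_image (\<lambda>s. \<Gamma> s t) \<subseteq> (\<Union>i<r. (\<lambda>s. \<Gamma> s t) ` {b i..b (Suc i)})"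
    using cover by (fastforce simp: path_image_def)
  ultimately have "negligible (path_image (\<lambda>s. \<Gamma> s t))" by (rule negligible_subset)
  moreover have "path_image (\<lambda>s. \<Gamma> s t) \<in> sets lborel"
    using compact_path_image[OF simple_path_imp_path[OF simple[OF t]]] by (auto intro: borel_compact)
  ultimately have "path_image (\<lambda>s. \<Gamma> s t) \<in> null_sets lborel"
    by (simp add: negligible_iff_null_sets null_sets_completion_iff)
  then show ?thesis by (rule AE_not_in)
qed

text \<open>Modulus and continuous argument give a logarithm \<open>L\<close> of
  \<open>\<Gamma> - z\<close> across the corners, a primitive of the integrand on each arc. The sum
  telescopes to the increment of the argument, since the modulus is periodic.\<close>

lemma sum_integral_winding:
  assumes t: "t \<in> {0..T}" and z: "z \<notin> path_image (\<lambda>s. \<Gamma> s t)"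
  shows "(\<Sum>i<r. integral {b i..b (Suc i)} (\<lambda>s. D i (s, t) / (\<Gamma> s t - z))) =
    2 * pi * \<i> * winding_number (\<lambda>s. \<Gamma> s t) z"
proof -
  have zr: "z \<notin> range (\<lambda>s. \<Gamma> s t)" using z range_eq_path_image[OF t] by simp
  have nz: "\<Gamma> s t - z \<noteq> 0" for s using zr by auto
  obtain \<theta> where \<theta>: "arg_lift (\<lambda>s. \<Gamma> s t - z) 0 1 \<theta>"
    using winding_number_eq_arg_inc(2)[OF cont_s[OF t] per[OF t] zr, of 0] by auto
  have wn: "winding_number (\<lambda>s. \<Gamma> s t) z = of_real ((\<theta> 1 - \<theta> 0) / (2 * pi))"
    using winding_number_eq_arg_inc(1)[OF cont_s[OF t] per[OF t] zr, of 0] arg_inc_eq[OF _ \<theta>] by simp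
  define L where "L s = complex_of_real (ln (norm (\<Gamma> s t - z))) + \<i> * of_real (\<theta> s)" for s
  have cL: "continuous_on {0..1} L"
  proof -
    have "continuous_on {0..1} (\<lambda>s. ln (norm (\<Gamma> s t - z)))"
      by (intro continuous_on_ln continuous_on_norm continuous_on_diff continuous_on_const cont_s t) (use nz in auto)
    then show ?thesis
      using \<theta> unfolding L_def arg_lift_def
      by (intro continuous_on_add continuous_on_mult continuous_on_const continuous_on_of_real) auto
  qed
  have "integral {b i..b (Suc i)} (\<lambda>s. D i (s, t) / (\<Gamma> s t - z)) = L (b (Suc i)) - L (b i)" if i: "i < r" for i
  proof (rule integral_unique, rule fundamental_theorem_of_calculus_interior)
    have sub: "{b i..b (Suc i)} \<subseteq> {0..1}" using b_range[of i] b_range[of "Suc i"] i by auto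
    show "continuous_on {b i..b (Suc i)} L" by (rule continuous_on_subset[OF cL sub])
    fix s assume s: "s \<in> {b i<..<b (Suc i)}"
    have "((\<lambda>s. \<Gamma> s t) has_vector_derivative D i (s, t)) (at s within {b i..b (Suc i)})"
      by (rule dD[OF i _ t]) (use s in auto)
    then have g: "((\<lambda>s. \<Gamma> s t) has_vector_derivative D i (s, t)) (at s)"
      using s by (simp add: at_within_Icc_at)
    have g1: "((\<lambda>s. \<Gamma> s t - z) has_vector_derivative D i (s, t)) (at s)"
      using has_vector_derivative_diff[OF g has_vector_derivative_const] by simp
    have "s \<in> {0<..<1}" using s sub by (auto simp: subset_iff intro: less_le_trans le_less_trans) 
    then have d\<theta>: "(\<theta> has_real_derivative Im (D i (s, t) / (\<Gamma> s t - z))) (at s)"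
      by (rule arg_lift_has_derivative[OF \<theta> _ g1])
    have dn: "((\<lambda>s. ln (norm (\<Gamma> s t - z))) has_real_derivative Re (D i (s, t) / (\<Gamma> s t - z))) (at s)"
    proof -
      define v where "v = \<Gamma> s t - z"
      have "((\<lambda>s. norm (\<Gamma> s t - z)) has_derivative (\<lambda>h. (h *\<^sub>R D i (s, t)) \<bullet> sgn v)) (at s)"
        using has_derivative_compose[OF g1[unfolded has_vector_derivative_def] has_derivative_norm[OF nz]]
        by (simp add: v_def)
      then have "((\<lambda>s. norm (\<Gamma> s t - z)) has_real_derivative (D i (s, t) \<bullet> sgn v)) (at s)"
        by (simp add: has_field_derivative_def mult.commute[of "_ \<bullet> _"] mult_commute_abs)
      then have "((\<lambda>s. ln (norm (\<Gamma> s t - z))) has_real_derivative (inverse (norm v) * (D i (s, t) \<bullet> sgn v))) (at s)"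
        unfolding v_def by (rule DERIV_chain2[OF DERIV_ln, rotated]) (use nz[of s] in simp)
      moreover have "inverse (norm v) * (D i (s, t) \<bullet> sgn v) = Re (D i (s, t) / v)"
      proof -
        have "Re (D i (s, t) / v) = (D i (s, t) \<bullet> v) / (norm v)\<^sup>2"
          by (simp add: Re_divide inner_complex_def cmod_power2)
        moreover have "inverse (norm v) * (D i (s, t) \<bullet> sgn v) = (D i (s, t) \<bullet> v) / (norm v)\<^sup>2"
          by (simp add: sgn_div_norm power2_eq_square divide_inverse)
        ultimately show ?thesis by simp
      qed
      ultimately show ?thesis by (simp add: v_def)
    qed
    have "(L has_vector_derivative (of_real (Re (D i (s, t) / (\<Gamma> s t - z))) + \<i> * of_real (Im (D i (s, t) / (\<Gamma> s t - z))))) (at s)"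
      unfolding L_def
      by (intro has_vector_derivative_add has_vector_derivative_mult_right has_vector_derivative_of_real)
         (use dn d\<theta> in auto)
    then show "(L has_vector_derivative D i (s, t) / (\<Gamma> s t - z)) (at s)"
      by (simp add: complex_eq[symmetric])
  qed (use b_less[OF i] in simp)
  then have "(\<Sum>i<r. integral {b i..b (Suc i)} (\<lambda>s. D i (s, t) / (\<Gamma> s t - z))) = (\<Sum>i<r. L (b (Suc i)) - L (b i))"
    by simp
  also have "\<dots> = L 1 - L 0" using sum_lessThan_telescope[of "\<lambda>i. L (b i)" r] b by simp
  also have "\<dots> = \<i> * of_real (\<theta> 1 - \<theta> 0)"
    using per[OF t, of 0] by (simp add: L_def algebra_simps)
  finally show ?thesis unfolding wn by simp
qed

text \<open>After Fubini the inner contour integral is \<open>2 * pi * \<i>\<close> times the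
  winding number, which is \<open>\<sigma>\<close> inside the curve and 0 outside.\<close>

lemma cauchy_transform_eq_area:
  fixes \<phi> :: "complex \<Rightarrow> real"
  assumes t: "t \<in> {0..T}" and \<phi>: "continuous_on UNIV \<phi>"
    and box: "\<And>s. \<Gamma> s t \<in> box lo hi" and R: "R \<ge> 0" "\<And>s. cbox lo hi \<subseteq> cball (\<Gamma> s t) R"
    and \<sigma>: "\<And>z. z \<in> enclosed_region (\<lambda>s. \<Gamma> s t) \<Longrightarrow> winding_number (\<lambda>s. \<Gamma> s t) z = of_real \<sigma>"
  shows "(\<Sum>i<r. integral {b i..b (Suc i)} (\<lambda>s. integral (cbox lo hi) (\<lambda>z. of_real (\<phi> z) / (\<Gamma> s t - z)) * D i (s, t)))
    = 2 * pi * \<i> * of_real (\<sigma> * g_area \<phi> (enclosed_region (\<lambda>s. \<Gamma> s t)))"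
proof -
  define c where "c s = \<Gamma> s t" for s
  define U where "U = enclosed_region c"
  define k where "k i s z = indicator {b i..b (Suc i)} s *\<^sub>R (indicator (cbox lo hi) z *\<^sub>R (of_real (\<phi> z) * D i (s, t) / (c s - z)))" for i s z
  have Dt: "continuous_on {b i..b (Suc i)} (\<lambda>s. D i (s, t))" if "i < r" for i
    by (rule continuous_on_snd_param[OF D[OF that] t])
  have cc: "continuous_on A c" for A unfolding c_def by (rule cont_s[OF t])
  have sum1: "(\<Sum>i<r. integral {b i..b (Suc i)} (\<lambda>s. integral (cbox lo hi) (\<lambda>z. of_real (\<phi> z) / (c s - z)) * D i (s, t)))
      = (LINT z|lborel. (\<Sum>i<r. LINT s|lborel. k i s z))"
  proof -
    have "(\<Sum>i<r. integral {b i..b (Suc i)} (\<lambda>s. integral (cbox lo hi) (\<lambda>z. of_real (\<phi> z) / (c s - z)) * D i (s, t)))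
        = (\<Sum>i<r. LINT z|lborel. LINT s|lborel. k i s z)"
    proof (rule sum.cong[OF refl])
      fix i assume "i \<in> {..<r}"
      then have i: "i < r" by simp
      show "integral {b i..b (Suc i)} (\<lambda>s. integral (cbox lo hi) (\<lambda>z. of_real (\<phi> z) / (c s - z)) * D i (s, t)) = (LINT z|lborel. LINT s|lborel. k i s z)"
        using cauchy_transform_fubini(1)[OF less_imp_le[OF b_less[OF i]] cc Dt[OF i] \<phi> R(1), of lo hi] R(2)
        by (simp add: k_def c_def)
    qed
    also have "\<dots> = (LINT z|lborel. (\<Sum>i<r. LINT s|lborel. k i s z))"
    proof (rule Bochner_Integration.integral_sum[symmetric])
      fix i assume "i \<in> {..<r}"
      then have i: "i < r" by simp
      show "integrable lborel (\<lambda>z. LINT s|lborel. k i s z)"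
        using cauchy_transform_fubini(2)[OF less_imp_le[OF b_less[OF i]] cc Dt[OF i] \<phi> R(1), of lo hi] R(2)
        by (simp add: k_def c_def)
    qed
    finally show ?thesis .
  qed
  have intk: "integrable lborel (\<lambda>z. \<Sum>i<r. LINT s|lborel. k i s z)"
  proof (rule Bochner_Integration.integrable_sum)
    fix i assume "i \<in> {..<r}"
    then have i: "i < r" by simp
    show "integrable lborel (\<lambda>z. LINT s|lborel. k i s z)"
      using cauchy_transform_fubini(2)[OF less_imp_le[OF b_less[OF i]] cc Dt[OF i] \<phi> R(1), of lo hi] R(2)
      by (simp add: k_def c_def)
  qed
  have loop: "pathfinish c = pathstart c" using per[OF t, of 0] by (simp add: c_def pathfinish_def pathstart_def)
  have pc: "path c" using simple_path_imp_path[OF simple[OF t]] by (simp add: c_def[abs_def])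
  \<comment> \<open>The kernel is restricted to the box; since the enclosed region lies in it, the
    area integral loses nothing.\<close>
  have Usub: "U \<subseteq> cbox lo hi"
  proof -
    have "path_image c \<subseteq> cbox lo hi" using box box_subset_cbox[of lo hi] by (auto simp: path_image_def c_def)
    then have "- cbox lo hi \<subseteq> outside (path_image c)" by (rule outside_subset_convex[OF convex_box(1)])
    then show ?thesis unfolding U_def enclosed_region_def using inside_Int_outside by blast
  qed
  have Uopen: "open U" unfolding U_def enclosed_region_def
    by (rule open_inside) (simp add: closed_path_image pc)
  have ae: "AE z in lborel. (\<Sum>i<r. LINT s|lborel. k i s z) = 2 * pi * \<i> * of_real (\<sigma> * (indicator U z * \<phi> z))"
    using path_image_null[OF t]
  proof eventually_elim
    case (elim z)
    then have z: "z \<notin> path_image c" by (simp add: c_def[abs_def])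
    have nz: "c s - z \<noteq> 0" for s using z range_eq_path_image[OF t] by (auto simp: c_def[abs_def])
    have "(LINT s|lborel. k i s z) = indicator (cbox lo hi) z *\<^sub>R (of_real (\<phi> z) * integral {b i..b (Suc i)} (\<lambda>s. D i (s, t) / (c s - z)))"
      if i: "i < r" for i
    proof -
      have "set_integrable lborel {b i..b (Suc i)} (\<lambda>s. D i (s, t) / (c s - z))"
        by (rule borel_integrable_atLeastAtMost', intro continuous_on_divide Dt[OF i] continuous_on_diff cc continuous_on_const) (use nz in auto)
      then have 1: "(LINT s|lborel. indicator {b i..b (Suc i)} s *\<^sub>R (D i (s, t) / (c s - z))) = integral {b i..b (Suc i)} (\<lambda>s. D i (s, t) / (c s - z))"
        using set_borel_integral_eq_integral(2) by (simp add: set_lebesgue_integral_def)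
      have "(LINT s|lborel. k i s z) = (LINT s|lborel. (indicator (cbox lo hi) z *\<^sub>R of_real (\<phi> z)) * (indicator {b i..b (Suc i)} s *\<^sub>R (D i (s, t) / (c s - z))))"
        by (rule Bochner_Integration.integral_cong) (auto simp: k_def indicator_def)
      also have "\<dots> = (indicator (cbox lo hi) z *\<^sub>R of_real (\<phi> z)) * integral {b i..b (Suc i)} (\<lambda>s. D i (s, t) / (c s - z))"
        unfolding 1[symmetric] by (rule integral_mult_right_zero)
      finally show ?thesis by simp
    qed
    then have "(\<Sum>i<r. LINT s|lborel. k i s z) = indicator (cbox lo hi) z *\<^sub>R (of_real (\<phi> z) * (\<Sum>i<r. integral {b i..b (Suc i)} (\<lambda>s. D i (s, t) / (c s - z))))"
      by (simp add: sum_distrib_left scaleR_sum_right)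
    also have "(\<Sum>i<r. integral {b i..b (Suc i)} (\<lambda>s. D i (s, t) / (c s - z))) = 2 * pi * \<i> * winding_number c z"
      using sum_integral_winding[OF t, of z] z by (simp add: c_def[abs_def])
    also have "winding_number c z = of_real (\<sigma> * indicator U z)"
    proof (cases "z \<in> U")
      case True then show ?thesis using \<sigma>[of z] by (simp add: U_def c_def[abs_def])
    next
      case False
      then have "z \<in> outside (path_image c)" using z by (simp add: U_def enclosed_region_def outside_inside)
      then show ?thesis using False winding_number_zero_in_outside[OF pc loop] by simp
    qed
    finally show ?case using Usub by (auto simp: indicator_def)
  qed
  have [measurable]: "\<phi> \<in> borel_measurable borel" by (rule borel_measurable_continuous_onI[OF \<phi>])
  have [measurable]: "U \<in> sets borel" using Uopen by simp
  have "(LINT z|lborel. (\<Sum>i<r. LINT s|lborel. k i s z)) = (LINT z|lborel. 2 * pi * \<i> * of_real (\<sigma> * (indicator U z * \<phi> z)))"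
    by (rule integral_cong_AE) (use ae borel_measurable_integrable[OF intk] in auto)
  also have "\<dots> = 2 * pi * \<i> * of_real (\<sigma> * (LINT z|lborel. indicator U z * \<phi> z))"
    by (simp only: integral_mult_right_zero integral_complex_of_real)
  finally show ?thesis using sum1 by (simp add: g_area_def set_lebesgue_integral_def U_def c_def[abs_def])
qed

lemma vector_derivative_t:
  assumes "i < r" "s \<in> {b i..b (Suc i)}" "t \<in> {0..T}"
  shows "vector_derivative (\<Gamma> s) (at t within {0..T}) = E i (s, t)"
  using vector_derivative_within_cbox[OF T, of t "\<Gamma> s" "E i (s, t)"] dE[OF assms] assms(3) by simp

text \<open>For fixed \<open>\<epsilon>\<close> the strip formula is exact. In the limit the left
  side becomes the contour integral of the true Cauchy transform, that is
  \<open>2 * pi * \<i> * \<sigma>\<close> times the area, and the \<open>bump\<close> averages on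
  the right become \<open>pi * \<phi>\<close> on the curve.\<close>

lemma area_variation:
  fixes \<phi> :: "complex \<Rightarrow> real"
  assumes t: "t1 \<in> {0..T}" "t2 \<in> {0..T}" "t1 \<le> t2" and \<phi>: "continuous_on UNIV \<phi>"
    and \<sigma>: "\<sigma> = 1 \<or> \<sigma> = - 1"
      "\<And>z. z \<in> enclosed_region (\<lambda>s. \<Gamma> s t1) \<Longrightarrow> winding_number (\<lambda>s. \<Gamma> s t1) z = of_real \<sigma>"
      "\<And>z. z \<in> enclosed_region (\<lambda>s. \<Gamma> s t2) \<Longrightarrow> winding_number (\<lambda>s. \<Gamma> s t2) z = of_real \<sigma>"
  shows "g_area \<phi> (enclosed_region (\<lambda>s. \<Gamma> s t2)) - g_area \<phi> (enclosed_region (\<lambda>s. \<Gamma> s t1)) =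
    - \<sigma> * (\<Sum>i<r. integral {t1..t2} (\<lambda>t. integral {b i..b (Suc i)} (\<lambda>s. \<phi> (\<Gamma> s t) * Im (cnj (D i (s, t)) * E i (s, t)))))"
proof -
  obtain lo hi R where box: "\<And>s t. t \<in> {0..T} \<Longrightarrow> \<Gamma> s t \<in> box lo hi" and R: "R \<ge> 0"
    "\<And>s t. t \<in> {0..T} \<Longrightarrow> cbox lo hi \<subseteq> cball (\<Gamma> s t) R"
    using bounding_box by blast
  have \<phi>B: "continuous_on (cbox lo hi) \<phi>" by (rule continuous_on_subset[OF \<phi>]) auto
  obtain C where C: "C \<ge> 0" "\<And>z. z \<in> cbox lo hi \<Longrightarrow> \<bar>\<phi> z\<bar> \<le> C"
  proof -
    have "bounded (\<phi> ` cbox lo hi)" by (intro compact_imp_bounded compact_continuous_image \<phi>B) auto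
    then show ?thesis using that unfolding bounded_pos by (auto intro: less_imp_le)
  qed
  define \<epsilon> :: "nat \<Rightarrow> real" where "\<epsilon> k = inverse (real (Suc k))" for k
  have \<epsilon>: "\<epsilon> k > 0" "\<epsilon> \<longlonglongrightarrow> 0" for k
    using LIMSEQ_inverse_real_of_nat by (simp_all add: \<epsilon>_def[abs_def])
  define F where "F k w = integral (cbox lo hi) (\<lambda>z. of_real (\<phi> z) * cauchy_kernel (\<epsilon> k) (w - z))" for k w
  define J where "J k w = integral (cbox lo hi) (\<lambda>z. \<phi> z * bump (\<epsilon> k) (w - z))" for k w
  define \<Phi> where "\<Phi> w = integral (cbox lo hi) (\<lambda>z. complex_of_real (\<phi> z) / (w - z))" for w
  define g where "g z = \<Gamma> (fst z) (snd z)" for z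
  define j where "j i z = Im (cnj (D i z) * E i z)" for i z
  have sub: "{t1..t2} \<subseteq> {0..T}" using t by auto
  have cg: "continuous_on (A \<times> {0..T}) g" for A unfolding g_def by (rule cont_on) simp
  have cj: "continuous_on ({b i..b (Suc i)} \<times> {0..T}) (j i)" if "i < r" for i
    unfolding j_def by (intro continuous_intros D E that)
  have strip: "integral {b i..b (Suc i)} (\<lambda>s. F k (\<Gamma> s t2) * D i (s, t2)) - integral {b i..b (Suc i)} (\<lambda>s. F k (\<Gamma> s t1) * D i (s, t1)) =
      integral {t1..t2} (\<lambda>t. F k (\<Gamma> (b (Suc i)) t) * E i (b (Suc i), t) - F k (\<Gamma> (b i) t) * E i (b i, t)) +
      integral {t1..t2} (\<lambda>t. integral {b i..b (Suc i)} (\<lambda>s. - 2 * \<i> * of_real (J k (\<Gamma> s t) * j i (s, t))))"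
    and cF: "continuous_on UNIV (F k)" and cJ: "continuous_on UNIV (J k)" if i: "i < r" for i k
  proof -
    have dg: "((\<lambda>s. g (s, t)) has_vector_derivative D i (s, t)) (at s)" if "s \<in> {b i<..<b (Suc i)}" "t \<in> {0<..<T}" for s t
      using dD[OF i, of s t] that by (simp add: g_def at_within_Icc_at)
    have eg: "((\<lambda>t. g (s, t)) has_vector_derivative E i (s, t)) (at t)" if "s \<in> {b i<..<b (Suc i)}" "t \<in> {0<..<T}" for s t
      using dE[OF i, of s t] that by (simp add: g_def at_within_Icc_at)
    have tt: "0 \<le> t1" "t1 \<le> t2" "t2 \<le> T" using t by auto
    note st = strip_cauchy_transform[OF b_less[OF i] T \<epsilon>(1)[of k] cg D[OF i] E[OF i] dg eg M[OF i] dDM[OF i] dEM[OF i] \<phi>B tt]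
    show "integral {b i..b (Suc i)} (\<lambda>s. F k (\<Gamma> s t2) * D i (s, t2)) - integral {b i..b (Suc i)} (\<lambda>s. F k (\<Gamma> s t1) * D i (s, t1)) =
      integral {t1..t2} (\<lambda>t. F k (\<Gamma> (b (Suc i)) t) * E i (b (Suc i), t) - F k (\<Gamma> (b i) t) * E i (b i, t)) +
      integral {t1..t2} (\<lambda>t. integral {b i..b (Suc i)} (\<lambda>s. - 2 * \<i> * of_real (J k (\<Gamma> s t) * j i (s, t))))"
      using st(1) by (simp add: F_def J_def g_def j_def)
    show "continuous_on UNIV (F k)" "continuous_on UNIV (J k)"
      using st(2,3) by (simp_all add: F_def[abs_def] J_def[abs_def])
  qed
  \<comment> \<open>At a break point both neighbouring arcs have the same
    \<open>t\<close>-derivative, that of \<open>\<Gamma> (b i)\<close>, so the boundary terms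
    telescope; those at 0 and 1 agree by periodicity.\<close>
  have boundary: "(\<Sum>i<r. integral {t1..t2} (\<lambda>t. F k (\<Gamma> (b (Suc i)) t) * E i (b (Suc i), t) - F k (\<Gamma> (b i) t) * E i (b i, t))) = 0" for k
  proof -
    define q where "q s t = F k (\<Gamma> s t) * vector_derivative (\<Gamma> s) (at t within {0..T})" for s t
    define I where "I i = integral {t1..t2} (q (b i))" for i
    have q: "q s t = F k (\<Gamma> s t) * E i (s, t)" if "i < r" "s \<in> {b i..b (Suc i)}" "t \<in> {t1..t2}" for i s t
      using vector_derivative_t[OF that(1,2), of t] that(3) sub by (auto simp: q_def)
    have iq: "q s integrable_on {t1..t2}" if "i < r" "s \<in> {b i..b (Suc i)}" for i s
    proof (rule integrable_continuous_interval)
      have 1: "continuous_on {t1..t2} (\<lambda>t. F k (\<Gamma> s t))"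
        by (rule continuous_on_compose2[OF cF[OF that(1)] continuous_on_subset[OF cont_t sub]]) auto
      have 2: "continuous_on {t1..t2} (\<lambda>t. E i (s, t))"
        by (rule continuous_on_subset[OF continuous_on_fst_param[OF E[OF that(1)] that(2)] sub])
      have "continuous_on {t1..t2} (\<lambda>t. F k (\<Gamma> s t) * E i (s, t))"
        by (rule continuous_on_mult[OF 1 2])
      then show "continuous_on {t1..t2} (q s)"
        by (rule continuous_on_eq) (simp add: q[OF that])
    qed
    have "integral {t1..t2} (\<lambda>t. F k (\<Gamma> (b (Suc i)) t) * E i (b (Suc i), t) - F k (\<Gamma> (b i) t) * E i (b i, t)) = I (Suc i) - I i" if "i < r" for i
    proof -
      have e: "b i \<in> {b i..b (Suc i)}" "b (Suc i) \<in> {b i..b (Suc i)}" using b_less[OF that] by auto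
      have "integral {t1..t2} (\<lambda>t. F k (\<Gamma> (b (Suc i)) t) * E i (b (Suc i), t) - F k (\<Gamma> (b i) t) * E i (b i, t))
          = integral {t1..t2} (\<lambda>t. q (b (Suc i)) t - q (b i) t)"
        by (rule integral_cong) (simp add: q[OF that e(1)] q[OF that e(2)])
      then show ?thesis
        unfolding I_def using integral_diff[OF iq[OF that e(2)] iq[OF that e(1)]] by simp
    qed
    then have "(\<Sum>i<r. integral {t1..t2} (\<lambda>t. F k (\<Gamma> (b (Suc i)) t) * E i (b (Suc i), t) - F k (\<Gamma> (b i) t) * E i (b i, t))) = I r - I 0"
      using sum_lessThan_telescope[of I r] by simp
    also have "I r = I 0"
      unfolding I_def b(2,3)
    proof (rule integral_cong)
      fix t assume "t \<in> {t1..t2}"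
      then have t: "t \<in> {0..T}" using sub by auto
      have r0: "0 < r" "(0::real) \<in> {b 0..b (Suc 0)}" using r_pos b_less[OF r_pos] b(2) by auto
      have "(\<Gamma> 1 has_vector_derivative E 0 (0, t)) (at t within {0..T})"
        by (rule has_vector_derivative_transform[OF t _ dE[OF r0 t]]) (use per[of _ 0] in simp)
      then have "vector_derivative (\<Gamma> 1) (at t within {0..T}) = E 0 (0, t)"
        using vector_derivative_within_cbox[OF T, of t "\<Gamma> 1"] t by simp
      then show "q 1 t = q 0 t" using per[OF t, of 0] vector_derivative_t[OF r0 t] by (simp add: q_def)
    qed
    finally show ?thesis by simp
  qed
  define S where "S k t = (\<Sum>i<r. integral {b i..b (Suc i)} (\<lambda>s. F k (\<Gamma> s t) * D i (s, t)))" for k t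
  define H where "H k i t = integral {b i..b (Suc i)} (\<lambda>s. - 2 * \<i> * of_real (J k (\<Gamma> s t) * j i (s, t)))" for k i t
  define X where "X i t = integral {b i..b (Suc i)} (\<lambda>s. \<phi> (\<Gamma> s t) * j i (s, t))" for i t
  have S_eq: "S k t2 - S k t1 = (\<Sum>i<r. integral {t1..t2} (H k i))" for k
  proof -
    have "S k t2 - S k t1 = (\<Sum>i<r. integral {t1..t2} (\<lambda>t. F k (\<Gamma> (b (Suc i)) t) * E i (b (Suc i), t) - F k (\<Gamma> (b i) t) * E i (b i, t)) + integral {t1..t2} (H k i))"
      unfolding S_def sum_subtractf[symmetric] H_def by (rule sum.cong[OF refl]) (use strip in auto)
    then show ?thesis unfolding sum.distrib boundary by simp
  qed
  have S_lim: "(\<lambda>k. S k t) \<longlonglongrightarrow> (\<Sum>i<r. integral {b i..b (Suc i)} (\<lambda>s. \<Phi> (\<Gamma> s t) * D i (s, t)))" if t: "t \<in> {0..T}" for t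
    unfolding S_def
  proof (rule tendsto_sum)
    fix i assume "i \<in> {..<r}"
    then have i: "i < r" by simp
    have Dt: "continuous_on {b i..b (Suc i)} (\<lambda>s. D i (s, t))" by (rule continuous_on_snd_param[OF D[OF i] t])
    show "(\<lambda>k. integral {b i..b (Suc i)} (\<lambda>s. F k (\<Gamma> s t) * D i (s, t))) \<longlonglongrightarrow> integral {b i..b (Suc i)} (\<lambda>s. \<Phi> (\<Gamma> s t) * D i (s, t))"
    proof (rule dominated_convergence(2))
      show "(\<lambda>s. F k (\<Gamma> s t) * D i (s, t)) integrable_on {b i..b (Suc i)}" for k
      proof (intro integrable_continuous_interval continuous_on_mult Dt)
        show "continuous_on {b i..b (Suc i)} (\<lambda>s. F k (\<Gamma> s t))"
          by (rule continuous_on_compose2[OF cF[OF i] cont_s[OF t]]) auto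
      qed
      show "(\<lambda>s. C * (2 * pi * R) * norm (D i (s, t))) integrable_on {b i..b (Suc i)}"
        by (intro integrable_continuous_interval continuous_on_mult continuous_on_const continuous_on_norm Dt)
      show "norm (F k (\<Gamma> s t) * D i (s, t)) \<le> C * (2 * pi * R) * norm (D i (s, t))" for k s
        unfolding norm_mult F_def
        by (intro mult_right_mono cauchy_convolution_bound[OF \<phi>B C(2) C(1) R(1) R(2)] \<epsilon> t) auto
      show "(\<lambda>k. F k (\<Gamma> s t) * D i (s, t)) \<longlonglongrightarrow> \<Phi> (\<Gamma> s t) * D i (s, t)" for s
        unfolding F_def \<Phi>_def
        by (intro tendsto_mult tendsto_const cauchy_convolution_limit[OF \<phi>B C(2) C(1) R(1) R(2)] \<epsilon> t)
    qed
  qed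
  have H_lim: "(\<lambda>k. integral {t1..t2} (H k i)) \<longlonglongrightarrow> integral {t1..t2} (\<lambda>t. - 2 * pi * \<i> * of_real (X i t))" if i: "i < r" for i
  proof (rule dominated_convergence(2))
    have cJg: "continuous_on ({b i..b (Suc i)} \<times> {0..T}) (\<lambda>z. J k (g z))" for k
      by (rule continuous_on_compose2[OF cJ[OF i] cg]) auto
    have cH: "continuous_on ({b i..b (Suc i)} \<times> {0..T}) (\<lambda>z. - 2 * \<i> * of_real (J k (g z) * j i z))" for k
      by (intro continuous_on_mult continuous_on_const continuous_on_of_real cJg cj[OF i])
    show "H k i integrable_on {t1..t2}" for k
      using continuous_on_integral_fst[OF cH, of k]
      by (intro integrable_continuous_interval continuous_on_subset[OF _ sub]) (simp add: H_def[abs_def] g_def)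
    have cb: "continuous_on ({b i..b (Suc i)} \<times> {0..T}) (\<lambda>z. 2 * (C * pi) * \<bar>j i z\<bar>)"
      by (intro continuous_on_mult continuous_on_const continuous_on_rabs cj[OF i])
    show "(\<lambda>t. integral {b i..b (Suc i)} (\<lambda>s. 2 * (C * pi) * \<bar>j i (s, t)\<bar>)) integrable_on {t1..t2}"
      by (intro integrable_continuous_interval continuous_on_subset[OF continuous_on_integral_fst[OF cb] sub])
    have bd: "norm (- 2 * \<i> * of_real (J k (\<Gamma> s t) * j i (s, t))) \<le> 2 * (C * pi) * \<bar>j i (s, t)\<bar>" for k s t
    proof -
      have "\<bar>J k (\<Gamma> s t)\<bar> \<le> C * pi" unfolding J_def by (rule bump_convolution_bound[OF \<epsilon>(1) \<phi>B C(2) C(1)])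
      then have "\<bar>J k (\<Gamma> s t)\<bar> * \<bar>j i (s, t)\<bar> \<le> C * pi * \<bar>j i (s, t)\<bar>" by (rule mult_right_mono) simp
      then show ?thesis by (simp add: norm_mult)
    qed
    fix t assume "t \<in> {t1..t2}"
    then have t: "t \<in> {0..T}" using sub by auto
    have Hs: "(\<lambda>s. - 2 * \<i> * of_real (J k (\<Gamma> s t) * j i (s, t))) integrable_on {b i..b (Suc i)}" for k
      using continuous_on_snd_param[OF cH t, of k] by (intro integrable_continuous_interval) (simp add: g_def)
    have bs: "(\<lambda>s. 2 * (C * pi) * \<bar>j i (s, t)\<bar>) integrable_on {b i..b (Suc i)}"
      by (rule integrable_continuous_interval[OF continuous_on_snd_param[OF cb t]])
    show "norm (H k i t) \<le> integral {b i..b (Suc i)} (\<lambda>s. 2 * (C * pi) * \<bar>j i (s, t)\<bar>)" for k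
      unfolding H_def by (rule integral_norm_bound_integral[OF Hs bs bd])
    have "(\<lambda>k. H k i t) \<longlonglongrightarrow> integral {b i..b (Suc i)} (\<lambda>s. - 2 * \<i> * of_real (pi * \<phi> (\<Gamma> s t) * j i (s, t)))"
      unfolding H_def
    proof (rule dominated_convergence(2)[OF Hs bs bd])
      show "(\<lambda>k. - 2 * \<i> * of_real (J k (\<Gamma> s t) * j i (s, t))) \<longlonglongrightarrow> - 2 * \<i> * of_real (pi * \<phi> (\<Gamma> s t) * j i (s, t))" for s
        unfolding J_def
        by (intro tendsto_mult tendsto_const tendsto_of_real bump_convolution_limit \<epsilon> \<phi>B box t)
    qed
    moreover have "integral {b i..b (Suc i)} (\<lambda>s. - 2 * \<i> * of_real (pi * \<phi> (\<Gamma> s t) * j i (s, t))) = - 2 * pi * \<i> * of_real (X i t)"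
    proof -
      have "continuous_on {b i..b (Suc i)} (\<lambda>s. \<phi> (\<Gamma> s t))"
        by (rule continuous_on_compose2[OF \<phi> cont_s[OF t]]) auto
      then have "continuous_on {b i..b (Suc i)} (\<lambda>s. \<phi> (\<Gamma> s t) * j i (s, t))"
        by (intro continuous_on_mult continuous_on_snd_param[OF cj[OF i] t])
      then have "((\<lambda>s. \<phi> (\<Gamma> s t) * j i (s, t)) has_integral X i t) {b i..b (Suc i)}"
        unfolding X_def by (intro integrable_integral integrable_continuous_interval)
      from has_integral_mult_right[OF has_integral_of_real[OF this], of "- 2 * pi * \<i>"]
      have "((\<lambda>s. - 2 * \<i> * of_real (pi * \<phi> (\<Gamma> s t) * j i (s, t))) has_integral - 2 * pi * \<i> * of_real (X i t)) {b i..b (Suc i)}"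
        by (simp add: mult_ac)
      then show ?thesis by (rule integral_unique)
    qed
    ultimately show "(\<lambda>k. H k i t) \<longlonglongrightarrow> - 2 * pi * \<i> * of_real (X i t)" by (simp only:)
  qed
  have X_int: "X i integrable_on {t1..t2}" if i: "i < r" for i
  proof -
    have "continuous_on ({b i..b (Suc i)} \<times> {0..T}) (\<lambda>z. \<phi> (g z) * j i z)"
      by (intro continuous_on_mult cj[OF i] continuous_on_compose2[OF \<phi> cg]) auto
    from continuous_on_subset[OF continuous_on_integral_fst[OF this] sub]
    show ?thesis unfolding X_def[abs_def] g_def by (intro integrable_continuous_interval) simp
  qed
  have XI: "integral {t1..t2} (\<lambda>t. - 2 * pi * \<i> * of_real (X i t)) = - 2 * pi * \<i> * of_real (integral {t1..t2} (X i))" if "i < r" for i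
    by (intro integral_unique has_integral_mult_right has_integral_of_real integrable_integral X_int that)
  have "(\<lambda>k. S k t2 - S k t1) \<longlonglongrightarrow> (\<Sum>i<r. integral {t1..t2} (\<lambda>t. - 2 * pi * \<i> * of_real (X i t)))"
    unfolding S_eq by (intro tendsto_sum H_lim) simp
  from LIMSEQ_unique[OF tendsto_diff[OF S_lim[OF t(2)] S_lim[OF t(1)]] this]
  have "2 * pi * \<i> * of_real (\<sigma> * g_area \<phi> (enclosed_region (\<lambda>s. \<Gamma> s t2))) - 2 * pi * \<i> * of_real (\<sigma> * g_area \<phi> (enclosed_region (\<lambda>s. \<Gamma> s t1)))
      = (\<Sum>i<r. - 2 * pi * \<i> * of_real (integral {t1..t2} (X i)))"
    unfolding \<Phi>_def
    using cauchy_transform_eq_area[OF t(1) \<phi> box[OF t(1)] R(1) R(2)[OF t(1)] \<sigma>(2)]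
      cauchy_transform_eq_area[OF t(2) \<phi> box[OF t(2)] R(1) R(2)[OF t(2)] \<sigma>(3)] XI by simp
  also have "\<dots> = 2 * pi * \<i> * of_real (- (\<Sum>i<r. integral {t1..t2} (X i)))"
    by (simp add: sum_negf sum_distrib_left)
  finally have "2 * pi * \<i> * of_real (\<sigma> * (g_area \<phi> (enclosed_region (\<lambda>s. \<Gamma> s t2)) - g_area \<phi> (enclosed_region (\<lambda>s. \<Gamma> s t1))))
      = 2 * pi * \<i> * of_real (- (\<Sum>i<r. integral {t1..t2} (X i)))"
    by (simp add: algebra_simps)
  then have "\<sigma> * (g_area \<phi> (enclosed_region (\<lambda>s. \<Gamma> s t2)) - g_area \<phi> (enclosed_region (\<lambda>s. \<Gamma> s t1))) = - (\<Sum>i<r. integral {t1..t2} (X i))"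
    unfolding mult_cancel_left of_real_eq_iff by simp
  then show ?thesis using \<sigma>(1) unfolding X_def j_def by (auto simp: X_def)
qed

end

section \<open>Flat metrics with conical singularities\<close>

text \<open>For \<open>\<rho> = e\<^bsup>2u\<^esup>\<close> this is \<open>u\<^sub>x - \<i> u\<^sub>y\<close>, holomorphic because \<open>u\<close> is harmonic.\<close>

definition log_gradient :: "(complex \<Rightarrow> real) \<Rightarrow> complex \<Rightarrow> complex" where
  "log_gradient \<rho> z = cnj (gradient \<rho> z) / of_real (2 * \<rho> z)"

text \<open>The Cauchy-Riemann equations here are the vanishing Laplacian of \<open>u\<close> and
  the symmetry of its second derivatives. \<open>v b\<close> is the \<open>b\<close>-derivative of
  \<open>ln \<rho>\<close>, that is of \<open>2 * u\<close>; the quotient rule reduces its symmetry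
  to that of \<open>\<rho>\<close>.\<close>

lemma log_gradient_holomorphic:
  assumes S: "open S" and pos: "\<And>z. z \<in> S \<Longrightarrow> \<rho> z > 0" and smooth: "smooth_on S \<rho>"
    and flat: "\<And>z. z \<in> S \<Longrightarrow> gauss_curvature \<rho> z = 0"
  shows "log_gradient \<rho> holomorphic_on S"
proof (rule holomorphic_onI)
  fix z assume z: "z \<in> S"
  define R where "R b w = frechet_derivative \<rho> (at w) b" for b w
  have Ck: "Ck_on S \<rho> (Suc (Suc 0))" using smooth unfolding smooth_on_def by blast
  have d\<rho>: "(\<rho> has_derivative (\<lambda>h. R h w)) (at w)" if "w \<in> S" for w
    unfolding R_def using Ck that by (simp add: frechet_derivative_works)
  have dR: "(R b has_derivative (\<lambda>h. frechet_derivative (R b) (at w) h)) (at w)" if "w \<in> S" for w b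
    using Ck that by (simp add: frechet_derivative_works R_def[abs_def])
  define v where "v b w = R b w / \<rho> w" for b w
  define v' where "v' b w h = (frechet_derivative (R b) (at w) h * \<rho> w - R b w * R h w) / (\<rho> w * \<rho> w)" for b w h
  have dv: "(v b has_derivative v' b w) (at w)" if "w \<in> S" for b w
    unfolding v_def v'_def by (rule has_derivative_divide'[OF dR[OF that] d\<rho>[OF that]]) (use pos[OF that] in simp)
  have ln: "frechet_derivative (\<lambda>w. ln (\<rho> w)) (at w) b = v b w" if "w \<in> S" for w b
  proof -
    have "((\<lambda>w. ln (\<rho> w)) has_derivative (\<lambda>h. R h w * inverse (\<rho> w))) (at w)"
      using has_derivative_ln[OF pos[OF that] d\<rho>[OF that]] by simp
    then show ?thesis by (simp add: frechet_derivative_at[symmetric] v_def divide_inverse)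
  qed
  have lnd: "frechet_derivative (\<lambda>w. frechet_derivative (\<lambda>w. ln (\<rho> w)) (at w) b) (at z) h = v' b z h" for b h
  proof -
    have "((\<lambda>w. frechet_derivative (\<lambda>w. ln (\<rho> w)) (at w) b) has_derivative v' b z) (at z)"
      by (rule has_derivative_transform_within_open[OF dv[OF z] S z]) (simp add: ln)
    then show ?thesis by (simp add: frechet_derivative_at[symmetric])
  qed
  have "laplacian (\<lambda>w. ln (\<rho> w)) z = 0"
    using flat[OF z] pos[OF z] by (simp add: gauss_curvature_def)
  then have harm: "v' 1 z 1 + v' \<i> z \<i> = 0"
    unfolding laplacian_def lnd by (simp add: Basis_complex_def)
  have symv: "v' 1 z \<i> = v' \<i> z 1"
    using symmetric_second_derivative[OF S Ck z, of 1 \<i>] by (simp add: v'_def R_def[abs_def] mult.commute)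
  have lin: "v' b z h = Re h * v' b z 1 + Im h * v' b z \<i>" for b h
  proof -
    interpret bounded_linear "v' b z" by (rule has_derivative_bounded_linear[OF dv[OF z]])
    have "Re h *\<^sub>R 1 + Im h *\<^sub>R \<i> = h" by (simp add: complex_eq_iff)
    then have "v' b z h = v' b z (Re h *\<^sub>R 1 + Im h *\<^sub>R \<i>)" by simp
    also have "\<dots> = Re h * v' b z 1 + Im h * v' b z \<i>" by (simp only: add scaleR real_scaleR_def)
    finally show ?thesis .
  qed
  have "((\<lambda>w. (of_real (v 1 w) - \<i> * of_real (v \<i> w)) / 2) has_derivative
      (\<lambda>h. (of_real (v' 1 z h) - \<i> * of_real (v' \<i> z h)) / 2)) (at z)"
    by (rule bounded_linear.has_derivative[OF bounded_linear_divide has_derivative_diff[OF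
          bounded_linear.has_derivative[OF bounded_linear_of_real dv[OF z]]
          has_derivative_mult_right[OF bounded_linear.has_derivative[OF bounded_linear_of_real dv[OF z]]]]])
  moreover have "(of_real (v' 1 z h) - \<i> * of_real (v' \<i> z h)) / 2 = (of_real (v' 1 z 1) - \<i> * of_real (v' 1 z \<i>)) / 2 * h" for h
  proof -
    define a c where "a = v' 1 z 1" and "c = v' 1 z \<i>"
    have "v' \<i> z 1 = c" "v' \<i> z \<i> = - a" using harm symv by (simp_all add: a_def c_def)
    then have "v' 1 z h = Re h * a + Im h * c" "v' \<i> z h = Re h * c - Im h * a"
      using lin[of 1 h] lin[of \<i> h] by (simp_all add: a_def c_def)
    then show ?thesis unfolding a_def[symmetric] c_def[symmetric] by (simp add: complex_eq_iff algebra_simps)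
  qed
  ultimately have "((\<lambda>w. (of_real (v 1 w) - \<i> * of_real (v \<i> w)) / 2) has_field_derivative
      (of_real (v' 1 z 1) - \<i> * of_real (v' 1 z \<i>)) / 2) (at z)"
    unfolding has_field_derivative_def by (simp only:)
  moreover have "log_gradient \<rho> = (\<lambda>w. (of_real (v 1 w) - \<i> * of_real (v \<i> w)) / 2)"
    by (rule ext) (simp add: log_gradient_def gradient_def v_def R_def complex_eq_iff)
  ultimately show "log_gradient \<rho> field_differentiable at z within S"
    unfolding field_differentiable_def by (metis has_field_derivative_at_within)
qed

text \<open>Only the function \<open>\<zeta>\<close> vanishes to first order at \<open>q\<close>; the factor \<open>norm (deriv \<zeta> z)\<close> contributes
  nothing to the residue.\<close>

lemma conical_point_local:
  assumes "conical_point \<rho> q b"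
  obtains \<epsilon> C where "\<epsilon> > 0" "C > 0"
    "\<And>z. z \<in> ball q \<epsilon> - {q} \<Longrightarrow> \<rho> z \<le> C * norm (z - q) powr (2 * b)"
    "((\<lambda>z. (z - q) * log_gradient \<rho> z) \<longlongrightarrow> of_real b) (at q)"
proof -
  obtain U \<zeta> where U: "open U" "q \<in> U" and hol: "\<zeta> holomorphic_on U" and inj: "inj_on \<zeta> U" and \<zeta>0: "\<zeta> q = 0"
    and \<rho>: "\<And>z. z \<in> U - {q} \<Longrightarrow> \<rho> z = norm (\<zeta> z) powr (2 * b) * (norm (deriv \<zeta> z))\<^sup>2"
    using assms by (auto simp: conical_point_def)
  have d\<zeta>: "(\<zeta> has_field_derivative deriv \<zeta> z) (at z)" if "z \<in> U" for z
    by (rule holomorphic_derivI[OF hol U(1) that])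
  have hol': "deriv \<zeta> holomorphic_on U" by (rule holomorphic_deriv[OF hol U(1)])
  have d\<zeta>': "(deriv \<zeta> has_field_derivative deriv (deriv \<zeta>) z) (at z)" if "z \<in> U" for z
    by (rule holomorphic_derivI[OF hol' U(1) that])
  have nz': "deriv \<zeta> z \<noteq> 0" if "z \<in> U" for z
    by (rule holomorphic_injective_imp_regular[OF hol U(1) inj that])
  have nz: "\<zeta> z \<noteq> 0" if "z \<in> U - {q}" for z
    using inj that U(2) \<zeta>0 by (auto simp: inj_on_def)
  \<comment> \<open>Here \<open>u = b * ln (norm \<zeta>) + ln (norm (deriv \<zeta>))\<close>. Since
    \<open>ln (norm F)\<close> is locally the real part of a logarithm of \<open>F\<close>, it
    contributes \<open>deriv F / F\<close>.\<close>
  define X where "X z = of_real b * (deriv \<zeta> z / \<zeta> z) + deriv (deriv \<zeta>) z / deriv \<zeta> z" for z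
  have lnder: "((\<lambda>w. ln (norm (F w))) has_derivative (\<lambda>h. Re (F' / F z * h))) (at z)"
    if "(F has_field_derivative F') (at z)" "F z \<noteq> 0" for F F' z
  proof -
    have 1: "((\<lambda>w. norm (F w)) has_derivative (\<lambda>h. (F' * h) \<bullet> sgn (F z))) (at z)"
      using has_derivative_compose[OF that(1)[unfolded has_field_derivative_def] has_derivative_norm[OF that(2)]] by simp
    have "((\<lambda>w. ln (norm (F w))) has_derivative (\<lambda>h. ((F' * h) \<bullet> sgn (F z)) * inverse (norm (F z)))) (at z)"
      using has_derivative_ln[OF _ 1] that(2) by simp
    moreover have "((F' * h) \<bullet> sgn (F z)) * inverse (norm (F z)) = Re (F' / F z * h)" for h
    proof -
      have "Re (F' / F z * h) = Re (F' * h / F z)" by simp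
      also have "\<dots> = ((F' * h) \<bullet> F z) / (norm (F z))\<^sup>2"
        by (simp only: Re_divide inner_complex_def cmod_power2)
      finally show ?thesis by (simp add: sgn_div_norm power2_eq_square divide_inverse)
    qed
    ultimately show ?thesis by simp
  qed
  have lg: "log_gradient \<rho> z = X z" if z: "z \<in> U - {q}" for z
  proof -
    have zU: "z \<in> U" using z by simp
    have oU: "open (U - {q})" using U(1) by (simp add: open_Diff)
    define L where "L w = 2 * b * ln (norm (\<zeta> w)) + 2 * ln (norm (deriv \<zeta> w))" for w
    have dL: "(L has_derivative (\<lambda>h. 2 * b * Re (deriv \<zeta> z / \<zeta> z * h) + 2 * Re (deriv (deriv \<zeta>) z / deriv \<zeta> z * h))) (at z)"
      unfolding L_def
      by (intro has_derivative_add has_derivative_mult_right lnder[OF d\<zeta>[OF zU] nz[OF z]] lnder[OF d\<zeta>'[OF zU] nz'[OF zU]])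
    have \<rho>L: "\<rho> w = exp (L w)" if "w \<in> U - {q}" for w
    proof -
      have "norm (deriv \<zeta> w) > 0" "norm (\<zeta> w) > 0" using nz[OF that] nz'[of w] that by auto
      then show ?thesis unfolding \<rho>[OF that] L_def exp_add powr_def
        by (simp add: exp_double power2_eq_square)
    qed
    have "((\<lambda>w. exp (L w)) has_derivative (\<lambda>h. (2 * b * Re (deriv \<zeta> z / \<zeta> z * h) + 2 * Re (deriv (deriv \<zeta>) z / deriv \<zeta> z * h)) * exp (L z))) (at z)"
      using has_derivative_exp[OF dL] by simp
    then have "(\<rho> has_derivative (\<lambda>h. (2 * b * Re (deriv \<zeta> z / \<zeta> z * h) + 2 * Re (deriv (deriv \<zeta>) z / deriv \<zeta> z * h)) * exp (L z))) (at z)"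
      by (rule has_derivative_transform_within_open[OF _ oU z]) (simp add: \<rho>L)
    then have FD: "frechet_derivative \<rho> (at z) h = (2 * b * Re (deriv \<zeta> z / \<zeta> z * h) + 2 * Re (deriv (deriv \<zeta>) z / deriv \<zeta> z * h)) * \<rho> z" for h
      by (simp add: frechet_derivative_at[symmetric] \<rho>L[OF z])
    have fd: "frechet_derivative \<rho> (at z) h = 2 * \<rho> z * Re (X z * h)" for h :: complex
    proof -
      have "Re (X z * h) = b * Re (deriv \<zeta> z / \<zeta> z * h) + Re (deriv (deriv \<zeta>) z / deriv \<zeta> z * h)"
        unfolding X_def distrib_right mult.assoc[of "of_real b"] scaleR_conv_of_real[symmetric] by simp
      then show ?thesis unfolding FD by algebra
    qed
    have "\<rho> z \<noteq> 0" using \<rho>L[OF z] by simp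
    moreover have "gradient \<rho> z = of_real (2 * \<rho> z) * cnj (X z)"
      unfolding gradient_def fd by (simp add: complex_eq_iff)
    ultimately show ?thesis by (simp add: log_gradient_def)
  qed
  \<comment> \<open>The quotient tends to \<open>deriv \<zeta> q\<close>, which is not 0; this
    yields both the residue and the growth of \<open>\<rho>\<close>.\<close>
  define Q where "Q z = \<zeta> z / (z - q)" for z
  have Q: "(Q \<longlongrightarrow> deriv \<zeta> q) (at q)"
    using d\<zeta>[OF U(2)] unfolding has_field_derivative_iff by (simp add: Q_def[abs_def] \<zeta>0)
  have cd: "(deriv \<zeta> \<longlongrightarrow> deriv \<zeta> q) (at q)" "(deriv (deriv \<zeta>) \<longlongrightarrow> deriv (deriv \<zeta>) q) (at q)"
    using holomorphic_on_imp_continuous_on[OF hol'] holomorphic_on_imp_continuous_on[OF holomorphic_deriv[OF hol' U(1)]] U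
    by (auto simp: continuous_on_eq_continuous_at isCont_def)
  have evU: "\<forall>\<^sub>F z in at q. z \<in> U - {q}"
    using eventually_at_in_open[OF U] .
  have lim: "((\<lambda>z. (z - q) * log_gradient \<rho> z) \<longlongrightarrow> of_real b) (at q)"
  proof -
    have "((\<lambda>z. of_real b * (deriv \<zeta> z / Q z) + (z - q) * (deriv (deriv \<zeta>) z / deriv \<zeta> z)) \<longlongrightarrow>
        of_real b * (deriv \<zeta> q / deriv \<zeta> q) + (q - q) * (deriv (deriv \<zeta>) q / deriv \<zeta> q)) (at q)"
      by (intro tendsto_intros Q cd nz' U)
    then have *: "((\<lambda>z. of_real b * (deriv \<zeta> z / Q z) + (z - q) * (deriv (deriv \<zeta>) z / deriv \<zeta> z)) \<longlongrightarrow> of_real b) (at q)"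
      using nz'[OF U(2)] by simp
    show ?thesis
    proof (rule Lim_transform_eventually[OF *])
      show "\<forall>\<^sub>F z in at q. of_real b * (deriv \<zeta> z / Q z) + (z - q) * (deriv (deriv \<zeta>) z / deriv \<zeta> z) = (z - q) * log_gradient \<rho> z"
        using evU
      proof eventually_elim
        case (elim z)
        then show ?case using nz[OF elim] nz'[of z] by (simp add: lg[OF elim] X_def Q_def field_simps)
      qed
    qed
  qed
  define c where "c = norm (deriv \<zeta> q)"
  have c: "c > 0" using nz'[OF U(2)] by (simp add: c_def)
  \<comment> \<open>One more than the limit at \<open>q\<close>, hence an upper bound
    nearby.\<close>
  have ev1: "\<forall>\<^sub>F z in at q. norm (Q z) powr (2 * b) * (norm (deriv \<zeta> z))\<^sup>2 < c powr (2 * b) * c\<^sup>2 + 1"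
  proof (rule order_tendstoD(2))
    show "((\<lambda>z. norm (Q z) powr (2 * b) * (norm (deriv \<zeta> z))\<^sup>2) \<longlongrightarrow> c powr (2 * b) * c\<^sup>2) (at q)"
      unfolding c_def by (intro tendsto_intros Q cd) (use nz'[OF U(2)] in auto)
  qed simp
  have "\<forall>\<^sub>F z in at q. \<rho> z \<le> (c powr (2 * b) * c\<^sup>2 + 1) * norm (z - q) powr (2 * b)"
    using ev1 evU
  proof eventually_elim
    case (elim z)
    then have "\<zeta> z = (z - q) * Q z" by (simp add: Q_def)
    then have "\<rho> z = norm (Q z) powr (2 * b) * (norm (deriv \<zeta> z))\<^sup>2 * norm (z - q) powr (2 * b)"
      using \<rho>[of z] elim by (simp add: norm_mult powr_mult)
    also have "\<dots> \<le> (c powr (2 * b) * c\<^sup>2 + 1) * norm (z - q) powr (2 * b)"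
      using elim(1) by (intro mult_right_mono) auto
    finally show ?case .
  qed
  then obtain \<epsilon> where "\<epsilon> > 0" "\<And>z. z \<noteq> q \<Longrightarrow> dist z q < \<epsilon> \<Longrightarrow> \<rho> z \<le> (c powr (2 * b) * c\<^sup>2 + 1) * norm (z - q) powr (2 * b)"
    unfolding eventually_at by auto
  then show ?thesis
    using that[of \<epsilon> "c powr (2 * b) * c\<^sup>2 + 1"] lim by (auto simp: dist_commute add_nonneg_pos)
qed

text \<open>Riemann's theorem on removable singularities, one puncture at a time. The extension
  agrees with \<open>f\<close> near the remaining punctures and inherits the limits there.\<close>

lemma holomorphic_extension_finite:
  assumes "finite P" "f holomorphic_on - P" "\<And>p. p \<in> P \<Longrightarrow> ((\<lambda>z. (z - p) * f z) \<longlongrightarrow> 0) (at p)"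
  obtains g where "g holomorphic_on UNIV" "\<And>z. z \<notin> P \<Longrightarrow> g z = f z"
proof -
  have "\<exists>g. g holomorphic_on UNIV \<and> (\<forall>z. z \<notin> P \<longrightarrow> g z = f z)"
    using assms
  proof (induction P arbitrary: f rule: finite_induct)
    case empty then show ?case by auto
  next
    case (insert p P)
    define S where "S = - P"
    have S: "open S" "p \<in> S" using insert by (auto simp: S_def finite_imp_closed)
    have "S - {p} = - insert p P" by (auto simp: S_def)
    then have hol: "f holomorphic_on S - {p}" using insert.prems(1) by simp
    then obtain g where g: "g holomorphic_on S" "\<And>z. z \<in> S - {p} \<Longrightarrow> g z = f z"
      using holomorphic_on_extend_lim[OF hol] insert.prems(2)[of p] S by (auto simp: interior_open)
    have "((\<lambda>z. (z - q) * g z) \<longlongrightarrow> 0) (at q)" if "q \<in> P" for q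
    proof -
      have "isCont (\<lambda>z. z) q" by simp
      have "open (- (insert p P - {q}))" using insert.hyps by (intro open_Compl finite_imp_closed) auto
      then have "\<forall>\<^sub>F z in at q. z \<in> - (insert p P - {q}) - {q}"
        by (rule eventually_at_in_open) (use that insert.hyps in auto)
      then have "\<forall>\<^sub>F z in at q. (z - q) * f z = (z - q) * g z"
        by eventually_elim (use g(2) in \<open>auto simp: S_def\<close>)
      then show ?thesis
        by (rule Lim_transform_eventually[OF insert.prems(2), rotated]) (use that in simp)
    qed
    then obtain h where "h holomorphic_on UNIV" "\<forall>z. z \<notin> P \<longrightarrow> h z = g z"
      using insert.IH[of g] g(1) by (auto simp: S_def)
    then show ?case using g(2) by (intro exI[of _ h]) (auto simp: S_def)
  qed
  then show ?thesis using that by blast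
qed

text \<open>At \<open>p i\<close> the remainder \<open>k\<close> times \<open>z - p i\<close> tends
  to \<open>\<beta> i - \<beta> i\<close>, the other fractions being continuous there. Hence
  \<open>k\<close> extends to an entire function, which has a primitive on the plane.\<close>

lemma partial_fractions_primitive:
  fixes p :: "nat \<Rightarrow> complex" and \<beta> :: "nat \<Rightarrow> real"
  assumes inj: "inj_on p {1..n}" and hol: "f holomorphic_on - p ` {1..n}"
    and res: "\<And>j. j \<in> {1..n} \<Longrightarrow> ((\<lambda>z. (z - p j) * f z) \<longlongrightarrow> of_real (\<beta> j)) (at (p j))"
  obtains H h where "\<And>z. (H has_field_derivative h z) (at z)"
    "\<And>z. z \<notin> p ` {1..n} \<Longrightarrow> f z = (\<Sum>j=1..n. of_real (\<beta> j) / (z - p j)) + h z"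
proof -
  define P where "P = p ` {1..n}"
  define k where "k z = f z - (\<Sum>j=1..n. of_real (\<beta> j) / (z - p j))" for z
  have holk: "k holomorphic_on - P"
    unfolding k_def using hol by (intro holomorphic_intros) (auto simp: P_def)
  have lim: "((\<lambda>z. (z - q) * k z) \<longlongrightarrow> 0) (at q)" if "q \<in> P" for q
  proof -
    obtain i where i: "i \<in> {1..n}" "q = p i" using \<open>q \<in> P\<close> by (auto simp: P_def)
    have ne: "p j \<noteq> p i" if "j \<in> {1..n} - {i}" for j
      using inj_on_eq_iff[OF inj, of j i] i(1) that by auto
    define s where "s z = (\<Sum>j\<in>{1..n} - {i}. of_real (\<beta> j) / (z - p j))" for z
    have "((\<lambda>z. (z - p i) * f z - of_real (\<beta> i) - (z - p i) * s z) \<longlongrightarrow>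
        of_real (\<beta> i) - of_real (\<beta> i) - (p i - p i) * s (p i)) (at (p i))"
      unfolding s_def by (intro tendsto_intros res[OF i(1)]) (use ne[symmetric] in auto)
    then have *: "((\<lambda>z. (z - p i) * f z - of_real (\<beta> i) - (z - p i) * s z) \<longlongrightarrow> 0) (at (p i))" by simp
    have "\<forall>\<^sub>F z in at (p i). (z - p i) * f z - of_real (\<beta> i) - (z - p i) * s z = (z - p i) * k z"
      unfolding eventually_at_filter
    proof (rule always_eventually, intro allI impI)
      fix z assume "z \<noteq> p i"
      then show "(z - p i) * f z - of_real (\<beta> i) - (z - p i) * s z = (z - p i) * k z"
      proof -
        have "(\<Sum>j=1..n. of_real (\<beta> j) / (z - p j)) = of_real (\<beta> i) / (z - p i) + s z"
          unfolding s_def by (rule sum.remove) (use i(1) in auto)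
        then have "(z - p i) * k z = (z - p i) * f z - ((z - p i) * (of_real (\<beta> i) / (z - p i)) + (z - p i) * s z)"
          by (simp only: k_def right_diff_distrib distrib_left)
        also have "(z - p i) * (of_real (\<beta> i) / (z - p i)) = of_real (\<beta> i)" using \<open>z \<noteq> p i\<close> by simp
        finally show ?thesis by simp
      qed
    qed
    then show ?thesis unfolding i(2) by (rule Lim_transform_eventually[OF *])
  qed
  obtain h where h: "h holomorphic_on UNIV" "\<And>z. z \<notin> P \<Longrightarrow> h z = k z"
    using holomorphic_extension_finite[OF _ holk lim] by (auto simp: P_def)
  obtain H where "\<And>z. z \<in> UNIV \<Longrightarrow> (H has_field_derivative h z) (at z)"
    using holomorphic_convex_primitive'[OF convex_UNIV open_UNIV h(1)] by auto
  then show ?thesis using that[of H h] h(2) by (simp add: k_def P_def)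
qed

section \<open>The flow equation in terms of the tangent\<close>

text \<open>Pairing the equation with \<open>N = \<i> * c' s0\<close> kills every tangential term.
  What remains is the conformal change of curvature: \<open>Im (c'' / c' s0)\<close> is the
  derivative of the tangent angle, and the \<open>log_gradient\<close> term is minus the derivative
  of \<open>u\<close> along \<open>N\<close>.\<close>

lemma flow_equation_normal_speed:
  assumes c: "\<And>s. s \<in> I \<Longrightarrow> (c has_vector_derivative c' s) (at s)" and I: "open I" "s0 \<in> I"
    and c'': "(c' has_vector_derivative c'') (at s0)" and nz: "c' s0 \<noteq> 0"
    and \<rho>: "\<rho> differentiable (at (c s0))" "\<rho> (c s0) > 0"
    and eq: "normal_part \<rho> c s0 V = geodesic_curvature_vector \<rho> c s0"
  shows "\<rho> (c s0) * Im (cnj (c' s0) * V) = Im (c'' / c' s0 + log_gradient \<rho> (c s0) * c' s0)"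
proof -
  define N where "N = \<i> * c' s0"
  define r where "r = \<rho> (c s0)"
  define G where "G = gradient \<rho> (c s0)"
  define e where "e s = 1 / sqrt (\<rho> (c s) * (c' s \<bullet> c' s))" for s
  have vd: "vector_derivative c (at s) = c' s" if "s \<in> I" for s
    using c[OF that] by (rule vector_derivative_at)
  have tan: "g_tangent \<rho> c s = e s *\<^sub>R c' s" if "s \<in> I" for s
    by (simp add: g_tangent_def g_norm_def g_inner_def vd[OF that] e_def)
  have cc: "c' s0 \<bullet> c' s0 > 0" using nz by simp
  have e2: "e s0 * e s0 = 1 / (r * (c' s0 \<bullet> c' s0))"
    using \<rho>(2) cc by (auto simp: e_def r_def)
  \<comment> \<open>Only the existence of the derivative \<open>e'\<close> matters: it multiplies
    \<open>c' s0\<close>, which is orthogonal to \<open>N\<close>.\<close>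
  have "e differentiable (at s0)"
  proof -
    have 1: "(\<lambda>s. \<rho> (c s)) differentiable (at s0)"
      using differentiable_chain_at[of c s0 \<rho>] c[OF I(2)] \<rho>(1) by (auto simp: o_def intro: differentiableI_vector)
    have 2: "c' differentiable (at s0)" using c'' by (rule differentiableI_vector)
    have 3: "(\<lambda>s. \<rho> (c s) * (c' s \<bullet> c' s)) differentiable (at s0)"
      by (intro differentiable_mult 1 differentiable_inner 2)
    have "sqrt differentiable (at (\<rho> (c s0) * (c' s0 \<bullet> c' s0)))"
      using DERIV_real_sqrt[of "\<rho> (c s0) * (c' s0 \<bullet> c' s0)"] \<rho>(2) cc unfolding real_differentiable_def
      by (metis mult_pos_pos)
    from differentiable_chain_at[OF 3 this]
    have "(\<lambda>s. sqrt (\<rho> (c s) * (c' s \<bullet> c' s))) differentiable (at s0)" by (simp add: o_def)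
    then show ?thesis unfolding e_def using \<rho>(2) cc by (intro differentiable_divide) auto
  qed
  then obtain e' where e': "(e has_vector_derivative e') (at s0)"
    by (auto simp: vector_derivative_works)
  have "((\<lambda>s. e s *\<^sub>R c' s) has_vector_derivative (e s0 *\<^sub>R c'' + e' *\<^sub>R c' s0)) (at s0)"
    using has_vector_derivative_scaleR[of e e' s0 UNIV c' c''] e' c''
    by (simp add: has_real_derivative_iff_has_vector_derivative)
  then have "(g_tangent \<rho> c has_vector_derivative (e s0 *\<^sub>R c'' + e' *\<^sub>R c' s0)) (at s0)"
    by (rule has_vector_derivative_transform_within_open[OF _ I]) (simp add: tan)
  then have vt: "vector_derivative (g_tangent \<rho> c) (at s0) = e s0 *\<^sub>R c'' + e' *\<^sub>R c' s0"
    by (rule vector_derivative_at)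
  have orth: "c' s0 \<bullet> N = 0" "(c' s0 * 2) \<bullet> N = 0" by (simp_all add: N_def inner_complex_def)
  have "normal_part \<rho> c s0 V \<bullet> N = V \<bullet> N"
    by (simp add: normal_part_def tan[OF I(2)] inner_diff_left orth)
  moreover have "geodesic_curvature_vector \<rho> c s0 \<bullet> N = e s0 * e s0 * (c'' \<bullet> N - (c' s0 \<bullet> c' s0) * (G \<bullet> N) / (2 * r))"
  proof -
    have g: "1 / g_norm \<rho> (c s0) (c' s0) = e s0" by (simp add: e_def g_norm_def g_inner_def)
    show ?thesis
      unfolding geodesic_curvature_vector_def cov_deriv_def vd[OF I(2)] g vt tan[OF I(2)] christoffel_def r_def[symmetric] G_def[symmetric]
      by (simp add: inner_add_left inner_diff_left orth algebra_simps)
  qed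
  ultimately have "V \<bullet> N = (c'' \<bullet> N) / (r * (c' s0 \<bullet> c' s0)) - (G \<bullet> N) / (2 * r) / r"
    using eq cc \<rho>(2) unfolding e2 by (simp add: diff_divide_distrib r_def)
  then have "r * (V \<bullet> N) = (c'' \<bullet> N) / (c' s0 \<bullet> c' s0) - (G \<bullet> N) / (2 * r)"
    using \<rho>(2) by (simp add: r_def right_diff_distrib)
  moreover have "V \<bullet> N = Im (cnj (c' s0) * V)" by (simp add: N_def inner_complex_def)
  moreover have "(c'' \<bullet> N) / (c' s0 \<bullet> c' s0) = Im (c'' / c' s0)"
    by (simp add: N_def inner_complex_def Im_divide power2_eq_square algebra_simps)
  moreover have "- (G \<bullet> N) / (2 * r) = Im (log_gradient \<rho> (c s0) * c' s0)"
    unfolding log_gradient_def G_def[symmetric] r_def[symmetric]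
    by (simp add: N_def inner_complex_def diff_divide_distrib add_divide_distrib algebra_simps)
  ultimately show ?thesis by (simp add: r_def)
qed

section \<open>Cutting off the singular points\<close>

text \<open>A one-dimensional Poisson kernel, up to normalisation.\<close>

definition layer_kernel :: "real \<Rightarrow> real \<Rightarrow> real \<Rightarrow> real" where
  "layer_kernel \<kappa> \<delta> x = \<delta> / (\<kappa>\<^sup>2 * x\<^sup>2 + \<delta>\<^sup>2)"

text \<open>The error of integrating by parts against a cut-off that switches on near
  \<open>a\<close>. It tends to 0 with \<open>\<delta>\<close> because the kernel concentrates at
  \<open>a\<close>, where \<open>W - W a\<close> vanishes.\<close>

definition layer :: "real \<Rightarrow> real \<Rightarrow> (real \<Rightarrow> real) \<Rightarrow> real \<Rightarrow> real \<Rightarrow> real" where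
  "layer \<kappa> \<delta> W a m = integral {a..m} (\<lambda>s. layer_kernel \<kappa> \<delta> (s - a) * \<bar>W s - W a\<bar>)"

lemma layer_kernel_pos: "\<delta> > 0 \<Longrightarrow> layer_kernel \<kappa> \<delta> x > 0"
  by (simp add: layer_kernel_def add_nonneg_pos)

lemma continuous_on_layer_kernel:
  assumes "\<delta> > 0"
  shows "continuous_on S (\<lambda>s. layer_kernel \<kappa> \<delta> (s - a))"
proof -
  have "\<kappa>\<^sup>2 * (s - a)\<^sup>2 + \<delta>\<^sup>2 \<noteq> 0" for s
    using assms by (metis add_nonneg_pos less_irrefl mult_nonneg_nonneg zero_le_power2 zero_less_power)
  then show ?thesis
    unfolding layer_kernel_def
    by (intro continuous_on_divide continuous_on_add continuous_on_mult continuous_on_power continuous_on_diff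
        continuous_on_const continuous_on_id ballI)
qed

text \<open>The antiderivative is \<open>arctan (\<kappa> * (s - a) / \<delta>) / \<kappa>\<close>;
  the bound does not involve \<open>\<delta>\<close>, so the mass stays bounded as the kernel
  concentrates.\<close>

lemma integral_layer_kernel_le:
  assumes "\<kappa> > 0" "\<delta> > 0" "a \<le> m"
  shows "integral {a..m} (\<lambda>s. layer_kernel \<kappa> \<delta> (s - a)) \<le> pi / (2 * \<kappa>)"
proof -
  have "((\<lambda>s. layer_kernel \<kappa> \<delta> (s - a)) has_integral (arctan (\<kappa> * (m - a) / \<delta>) / \<kappa> - arctan (\<kappa> * (a - a) / \<delta>) / \<kappa>)) {a..m}"
  proof (rule fundamental_theorem_of_calculus[OF assms(3)])
    fix s assume "s \<in> {a..m}"
    have "((\<lambda>s. arctan (\<kappa> * (s - a) / \<delta>) / \<kappa>) has_real_derivative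
        (inverse (1 + (\<kappa> * (s - a) / \<delta>)\<^sup>2) * (\<kappa> / \<delta>)) / \<kappa>) (at s within {a..m})"
      using assms by (auto intro!: derivative_eq_intros simp: divide_inverse)
    moreover have "(inverse (1 + (\<kappa> * (s - a) / \<delta>)\<^sup>2) * (\<kappa> / \<delta>)) / \<kappa> = layer_kernel \<kappa> \<delta> (s - a)"
    proof -
      have "1 + (\<kappa> * (s - a) / \<delta>)\<^sup>2 = (\<kappa>\<^sup>2 * (s - a)\<^sup>2 + \<delta>\<^sup>2) / \<delta>\<^sup>2"
        using assms(2) by (simp add: power_divide power_mult_distrib add_divide_distrib)
      then show ?thesis using assms by (simp add: layer_kernel_def power2_eq_square)
    qed
    ultimately show "((\<lambda>s. arctan (\<kappa> * (s - a) / \<delta>) / \<kappa>) has_vector_derivative layer_kernel \<kappa> \<delta> (s - a)) (at s within {a..m})"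
      by (simp add: has_real_derivative_iff_has_vector_derivative)
  qed
  then have "integral {a..m} (\<lambda>s. layer_kernel \<kappa> \<delta> (s - a)) = arctan (\<kappa> * (m - a) / \<delta>) / \<kappa>"
    by (simp add: integral_unique)
  also have "\<dots> \<le> (pi / 2) / \<kappa>"
    using arctan_ubound[of "\<kappa> * (m - a) / \<delta>"] assms(1) by (intro divide_right_mono) auto
  finally show ?thesis by simp
qed

lemma layer_bound:
  assumes "\<kappa> > 0" "\<delta> > 0" "a \<le> m" "continuous_on {a..m} W" "\<And>s. s \<in> {a..m} \<Longrightarrow> \<bar>W s\<bar> \<le> B"
  shows "layer \<kappa> \<delta> W a m \<le> 2 * B * (pi / (2 * \<kappa>))"
proof -
  have B: "B \<ge> 0" using assms(5)[of a] assms(3) by fastforce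
  have "layer \<kappa> \<delta> W a m \<le> integral {a..m} (\<lambda>s. 2 * B * layer_kernel \<kappa> \<delta> (s - a))"
    unfolding layer_def
  proof (rule integral_le)
    show "(\<lambda>s. layer_kernel \<kappa> \<delta> (s - a) * \<bar>W s - W a\<bar>) integrable_on {a..m}"
      by (intro integrable_continuous_interval continuous_on_mult continuous_on_layer_kernel assms continuous_on_rabs continuous_on_diff continuous_on_const)
    show "(\<lambda>s. 2 * B * layer_kernel \<kappa> \<delta> (s - a)) integrable_on {a..m}"
      by (intro integrable_continuous_interval continuous_on_mult continuous_on_layer_kernel assms continuous_on_const)
    fix s assume s: "s \<in> {a..m}"
    have "\<bar>W s - W a\<bar> \<le> 2 * B" using assms(5)[OF s] assms(5)[of a] assms(3) by auto
    from mult_left_mono[OF this less_imp_le[OF layer_kernel_pos[OF assms(2), of \<kappa> "s - a"]]]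
    show "layer_kernel \<kappa> \<delta> (s - a) * \<bar>W s - W a\<bar> \<le> 2 * B * layer_kernel \<kappa> \<delta> (s - a)" by (simp add: mult.commute)
  qed
  also have "\<dots> = 2 * B * integral {a..m} (\<lambda>s. layer_kernel \<kappa> \<delta> (s - a))" by (rule integral_mult_right)
  also have "\<dots> \<le> 2 * B * (pi / (2 * \<kappa>))"
    using integral_layer_kernel_le[OF assms(1-3)] B by (intro mult_left_mono) auto
  finally show ?thesis .
qed

text \<open>Within distance \<open>d\<close> of \<open>a\<close> the oscillation of \<open>W\<close>
  is small and the kernel has bounded mass; farther away the kernel is at most
  \<open>\<delta> / (\<kappa>\<^sup>2 * d\<^sup>2)\<close>.\<close>

lemma layer_limit:
  assumes \<kappa>: "\<kappa> > 0" and \<delta>: "\<And>k. \<delta> k > 0" "\<delta> \<longlonglongrightarrow> 0" and am: "a \<le> m" and W: "continuous_on {a..m} W"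
  shows "(\<lambda>k. layer \<kappa> (\<delta> k) W a m) \<longlonglongrightarrow> 0"
proof (rule LIMSEQ_I)
  fix e :: real assume e: "e > 0"
  obtain B where B: "B > 0" "\<And>s. s \<in> {a..m} \<Longrightarrow> \<bar>W s\<bar> \<le> B"
  proof -
    have "bounded (W ` {a..m})" by (intro compact_imp_bounded compact_continuous_image W) auto
    then show ?thesis using that unfolding bounded_pos by auto
  qed
  \<comment> \<open>Against the mass bound \<open>pi / (2 * \<kappa>)\<close> this gives
    \<open>e / 2\<close>.\<close>
  define \<eta> where "\<eta> = e * \<kappa> / pi"
  have \<eta>: "\<eta> > 0" using e \<kappa> by (simp add: \<eta>_def)
  obtain d where d: "d > 0" "\<And>s. s \<in> {a..m} \<Longrightarrow> dist s a < d \<Longrightarrow> dist (W s) (W a) < \<eta>"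
    using W[unfolded continuous_on_iff, rule_format, of a \<eta>] am \<eta> by auto
  define c where "c = 2 * B * (m - a) / (\<kappa>\<^sup>2 * d\<^sup>2)"
  have bound: "layer \<kappa> x W a m \<le> e / 2 + c * x" if x: "x > 0" for x
  proof -
    have "layer \<kappa> x W a m \<le> integral {a..m} (\<lambda>s. \<eta> * layer_kernel \<kappa> x (s - a) + 2 * B * (x / (\<kappa>\<^sup>2 * d\<^sup>2)))"
      unfolding layer_def
    proof (rule integral_le)
      show "(\<lambda>s. layer_kernel \<kappa> x (s - a) * \<bar>W s - W a\<bar>) integrable_on {a..m}"
        by (intro integrable_continuous_interval continuous_on_mult continuous_on_layer_kernel x W continuous_on_rabs continuous_on_diff continuous_on_const)
      show "(\<lambda>s. \<eta> * layer_kernel \<kappa> x (s - a) + 2 * B * (x / (\<kappa>\<^sup>2 * d\<^sup>2))) integrable_on {a..m}"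
        by (intro integrable_continuous_interval continuous_on_add continuous_on_mult continuous_on_layer_kernel x continuous_on_const)
      fix s assume s: "s \<in> {a..m}"
      have k0: "layer_kernel \<kappa> x (s - a) > 0" by (rule layer_kernel_pos[OF x])
      have r0: "0 \<le> 2 * B * (x / (\<kappa>\<^sup>2 * d\<^sup>2))" using B x by simp
      show "layer_kernel \<kappa> x (s - a) * \<bar>W s - W a\<bar> \<le> \<eta> * layer_kernel \<kappa> x (s - a) + 2 * B * (x / (\<kappa>\<^sup>2 * d\<^sup>2))"
      proof (cases "dist s a < d")
        case True
        then have "\<bar>W s - W a\<bar> \<le> \<eta>" using d(2)[OF s True] by (simp add: dist_real_def)
        then have "layer_kernel \<kappa> x (s - a) * \<bar>W s - W a\<bar> \<le> layer_kernel \<kappa> x (s - a) * \<eta>"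
          using k0 by (intro mult_left_mono) auto
        then show ?thesis using r0 by (simp add: mult.commute)
      next
        case False
        then have "d \<le> s - a" using s by (simp add: dist_real_def)
        then have "\<kappa>\<^sup>2 * d\<^sup>2 \<le> \<kappa>\<^sup>2 * (s - a)\<^sup>2" using d(1) by (intro mult_left_mono power_mono) auto
        then have "\<kappa>\<^sup>2 * d\<^sup>2 \<le> \<kappa>\<^sup>2 * (s - a)\<^sup>2 + x\<^sup>2" by (simp add: add_increasing2)
        then have "layer_kernel \<kappa> x (s - a) \<le> x / (\<kappa>\<^sup>2 * d\<^sup>2)"
          unfolding layer_kernel_def using \<kappa> d(1) x by (intro divide_left_mono) (auto simp: add_nonneg_pos)
        moreover have "\<bar>W s - W a\<bar> \<le> 2 * B" using B(2)[OF s] B(2)[of a] am by auto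
        ultimately have "layer_kernel \<kappa> x (s - a) * \<bar>W s - W a\<bar> \<le> x / (\<kappa>\<^sup>2 * d\<^sup>2) * (2 * B)"
          using k0 x by (intro mult_mono) auto
        moreover have "0 \<le> \<eta> * layer_kernel \<kappa> x (s - a)" using \<eta> k0 by simp
        ultimately show ?thesis by (simp add: mult.commute)
      qed
    qed
    also have "\<dots> = \<eta> * integral {a..m} (\<lambda>s. layer_kernel \<kappa> x (s - a)) + 2 * B * (x / (\<kappa>\<^sup>2 * d\<^sup>2)) * (m - a)"
      using am
      by (subst integral_add)
         (auto intro!: integrable_continuous_interval continuous_on_mult continuous_on_layer_kernel x continuous_on_const)
    also have "\<dots> \<le> \<eta> * (pi / (2 * \<kappa>)) + 2 * B * (x / (\<kappa>\<^sup>2 * d\<^sup>2)) * (m - a)"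
      using integral_layer_kernel_le[OF \<kappa> x am] \<eta> by (intro add_right_mono mult_left_mono) auto
    also have "\<dots> = e / 2 + c * x" using \<kappa> by (simp add: \<eta>_def c_def)
    finally show ?thesis .
  qed
  have "(\<lambda>k. e / 2 + c * \<delta> k) \<longlonglongrightarrow> e / 2 + c * 0" by (intro tendsto_intros \<delta>)
  from order_tendstoD(2)[OF this, of e] e
  obtain N where N: "\<And>k. k \<ge> N \<Longrightarrow> e / 2 + c * \<delta> k < e" by (auto simp: eventually_sequentially)
  have nn: "layer \<kappa> (\<delta> k) W a m \<ge> 0" for k
    unfolding layer_def
    by (intro integral_nonneg integrable_continuous_interval continuous_on_mult continuous_on_layer_kernel \<delta> W continuous_on_rabs continuous_on_diff continuous_on_const)
       (simp add: less_imp_le layer_kernel_pos \<delta>)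
  show "\<exists>N. \<forall>k\<ge>N. norm (layer \<kappa> (\<delta> k) W a m - 0) < e"
  proof (intro exI allI impI)
    fix k assume "k \<ge> N"
    from bound[OF \<delta>(1), of k] N[OF this] nn[of k]
    show "norm (layer \<kappa> (\<delta> k) W a m - 0) < e" by simp
  qed
qed

text \<open>Integration by parts against a cut-off \<open>c\<close> whose derivative concentrates at \<open>a\<close>: only the
  continuity of \<open>W\<close> at \<open>a\<close> is needed, not the integrability of \<open>W'\<close>.\<close>

lemma cutoff_by_parts:
  fixes W c :: "real \<Rightarrow> real"
  assumes am: "a < m" and \<delta>: "\<delta> > 0" and W: "continuous_on {a..m} W" and c: "continuous_on {a..m} c"
    and dW: "\<And>s. s \<in> {a<..<m} \<Longrightarrow> (W has_real_derivative W' s) (at s)"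
    and dc: "\<And>s. s \<in> {a<..<m} \<Longrightarrow> \<exists>c'. (c has_real_derivative c') (at s) \<and> \<bar>c'\<bar> \<le> K * layer_kernel \<kappa> \<delta> (s - a)"
    and int: "(\<lambda>s. c s * W' s) integrable_on {a..m}"
  shows "\<bar>integral {a..m} (\<lambda>s. c s * W' s) - c m * (W m - W a)\<bar> \<le> K * layer \<kappa> \<delta> W a m"
proof -
  obtain c' where c': "\<And>s. s \<in> {a<..<m} \<Longrightarrow> (c has_real_derivative c' s) (at s)"
    "\<And>s. s \<in> {a<..<m} \<Longrightarrow> \<bar>c' s\<bar> \<le> K * layer_kernel \<kappa> \<delta> (s - a)"
    using dc by metis
  define d where "d s = (if s \<in> {a<..<m} then c' s * (W s - W a) else 0)" for s
  \<comment> \<open>Subtracting \<open>W a\<close> removes the boundary term at \<open>a\<close>. At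
    the end points, where no derivatives are given, the \<open>if\<close> supplies the value that
    makes \<open>d\<close> vanish there.\<close>
  have FTC: "((\<lambda>s. if s \<in> {a<..<m} then c' s * (W s - W a) + c s * W' s else c s * W' s) has_integral (c m * (W m - W a) - c a * (W a - W a))) {a..m}"
  proof (rule fundamental_theorem_of_calculus_interior)
    show "continuous_on {a..m} (\<lambda>s. c s * (W s - W a))"
      by (intro continuous_on_mult c continuous_on_diff W continuous_on_const)
    fix s assume s: "s \<in> {a<..<m}"
    have "((\<lambda>s. c s * (W s - W a)) has_real_derivative c' s * (W s - W a) + c s * W' s) (at s)"
      using DERIV_mult[OF c'(1)[OF s] DERIV_diff[OF dW[OF s] DERIV_const[of "W a"]]] by (simp add: algebra_simps)
    then show "((\<lambda>s. c s * (W s - W a)) has_vector_derivative (if s \<in> {a<..<m} then c' s * (W s - W a) + c s * W' s else c s * W' s)) (at s)"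
      using s by (simp add: has_real_derivative_iff_has_vector_derivative)
  qed (use am in simp)
  \<comment> \<open>\<open>c'\<close> carries only a pointwise bound, so the integrability of
    \<open>d\<close> is read off from this difference.\<close>
  have "(d has_integral (c m * (W m - W a) - c a * (W a - W a) - integral {a..m} (\<lambda>s. c s * W' s))) {a..m}"
    using has_integral_diff[OF FTC integrable_integral[OF int]]
    by (rule has_integral_eq[rotated]) (simp add: d_def)
  then have id: "integral {a..m} d = c m * (W m - W a) - integral {a..m} (\<lambda>s. c s * W' s)" "d integrable_on {a..m}"
    by (auto simp: integral_unique integrable_on_def)
  have "norm (integral {a..m} d) \<le> integral {a..m} (\<lambda>s. K * (layer_kernel \<kappa> \<delta> (s - a) * \<bar>W s - W a\<bar>))"
  proof (rule integral_norm_bound_integral[OF id(2)])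
    show "(\<lambda>s. K * (layer_kernel \<kappa> \<delta> (s - a) * \<bar>W s - W a\<bar>)) integrable_on {a..m}"
      by (intro integrable_continuous_interval continuous_on_mult continuous_on_layer_kernel \<delta> W continuous_on_rabs continuous_on_diff continuous_on_const)
    fix s assume "s \<in> {a..m}"
    have K: "K \<ge> 0"
    proof -
      have "(a + m) / 2 \<in> {a<..<m}" using am by simp
      from c'(2)[OF this] have "0 \<le> K * layer_kernel \<kappa> \<delta> ((a + m) / 2 - a)" by linarith
      then show ?thesis using layer_kernel_pos[OF \<delta>] by (simp add: zero_le_mult_iff not_less less_le_not_le)
    qed
    show "norm (d s) \<le> K * (layer_kernel \<kappa> \<delta> (s - a) * \<bar>W s - W a\<bar>)"
    proof (cases "s \<in> {a<..<m}")
      case True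
      then show ?thesis using mult_right_mono[OF c'(2)[OF True], of "\<bar>W s - W a\<bar>"] by (simp add: d_def abs_mult mult.assoc)
    next
      case False
      have "0 \<le> layer_kernel \<kappa> \<delta> (s - a) * \<bar>W s - W a\<bar>" using layer_kernel_pos[OF \<delta>, of \<kappa> "s - a"] by simp
      then show ?thesis using False K by (simp only: d_def if_False norm_zero mult_nonneg_nonneg)
    qed
  qed
  also have "\<dots> = K * layer \<kappa> \<delta> W a m" unfolding layer_def by (rule integral_mult_right)
  finally show ?thesis unfolding id(1) by (simp add: abs_minus_commute)
qed

text \<open>The right half becomes a left half under the reflection of \<open>s\<close> to
  \<open>- s\<close>. The halves are joined at \<open>m\<close>, and the common factor
  \<open>c m\<close> multiplies the full increment of \<open>W\<close>.\<close>

lemma cutoff_by_parts_two_sided: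
  fixes W c :: "real \<Rightarrow> real"
  assumes amb: "a < m" "m < b" and \<delta>: "\<delta> > 0" and W: "continuous_on {a..b} W" and c: "continuous_on {a..b} c"
    and dW: "\<And>s. s \<in> {a<..<b} \<Longrightarrow> (W has_real_derivative W' s) (at s)"
    and dca: "\<And>s. s \<in> {a<..<m} \<Longrightarrow> \<exists>c'. (c has_real_derivative c') (at s) \<and> \<bar>c'\<bar> \<le> K * layer_kernel \<kappa> \<delta> (s - a)"
    and dcb: "\<And>s. s \<in> {m<..<b} \<Longrightarrow> \<exists>c'. (c has_real_derivative c') (at s) \<and> \<bar>c'\<bar> \<le> K * layer_kernel \<kappa> \<delta> (b - s)"
    and int: "(\<lambda>s. c s * W' s) integrable_on {a..b}"
  shows "\<bar>integral {a..b} (\<lambda>s. c s * W' s) - c m * (W b - W a)\<bar>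
    \<le> K * (layer \<kappa> \<delta> W a m + layer \<kappa> \<delta> (\<lambda>s. W (- s)) (- b) (- m))"
proof -
  have intl: "(\<lambda>s. c s * W' s) integrable_on {a..m}" and intr: "(\<lambda>s. c s * W' s) integrable_on {m..b}"
    using integrable_on_subinterval[OF int] amb by auto
  have L: "\<bar>integral {a..m} (\<lambda>s. c s * W' s) - c m * (W m - W a)\<bar> \<le> K * layer \<kappa> \<delta> W a m"
    by (rule cutoff_by_parts[OF amb(1) \<delta> continuous_on_subset[OF W] continuous_on_subset[OF c] dW dca intl])
       (use amb in auto)
  have refl: "continuous_on {- b..- m} (\<lambda>s. f (- s))" if "continuous_on {a..b} f" for f :: "real \<Rightarrow> real"
    by (rule continuous_on_compose2[OF that]) (use amb in \<open>auto intro!: continuous_intros\<close>)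
  have drefl: "((\<lambda>s. f (- s)) has_real_derivative - f') (at s)" if "(f has_real_derivative f') (at (- s))" for f f' s
    using DERIV_chain2[OF that DERIV_minus[OF DERIV_ident]] by simp
  have eqr: "integral {- b..- m} (\<lambda>s. c (- s) * (- W' (- s))) = - integral {m..b} (\<lambda>s. c s * W' s)"
    using Henstock_Kurzweil_Integration.integral_reflect_real[of b m "\<lambda>s. c s * W' s"] by simp
  have "\<bar>integral {- b..- m} (\<lambda>s. c (- s) * (- W' (- s))) - c (- (- m)) * (W (- (- m)) - W (- (- b)))\<bar>
      \<le> K * layer \<kappa> \<delta> (\<lambda>s. W (- s)) (- b) (- m)"
  proof (rule cutoff_by_parts[OF _ \<delta> refl[OF W] refl[OF c]])
    show "- b < - m" using amb by simp
    show "((\<lambda>s. W (- s)) has_real_derivative - W' (- s)) (at s)" if "s \<in> {- b<..<- m}" for s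
      by (rule drefl[OF dW]) (use that amb in auto)
    show "\<exists>c'. ((\<lambda>s. c (- s)) has_real_derivative c') (at s) \<and> \<bar>c'\<bar> \<le> K * layer_kernel \<kappa> \<delta> (s - - b)"
      if "s \<in> {- b<..<- m}" for s
    proof -
      obtain c' where "(c has_real_derivative c') (at (- s))" "\<bar>c'\<bar> \<le> K * layer_kernel \<kappa> \<delta> (b - - s)"
        using dcb[of "- s"] \<open>s \<in> _\<close> by auto
      with drefl[OF this(1)] show ?thesis by (intro exI[of _ "- c'"]) (simp add: add.commute)
    qed
    show "(\<lambda>s. c (- s) * (- W' (- s))) integrable_on {- b..- m}"
      using integrable_neg[OF Henstock_Kurzweil_Integration.integrable_reflect_real[THEN iffD2, OF intr]] by simp
  qed
  then have R: "\<bar>- integral {m..b} (\<lambda>s. c s * W' s) - c m * (W m - W b)\<bar> \<le> K * layer \<kappa> \<delta> (\<lambda>s. W (- s)) (- b) (- m)"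
    unfolding eqr by simp
  have "integral {a..b} (\<lambda>s. c s * W' s) = integral {a..m} (\<lambda>s. c s * W' s) + integral {m..b} (\<lambda>s. c s * W' s)"
    by (rule Henstock_Kurzweil_Integration.integral_combine[symmetric]) (use amb int in auto)
  then have "integral {a..b} (\<lambda>s. c s * W' s) - c m * (W b - W a) =
      (integral {a..m} (\<lambda>s. c s * W' s) - c m * (W m - W a)) - (- integral {m..b} (\<lambda>s. c s * W' s) - c m * (W m - W b))"
    by (simp add: algebra_simps)
  with L R show ?thesis unfolding distrib_left by linarith
qed

text \<open>Every factor vanishes to second order at its point, enough against a density growing
  like a power with exponent above -2. Along a curve leaving \<open>q\<close> at a linear rate, the
  derivative of the factor is bounded by a multiple of \<open>layer_kernel\<close>.\<close>

definition cutoff :: "complex set \<Rightarrow> real \<Rightarrow> complex \<Rightarrow> real" where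
  "cutoff P \<delta> z = (\<Prod>q\<in>P. (norm (z - q))\<^sup>2 / ((norm (z - q))\<^sup>2 + \<delta>\<^sup>2))"

lemma cutoff_factor_bounds:
  assumes "\<delta> > 0"
  shows "0 \<le> (norm (z - q :: complex))\<^sup>2 / ((norm (z - q))\<^sup>2 + \<delta>\<^sup>2)" "(norm (z - q))\<^sup>2 / ((norm (z - q))\<^sup>2 + \<delta>\<^sup>2) \<le> 1"
  using denominator_pos[OF assms, of "z - q"] by (auto simp: divide_le_eq_1)

lemma cutoff_bounds: "\<delta> > 0 \<Longrightarrow> 0 \<le> cutoff P \<delta> z" "\<delta> > 0 \<Longrightarrow> cutoff P \<delta> z \<le> 1"
  unfolding cutoff_def using cutoff_factor_bounds by (auto intro: prod_nonneg prod_le_1)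

lemma continuous_on_cutoff: "\<delta> > 0 \<Longrightarrow> continuous_on S g \<Longrightarrow> continuous_on S (\<lambda>x. cutoff P \<delta> (g x))"
  unfolding cutoff_def
  by (intro continuous_on_prod continuous_on_divide continuous_on_power continuous_on_norm continuous_on_diff
      continuous_on_const continuous_on_add ballI) (use denominator_pos less_imp_neq in metis)+

lemma cutoff_zero: "finite P \<Longrightarrow> z \<in> P \<Longrightarrow> cutoff P \<delta> z = 0"
  unfolding cutoff_def by (rule prod_zero) auto

lemma cutoff_limit:
  assumes "z \<notin> P" "\<delta> \<longlonglongrightarrow> 0"
  shows "(\<lambda>k. cutoff P (\<delta> k) z) \<longlonglongrightarrow> 1"
proof -
  have "(\<lambda>k. cutoff P (\<delta> k) z) \<longlonglongrightarrow> (\<Prod>q\<in>P. (norm (z - q))\<^sup>2 / ((norm (z - q))\<^sup>2 + 0\<^sup>2))"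
    unfolding cutoff_def by (intro tendsto_prod tendsto_intros assms(2)) (use assms(1) in auto)
  also have "(\<Prod>q\<in>P. (norm (z - q))\<^sup>2 / ((norm (z - q))\<^sup>2 + 0\<^sup>2)) = 1"
    using assms(1) by (intro prod.neutral) auto
  finally show ?thesis .
qed

text \<open>With \<open>n = norm (g s - q)\<close> the derivative of \<open>n\<^sup>2\<close> is at
  most \<open>2 * n * norm g'\<close>, so that of one factor is at most \<open>\<delta>\<^sup>2 * 2
  * n * norm g' / (n\<^sup>2 + \<delta>\<^sup>2)\<^sup>2\<close>; the inequality
  \<open>2 * n * \<delta> \<le> n\<^sup>2 + \<delta>\<^sup>2\<close> cancels one power of the
  denominator.\<close>

lemma cutoff_derivative_along_curve:
  assumes "finite P" and \<delta>: "\<delta> > 0" and g: "(g has_vector_derivative g') (at s)"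
  shows "\<exists>X. ((\<lambda>s. cutoff P \<delta> (g s)) has_real_derivative X) (at s) \<and>
    \<bar>X\<bar> \<le> (\<Sum>q\<in>P. norm g' * (\<delta> / ((norm (g s - q))\<^sup>2 + \<delta>\<^sup>2)))"
proof -
  define y where "y q s = (norm (g s - q))\<^sup>2" for q s
  define y' where "y' q = 2 * ((g s - q) \<bullet> g')" for q
  have pos: "y q s + \<delta>\<^sup>2 > 0" for q s using denominator_pos[OF \<delta>] by (simp add: y_def)
  have dy: "(y q has_real_derivative y' q) (at s)" for q
  proof -
    have g1: "((\<lambda>s. g s - q) has_vector_derivative g') (at s)"
      using has_vector_derivative_diff[OF g has_vector_derivative_const] by simp
    from bounded_bilinear.has_vector_derivative[OF bounded_bilinear_inner g1 g1]
    have "((\<lambda>s. (g s - q) \<bullet> (g s - q)) has_vector_derivative ((g s - q) \<bullet> g' + g' \<bullet> (g s - q))) (at s)" .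
    then show ?thesis
      unfolding y_def y'_def power2_norm_eq_inner has_real_derivative_iff_has_vector_derivative
      by (simp add: inner_commute)
  qed
  define u where "u q s = y q s / (y q s + \<delta>\<^sup>2)" for q s
  define u' where "u' q = \<delta>\<^sup>2 * y' q / (y q s + \<delta>\<^sup>2)\<^sup>2" for q
  have du: "(u q has_real_derivative u' q) (at s)" for q
  proof -
    have "((\<lambda>s. y q s / (y q s + \<delta>\<^sup>2)) has_real_derivative (y' q * (y q s + \<delta>\<^sup>2) - y q s * (y' q + 0)) / ((y q s + \<delta>\<^sup>2) * (y q s + \<delta>\<^sup>2))) (at s)"
      by (intro DERIV_divide DERIV_add dy DERIV_const) (use pos in \<open>auto simp: less_imp_neq[symmetric]\<close>)
    then show ?thesis unfolding u_def[abs_def] u'_def by (simp add: power2_eq_square algebra_simps)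
  qed
  have u01: "0 \<le> u q s" "u q s \<le> 1" for q s
    unfolding u_def y_def using cutoff_factor_bounds[OF \<delta>] by auto
  have u'_le: "\<bar>u' q\<bar> \<le> norm g' * (\<delta> / (y q s + \<delta>\<^sup>2))" for q
  proof -
    define n where "n = norm (g s - q)"
    have p: "n\<^sup>2 + \<delta>\<^sup>2 > 0" using pos[of q s] by (simp add: y_def n_def)
    have "\<bar>y' q\<bar> \<le> 2 * (n * norm g')"
      unfolding y'_def n_def using Cauchy_Schwarz_ineq2[of "g s - q" g'] by simp
    then have "\<delta>\<^sup>2 * \<bar>y' q\<bar> \<le> \<delta>\<^sup>2 * (2 * (n * norm g'))" by (intro mult_left_mono) auto
    also have "\<dots> = (\<delta> * norm g') * (2 * n * \<delta>)" by (simp add: power2_eq_square)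
    also have "\<dots> \<le> (\<delta> * norm g') * (n\<^sup>2 + \<delta>\<^sup>2)"
      using sum_squares_bound[of n \<delta>] \<delta> by (intro mult_left_mono) auto
    finally have "\<delta>\<^sup>2 * \<bar>y' q\<bar> / (n\<^sup>2 + \<delta>\<^sup>2)\<^sup>2 \<le> (\<delta> * norm g') * (n\<^sup>2 + \<delta>\<^sup>2) / (n\<^sup>2 + \<delta>\<^sup>2)\<^sup>2"
      by (rule divide_right_mono) simp
    also have "\<dots> = norm g' * (\<delta> / (n\<^sup>2 + \<delta>\<^sup>2))" using p by (simp add: power2_eq_square)
    finally show ?thesis by (simp add: u'_def y_def n_def abs_mult)
  qed
  have "((\<lambda>s. \<Prod>q\<in>P. u q s) has_real_derivative (\<Sum>q\<in>P. u' q * (\<Prod>p\<in>P - {q}. u p s))) (at s)"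
  proof -
    have "((\<lambda>s. \<Prod>q\<in>P. u q s) has_derivative (\<lambda>h. \<Sum>q\<in>P. (u' q * h) * (\<Prod>p\<in>P - {q}. u p s))) (at s)"
      by (rule has_derivative_prod) (use du in \<open>simp add: has_field_derivative_def\<close>)
    then show ?thesis
      unfolding has_field_derivative_def
      by (rule has_derivative_eq_rhs) (rule ext, simp add: sum_distrib_left mult_ac)
  qed
  moreover have "\<bar>\<Sum>q\<in>P. u' q * (\<Prod>p\<in>P - {q}. u p s)\<bar> \<le> (\<Sum>q\<in>P. norm g' * (\<delta> / (y q s + \<delta>\<^sup>2)))"
  proof (rule order_trans[OF sum_abs sum_mono])
    fix q
    have "0 \<le> (\<Prod>p\<in>P - {q}. u p s)" "(\<Prod>p\<in>P - {q}. u p s) \<le> 1"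
      using u01 by (auto intro: prod_nonneg prod_le_1)
    then have "\<bar>u' q * (\<Prod>p\<in>P - {q}. u p s)\<bar> \<le> \<bar>u' q\<bar>"
      by (simp add: abs_mult mult_left_le)
    also note u'_le
    finally show "\<bar>u' q * (\<Prod>p\<in>P - {q}. u p s)\<bar> \<le> norm g' * (\<delta> / (y q s + \<delta>\<^sup>2))" .
  qed
  ultimately show ?thesis unfolding cutoff_def u_def y_def by blast
qed

text \<open>If \<open>g\<close> vanishes at \<open>c\<close>, the divided difference is zero-free on
  the compact rectangle, by the tangent at \<open>c\<close> and by \<open>nz\<close> elsewhere, and
  its least modulus is \<open>\<kappa>\<close>. If \<open>g\<close> has no zero at \<open>c\<close>,
  its least modulus divided by the length of the interval will do.\<close>

lemma linear_lower_bound: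
  fixes g :: "real \<Rightarrow> real \<Rightarrow> complex"
  assumes xy: "x < y" and T: "0 < T" and c: "c \<in> {x..y}"
    and cont: "continuous_on ({x..y} \<times> {0..T}) (\<lambda>z. g (fst z) (snd z))"
    and D: "continuous_on ({x..y} \<times> {0..T}) D"
    and der: "\<And>s t. s \<in> {x..y} \<Longrightarrow> t \<in> {0..T} \<Longrightarrow> ((\<lambda>s. g s t) has_vector_derivative D (s, t)) (at s within {x..y})"
    and nzD: "\<And>t. t \<in> {0..T} \<Longrightarrow> D (c, t) \<noteq> 0"
    and ends: "(\<forall>t\<in>{0..T}. g c t = 0) \<or> (\<forall>t\<in>{0..T}. g c t \<noteq> 0)"
    and nz: "\<And>s t. s \<in> {x..y} \<Longrightarrow> s \<noteq> c \<Longrightarrow> t \<in> {0..T} \<Longrightarrow> g s t \<noteq> 0"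
  obtains \<kappa> where "\<kappa> > 0" "\<And>s t. s \<in> {x..y} \<Longrightarrow> t \<in> {0..T} \<Longrightarrow> \<kappa> * \<bar>s - c\<bar> \<le> norm (g s t)"
proof -
  define R where "R = {x..y} \<times> {0..T}"
  have R: "compact R" "R \<noteq> {}" using xy T by (auto simp: R_def compact_Times)
  from ends show ?thesis
  proof
    assume z: "\<forall>t\<in>{0..T}. g c t = 0"
    obtain Q where Q: "continuous_on ({x..y} \<times> {0..T}) Q"
      "\<And>s t. s \<in> {x..y} \<Longrightarrow> t \<in> {0..T} \<Longrightarrow> g s t - g c t = of_real (s - c) * Q (s, t)"
      "\<And>t. t \<in> {0..T} \<Longrightarrow> Q (c, t) = D (c, t)"
      using divided_difference_param[OF D der c] by blast
    have eq: "g s t = of_real (s - c) * Q (s, t)" if "s \<in> {x..y}" "t \<in> {0..T}" for s t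
      using Q(2)[OF that] z that by simp
    have "continuous_on R (\<lambda>z. norm (Q z))" unfolding R_def by (intro continuous_on_norm Q(1))
    then obtain z0 where z0: "z0 \<in> R" "\<And>z. z \<in> R \<Longrightarrow> norm (Q z0) \<le> norm (Q z)"
      using continuous_attains_inf[OF R] by blast
    have "Q z0 \<noteq> 0"
    proof -
      obtain s t where st: "z0 = (s, t)" "s \<in> {x..y}" "t \<in> {0..T}" using z0(1) by (auto simp: R_def)
      show ?thesis
      proof (cases "s = c")
        case True then show ?thesis using Q(3)[OF st(3)] nzD[OF st(3)] st(1) by simp
      next
        case False then show ?thesis using eq[OF st(2,3)] nz[OF st(2) False st(3)] st(1) by auto
      qed
    qed
    moreover have "norm (Q z0) * \<bar>s - c\<bar> \<le> norm (g s t)" if "s \<in> {x..y}" "t \<in> {0..T}" for s t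
    proof -
      have "norm (g s t) = \<bar>s - c\<bar> * norm (Q (s, t))" unfolding eq[OF that] norm_mult norm_of_real ..
      then show ?thesis using mult_left_mono[OF z0(2)[of "(s, t)"], of "\<bar>s - c\<bar>"] that by (simp add: R_def mult.commute)
    qed
    ultimately show ?thesis using that[of "norm (Q z0)"] by simp
  next
    assume n: "\<forall>t\<in>{0..T}. g c t \<noteq> 0"
    have "continuous_on R (\<lambda>z. norm (g (fst z) (snd z)))" unfolding R_def by (intro continuous_on_norm cont)
    then obtain z0 where z0: "z0 \<in> R" "\<And>z. z \<in> R \<Longrightarrow> norm (g (fst z0) (snd z0)) \<le> norm (g (fst z) (snd z))"
      using continuous_attains_inf[OF R] by blast
    define \<mu> where "\<mu> = norm (g (fst z0) (snd z0))"
    have "\<mu> > 0"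
      using z0(1) n nz[of "fst z0" "snd z0"] by (cases "fst z0 = c") (auto simp: R_def \<mu>_def)
    moreover have "\<mu> / (y - x) * \<bar>s - c\<bar> \<le> norm (g s t)" if "s \<in> {x..y}" "t \<in> {0..T}" for s t
    proof -
      have "\<bar>s - c\<bar> \<le> y - x" using that(1) c by auto
      then have "\<mu> / (y - x) * \<bar>s - c\<bar> \<le> \<mu> / (y - x) * (y - x)"
        using \<open>\<mu> > 0\<close> xy by (intro mult_left_mono) auto
      also have "\<dots> = \<mu>" using xy by simp
      also have "\<mu> \<le> norm (g s t)" using z0(2)[of "(s, t)"] that by (simp add: R_def \<mu>_def)
      finally show ?thesis .
    qed
    ultimately show ?thesis using that[of "\<mu> / (y - x)"] xy by simp
  qed
qed

text \<open>By \<open>ends\<close>, a break point either stays at \<open>q\<close> for all times or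
  never meets it. This is the alternative of \<open>linear_lower_bound\<close>, and it gives one
  constant for all times.\<close>

locale singular_flow = piecewise_flow +
  fixes P :: "complex set"
  assumes finite_P: "finite P"
    and off: "\<And>i s t. i < r \<Longrightarrow> s \<in> {b i<..<b (Suc i)} \<Longrightarrow> t \<in> {0..T} \<Longrightarrow> \<Gamma> s t \<notin> P"
    and ends: "\<And>i q. i \<le> r \<Longrightarrow> q \<in> P \<Longrightarrow> (\<forall>t\<in>{0..T}. \<Gamma> (b i) t = q) \<or> (\<forall>t\<in>{0..T}. \<Gamma> (b i) t \<noteq> q)"
begin

definition mid :: "nat \<Rightarrow> real" where "mid i = (b i + b (Suc i)) / 2"

lemma mid: "i < r \<Longrightarrow> b i < mid i" "i < r \<Longrightarrow> mid i < b (Suc i)"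
  using b_less[of i] by (auto simp: mid_def)

lemma distance_lower_bound:
  assumes i: "i < r"
  obtains \<kappa> where "\<kappa> > 0"
    "\<And>q s t. q \<in> P \<Longrightarrow> s \<in> {b i..mid i} \<Longrightarrow> t \<in> {0..T} \<Longrightarrow> \<kappa> * (s - b i) \<le> norm (\<Gamma> s t - q)"
    "\<And>q s t. q \<in> P \<Longrightarrow> s \<in> {mid i..b (Suc i)} \<Longrightarrow> t \<in> {0..T} \<Longrightarrow> \<kappa> * (b (Suc i) - s) \<le> norm (\<Gamma> s t - q)"
proof -
  have "\<exists>k>0. \<forall>t\<in>{0..T}. (\<forall>s\<in>{b i..mid i}. k * (s - b i) \<le> norm (\<Gamma> s t - q)) \<and>
      (\<forall>s\<in>{mid i..b (Suc i)}. k * (b (Suc i) - s) \<le> norm (\<Gamma> s t - q))" if q: "q \<in> P" for q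
  proof -
    have cont': "continuous_on (A \<times> {0..T}) (\<lambda>z. \<Gamma> (fst z) (snd z) - q)" for A
      by (intro continuous_on_diff cont_on continuous_on_const) simp
    have der: "((\<lambda>s. \<Gamma> s t - q) has_vector_derivative D i (s, t)) (at s within A)"
      if "s \<in> A" "A \<subseteq> {b i..b (Suc i)}" "t \<in> {0..T}" for s t A
      using has_vector_derivative_diff[OF has_vector_derivative_within_subset[OF dD[OF i _ that(3)] that(2)] has_vector_derivative_const] that
      by auto
    have ne: "\<Gamma> s t - q \<noteq> 0" if "s \<in> {b i<..<b (Suc i)}" "t \<in> {0..T}" for s t
      using off[OF i that] q by auto
    have e: "(\<forall>t\<in>{0..T}. \<Gamma> (b k) t - q = 0) \<or> (\<forall>t\<in>{0..T}. \<Gamma> (b k) t - q \<noteq> 0)" if "k \<le> r" for k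
      using ends[OF that q] by auto
    have subl: "{b i..mid i} \<subseteq> {b i..b (Suc i)}" and subr: "{mid i..b (Suc i)} \<subseteq> {b i..b (Suc i)}"
      using mid[OF i] by auto
    obtain k1 where k1: "k1 > 0" "\<And>s t. s \<in> {b i..mid i} \<Longrightarrow> t \<in> {0..T} \<Longrightarrow> k1 * \<bar>s - b i\<bar> \<le> norm (\<Gamma> s t - q)"
    proof (rule linear_lower_bound[OF mid(1)[OF i] T, of "b i" "\<lambda>s t. \<Gamma> s t - q" "D i"])
      show "continuous_on ({b i..mid i} \<times> {0..T}) (D i)"
        by (rule continuous_on_subset[OF D[OF i]]) (use subl in auto)
      show "((\<lambda>s. \<Gamma> s t - q) has_vector_derivative D i (s, t)) (at s within {b i..mid i})"
        if "s \<in> {b i..mid i}" "t \<in> {0..T}" for s t by (rule der) (use that subl in auto)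
      show "(\<forall>t\<in>{0..T}. \<Gamma> (b i) t - q = 0) \<or> (\<forall>t\<in>{0..T}. \<Gamma> (b i) t - q \<noteq> 0)" using e[of i] i by simp
      show "\<Gamma> s t - q \<noteq> 0" if "s \<in> {b i..mid i}" "s \<noteq> b i" "t \<in> {0..T}" for s t
        by (rule ne) (use that mid[OF i] in auto)
    qed (use mid[OF i] cont' D_nz[OF i] b_less[OF i] in auto)
    obtain k2 where k2: "k2 > 0" "\<And>s t. s \<in> {mid i..b (Suc i)} \<Longrightarrow> t \<in> {0..T} \<Longrightarrow> k2 * \<bar>s - b (Suc i)\<bar> \<le> norm (\<Gamma> s t - q)"
    proof (rule linear_lower_bound[OF mid(2)[OF i] T, of "b (Suc i)" "\<lambda>s t. \<Gamma> s t - q" "D i"])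
      show "continuous_on ({mid i..b (Suc i)} \<times> {0..T}) (D i)"
        by (rule continuous_on_subset[OF D[OF i]]) (use subr in auto)
      show "((\<lambda>s. \<Gamma> s t - q) has_vector_derivative D i (s, t)) (at s within {mid i..b (Suc i)})"
        if "s \<in> {mid i..b (Suc i)}" "t \<in> {0..T}" for s t by (rule der) (use that subr in auto)
      show "(\<forall>t\<in>{0..T}. \<Gamma> (b (Suc i)) t - q = 0) \<or> (\<forall>t\<in>{0..T}. \<Gamma> (b (Suc i)) t - q \<noteq> 0)" using e[of "Suc i"] i by simp
      show "\<Gamma> s t - q \<noteq> 0" if "s \<in> {mid i..b (Suc i)}" "s \<noteq> b (Suc i)" "t \<in> {0..T}" for s t
        by (rule ne) (use that mid[OF i] in auto)
    qed (use mid[OF i] cont' D_nz[OF i] b_less[OF i] in auto)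
    define k where "k = min k1 k2"
    have "k * (s - b i) \<le> norm (\<Gamma> s t - q)" if "s \<in> {b i..mid i}" "t \<in> {0..T}" for s t
      using k1(2)[OF that] mult_right_mono[of k k1 "s - b i"] that by (auto simp: k_def)
    moreover have "k * (b (Suc i) - s) \<le> norm (\<Gamma> s t - q)" if "s \<in> {mid i..b (Suc i)}" "t \<in> {0..T}" for s t
      using k2(2)[OF that] mult_right_mono[of k k2 "b (Suc i) - s"] that by (auto simp: k_def)
    moreover have "k > 0" using k1 k2 by (simp add: k_def)
    ultimately show ?thesis by blast
  qed
  then obtain k where k: "\<And>q. q \<in> P \<Longrightarrow> k q > 0"
    "\<And>q t s. q \<in> P \<Longrightarrow> t \<in> {0..T} \<Longrightarrow> s \<in> {b i..mid i} \<Longrightarrow> k q * (s - b i) \<le> norm (\<Gamma> s t - q)"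
    "\<And>q t s. q \<in> P \<Longrightarrow> t \<in> {0..T} \<Longrightarrow> s \<in> {mid i..b (Suc i)} \<Longrightarrow> k q * (b (Suc i) - s) \<le> norm (\<Gamma> s t - q)"
    by metis
  \<comment> \<open>The 1 is there for empty \<open>P\<close>.\<close>
  define \<kappa> where "\<kappa> = Min (insert 1 (k ` P))"
  have \<kappa>: "\<kappa> > 0" "\<And>q. q \<in> P \<Longrightarrow> \<kappa> \<le> k q" using k(1) finite_P by (auto simp: \<kappa>_def)
  show ?thesis
  proof
    show "\<kappa> > 0" by (rule \<kappa>)
    show "\<kappa> * (s - b i) \<le> norm (\<Gamma> s t - q)" if "q \<in> P" "s \<in> {b i..mid i}" "t \<in> {0..T}" for q s t
      using k(2)[OF that(1,3,2)] mult_right_mono[OF \<kappa>(2)[OF that(1)], of "s - b i"] that by auto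
    show "\<kappa> * (b (Suc i) - s) \<le> norm (\<Gamma> s t - q)" if "q \<in> P" "s \<in> {mid i..b (Suc i)}" "t \<in> {0..T}" for q s t
      using k(3)[OF that(1,3,2)] mult_right_mono[OF \<kappa>(2)[OF that(1)], of "b (Suc i) - s"] that by auto
  qed
qed

text \<open>The linear distance from the singular points turns the bound for the derivative of the
  cut-off into a multiple of \<open>layer_kernel\<close>, the same for all \<open>t\<close>. The
  uniform bound \<open>B\<close> and the pointwise limit are the two ingredients of dominated
  convergence in time.\<close>

lemma cutoff_arc_estimate:
  assumes i: "i < r"
    and W: "continuous_on ({b i..b (Suc i)} \<times> {0..T}) W"
    and dW: "\<And>s t. s \<in> {b i<..<b (Suc i)} \<Longrightarrow> t \<in> {0<..<T} \<Longrightarrow> ((\<lambda>s. W (s, t)) has_real_derivative W' s t) (at s)"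
    and int: "\<And>\<delta> t. \<delta> > 0 \<Longrightarrow> t \<in> {0<..<T} \<Longrightarrow> (\<lambda>s. cutoff P \<delta> (\<Gamma> s t) * W' s t) integrable_on {b i..b (Suc i)}"
  obtains B where
    "\<And>\<delta> t. \<delta> > 0 \<Longrightarrow> t \<in> {0<..<T} \<Longrightarrow> \<bar>integral {b i..b (Suc i)} (\<lambda>s. cutoff P \<delta> (\<Gamma> s t) * W' s t)\<bar> \<le> B"
    "\<And>\<delta> t. (\<And>k. \<delta> k > 0) \<Longrightarrow> \<delta> \<longlonglongrightarrow> 0 \<Longrightarrow> t \<in> {0<..<T} \<Longrightarrow>
      (\<lambda>k. integral {b i..b (Suc i)} (\<lambda>s. cutoff P (\<delta> k) (\<Gamma> s t) * W' s t)) \<longlonglongrightarrow> W (b (Suc i), t) - W (b i, t)"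
proof -
  define x y m where "x = b i" and "y = b (Suc i)" and "m = mid i"
  have xmy: "x < m" "m < y" using mid[OF i] by (auto simp: x_def y_def m_def)
  obtain \<kappa> where \<kappa>: "\<kappa> > 0"
    "\<And>q s t. q \<in> P \<Longrightarrow> s \<in> {x..m} \<Longrightarrow> t \<in> {0..T} \<Longrightarrow> \<kappa> * (s - x) \<le> norm (\<Gamma> s t - q)"
    "\<And>q s t. q \<in> P \<Longrightarrow> s \<in> {m..y} \<Longrightarrow> t \<in> {0..T} \<Longrightarrow> \<kappa> * (y - s) \<le> norm (\<Gamma> s t - q)"
    using distance_lower_bound[OF i] unfolding x_def y_def m_def by metis
  have cR: "compact ({x..y} \<times> {0..T})" by (intro compact_Times) auto
  obtain N where N: "N > 0" "\<And>s t. s \<in> {x..y} \<Longrightarrow> t \<in> {0..T} \<Longrightarrow> norm (D i (s, t)) \<le> N"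
  proof -
    have "bounded (D i ` ({x..y} \<times> {0..T}))"
      using compact_continuous_image[OF D[OF i]] cR by (simp add: x_def y_def compact_imp_bounded)
    then show ?thesis using that unfolding bounded_pos by (auto simp: image_iff)
  qed
  obtain V where V: "V > 0" "\<And>s t. s \<in> {x..y} \<Longrightarrow> t \<in> {0..T} \<Longrightarrow> \<bar>W (s, t)\<bar> \<le> V"
  proof -
    have "bounded (W ` ({x..y} \<times> {0..T}))"
      using compact_continuous_image[OF W] cR by (simp add: x_def y_def compact_imp_bounded)
    then show ?thesis using that unfolding bounded_pos by (auto simp: image_iff)
  qed
  \<comment> \<open>One summand for each factor of the cut-off, with \<open>N\<close> bounding the
    speed of the curve.\<close>
  define K where "K = real (card P) * N"
  have K: "K \<ge> 0" using N by (simp add: K_def)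
  define c where "c \<delta> t s = cutoff P \<delta> (\<Gamma> s t)" for \<delta> t s
  define lay where "lay \<delta> t = layer \<kappa> \<delta> (\<lambda>s. W (s, t)) x m + layer \<kappa> \<delta> (\<lambda>s. W (- s, t)) (- y) (- m)" for \<delta> t
  have Wt: "continuous_on {x..y} (\<lambda>s. W (s, t))" if "t \<in> {0..T}" for t
    using continuous_on_snd_param[OF W that] by (simp add: x_def y_def)
  have Wt': "continuous_on {x..m} (\<lambda>s. W (s, t))" "continuous_on {- y..- m} (\<lambda>s. W (- s, t))" if "t \<in> {0..T}" for t
  proof -
    show "continuous_on {x..m} (\<lambda>s. W (s, t))" using continuous_on_subset[OF Wt[OF that]] xmy by auto
    show "continuous_on {- y..- m} (\<lambda>s. W (- s, t))"
      by (rule continuous_on_compose2[OF Wt[OF that]]) (use xmy in \<open>auto intro!: continuous_intros\<close>)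
  qed
  have est: "\<bar>integral {x..y} (\<lambda>s. c \<delta> t s * W' s t) - c \<delta> t m * (W (y, t) - W (x, t))\<bar> \<le> K * lay \<delta> t"
    if \<delta>: "\<delta> > 0" and t: "t \<in> {0<..<T}" for \<delta> t
  proof -
    have tT: "t \<in> {0..T}" using t by auto
    have dc: "\<exists>c'. (c \<delta> t has_real_derivative c') (at s) \<and> \<bar>c'\<bar> \<le> K * layer_kernel \<kappa> \<delta> u"
      if s: "s \<in> {x<..<y}" and u: "u \<ge> 0" "\<And>q. q \<in> P \<Longrightarrow> \<kappa> * u \<le> norm (\<Gamma> s t - q)" for s u
    proof -
      have g: "((\<lambda>s. \<Gamma> s t) has_vector_derivative D i (s, t)) (at s)"
        using dD[OF i _ tT, of s] s by (simp add: x_def y_def at_within_Icc_at)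
      obtain X where X: "((\<lambda>s. cutoff P \<delta> (\<Gamma> s t)) has_real_derivative X) (at s)"
        "\<bar>X\<bar> \<le> (\<Sum>q\<in>P. norm (D i (s, t)) * (\<delta> / ((norm (\<Gamma> s t - q))\<^sup>2 + \<delta>\<^sup>2)))"
        using cutoff_derivative_along_curve[OF finite_P \<delta> g] by auto
      have "\<delta> / ((norm (\<Gamma> s t - q))\<^sup>2 + \<delta>\<^sup>2) \<le> layer_kernel \<kappa> \<delta> u" if "q \<in> P" for q
      proof -
        have "(\<kappa> * u)\<^sup>2 \<le> (norm (\<Gamma> s t - q))\<^sup>2" using u \<kappa>(1) that by (intro power_mono) auto
        then show ?thesis
          unfolding layer_kernel_def using \<delta> by (intro divide_left_mono) (auto simp: power_mult_distrib add_nonneg_pos)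
      qed
      then have "(\<Sum>q\<in>P. norm (D i (s, t)) * (\<delta> / ((norm (\<Gamma> s t - q))\<^sup>2 + \<delta>\<^sup>2))) \<le> (\<Sum>q\<in>P. N * layer_kernel \<kappa> \<delta> u)"
        using N s tT \<delta> by (intro sum_mono mult_mono) (auto simp: add_nonneg_pos less_imp_le)
      also have "\<dots> = K * layer_kernel \<kappa> \<delta> u" by (simp add: K_def)
      finally show ?thesis using X unfolding c_def by (intro exI[of _ X]) simp
    qed
    show ?thesis
      unfolding lay_def
    proof (rule cutoff_by_parts_two_sided[OF xmy \<delta> Wt[OF tT]])
      show "continuous_on {x..y} (c \<delta> t)" unfolding c_def by (intro continuous_on_cutoff \<delta> cont_s tT)
      show "((\<lambda>s. W (s, t)) has_real_derivative W' s t) (at s)" if "s \<in> {x<..<y}" for s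
        by (rule dW) (use that t in \<open>auto simp: x_def y_def\<close>)
      show "\<exists>c'. (c \<delta> t has_real_derivative c') (at s) \<and> \<bar>c'\<bar> \<le> K * layer_kernel \<kappa> \<delta> (s - x)" if "s \<in> {x<..<m}" for s
        by (rule dc) (use that xmy \<kappa>(2)[of _ s t] tT in auto)
      show "\<exists>c'. (c \<delta> t has_real_derivative c') (at s) \<and> \<bar>c'\<bar> \<le> K * layer_kernel \<kappa> \<delta> (y - s)" if "s \<in> {m<..<y}" for s
        by (rule dc) (use that xmy \<kappa>(3)[of _ s t] tT in auto)
      show "(\<lambda>s. c \<delta> t s * W' s t) integrable_on {x..y}" using int[OF \<delta> t] by (simp add: c_def x_def y_def)
    qed
  qed
  show ?thesis
  proof
    fix \<delta> t :: real assume \<delta>: "\<delta> > 0" and t: "t \<in> {0<..<T}"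
    then have tT: "t \<in> {0..T}" by auto
    have "layer \<kappa> \<delta> (\<lambda>s. W (s, t)) x m \<le> 2 * V * (pi / (2 * \<kappa>))"
      by (rule layer_bound[OF \<kappa>(1) \<delta> _ Wt'(1)[OF tT]]) (use xmy V tT in auto)
    moreover have "layer \<kappa> \<delta> (\<lambda>s. W (- s, t)) (- y) (- m) \<le> 2 * V * (pi / (2 * \<kappa>))"
      by (rule layer_bound[OF \<kappa>(1) \<delta> _ Wt'(2)[OF tT]]) (use xmy V tT in auto)
    ultimately have "lay \<delta> t \<le> 2 * (2 * V * (pi / (2 * \<kappa>)))"
      unfolding lay_def by linarith
    then have "K * lay \<delta> t \<le> K * (2 * (2 * V * (pi / (2 * \<kappa>))))"
      using K by (rule mult_left_mono)
    moreover have "\<bar>c \<delta> t m * (W (y, t) - W (x, t))\<bar> \<le> 1 * (2 * V)"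
      unfolding abs_mult using cutoff_bounds[OF \<delta>, of P "\<Gamma> m t"] V(2)[of x t] V(2)[of y t] xmy tT
      by (intro mult_mono) (auto simp: c_def)
    ultimately show "\<bar>integral {b i..b (Suc i)} (\<lambda>s. cutoff P \<delta> (\<Gamma> s t) * W' s t)\<bar> \<le> 2 * V + K * (2 * (2 * V * (pi / (2 * \<kappa>))))"
      using est[OF \<delta> t] unfolding c_def x_def y_def by linarith
  next
    fix \<delta> :: "nat \<Rightarrow> real" and t assume \<delta>: "\<And>k. \<delta> k > 0" "\<delta> \<longlonglongrightarrow> 0" and t: "t \<in> {0<..<T}"
    then have tT: "t \<in> {0..T}" by auto
    have "(\<lambda>k. K * lay (\<delta> k) t) \<longlonglongrightarrow> K * (0 + 0)"
      unfolding lay_def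
      by (intro tendsto_mult tendsto_const tendsto_add layer_limit \<kappa>(1) \<delta> Wt' tT) (use xmy in auto)
    then have "(\<lambda>k. K * lay (\<delta> k) t) \<longlonglongrightarrow> 0" by simp
    then have 1: "(\<lambda>k. integral {x..y} (\<lambda>s. c (\<delta> k) t s * W' s t) - c (\<delta> k) t m * (W (y, t) - W (x, t))) \<longlonglongrightarrow> 0"
      by (rule Lim_null_comparison[rotated]) (use est[OF \<delta>(1) t] in auto)
    have "\<Gamma> m t \<notin> P" by (rule off[OF i _ tT]) (use xmy in \<open>auto simp: x_def y_def\<close>)
    then have "(\<lambda>k. c (\<delta> k) t m * (W (y, t) - W (x, t))) \<longlonglongrightarrow> 1 * (W (y, t) - W (x, t))"
      unfolding c_def by (intro tendsto_mult tendsto_const cutoff_limit \<delta>)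
    from tendsto_add[OF 1 this]
    show "(\<lambda>k. integral {b i..b (Suc i)} (\<lambda>s. cutoff P (\<delta> k) (\<Gamma> s t) * W' s t)) \<longlonglongrightarrow> W (b (Suc i), t) - W (b i, t)"
      by (simp add: c_def x_def y_def)
  qed
qed

text \<open>Each cut-off density is continuous, so \<open>area_variation\<close> applies to it. As
  the cut-off is removed, the areas converge with \<open>\<rho>\<close> as majorant, and the arc
  integrals converge to increments of \<open>W\<close> by
  \<open>cutoff_arc_estimate\<close>.\<close>

lemma area_identity:
  fixes \<rho> :: "complex \<Rightarrow> real" and W :: "nat \<Rightarrow> real \<times> real \<Rightarrow> real"
  assumes \<rho>_cont: "\<And>\<delta>. \<delta> > 0 \<Longrightarrow> continuous_on UNIV (\<lambda>z. if z \<in> P then 0 else \<rho> z * cutoff P \<delta> z)"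
    and \<rho>_int: "\<And>R. set_integrable lborel (cball 0 R) \<rho>"
    and W: "\<And>i. i < r \<Longrightarrow> continuous_on ({b i..b (Suc i)} \<times> {0..T}) (W i)"
    and dW: "\<And>i s t. i < r \<Longrightarrow> s \<in> {b i<..<b (Suc i)} \<Longrightarrow> t \<in> {0<..<T} \<Longrightarrow>
      ((\<lambda>s. W i (s, t)) has_real_derivative \<rho> (\<Gamma> s t) * Im (cnj (D i (s, t)) * E i (s, t))) (at s)"
    and \<sigma>: "\<sigma> = 1 \<or> \<sigma> = - 1"
      "\<And>t z. t \<in> {0..T} \<Longrightarrow> z \<in> enclosed_region (\<lambda>s. \<Gamma> s t) \<Longrightarrow> winding_number (\<lambda>s. \<Gamma> s t) z = of_real \<sigma>"
    and t: "t1 \<in> {0..T}" "t2 \<in> {0..T}" "t1 \<le> t2"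
  shows "g_area \<rho> (enclosed_region (\<lambda>s. \<Gamma> s t2)) - g_area \<rho> (enclosed_region (\<lambda>s. \<Gamma> s t1)) =
    - \<sigma> * integral {t1..t2} (\<lambda>t. \<Sum>i<r. W i (b (Suc i), t) - W i (b i, t))"
proof -
  define \<delta> :: "nat \<Rightarrow> real" where "\<delta> k = inverse (real (Suc k))" for k
  have \<delta>: "\<delta> k > 0" "\<delta> \<longlonglongrightarrow> 0" for k
    using LIMSEQ_inverse_real_of_nat by (simp_all add: \<delta>_def[abs_def])
  define \<phi> where "\<phi> k z = (if z \<in> P then 0 else \<rho> z * cutoff P (\<delta> k) z)" for k z
  have \<phi>: "continuous_on UNIV (\<phi> k)" for k unfolding \<phi>_def by (rule \<rho>_cont[OF \<delta>(1)])
  define j where "j i s t = Im (cnj (D i (s, t)) * E i (s, t))" for i s t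
  define X where "X k i t = integral {b i..b (Suc i)} (\<lambda>s. \<phi> k (\<Gamma> s t) * j i s t)" for k i t
  have sub: "{t1..t2} \<subseteq> {0..T}" and sub': "{t1<..<t2} \<subseteq> {0<..<T}" using t by auto
  have variation: "g_area (\<phi> k) (enclosed_region (\<lambda>s. \<Gamma> s t2)) - g_area (\<phi> k) (enclosed_region (\<lambda>s. \<Gamma> s t1)) =
      - \<sigma> * (\<Sum>i<r. integral {t1..t2} (X k i))" for k
    unfolding X_def j_def by (rule area_variation[OF t \<phi> \<sigma>(1) \<sigma>(2)[OF t(1)] \<sigma>(2)[OF t(2)]])
  have area_lim: "(\<lambda>k. g_area (\<phi> k) U) \<longlonglongrightarrow> g_area \<rho> U" if U: "open U" "bounded U" for U
  proof -
    obtain R where R: "U \<subseteq> cball 0 R" using U(2) bounded_subset_ballD[of U 0] ball_subset_cball by blast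
    have "set_integrable lborel U \<rho>" by (rule set_integrable_subset[OF \<rho>_int _ R]) (use U(1) in auto)
    then have int: "integrable lborel (\<lambda>z. indicator U z *\<^sub>R \<rho> z)" by (simp add: set_integrable_def)
    have "(\<lambda>k. LINT z|lborel. indicator U z *\<^sub>R \<phi> k z) \<longlonglongrightarrow> (LINT z|lborel. indicator U z *\<^sub>R \<rho> z)"
    proof (rule integral_dominated_convergence[OF borel_measurable_integrable[OF int] _ integrable_norm[OF int]])
      show "(\<lambda>z. indicator U z *\<^sub>R \<phi> k z) \<in> borel_measurable lborel" for k
        using borel_measurable_continuous_onI[OF \<phi>, of k] U(1) by auto
      have "AE z in lborel. z \<notin> P"
        using finite_imp_null_set_lborel[OF finite_P] by (rule AE_not_in)
      then show "AE z in lborel. (\<lambda>k. indicator U z *\<^sub>R \<phi> k z) \<longlonglongrightarrow> indicator U z *\<^sub>R \<rho> z"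
      proof eventually_elim
        case (elim z)
        have "(\<lambda>k. indicator U z *\<^sub>R (\<rho> z * cutoff P (\<delta> k) z)) \<longlonglongrightarrow> indicator U z *\<^sub>R (\<rho> z * 1)"
          by (intro tendsto_scaleR tendsto_mult tendsto_const cutoff_limit elim \<delta>)
        then show ?case using elim by (simp add: \<phi>_def)
      qed
      show "AE z in lborel. norm (indicator U z *\<^sub>R \<phi> k z) \<le> norm (indicator U z *\<^sub>R \<rho> z)" for k
      proof (rule AE_I2)
        fix z
        have "norm (\<phi> k z) \<le> norm (\<rho> z)"
          using cutoff_bounds[OF \<delta>(1)[of k], of P z] by (auto simp: \<phi>_def abs_mult mult_left_le)
        then show "norm (indicator U z *\<^sub>R \<phi> k z) \<le> norm (indicator U z *\<^sub>R \<rho> z)"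
          unfolding norm_scaleR by (rule mult_left_mono) simp
      qed
    qed
    then show ?thesis by (simp add: g_area_def set_lebesgue_integral_def)
  qed
  have region: "open (enclosed_region (\<lambda>s. \<Gamma> s t))" "bounded (enclosed_region (\<lambda>s. \<Gamma> s t))" if "t \<in> {0..T}" for t
    using compact_path_image[OF simple_path_imp_path[OF simple[OF that]]]
    by (auto simp: enclosed_region_def open_inside compact_imp_closed bounded_inside compact_imp_bounded)
  have X_lim: "(\<lambda>k. integral {t1..t2} (X k i)) \<longlonglongrightarrow> integral {t1..t2} (\<lambda>t. W i (b (Suc i), t) - W i (b i, t))"
    and W_int: "(\<lambda>t. W i (b (Suc i), t) - W i (b i, t)) integrable_on {t1..t2}" if i: "i < r" for i
  proof -
    have cX: "continuous_on ({b i..b (Suc i)} \<times> {0..T}) (\<lambda>z. \<phi> k (\<Gamma> (fst z) (snd z)) * j i (fst z) (snd z))" for k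
    proof (intro continuous_on_mult)
      show "continuous_on ({b i..b (Suc i)} \<times> {0..T}) (\<lambda>z. \<phi> k (\<Gamma> (fst z) (snd z)))"
        by (rule continuous_on_compose2[OF \<phi> cont_on]) auto
      show "continuous_on ({b i..b (Suc i)} \<times> {0..T}) (\<lambda>z. j i (fst z) (snd z))"
        unfolding j_def using D[OF i] E[OF i] by (auto intro!: continuous_intros)
    qed
    have X_int: "X k i integrable_on {t1..t2}" for k
      using continuous_on_subset[OF continuous_on_integral_fst[OF cX, of k] sub]
      by (intro integrable_continuous_interval) (simp add: X_def[abs_def])
    have eq: "\<phi> k (\<Gamma> s t) * j i s t = cutoff P (\<delta> k) (\<Gamma> s t) * (\<rho> (\<Gamma> s t) * j i s t)" for k s t
      using cutoff_zero[OF finite_P] by (simp add: \<phi>_def)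
    have eq': "(if \<Gamma> s t \<in> P then 0 else \<rho> (\<Gamma> s t) * cutoff P e (\<Gamma> s t)) * j i s t = cutoff P e (\<Gamma> s t) * (\<rho> (\<Gamma> s t) * j i s t)" for e s t
      using cutoff_zero[OF finite_P] by simp
    have cint: "(\<lambda>s. cutoff P e (\<Gamma> s t) * (\<rho> (\<Gamma> s t) * j i s t)) integrable_on {b i..b (Suc i)}" if "e > 0" "t \<in> {0<..<T}" for e t
    proof -
      have tT: "t \<in> {0..T}" using that by auto
      have "continuous_on {b i..b (Suc i)} (\<lambda>s. (if \<Gamma> s t \<in> P then 0 else \<rho> (\<Gamma> s t) * cutoff P e (\<Gamma> s t)) * j i s t)"
      proof (intro continuous_on_mult)
        show "continuous_on {b i..b (Suc i)} (\<lambda>s. if \<Gamma> s t \<in> P then 0 else \<rho> (\<Gamma> s t) * cutoff P e (\<Gamma> s t))"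
          by (rule continuous_on_compose2[OF \<rho>_cont[OF that(1)] cont_s[OF tT]]) auto
        show "continuous_on {b i..b (Suc i)} (\<lambda>s. j i s t)"
          unfolding j_def using continuous_on_snd_param[OF D[OF i] tT] continuous_on_snd_param[OF E[OF i] tT]
          by (intro continuous_intros)
      qed
      then show ?thesis unfolding eq' by (rule integrable_continuous_interval)
    qed
    obtain B where B: "\<And>e t. e > 0 \<Longrightarrow> t \<in> {0<..<T} \<Longrightarrow> \<bar>integral {b i..b (Suc i)} (\<lambda>s. cutoff P e (\<Gamma> s t) * (\<rho> (\<Gamma> s t) * j i s t))\<bar> \<le> B"
      "\<And>e t. (\<And>k. e k > 0) \<Longrightarrow> e \<longlonglongrightarrow> 0 \<Longrightarrow> t \<in> {0<..<T} \<Longrightarrow>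
        (\<lambda>k. integral {b i..b (Suc i)} (\<lambda>s. cutoff P (e k) (\<Gamma> s t) * (\<rho> (\<Gamma> s t) * j i s t))) \<longlonglongrightarrow> W i (b (Suc i), t) - W i (b i, t)"
      using cutoff_arc_estimate[OF i W[OF i], of "\<lambda>s t. \<rho> (\<Gamma> s t) * j i s t"] dW[OF i] cint unfolding j_def by blast
    \<comment> \<open>Open interval, since \<open>W\<close> is a primitive only for
      \<open>0 < t < T\<close>; the integrals are the same.\<close>
    have "(\<lambda>k. integral {t1<..<t2} (X k i)) \<longlonglongrightarrow> integral {t1<..<t2} (\<lambda>t. W i (b (Suc i), t) - W i (b i, t))"
    proof (rule dominated_convergence(2)[where h="\<lambda>_. B"])
      show "X k i integrable_on {t1<..<t2}" for k using X_int by (simp add: integrable_on_open_interval_real)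
      show "(\<lambda>_. B) integrable_on {t1<..<t2}"
        using integrable_const_ivl[of B t1 t2] by (simp add: integrable_on_open_interval_real)
      fix t assume "t \<in> {t1<..<t2}"
      then have tT: "t \<in> {0<..<T}" using sub' by auto
      show "norm (X k i t) \<le> B" for k unfolding X_def eq using B(1)[OF \<delta>(1) tT, of k] by simp
      show "(\<lambda>k. X k i t) \<longlonglongrightarrow> W i (b (Suc i), t) - W i (b i, t)"
        unfolding X_def eq by (rule B(2)[OF \<delta> tT])
    qed
    then show "(\<lambda>k. integral {t1..t2} (X k i)) \<longlonglongrightarrow> integral {t1..t2} (\<lambda>t. W i (b (Suc i), t) - W i (b i, t))"
      by (simp add: integral_open_interval_real)
    have "continuous_on {0..T} (\<lambda>t. W i (b (Suc i), t) - W i (b i, t))"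
      using b_less[OF i] by (intro continuous_on_diff continuous_on_fst_param[OF W[OF i]]) auto
    from continuous_on_subset[OF this sub]
    show "(\<lambda>t. W i (b (Suc i), t) - W i (b i, t)) integrable_on {t1..t2}" by (rule integrable_continuous_interval)
  qed
  have "(\<lambda>k. - \<sigma> * (\<Sum>i<r. integral {t1..t2} (X k i))) \<longlonglongrightarrow> - \<sigma> * (\<Sum>i<r. integral {t1..t2} (\<lambda>t. W i (b (Suc i), t) - W i (b i, t)))"
    by (intro tendsto_mult tendsto_const tendsto_sum X_lim) simp
  moreover have "(\<lambda>k. - \<sigma> * (\<Sum>i<r. integral {t1..t2} (X k i))) \<longlonglongrightarrow> g_area \<rho> (enclosed_region (\<lambda>s. \<Gamma> s t2)) - g_area \<rho> (enclosed_region (\<lambda>s. \<Gamma> s t1))"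
    unfolding variation[symmetric] by (intro tendsto_diff area_lim region t)
  ultimately have "g_area \<rho> (enclosed_region (\<lambda>s. \<Gamma> s t2)) - g_area \<rho> (enclosed_region (\<lambda>s. \<Gamma> s t1)) = - \<sigma> * (\<Sum>i<r. integral {t1..t2} (\<lambda>t. W i (b (Suc i), t) - W i (b i, t)))"
    using LIMSEQ_unique by blast
  also have "(\<Sum>i<r. integral {t1..t2} (\<lambda>t. W i (b (Suc i), t) - W i (b i, t))) = integral {t1..t2} (\<lambda>t. \<Sum>i<r. W i (b (Suc i), t) - W i (b i, t))"
    by (rule integral_sum[symmetric]) (use W_int in auto)
  finally show ?thesis .
qed

end

section \<open>Singular parameters of a closed curve\<close>

text \<open>Equal values force equal fractional parts, but two distinct parameters less than one
  apart cannot differ by an integer.\<close>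

lemma periodic_simple_path_inj:
  assumes "simple_path c" and per: "\<And>s. c (s + 1) = c s" and xy: "x < y" "y < x + 1"
  shows "c x \<noteq> c y"
proof
  assume eq: "c x = c y"
  interpret periodic_fun_simple c "1::real" by standard (rule per)
  have fr: "c (frac s) = c s" for s
    using minus_of_int[of s "\<lfloor>s\<rfloor>"] by (simp add: frac_def)
  have f01: "0 \<le> frac s" "frac s < 1" for s :: real by (auto simp: frac_lt_1)
  have "c (frac x) = c (frac y)" using eq fr by simp
  moreover have "frac x \<in> {0..1}" "frac y \<in> {0..1}" using f01 by (auto simp: less_imp_le)
  ultimately have "frac x = frac y"
    using assms(1) f01[of x] f01[of y] unfolding simple_path_def loop_free_def by fastforce
  then have "y - x = of_int (\<lfloor>y\<rfloor> - \<lfloor>x\<rfloor>)" by (simp add: frac_def)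
  then have "0 < real_of_int (\<lfloor>y\<rfloor> - \<lfloor>x\<rfloor>)" "real_of_int (\<lfloor>y\<rfloor> - \<lfloor>x\<rfloor>) < 1" using xy by linarith+
  then show False unfolding of_int_0_less_iff of_int_less_1_iff by simp
qed

lemma finite_parameters:
  assumes "simple_path c" "\<And>s. c (s + 1) = c s" "finite P"
  shows "finite {s \<in> {a..a + 1}. c s \<in> P}"
proof -
  have "inj_on c {a..<a + 1}"
  proof (rule linorder_inj_onI')
    fix i j assume "i \<in> {a..<a + 1}" "j \<in> {a..<a + 1}" "i < j"
    then show "c i \<noteq> c j" by (intro periodic_simple_path_inj[OF assms(1,2)]) auto
  qed
  then have "finite (c -` P \<inter> {a..<a + 1})" by (rule finite_vimage_IntI[OF assms(3)])
  moreover have "{s \<in> {a..a + 1}. c s \<in> P} \<subseteq> insert (a + 1) (c -` P \<inter> {a..<a + 1})" by auto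
  ultimately show ?thesis using finite_subset by blast
qed

text \<open>The period centred at \<open>x\<close> contains only finitely many parameters that hit
  \<open>P\<close>; the cap \<open>1 / 3\<close> keeps the neighbourhood inside that period.\<close>

lemma isolated_parameters:
  assumes "simple_path c" "\<And>s. c (s + 1) = c s" "finite P"
  obtains \<eta> :: real where "0 < \<eta>" "\<eta> < 1 / 2" "\<And>s. s \<noteq> x \<Longrightarrow> \<bar>s - x\<bar> < \<eta> \<Longrightarrow> c s \<notin> P"
proof -
  define F where "F = {s \<in> {x - 1 / 2..x - 1 / 2 + 1}. c s \<in> P}"
  have fF: "finite F" unfolding F_def by (rule finite_parameters[OF assms])
  obtain d where d: "d > 0" "\<And>s. s \<in> F \<Longrightarrow> s \<noteq> x \<Longrightarrow> d \<le> dist x s"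
    using finite_set_avoid[OF fF, of x] by blast
  show ?thesis
  proof (rule that[of "min d (1 / 3)"])
    show "0 < min d (1 / 3)" "min d (1 / 3) < 1 / 2" using d(1) by auto
    fix s assume s: "s \<noteq> x" "\<bar>s - x\<bar> < min d (1 / 3)"
    then have "s \<in> {x - 1 / 2..x - 1 / 2 + 1}" unfolding atLeastAtMost_iff by linarith
    then show "c s \<notin> P" using d(2)[of s] s by (auto simp: F_def dist_real_def abs_minus_commute)
  qed
qed

lemma finite_set_enumeration:
  fixes S :: "real set"
  assumes "finite S" "0 \<in> S" "1 \<in> S" "S \<subseteq> {0..1}"
  obtains b :: "nat \<Rightarrow> real" and r where "strict_mono_on {..r} b" "b 0 = 0" "b r = 1" "b ` {..r} = S"
    "\<And>i s. i < r \<Longrightarrow> s \<in> {b i<..<b (Suc i)} \<Longrightarrow> s \<notin> S"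
proof -
  define xs where "xs = sorted_list_of_set S"
  have xs: "set xs = S" "sorted_wrt (<) xs" using assms(1) by (auto simp: xs_def)
  have ne: "xs \<noteq> []" using xs(1) assms(2) by auto
  define r where "r = length xs - 1"
  have len: "length xs = Suc r" using ne by (simp add: r_def)
  define b where "b i = xs ! i" for i
  have sm: "b i < b j" if "i < j" "j \<le> r" for i j
    unfolding b_def using sorted_wrt_nth_less[OF xs(2) that(1)] that(2) len by simp
  have le: "b i \<le> b j" if "i \<le> j" "j \<le> r" for i j
    using sm[of i j] that by (cases "i = j") auto
  have img: "b ` {..r} = S"
    unfolding xs(1)[symmetric] set_conv_nth len b_def by (auto simp: less_Suc_eq_le)
  have inS: "b i \<in> S" if "i \<le> r" for i using img that by auto
  obtain i0 where i0: "i0 \<le> r" "b i0 = 0" using img assms(2) by (auto simp: image_iff)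
  obtain i1 where i1: "i1 \<le> r" "b i1 = 1" using img assms(3) by (auto simp: image_iff)
  show ?thesis
  proof
    show "strict_mono_on {..r} b" using sm by (auto simp: strict_mono_on_def)
    show "b 0 = 0" using le[of 0 i0] i0 inS[of 0] assms(4) by fastforce
    show "b r = 1" using le[of i1 r] i1 inS[of r] assms(4) by fastforce
    show "b ` {..r} = S" by (rule img)
    fix i s assume i: "i < r" and s: "s \<in> {b i<..<b (Suc i)}"
    show "s \<notin> S"
    proof
      assume "s \<in> S"
      then obtain k where k: "k \<le> r" "s = b k" using img by auto
      have "k \<le> i \<or> Suc i \<le> k" by linarith
      then show False using le[of k i] le[of "Suc i" k] k i s by auto
    qed
  qed
qed

text \<open>One function \<open>Gst\<close> serves both mixed derivatives, by symmetry; this common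
  value is what cancels in Green's formula.\<close>

lemma smooth_on_partial_derivatives:
  fixes \<Gamma> :: "real \<Rightarrow> real \<Rightarrow> complex"
  assumes \<Omega>: "open \<Omega>" and smooth: "smooth_on \<Omega> (\<lambda>(s, t). \<Gamma> s t)"
  obtains Gs Gt Gst Gss where
    "\<And>s t. (s, t) \<in> \<Omega> \<Longrightarrow> ((\<lambda>s. \<Gamma> s t) has_vector_derivative Gs (s, t)) (at s)"
    "\<And>s t. (s, t) \<in> \<Omega> \<Longrightarrow> (\<Gamma> s has_vector_derivative Gt (s, t)) (at t)"
    "\<And>s t. (s, t) \<in> \<Omega> \<Longrightarrow> ((\<lambda>s. Gs (s, t)) has_vector_derivative Gss (s, t)) (at s)"
    "\<And>s t. (s, t) \<in> \<Omega> \<Longrightarrow> ((\<lambda>t. Gs (s, t)) has_vector_derivative Gst (s, t)) (at t)"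
    "\<And>s t. (s, t) \<in> \<Omega> \<Longrightarrow> ((\<lambda>s. Gt (s, t)) has_vector_derivative Gst (s, t)) (at s)"
    "continuous_on \<Omega> Gst"
proof -
  define G where "G = (\<lambda>(s, t). \<Gamma> s t)"
  have Ck: "Ck_on \<Omega> G (Suc (Suc 0))" using smooth unfolding smooth_on_def G_def by blast
  define F where "F v z = frechet_derivative G (at z) v" for v z
  have dG: "(G has_derivative (\<lambda>h. F h z)) (at z)" if "z \<in> \<Omega>" for z
    using Ck that by (simp add: F_def frechet_derivative_works)
  have dF: "(F v has_derivative frechet_derivative (F v) (at z)) (at z)" if "z \<in> \<Omega>" for v z
    using Ck that by (cases v) (simp add: F_def[abs_def] frechet_derivative_works)
  have line_s: "((\<lambda>s. f (s, t)) has_vector_derivative f' (1, 0)) (at s)" if "(f has_derivative f') (at (s, t))" for f :: "real \<times> real \<Rightarrow> complex" and f' s t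
    using has_vector_derivative_along_line[of f f' "(0, t)" s "(1, 0)" UNIV] that by simp
  have line_t: "((\<lambda>t. f (s, t)) has_vector_derivative f' (0, 1)) (at t)" if "(f has_derivative f') (at (s, t))" for f :: "real \<times> real \<Rightarrow> complex" and f' s t
    using has_vector_derivative_along_line[of f f' "(s, 0)" t "(0, 1)" UNIV] that by simp
  show ?thesis
  proof
    fix s t assume st: "(s, t) \<in> \<Omega>"
    show "((\<lambda>s. \<Gamma> s t) has_vector_derivative F (1, 0) (s, t)) (at s)"
      using line_s[OF dG[OF st]] by (simp add: G_def)
    show "(\<Gamma> s has_vector_derivative F (0, 1) (s, t)) (at t)"
      using line_t[OF dG[OF st]] by (simp add: G_def)
    show "((\<lambda>s. F (1, 0) (s, t)) has_vector_derivative frechet_derivative (F (1, 0)) (at (s, t)) (1, 0)) (at s)"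
      by (rule line_s[OF dF[OF st]])
    show "((\<lambda>t. F (1, 0) (s, t)) has_vector_derivative frechet_derivative (F (1, 0)) (at (s, t)) (0, 1)) (at t)"
      by (rule line_t[OF dF[OF st]])
    show "((\<lambda>s. F (0, 1) (s, t)) has_vector_derivative frechet_derivative (F (1, 0)) (at (s, t)) (0, 1)) (at s)"
      using line_s[OF dF[OF st, of "(0, 1)"]] symmetric_second_derivative[OF \<Omega> Ck st, of "(1, 0)" "(0, 1)"]
      by (simp add: F_def[abs_def])
  next
    show "continuous_on \<Omega> (\<lambda>z. frechet_derivative (F (1, 0)) (at z) (0, 1))"
      using Ck by (simp add: F_def[abs_def])
  qed
qed

lemma cis_Arg_divide:
  assumes "z \<noteq> 0" "w \<noteq> 0"
  shows "cis (Arg (z / w)) = sgn z / sgn w"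
  using cis_Arg[of "z / w"] assms by (simp add: sgn_divide)

section \<open>Turning of the evolved curves around their corners and regular points\<close>

locale conical_flow =
  fixes \<rho> :: "complex \<Rightarrow> real" and p :: "nat \<Rightarrow> complex" and \<beta> :: "nat \<Rightarrow> real"
    and n m :: nat and \<gamma> :: "real \<Rightarrow> complex" and \<Gamma> :: "real \<Rightarrow> real \<Rightarrow> complex" and T :: real
  assumes metric: "flat_conical_metric \<rho> n p \<beta>"
    and \<beta>: "\<And>j. j \<in> {1..n} \<Longrightarrow> - 1 < \<beta> j \<and> \<beta> j < 0"
    and m_le: "m \<le> n"
    and embedded: "smooth_closed_embedded \<gamma>"
    and on_curve: "p ` {1..m} \<subseteq> path_image \<gamma>"
    and inner_points: "p ` {m+1..n} \<subseteq> enclosed_region \<gamma>"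
    and T: "T > 0"
    and flow: "degenerate_csf \<rho> (p ` {1..n}) \<gamma> T \<Gamma>"
begin

definition P :: "complex set" where "P = p ` {1..n}"

lemma finite_P: "finite P" by (simp add: P_def)

lemma inj_p: "inj_on p {1..n}"
  using metric by (simp add: flat_conical_metric_def)

lemma \<gamma>_per: "\<gamma> (s + 1) = \<gamma> s" and \<gamma>_simple: "simple_path \<gamma>"
  and \<gamma>_nz: "vector_derivative \<gamma> (at s) \<noteq> 0" and \<gamma>_smooth: "smooth_on UNIV \<gamma>"
  using embedded by (auto simp: smooth_closed_embedded_def)

lemma per: "t \<in> {0..T} \<Longrightarrow> \<Gamma> (s + 1) t = \<Gamma> s t"
  and cont: "continuous_on (UNIV \<times> {0..T}) (\<lambda>(s, t). \<Gamma> s t)"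
  and init: "\<Gamma> s 0 = \<gamma> s"
  and fixed: "t \<in> {0..T} \<Longrightarrow> \<gamma> s \<in> P \<Longrightarrow> \<Gamma> s t = \<gamma> s"
  and avoid: "t \<in> {0..T} \<Longrightarrow> \<gamma> s \<notin> P \<Longrightarrow> \<Gamma> s t \<notin> P"
  and simple: "t \<in> {0..T} \<Longrightarrow> simple_path (\<lambda>s. \<Gamma> s t)"
  and no_cusp: "t \<in> {0..T} \<Longrightarrow> \<gamma> s \<in> P \<Longrightarrow> tangent_quotient (\<lambda>s. \<Gamma> s t) s \<notin> \<real>\<^sub>\<le>\<^sub>0"
  and smooth: "smooth_on ({s. \<gamma> s \<notin> P} \<times> {0<..<T}) (\<lambda>(s, t). \<Gamma> s t)"
  using flow unfolding degenerate_csf_def P_def[symmetric] by simp_all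

lemma flow_eq: "t \<in> {0<..<T} \<Longrightarrow> \<gamma> s \<notin> P \<Longrightarrow>
    normal_part \<rho> (\<lambda>s. \<Gamma> s t) s (vector_derivative (\<lambda>t. \<Gamma> s t) (at t)) = geodesic_curvature_vector \<rho> (\<lambda>s. \<Gamma> s t) s"
  using flow unfolding degenerate_csf_def P_def[symmetric] by simp

lemma cont_s: "t \<in> {0..T} \<Longrightarrow> continuous_on A (\<lambda>s. \<Gamma> s t)"
  using continuous_on_snd_param[OF cont, of t] by (auto elim: continuous_on_subset)

lemma cont_t: "continuous_on {0..T} (\<Gamma> s)"
  using continuous_on_fst_param[OF cont, of s] by auto

lemma cont_on: "B \<subseteq> {0..T} \<Longrightarrow> continuous_on (A \<times> B) (\<lambda>z. \<Gamma> (fst z) (snd z))"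
  using continuous_on_subset[OF cont, of "A \<times> B"] by (auto simp: case_prod_beta)

lemma \<gamma>_cont: "continuous_on A \<gamma>"
  using cont_s[of 0 A] T init by simp

definition \<gamma>' :: "real \<Rightarrow> complex" where "\<gamma>' s = vector_derivative \<gamma> (at s)"

lemma \<gamma>_deriv: "(\<gamma> has_vector_derivative \<gamma>' s) (at s)"
  and \<gamma>'_cont: "continuous_on UNIV \<gamma>'"
proof -
  have Ck: "Ck_on UNIV \<gamma> (Suc 0)" using \<gamma>_smooth unfolding smooth_on_def by blast
  have d: "(\<gamma> has_derivative frechet_derivative \<gamma> (at s)) (at s)" for s
    using Ck_on_has_derivative[OF Ck] by simp
  show "(\<gamma> has_vector_derivative \<gamma>' s) (at s)" for s
    unfolding \<gamma>'_def using d[of s] by (auto simp: vector_derivative_works[symmetric] differentiable_def)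
  have "\<gamma>' s = frechet_derivative \<gamma> (at s) 1" for s
    unfolding \<gamma>'_def
    using has_vector_derivative_along_line[of \<gamma> "frechet_derivative \<gamma> (at s)" 0 s 1 UNIV] d[of s]
    by (auto intro: vector_derivative_at)
  then show "continuous_on UNIV \<gamma>'" using Ck by (simp add: \<gamma>'_def[abs_def])
qed

text \<open>The last clause ties the end values of \<open>D\<close> to the one-sided derivatives in
  \<open>tangent_quotient\<close>; through it the corner angles inherit continuity in
  \<open>t\<close>.\<close>

definition arc_derivatives :: "real \<Rightarrow> real \<Rightarrow> (real \<times> real \<Rightarrow> complex) \<Rightarrow> (real \<times> real \<Rightarrow> complex) \<Rightarrow> bool" where
  "arc_derivatives x y D E \<longleftrightarrow>
    continuous_on ({x..y} \<times> {0..T}) D \<and> continuous_on ({x..y} \<times> {0..T}) E \<and>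
    (\<forall>s\<in>{x..y}. \<forall>t\<in>{0..T}. ((\<lambda>s. \<Gamma> s t) has_vector_derivative D (s, t)) (at s within {x..y}) \<and>
      (\<Gamma> s has_vector_derivative E (s, t)) (at t within {0..T}) \<and> D (s, t) \<noteq> 0) \<and>
    (\<forall>t\<in>{0..T}. D (x, t) = vector_derivative (\<lambda>s. \<Gamma> s t) (at_right x) \<and>
      D (y, t) = vector_derivative (\<lambda>s. \<Gamma> s t) (at_left y))"

lemma arc_derivativesD:
  assumes "arc_derivatives x y D E"
  shows "continuous_on ({x..y} \<times> {0..T}) D" "continuous_on ({x..y} \<times> {0..T}) E"
    "\<And>s t. s \<in> {x..y} \<Longrightarrow> t \<in> {0..T} \<Longrightarrow> ((\<lambda>s. \<Gamma> s t) has_vector_derivative D (s, t)) (at s within {x..y})"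
    "\<And>s t. s \<in> {x..y} \<Longrightarrow> t \<in> {0..T} \<Longrightarrow> (\<Gamma> s has_vector_derivative E (s, t)) (at t within {0..T})"
    "\<And>s t. s \<in> {x..y} \<Longrightarrow> t \<in> {0..T} \<Longrightarrow> D (s, t) \<noteq> 0"
    "\<And>t. t \<in> {0..T} \<Longrightarrow> D (x, t) = vector_derivative (\<lambda>s. \<Gamma> s t) (at_right x)"
    "\<And>t. t \<in> {0..T} \<Longrightarrow> D (y, t) = vector_derivative (\<lambda>s. \<Gamma> s t) (at_left y)"
  using assms unfolding arc_derivatives_def by simp_all

lemma arc_derivatives_exist:
  assumes "x < y" "\<And>s. s \<in> {x<..<y} \<Longrightarrow> \<gamma> s \<notin> P"
  shows "\<exists>D E. arc_derivatives x y D E"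
proof -
  have reg: "regular_piece P \<gamma> x y" using assms by (auto simp: regular_piece_def)
  have C1: "C1_upto_boundary ({x..y} \<times> {0..T}) (\<lambda>(s, t). \<Gamma> s t)"
    and nz: "\<And>s t. t \<in> {0..T} \<Longrightarrow> s \<in> {x..y} \<Longrightarrow> vector_derivative (\<lambda>s. \<Gamma> s t) (at s within {x..y}) \<noteq> 0"
    using flow reg unfolding degenerate_csf_def P_def[symmetric] by blast+
  obtain D E where DE: "continuous_on ({x..y} \<times> {0..T}) D" "continuous_on ({x..y} \<times> {0..T}) E"
    "\<And>s t. s \<in> {x..y} \<Longrightarrow> t \<in> {0..T} \<Longrightarrow> ((\<lambda>s. \<Gamma> s t) has_vector_derivative D (s, t)) (at s within {x..y})"
    "\<And>s t. s \<in> {x..y} \<Longrightarrow> t \<in> {0..T} \<Longrightarrow> (\<Gamma> s has_vector_derivative E (s, t)) (at t within {0..T})"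
    using C1_upto_boundary_partial_derivatives[OF C1] by blast
  have vd: "vector_derivative (\<lambda>s. \<Gamma> s t) (at s within {x..y}) = D (s, t)" if "s \<in> {x..y}" "t \<in> {0..T}" for s t
    using vector_derivative_within_cbox[OF assms(1), of s "\<lambda>s. \<Gamma> s t"] DE(3)[OF that] that by simp
  have "D (s, t) \<noteq> 0" if "s \<in> {x..y}" "t \<in> {0..T}" for s t using nz[OF that(2,1)] vd[OF that] by simp
  moreover have "D (x, t) = vector_derivative (\<lambda>s. \<Gamma> s t) (at_right x)" if "t \<in> {0..T}" for t
    using vd[of x t] that assms(1) by (simp add: at_within_Icc_at_right)
  moreover have "D (y, t) = vector_derivative (\<lambda>s. \<Gamma> s t) (at_left y)" if "t \<in> {0..T}" for t
    using vd[of y t] that assms(1) by (simp add: at_within_Icc_at_left)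
  ultimately have "arc_derivatives x y D E" using DE by (simp add: arc_derivatives_def)
  then show ?thesis by blast
qed

lemma isolated: obtains \<eta> :: real where "0 < \<eta>" "\<eta> < 1 / 2" "\<And>s. s \<noteq> x \<Longrightarrow> \<bar>s - x\<bar> < \<eta> \<Longrightarrow> \<gamma> s \<notin> P"
  using isolated_parameters[OF \<gamma>_simple \<gamma>_per finite_P] by blast

text \<open>A period starting at a corner ends at the same corner one parameter unit later, and
  there the incoming tangent is read off.\<close>

lemma left_derivative_shift:
  "t \<in> {0..T} \<Longrightarrow> vector_derivative (\<lambda>s. \<Gamma> s t) (at_left (s + 1)) = vector_derivative (\<lambda>s. \<Gamma> s t) (at_left s)"
proof -
  assume t: "t \<in> {0..T}"
  obtain \<eta> where \<eta>: "0 < \<eta>" "\<eta> < 1 / 2" "\<And>u. u \<noteq> s \<Longrightarrow> \<bar>u - s\<bar> < \<eta> \<Longrightarrow> \<gamma> u \<notin> P" using isolated by blast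
  have lt: "s - \<eta> < s" using \<eta>(1) by simp
  have r: "\<gamma> u \<notin> P" if "u \<in> {s - \<eta><..<s}" for u using \<eta>(3)[of u] that by auto
  obtain D E where "arc_derivatives (s - \<eta>) s D E" using arc_derivatives_exist[OF lt r] by blast
  note D = arc_derivativesD(3,7)[OF this]
  have "((\<lambda>u. u - 1) has_vector_derivative 1) (at (s + 1) within {s + 1 - \<eta>..s + 1})"
    by (auto intro!: derivative_eq_intros simp flip: has_real_derivative_iff_has_vector_derivative)
  moreover have "((\<lambda>s. \<Gamma> s t) has_vector_derivative D (s, t)) (at (s + 1 - 1) within (\<lambda>u. u - 1) ` {s + 1 - \<eta>..s + 1})"
    using D(1)[of s t] t \<eta>(1) by (simp add: image_diff_atLeastAtMost)
  ultimately have "((\<lambda>u. \<Gamma> (u - 1) t) has_vector_derivative D (s, t)) (at (s + 1) within {s + 1 - \<eta>..s + 1})"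
    using vector_diff_chain_within[of "\<lambda>u. u - 1" 1 "s + 1" "{s + 1 - \<eta>..s + 1}" "\<lambda>s. \<Gamma> s t" "D (s, t)"] by (simp add: o_def)
  moreover have "\<Gamma> (u - 1) t = \<Gamma> u t" for u using per[OF t, of "u - 1"] by simp
  ultimately have "((\<lambda>u. \<Gamma> u t) has_vector_derivative D (s, t)) (at_left (s + 1))"
    using \<eta>(1) by (simp add: at_within_Icc_at_left)
  then have "vector_derivative (\<lambda>s. \<Gamma> s t) (at_left (s + 1)) = D (s, t)"
    by (rule vector_derivative_within[OF trivial_limit_at_left_real])
  then show ?thesis using D(2)[OF t] by simp
qed

lemma tangent_quotient_initial: "tangent_quotient (\<lambda>s. \<Gamma> s 0) s = 1"
proof -
  have "vector_derivative \<gamma> (at s within A) = \<gamma>' s" if "at s within A \<noteq> bot" for A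
    by (rule vector_derivative_within[OF that has_vector_derivative_at_within[OF \<gamma>_deriv]])
  from this[OF trivial_limit_at_left_real] this[OF trivial_limit_at_right_real]
  show ?thesis using \<gamma>_nz[of s] by (simp only: tangent_quotient_def init) (simp add: \<gamma>'_def)
qed

text \<open>A neighbourhood of \<open>s\<close> is itself a regular piece, so the curve has a
  two-sided tangent at \<open>s\<close>.\<close>

lemma tangent_quotient_regular:
  assumes t: "t \<in> {0..T}" and s: "\<gamma> s \<notin> P"
  shows "tangent_quotient (\<lambda>s. \<Gamma> s t) s = 1"
proof -
  obtain \<eta> where \<eta>: "0 < \<eta>" "\<eta> < 1 / 2" "\<And>u. u \<noteq> s \<Longrightarrow> \<bar>u - s\<bar> < \<eta> \<Longrightarrow> \<gamma> u \<notin> P" using isolated by blast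
  have r: "\<gamma> u \<notin> P" if "u \<in> {s - \<eta><..<s + \<eta>}" for u
    using \<eta>(3)[of u] s that by (cases "u = s") (auto simp: abs_less_iff)
  have lt: "s - \<eta> < s + \<eta>" using \<eta>(1) by simp
  obtain D E where "arc_derivatives (s - \<eta>) (s + \<eta>) D E" using arc_derivatives_exist[OF lt r] by blast
  note D = arc_derivativesD(3,5)[OF this]
  have d: "((\<lambda>s. \<Gamma> s t) has_vector_derivative D (s, t)) (at s)"
    using D(1)[of s t] t \<eta>(1) by (simp add: at_within_Icc_at)
  have "vector_derivative (\<lambda>s. \<Gamma> s t) (at s within A) = D (s, t)" if "at s within A \<noteq> bot" for A
    by (rule vector_derivative_within[OF that has_vector_derivative_at_within[OF d]])
  from this[OF trivial_limit_at_left_real] this[OF trivial_limit_at_right_real]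
  have "tangent_quotient (\<lambda>s. \<Gamma> s t) s = D (s, t) / D (s, t)" by (simp only: tangent_quotient_def)
  moreover have "D (s, t) \<noteq> 0" by (rule D(2)) (use t \<eta>(1) in auto)
  ultimately show ?thesis by simp
qed

text \<open>The turning of \<open>\<Gamma> s t - \<Gamma> x t\<close> over one period starting at \<open>x\<close>, for a corner or a regular
  point \<open>x\<close>.\<close>

lemma window:
  obtains \<theta> where "continuous_on ({x..x + 1} \<times> {0..T}) \<theta>"
    "\<And>s t. s \<in> {x<..<x + 1} \<Longrightarrow> t \<in> {0..T} \<Longrightarrow> sgn (\<Gamma> s t - \<Gamma> x t) = cis (\<theta> (s, t))"
    "\<And>t t'. t \<in> {0..T} \<Longrightarrow> t' \<in> {0..T} \<Longrightarrow>
      \<theta> (x + 1, t) - \<theta> (x, t) + Arg (tangent_quotient (\<lambda>s. \<Gamma> s t) x)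
      = \<theta> (x + 1, t') - \<theta> (x, t') + Arg (tangent_quotient (\<lambda>s. \<Gamma> s t') x)"
proof -
  obtain \<eta> where \<eta>: "0 < \<eta>" "\<eta> < 1 / 2" "\<And>u. u \<noteq> x \<Longrightarrow> \<bar>u - x\<bar> < \<eta> \<Longrightarrow> \<gamma> u \<notin> P" using isolated by blast
  have r1: "\<gamma> u \<notin> P" if "u \<in> {x<..<x + \<eta>}" for u using \<eta>(3)[of u] that by auto
  have r2: "\<gamma> u \<notin> P" if "u \<in> {x + 1 - \<eta><..<x + 1}" for u
  proof -
    have "\<gamma> (u - 1) \<notin> P" using \<eta>(3)[of "u - 1"] that by (auto simp: abs_less_iff)
    then show ?thesis using \<gamma>_per[of "u - 1"] by simp
  qed
  have lt1: "x < x + \<eta>" and lt2: "x + 1 - \<eta> < x + 1" using \<eta>(1) by auto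
  obtain D1 E1 where "arc_derivatives x (x + \<eta>) D1 E1" using arc_derivatives_exist[OF lt1 r1] by blast
  note D1 = arc_derivativesD[OF this]
  obtain D2 E2 where "arc_derivatives (x + 1 - \<eta>) (x + 1) D2 E2" using arc_derivatives_exist[OF lt2 r2] by blast
  note D2 = arc_derivativesD[OF this]
  have n1: "D1 (x, t) \<noteq> 0" and n2: "D2 (x + 1, t) \<noteq> 0" if "t \<in> {0..T}" for t
    using D1(5)[of x t] D2(5)[of "x + 1" t] \<eta>(1) that by auto
  have tq: "tangent_quotient (\<lambda>s. \<Gamma> s t) x = D1 (x, t) / D2 (x + 1, t)" if "t \<in> {0..T}" for t
    using D1(6)[OF that] D2(7)[OF that] left_derivative_shift[OF that, of x] by (simp add: tangent_quotient_def)
  obtain \<theta> where \<theta>: "continuous_on ({x..x + 1} \<times> {0..T}) \<theta>"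
    "\<And>s t. s \<in> {x<..<x + 1} \<Longrightarrow> t \<in> {0..T} \<Longrightarrow> sgn (\<Gamma> s t - \<Gamma> x t) = cis (\<theta> (s, t))"
    "\<And>t. t \<in> {0..T} \<Longrightarrow> sgn (D1 (x, t)) = cis (\<theta> (x, t))"
    "\<And>t. t \<in> {0..T} \<Longrightarrow> - sgn (D2 (x + 1, t)) = cis (\<theta> (x + 1, t))"
  proof (rule window_arg_lift[where a=x and a'="x + \<eta>" and b'="x + 1 - \<eta>" and b="x + 1" and T=T
        and g="\<lambda>s t. \<Gamma> s t - \<Gamma> x t" and ?D1.0=D1 and ?D2.0=D2])
    show "continuous_on ({x..x + 1} \<times> {0..T}) (\<lambda>(s, t). \<Gamma> s t - \<Gamma> x t)"
    proof -
      have "continuous_on ({x..x + 1} \<times> {0..T}) (\<lambda>z. \<Gamma> x (snd z))"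
        by (rule continuous_on_compose2[OF cont_t]) (auto intro!: continuous_intros)
      then show ?thesis unfolding case_prod_beta by (intro continuous_on_diff cont_on) auto
    qed
    show "\<Gamma> (x + 1) t - \<Gamma> x t = 0" if "t \<in> {0..T}" for t using per[OF that] by simp
    show "\<Gamma> s t - \<Gamma> x t \<noteq> 0" if "s \<in> {x<..<x + 1}" "t \<in> {0..T}" for s t
      using periodic_simple_path_inj[OF simple[OF that(2)] per[OF that(2)], of x s] that(1) by auto
    show "((\<lambda>s. \<Gamma> s t - \<Gamma> x t) has_vector_derivative D1 (s, t)) (at s within {x..x + \<eta>})" if "s \<in> {x..x + \<eta>}" "t \<in> {0..T}" for s t
      using has_vector_derivative_diff[OF D1(3)[OF that] has_vector_derivative_const] by simp
    show "((\<lambda>s. \<Gamma> s t - \<Gamma> x t) has_vector_derivative D2 (s, t)) (at s within {x + 1 - \<eta>..x + 1})" if "s \<in> {x + 1 - \<eta>..x + 1}" "t \<in> {0..T}" for s t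
      using has_vector_derivative_diff[OF D2(3)[OF that] has_vector_derivative_const] by simp
  qed (use \<eta> D1(1) D2(1) n1 n2 in auto)
  \<comment> \<open>At \<open>x\<close> the direction is the outgoing tangent, at
    \<open>x + 1\<close> the negative of the incoming one; with the argument of their quotient
    added, the increment is pi modulo 2 pi.\<close>
  define k where "k t = (\<theta> (x + 1, t) - \<theta> (x, t) + Arg (tangent_quotient (\<lambda>s. \<Gamma> s t) x) - pi) / (2 * pi)" for t
  have ck: "continuous_on {0..T} k"
  proof -
    have "continuous_on {0..T} (\<lambda>t. D1 (x, t) / D2 (x + 1, t))"
      using continuous_on_fst_param[OF D1(1), of x] continuous_on_fst_param[OF D2(1), of "x + 1"] \<eta>(1) n2
      by (intro continuous_on_divide) auto
    \<comment> \<open>Corners are not cusps and at regular points the quotient is 1, so the branch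
      cut of \<open>Arg\<close> is avoided.\<close>
    then have "continuous_on {0..T} (\<lambda>t. Arg (D1 (x, t) / D2 (x + 1, t)))"
    proof (rule continuous_on_Arg')
      fix t assume t: "t \<in> {0..T}"
      show "D1 (x, t) / D2 (x + 1, t) \<notin> \<real>\<^sub>\<le>\<^sub>0"
        using no_cusp[OF t, of x] tangent_quotient_regular[OF t, of x] unfolding tq[OF t]
        by (cases "\<gamma> x \<in> P") auto
    qed
    then have "continuous_on {0..T} (\<lambda>t. Arg (tangent_quotient (\<lambda>s. \<Gamma> s t) x))"
      by (rule continuous_on_eq) (simp add: tq)
    then show ?thesis
      unfolding k_def using continuous_on_fst_param[OF \<theta>(1), of x] continuous_on_fst_param[OF \<theta>(1), of "x + 1"]
      by (intro continuous_on_divide continuous_on_diff continuous_on_add continuous_on_const) auto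
  qed
  have "k t \<in> \<int>" if t: "t \<in> {0..T}" for t
  proof -
    have "cis (\<theta> (x + 1, t) - \<theta> (x, t) + Arg (tangent_quotient (\<lambda>s. \<Gamma> s t) x)) = cis pi"
      unfolding cis_mult[symmetric] cis_divide[symmetric] \<theta>(3)[OF t, symmetric] \<theta>(4)[OF t, symmetric] tq[OF t]
        cis_Arg_divide[OF n1[OF t] n2[OF t]]
      using n1[OF t] n2[OF t] by (simp add: sgn_zero_iff)
    from cis_eq_imp_Ints[OF this] show ?thesis by (simp add: k_def)
  qed
  then have kc: "k t = k t'" if "t \<in> {0..T}" "t' \<in> {0..T}" for t t'
    by (intro connected_Ints_valued_constant[OF _ ck]) (use that in auto)
  show ?thesis
  proof (rule that[OF \<theta>(1,2)])
    fix t t' assume "t \<in> {0..T}" "t' \<in> {0..T}"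
    from kc[OF this] show "\<theta> (x + 1, t) - \<theta> (x, t) + Arg (tangent_quotient (\<lambda>s. \<Gamma> s t) x)
      = \<theta> (x + 1, t') - \<theta> (x, t') + Arg (tangent_quotient (\<lambda>s. \<Gamma> s t') x)" by (simp add: k_def)
  qed
qed

lemma sign:
  obtains \<sigma> :: real where "\<sigma> = 1 \<or> \<sigma> = - 1"
    "\<And>c. arg_inc (\<lambda>s. \<gamma> s - \<gamma> c) c (c + 1) = \<sigma> * pi" "arg_inc \<gamma>' 0 1 = 2 * pi * \<sigma>"
  using turning_tangents[OF \<gamma>_per \<gamma>_deriv \<gamma>'_cont _ periodic_simple_path_inj[OF \<gamma>_simple \<gamma>_per]] \<gamma>_nz
  by (metis \<gamma>'_def)

text \<open>One sign from Hopf's theorem for all base points of the initial curve;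
  \<open>orientation\<close> identifies it with the orientation of every evolved curve.\<close>

definition \<sigma> :: real where "\<sigma> = (SOME \<sigma>. (\<sigma> = 1 \<or> \<sigma> = - 1) \<and>
    (\<forall>c. arg_inc (\<lambda>s. \<gamma> s - \<gamma> c) c (c + 1) = \<sigma> * pi) \<and> arg_inc \<gamma>' 0 1 = 2 * pi * \<sigma>)"

lemma \<sigma>: "\<sigma> = 1 \<or> \<sigma> = - 1" and \<sigma>_window: "arg_inc (\<lambda>s. \<gamma> s - \<gamma> c) c (c + 1) = \<sigma> * pi"
  and \<sigma>_turning: "arg_inc \<gamma>' 0 1 = 2 * pi * \<sigma>"
proof -
  have "(\<sigma> = 1 \<or> \<sigma> = - 1) \<and> (\<forall>c. arg_inc (\<lambda>s. \<gamma> s - \<gamma> c) c (c + 1) = \<sigma> * pi) \<and> arg_inc \<gamma>' 0 1 = 2 * pi * \<sigma>"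
    unfolding \<sigma>_def by (rule someI_ex) (use sign in metis)
  then show "\<sigma> = 1 \<or> \<sigma> = - 1" "arg_inc (\<lambda>s. \<gamma> s - \<gamma> c) c (c + 1) = \<sigma> * pi" "arg_inc \<gamma>' 0 1 = 2 * pi * \<sigma>" by auto
qed

text \<open>At \<open>t = 0\<close> there are no corners and Hopf's theorem gives
  \<open>\<sigma> * pi\<close>; \<open>window\<close> carries the value to all times. At a corner
  the increment is \<open>\<sigma>\<close> times the interior angle.\<close>

lemma window_increment:
  obtains \<theta> where "continuous_on ({x..x + 1} \<times> {0..T}) \<theta>"
    "\<And>s t. s \<in> {x<..<x + 1} \<Longrightarrow> t \<in> {0..T} \<Longrightarrow> sgn (\<Gamma> s t - \<Gamma> x t) = cis (\<theta> (s, t))"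
    "\<And>t. t \<in> {0..T} \<Longrightarrow> \<theta> (x + 1, t) - \<theta> (x, t) = \<sigma> * pi - Arg (tangent_quotient (\<lambda>s. \<Gamma> s t) x)"
proof -
  obtain \<theta> where \<theta>: "continuous_on ({x..x + 1} \<times> {0..T}) \<theta>"
    "\<And>s t. s \<in> {x<..<x + 1} \<Longrightarrow> t \<in> {0..T} \<Longrightarrow> sgn (\<Gamma> s t - \<Gamma> x t) = cis (\<theta> (s, t))"
    "\<And>t t'. t \<in> {0..T} \<Longrightarrow> t' \<in> {0..T} \<Longrightarrow>
      \<theta> (x + 1, t) - \<theta> (x, t) + Arg (tangent_quotient (\<lambda>s. \<Gamma> s t) x)
      = \<theta> (x + 1, t') - \<theta> (x, t') + Arg (tangent_quotient (\<lambda>s. \<Gamma> s t') x)"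
    using window by blast
  have 0: "0 \<in> {0..T}" using T by simp
  have "arg_lift (\<lambda>s. \<gamma> s - \<gamma> x) x (x + 1) (\<lambda>s. \<theta> (s, 0))"
    using \<theta>(2)[OF _ 0] continuous_on_snd_param[OF \<theta>(1) 0] by (simp add: arg_lift_def init)
  from arg_inc_eq[OF _ this] have "\<theta> (x + 1, 0) - \<theta> (x, 0) = \<sigma> * pi" using \<sigma>_window[of x] by simp
  then have "\<theta> (x + 1, t) - \<theta> (x, t) = \<sigma> * pi - Arg (tangent_quotient (\<lambda>s. \<Gamma> s t) x)" if "t \<in> {0..T}" for t
    using \<theta>(3)[OF that 0] by (simp add: tangent_quotient_initial)
  with \<theta>(1,2) show ?thesis by (rule that)
qed

text \<open>The window criterion is applied at a regular base point, where the correction by the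
  corner angle vanishes. A small positive parameter is taken because 0 itself may be
  singular.\<close>

lemma orientation:
  assumes t: "t \<in> {0..T}"
  shows "orientation_sign (\<lambda>s. \<Gamma> s t) = \<sigma>"
    and "z \<in> enclosed_region (\<lambda>s. \<Gamma> s t) \<Longrightarrow> winding_number (\<lambda>s. \<Gamma> s t) z = of_real \<sigma>"
proof -
  obtain \<eta> where \<eta>: "0 < \<eta>" "\<eta> < 1 / 2" "\<And>u. u \<noteq> 0 \<Longrightarrow> \<bar>u - 0\<bar> < \<eta> \<Longrightarrow> \<gamma> u \<notin> P" using isolated by blast
  define x where "x = \<eta> / 2"
  have x: "\<gamma> x \<notin> P" using \<eta>(1) by (intro \<eta>(3)) (auto simp: x_def)
  obtain \<theta> where \<theta>: "continuous_on ({x..x + 1} \<times> {0..T}) \<theta>"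
    "\<And>s t. s \<in> {x<..<x + 1} \<Longrightarrow> t \<in> {0..T} \<Longrightarrow> sgn (\<Gamma> s t - \<Gamma> x t) = cis (\<theta> (s, t))"
    "\<And>t. t \<in> {0..T} \<Longrightarrow> \<theta> (x + 1, t) - \<theta> (x, t) = \<sigma> * pi - Arg (tangent_quotient (\<lambda>s. \<Gamma> s t) x)"
    using window_increment by blast
  have lift: "arg_lift (\<lambda>s. \<Gamma> s t - \<Gamma> x t) x (x + 1) (\<lambda>s. \<theta> (s, t))"
    using \<theta>(2)[OF _ t] continuous_on_snd_param[OF \<theta>(1) t] by (simp add: arg_lift_def)
  have inc: "\<theta> (x + 1, t) - \<theta> (x, t) = \<sigma> * pi" using \<theta>(3)[OF t] tangent_quotient_regular[OF t x] by simp
  note os = orientation_sign_eq_window[OF simple[OF t] cont_s[OF t] per[OF t] lift inc \<sigma>]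
  show "orientation_sign (\<lambda>s. \<Gamma> s t) = \<sigma>" by (rule os(1))
  show "z \<in> enclosed_region (\<lambda>s. \<Gamma> s t) \<Longrightarrow> winding_number (\<lambda>s. \<Gamma> s t) z = of_real \<sigma>" by (rule os(2))
qed

end

section \<open>Angles and the metric along the evolved curves\<close>

lemma cis_sum: "cis (\<Sum>i\<in>A. f i) = (\<Prod>i\<in>A. cis (f i))"
  by (induction A rule: infinite_finite_induct) (auto simp: cis_mult[symmetric])

section \<open>Density of the metric near the singular points\<close>

context conical_flow
begin

lemma density_pos: "z \<notin> P \<Longrightarrow> \<rho> z > 0"
  and density_smooth: "smooth_on (- P) \<rho>"
  and density_flat: "z \<notin> P \<Longrightarrow> gauss_curvature \<rho> z = 0"
  and conical: "j \<in> {1..n} \<Longrightarrow> conical_point \<rho> (p j) (\<beta> j)"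
  using metric unfolding flat_conical_metric_def P_def[symmetric] by simp_all

lemma open_regular: "open (- P)"
  using finite_P by (simp add: finite_imp_closed open_Compl)

lemma density_differentiable: "z \<notin> P \<Longrightarrow> \<rho> differentiable (at z)"
proof -
  have "Ck_on (- P) \<rho> (Suc 0)" using density_smooth unfolding smooth_on_def by blast
  then show "z \<notin> P \<Longrightarrow> \<rho> differentiable (at z)" by simp
qed

lemma density_continuous: "continuous_on (- P) \<rho>"
  using density_differentiable differentiable_imp_continuous_within
  by (auto simp: continuous_on_eq_continuous_at[OF open_regular])

lemma log_gradient_decomposition:
  obtains H h where "\<And>z. (H has_field_derivative h z) (at z)"
    "\<And>z. z \<notin> P \<Longrightarrow> log_gradient \<rho> z = (\<Sum>j=1..n. of_real (\<beta> j) / (z - p j)) + h z"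
proof -
  have hol: "log_gradient \<rho> holomorphic_on - p ` {1..n}"
    by (rule log_gradient_holomorphic) (use open_regular density_pos density_smooth density_flat in \<open>auto simp: P_def\<close>)
  have res: "((\<lambda>z. (z - p j) * log_gradient \<rho> z) \<longlongrightarrow> of_real (\<beta> j)) (at (p j))" if "j \<in> {1..n}" for j
    using conical_point_local[OF conical[OF that]] by metis
  from partial_fractions_primitive[OF inj_p hol res] that show ?thesis unfolding P_def by blast
qed

lemma density_bound:
  assumes "q \<in> P"
  obtains \<epsilon> C b where "\<epsilon> > 0" "C > 0" "- 2 < b" "\<And>z. z \<in> ball q \<epsilon> - {q} \<Longrightarrow> \<rho> z \<le> C * norm (z - q) powr b"
proof -
  obtain j where j: "j \<in> {1..n}" "q = p j" using assms by (auto simp: P_def)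
  obtain \<epsilon> C where "\<epsilon> > 0" "C > 0" "\<And>z. z \<in> ball q \<epsilon> - {q} \<Longrightarrow> \<rho> z \<le> C * norm (z - q) powr (2 * \<beta> j)"
    using conical_point_local[OF conical[OF j(1)]] j(2) by metis
  moreover have "- 2 < 2 * \<beta> j" using \<beta>[OF j(1)] by simp
  ultimately show ?thesis using that by blast
qed

text \<open>Near a singular point the cut-off is at most the squared distance over
  \<open>\<delta>\<^sup>2\<close> and the density at most a multiple of the distance to the power
  \<open>b > - 2\<close>, so the product is bounded by a positive power of the distance.\<close>

lemma density_cutoff_continuous:
  assumes \<delta>: "\<delta> > 0"
  shows "continuous_on UNIV (\<lambda>z. if z \<in> P then 0 else \<rho> z * cutoff P \<delta> z)" (is "continuous_on UNIV ?f")
proof (rule continuous_at_imp_continuous_on, rule ballI)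
  fix z
  show "isCont ?f z"
  proof (cases "z \<in> P")
    case False
    have "continuous_on (- P) (\<lambda>z. \<rho> z * cutoff P \<delta> z)"
      by (intro continuous_on_mult density_continuous continuous_on_cutoff \<delta> continuous_on_id)
    then have "continuous_on (- P) ?f" by (rule continuous_on_eq) auto
    then show ?thesis using False open_regular by (simp add: continuous_on_eq_continuous_at)
  next
    case True
    obtain \<epsilon> C b where \<epsilon>: "\<epsilon> > 0" "C > 0" "- 2 < b" "\<And>w. w \<in> ball z \<epsilon> - {z} \<Longrightarrow> \<rho> w \<le> C * norm (w - z) powr b"
      using density_bound[OF True] by blast
    have "(?f \<longlongrightarrow> 0) (at z)"
    proof (rule Lim_null_comparison)
      have "((\<lambda>w. C / \<delta>\<^sup>2 * norm (w - z) powr (b + 2)) \<longlongrightarrow> C / \<delta>\<^sup>2 * 0) (at z)"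
      proof (intro tendsto_mult tendsto_const tendsto_zero_powrI)
        have "((\<lambda>w. norm (w - z)) \<longlongrightarrow> norm (z - z)) (at z)" by (intro tendsto_intros)
        then show "((\<lambda>w. norm (w - z)) \<longlongrightarrow> 0) (at z)" by simp
      qed (use \<epsilon>(3) in auto)
      then show "((\<lambda>w. C / \<delta>\<^sup>2 * norm (w - z) powr (b + 2)) \<longlongrightarrow> 0) (at z)" by simp
      have "\<forall>\<^sub>F w in at z. w \<in> ball z \<epsilon> - {z}"
        using eventually_at_in_open[of "ball z \<epsilon>" z] \<epsilon>(1) by simp
      then show "\<forall>\<^sub>F w in at z. norm (?f w) \<le> C / \<delta>\<^sup>2 * norm (w - z) powr (b + 2)"
      proof eventually_elim
        case (elim w)
        show ?case
        proof (cases "w \<in> P")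
          case False
          have n: "norm (w - z) > 0" using elim by auto
          have "cutoff P \<delta> w \<le> (norm (w - z))\<^sup>2 / ((norm (w - z))\<^sup>2 + \<delta>\<^sup>2)"
          proof -
            have "cutoff P \<delta> w = (norm (w - z))\<^sup>2 / ((norm (w - z))\<^sup>2 + \<delta>\<^sup>2) * cutoff (P - {z}) \<delta> w"
              unfolding cutoff_def by (rule prod.remove[OF finite_P True])
            then show ?thesis
              using cutoff_bounds[OF \<delta>, of "P - {z}" w] cutoff_factor_bounds[OF \<delta>, of w z] by (simp only: mult_left_le)
          qed
          also have "\<dots> \<le> (norm (w - z))\<^sup>2 / \<delta>\<^sup>2"
            using \<delta> by (intro divide_left_mono) (auto simp: add_nonneg_pos)
          finally have c: "cutoff P \<delta> w \<le> (norm (w - z))\<^sup>2 / \<delta>\<^sup>2" .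
          have "\<rho> w * cutoff P \<delta> w \<le> (C * norm (w - z) powr b) * ((norm (w - z))\<^sup>2 / \<delta>\<^sup>2)"
            using \<epsilon>(4)[OF elim] c cutoff_bounds[OF \<delta>, of P w] \<epsilon>(2) by (intro mult_mono) auto
          also have "\<dots> = C / \<delta>\<^sup>2 * norm (w - z) powr (b + 2)"
            using n by (simp add: powr_add)
          finally show ?thesis
            using False density_pos[OF False] cutoff_bounds[OF \<delta>, of P w] by simp
        qed (use \<epsilon>(2) in simp)
      qed
    qed
    then show ?thesis using True by (simp add: isCont_def)
  qed
qed

text \<open>Near each singular point the power bound is integrable; the rest of the disc is compact
  and \<open>\<rho>\<close> is continuous on it. Measurability is transferred across the finite set
  \<open>P\<close>, where the values of \<open>\<rho>\<close> are arbitrary.\<close>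

lemma density_integrable: "set_integrable lborel (cball 0 R) \<rho>"
proof -
  have meas: "\<rho> \<in> borel_measurable borel"
  proof (rule measurable_discrete_difference)
    show "(\<lambda>z. indicator (- P) z *\<^sub>R \<rho> z) \<in> borel_measurable borel"
      by (rule borel_measurable_continuous_on_indicator[OF _ density_continuous]) (use open_regular in auto)
    show "countable P" using finite_P by (rule countable_finite)
  qed auto
  obtain e C b where e: "\<And>q. q \<in> P \<Longrightarrow> e q > 0" "\<And>q. q \<in> P \<Longrightarrow> C q > (0::real)" "\<And>q. q \<in> P \<Longrightarrow> - 2 < (b q :: real)"
    "\<And>q z. q \<in> P \<Longrightarrow> z \<in> ball q (e q) - {q} \<Longrightarrow> \<rho> z \<le> C q * norm (z - q) powr b q"
  proof -
    have "\<forall>q. \<exists>e C b. q \<in> P \<longrightarrow> e > 0 \<and> C > (0::real) \<and> - 2 < (b::real) \<and> (\<forall>z\<in>ball q e - {q}. \<rho> z \<le> C * norm (z - q) powr b)"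
      using density_bound by (metis (no_types, lifting))
    then show ?thesis using that by metis
  qed
  define U where "U = (\<Union>q\<in>P. ball q (e q))"
  define K where "K = cball 0 R - U"
  have U: "open U" by (auto simp: U_def)
  have near: "set_integrable lborel (ball q (e q)) \<rho>" if q: "q \<in> P" for q
  proof (rule set_integrable_bound)
    have "set_integrable lborel (cball q (e q)) (\<lambda>z. norm (z - q) powr b q)"
      by (rule set_integrable_norm_powr_cball) (use e(1,3)[OF q] in auto)
    then have "set_integrable lborel (ball q (e q)) (\<lambda>z. norm (z - q) powr b q)"
      by (rule set_integrable_subset) auto
    then show "set_integrable lborel (ball q (e q)) (\<lambda>z. C q * norm (z - q) powr b q)"
      by (rule set_integrable_mult_right)
    show "set_borel_measurable lborel (ball q (e q)) \<rho>"
      unfolding set_borel_measurable_def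
      by (intro borel_measurable_scaleR borel_measurable_indicator) (use meas in auto)
    have "AE z in lborel. z \<notin> P" using finite_imp_null_set_lborel[OF finite_P] by (rule AE_not_in)
    then show "AE z in lborel. z \<in> ball q (e q) \<longrightarrow> norm (\<rho> z) \<le> norm (C q * norm (z - q) powr b q)"
    proof eventually_elim
      case (elim z)
      show ?case
      proof
        assume z: "z \<in> ball q (e q)"
        then have "z \<in> ball q (e q) - {q}" using elim q by auto
        from e(4)[OF q this] show "norm (\<rho> z) \<le> norm (C q * norm (z - q) powr b q)"
          using density_pos[OF elim] e(2)[OF q] by (simp add: abs_mult)
      qed
    qed
  qed
  have "K \<subseteq> - P" using e(1) by (auto simp: K_def U_def)
  moreover have K: "compact K" unfolding K_def using U by (rule compact_diff[OF compact_cball])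
  ultimately have cK: "continuous_on K \<rho>" using continuous_on_subset[OF density_continuous] by blast
  have far: "set_integrable lborel K \<rho>" using borel_integrable_compact[OF K cK] by (simp add: set_integrable_def)
  have "set_integrable lborel U \<rho>"
    unfolding U_def by (rule set_integrable_UN[OF finite_P near]) auto
  then have "set_integrable lborel (K \<union> U) \<rho>"
    by (rule set_integrable_Un[OF far]) (use K U in \<open>auto simp: borel_compact\<close>)
  then show ?thesis by (rule set_integrable_subset) (auto simp: K_def)
qed

section \<open>Parameters at which the curves pass through singular points\<close>

lemma \<gamma>_range: "\<gamma> s \<in> path_image \<gamma>"
proof -
  interpret periodic_fun_simple \<gamma> "1::real" by standard (rule \<gamma>_per)
  have "\<gamma> (s - of_int \<lfloor>s\<rfloor>) = \<gamma> s" using minus_of_int[of s "\<lfloor>s\<rfloor>"] by simp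
  moreover have "s - of_int \<lfloor>s\<rfloor> \<in> {0..1}"
    unfolding atLeastAtMost_iff using floor_correct[of s] by linarith
  ultimately show ?thesis unfolding path_image_def by (metis image_eqI)
qed

lemma inner_point_off_curve: "j \<in> {m+1..n} \<Longrightarrow> \<gamma> s \<noteq> p j"
  using inner_points \<gamma>_range[of s] inside_no_overlap[of "path_image \<gamma>"] unfolding enclosed_region_def by blast

text \<open>Singular parameters are fixed and regular ones avoid \<open>P\<close>. Hence the
  \<open>THE\<close> in \<open>exterior_angle\<close> picks the same parameter
  \<open>corner j\<close> at all times.\<close>

lemma hits_iff:
  assumes "t \<in> {0..T}" "j \<in> {1..n}"
  shows "\<Gamma> s t = p j \<longleftrightarrow> \<gamma> s = p j"
proof (cases "\<gamma> s \<in> P")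
  case True then show ?thesis using fixed[OF assms(1) True] by simp
next
  case False
  then show ?thesis using avoid[OF assms(1) False] assms(2) by (auto simp: P_def)
qed

lemma corner_parameter_ex1:
  assumes "j \<in> {1..m}"
  shows "\<exists>!s. s \<in> {0..<1} \<and> \<gamma> s = p j"
proof -
  have "p j \<in> path_image \<gamma>" using on_curve assms by auto
  then obtain s where s: "s \<in> {0..1}" "\<gamma> s = p j" by (auto simp: path_image_def)
  have "\<gamma> 1 = \<gamma> 0" using \<gamma>_per[of 0] by simp
  then have "\<exists>s. s \<in> {0..<1} \<and> \<gamma> s = p j"
    using s by (cases "s = 1") (auto intro: exI[of _ 0] exI[of _ s])
  moreover have "x = y" if "x \<in> {0..<1} \<and> \<gamma> x = p j" "y \<in> {0..<1} \<and> \<gamma> y = p j" for x y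
    using periodic_simple_path_inj[OF \<gamma>_simple \<gamma>_per, of x y] periodic_simple_path_inj[OF \<gamma>_simple \<gamma>_per, of y x] that
    by (cases x y rule: linorder_cases) auto
  ultimately show ?thesis by blast
qed

definition corner :: "nat \<Rightarrow> real" where "corner j = (THE s. s \<in> {0..<1} \<and> \<gamma> s = p j)"

lemma corner: "j \<in> {1..m} \<Longrightarrow> corner j \<in> {0..<1}" "j \<in> {1..m} \<Longrightarrow> \<gamma> (corner j) = p j"
  unfolding corner_def using theI'[OF corner_parameter_ex1] by blast+

lemma corner_unique: "j \<in> {1..m} \<Longrightarrow> s \<in> {0..<1} \<Longrightarrow> \<gamma> s = p j \<Longrightarrow> corner j = s"
  using corner_parameter_ex1[of j] corner[of j] by blast

lemma exterior_angle_eq: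
  assumes "t \<in> {0..T}" "j \<in> {1..m}"
  shows "exterior_angle (\<lambda>s. \<Gamma> s t) (p j) = \<sigma> * Arg (tangent_quotient (\<lambda>s. \<Gamma> s t) (corner j))"
proof -
  have "j \<in> {1..n}" using assms(2) m_le by auto
  note h = hits_iff[OF assms(1) this]
  show ?thesis
    unfolding exterior_angle_def orientation(1)[OF assms(1)] h corner_def[symmetric] ..
qed

end

text \<open>\<open>Dss\<close> and \<open>Dst\<close> carry no arc index: off the singular
  parameters \<open>\<Gamma>\<close> is smooth for \<open>0 < t < T\<close>, and one function serves
  all arcs.\<close>

locale partitioned_flow = conical_flow +
  fixes b :: "nat \<Rightarrow> real" and r :: nat and D E :: "nat \<Rightarrow> real \<times> real \<Rightarrow> complex" and Dss Dst :: "real \<times> real \<Rightarrow> complex"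
  assumes b: "strict_mono_on {..r} b" "b 0 = 0" "b r = 1"
    and arcs: "\<And>i s. i < r \<Longrightarrow> s \<in> {b i<..<b (Suc i)} \<Longrightarrow> \<gamma> s \<notin> P"
    and breaks: "\<And>s. s \<in> {0..1} \<Longrightarrow> \<gamma> s \<in> P \<Longrightarrow> \<exists>i\<le>r. s = b i"
    and DE: "\<And>i. i < r \<Longrightarrow> arc_derivatives (b i) (b (Suc i)) (D i) (E i)"
    and Dst: "\<And>i. i < r \<Longrightarrow> continuous_on ({b i<..<b (Suc i)} \<times> {0<..<T}) Dst"
    and dDt: "\<And>i s t. i < r \<Longrightarrow> s \<in> {b i<..<b (Suc i)} \<Longrightarrow> t \<in> {0<..<T} \<Longrightarrow> ((\<lambda>t. D i (s, t)) has_vector_derivative Dst (s, t)) (at t)"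
    and dEs: "\<And>i s t. i < r \<Longrightarrow> s \<in> {b i<..<b (Suc i)} \<Longrightarrow> t \<in> {0<..<T} \<Longrightarrow> ((\<lambda>s. E i (s, t)) has_vector_derivative Dst (s, t)) (at s)"
    and dDs: "\<And>i s t. i < r \<Longrightarrow> s \<in> {b i<..<b (Suc i)} \<Longrightarrow> t \<in> {0<..<T} \<Longrightarrow> ((\<lambda>s. D i (s, t)) has_vector_derivative Dss (s, t)) (at s)"
begin

sublocale singular_flow \<Gamma> T b r D E "\<lambda>_. Dst" P
proof unfold_locales
  show "0 < T" by (rule T)
  show "continuous_on (UNIV \<times> {0..T}) (\<lambda>(s, t). \<Gamma> s t)" by (rule cont)
  show "finite P" by (rule finite_P)
  fix i assume i: "i < r"
  note a = arc_derivativesD[OF DE[OF i]]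
  show "continuous_on ({b i..b (Suc i)} \<times> {0..T}) (D i)" "continuous_on ({b i..b (Suc i)} \<times> {0..T}) (E i)"
    by (rule a)+
  show "continuous_on ({b i<..<b (Suc i)} \<times> {0<..<T}) Dst" by (rule Dst[OF i])
  fix s t
  show "s \<in> {b i..b (Suc i)} \<Longrightarrow> t \<in> {0..T} \<Longrightarrow> ((\<lambda>s. \<Gamma> s t) has_vector_derivative D i (s, t)) (at s within {b i..b (Suc i)})"
    "s \<in> {b i..b (Suc i)} \<Longrightarrow> t \<in> {0..T} \<Longrightarrow> (\<Gamma> s has_vector_derivative E i (s, t)) (at t within {0..T})"
    "s \<in> {b i..b (Suc i)} \<Longrightarrow> t \<in> {0..T} \<Longrightarrow> D i (s, t) \<noteq> 0"
    by (rule a; assumption)+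
  show "s \<in> {b i<..<b (Suc i)} \<Longrightarrow> t \<in> {0<..<T} \<Longrightarrow> ((\<lambda>t. D i (s, t)) has_vector_derivative Dst (s, t)) (at t)"
    "s \<in> {b i<..<b (Suc i)} \<Longrightarrow> t \<in> {0<..<T} \<Longrightarrow> ((\<lambda>s. E i (s, t)) has_vector_derivative Dst (s, t)) (at s)"
    by (rule dDt[OF i] dEs[OF i]; assumption)+
  show "s \<in> {b i<..<b (Suc i)} \<Longrightarrow> t \<in> {0..T} \<Longrightarrow> \<Gamma> s t \<notin> P"
    using avoid arcs[OF i] by blast
next
  fix i q assume "q \<in> P"
  then show "(\<forall>t\<in>{0..T}. \<Gamma> (b i) t = q) \<or> (\<forall>t\<in>{0..T}. \<Gamma> (b i) t \<noteq> q)"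
    using fixed[of _ "b i"] avoid[of _ "b i"] by (cases "\<gamma> (b i) \<in> P") metis+
qed (use b per simple in auto)

text \<open>The argument of \<open>\<Gamma> s t - p j\<close> jumps at a corner, so it is lifted
  over the period that starts there. For an enclosed point the increment is \<open>2 * pi\<close>
  times a winding number, constant in time because the curves never meet \<open>p j\<close>.\<close>

lemma arc_arguments:
  assumes j: "j \<in> {1..n}"
  shows "\<exists>\<psi>. (\<forall>i<r. continuous_on ({b i..b (Suc i)} \<times> {0..T}) (\<psi> i)) \<and>
    (\<forall>i<r. \<forall>s\<in>{b i<..<b (Suc i)}. \<forall>t\<in>{0..T}. sgn (\<Gamma> s t - p j) = cis (\<psi> i (s, t))) \<and>
    (\<forall>t\<in>{0..T}. (\<Sum>i<r. \<psi> i (b (Suc i), t) - \<psi> i (b i, t)) =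
      (if j \<le> m then \<sigma> * (pi - exterior_angle (\<lambda>s. \<Gamma> s t) (p j)) else 2 * pi * \<sigma>))"
proof (cases "j \<le> m")
  case True
  then have jm: "j \<in> {1..m}" using j by auto
  define c where "c = corner j"
  have c: "c \<in> {0..<1}" "\<gamma> c = p j" using corner[OF jm] by (auto simp: c_def)
  have "\<gamma> c \<in> P" using c(2) j by (auto simp: P_def)
  then obtain k where k: "k \<le> r" "c = b k" using breaks[of c] c(1) by auto
  have "k \<noteq> r" using k c(1) b(3) by auto
  have pc: "\<Gamma> c t = p j" if "t \<in> {0..T}" for t using hits_iff[OF that j] c(2) by simp
  obtain \<theta> where \<theta>: "continuous_on ({c..c + 1} \<times> {0..T}) \<theta>"
    "\<And>s t. s \<in> {c<..<c + 1} \<Longrightarrow> t \<in> {0..T} \<Longrightarrow> sgn (\<Gamma> s t - \<Gamma> c t) = cis (\<theta> (s, t))"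
    "\<And>t. t \<in> {0..T} \<Longrightarrow> \<theta> (c + 1, t) - \<theta> (c, t) = \<sigma> * pi - Arg (tangent_quotient (\<lambda>s. \<Gamma> s t) c)"
    using window_increment by blast
  \<comment> \<open>Arcs before the corner are seen one period later, inside
    \<open>[c, c + 1]\<close>; the two groups of arcs telescope to the increment over that
    period.\<close>
  define \<psi> where "\<psi> i z = (if i < k then \<theta> (fst z + 1, snd z) else \<theta> z)" for i z
  have early: "b i \<ge> 0" "b (Suc i) \<le> c" if "i < k" for i
    using b_range[of i] b_mono[of "Suc i" k] that k by auto
  have late: "c \<le> b i" "b (Suc i) \<le> 1" if "\<not> i < k" "i < r" for i
    using b_range[of "Suc i"] b_mono[of k i] that k by auto
  have "continuous_on ({b i..b (Suc i)} \<times> {0..T}) (\<psi> i)" if i: "i < r" for i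
  proof (cases "i < k")
    case True
    have "continuous_on ({b i..b (Suc i)} \<times> {0..T}) (\<lambda>z. \<theta> (fst z + 1, snd z))"
    proof (rule continuous_on_compose2[OF \<theta>(1)])
      show "(\<lambda>z. (fst z + 1, snd z)) ` ({b i..b (Suc i)} \<times> {0..T}) \<subseteq> {c..c + 1} \<times> {0..T}"
        using early[OF True] c(1) by auto
    qed (intro continuous_intros)
    then show ?thesis using True by (simp add: \<psi>_def[abs_def])
  next
    case False
    have "continuous_on ({b i..b (Suc i)} \<times> {0..T}) \<theta>"
      by (rule continuous_on_subset[OF \<theta>(1)]) (use late[OF False i] c(1) in auto)
    then show ?thesis using False by (simp add: \<psi>_def[abs_def])
  qed
  moreover have "sgn (\<Gamma> s t - p j) = cis (\<psi> i (s, t))" if i: "i < r" and s: "s \<in> {b i<..<b (Suc i)}" and t: "t \<in> {0..T}" for i s t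
  proof (cases "i < k")
    case True
    have "s + 1 \<in> {c<..<c + 1}" using early[OF True] s c(1) by auto
    from \<theta>(2)[OF this t] show ?thesis using True pc[OF t] per[OF t, of s] by (simp add: \<psi>_def)
  next
    case False
    have "s \<in> {c<..<c + 1}" using late[OF False i] s c(1) by auto
    from \<theta>(2)[OF this t] show ?thesis using False pc[OF t] by (simp add: \<psi>_def)
  qed
  moreover have "(\<Sum>i<r. \<psi> i (b (Suc i), t) - \<psi> i (b i, t)) = \<sigma> * (pi - exterior_angle (\<lambda>s. \<Gamma> s t) (p j))" if t: "t \<in> {0..T}" for t
  proof -
    have "(\<Sum>i<r. \<psi> i (b (Suc i), t) - \<psi> i (b i, t)) = (\<Sum>i=0..<k. \<psi> i (b (Suc i), t) - \<psi> i (b i, t)) + (\<Sum>i=k..<r. \<psi> i (b (Suc i), t) - \<psi> i (b i, t))"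
      unfolding lessThan_atLeast0 by (rule sum.atLeastLessThan_concat[symmetric]) (use k in auto)
    also have "(\<Sum>i=0..<k. \<psi> i (b (Suc i), t) - \<psi> i (b i, t)) = (\<Sum>i=0..<k. \<theta> (b (Suc i) + 1, t) - \<theta> (b i + 1, t))"
      by (rule sum.cong) (auto simp: \<psi>_def)
    also have "\<dots> = \<theta> (c + 1, t) - \<theta> (1, t)"
      using sum_Suc_diff'[of 0 k "\<lambda>i. \<theta> (b i + 1, t)"] k b(2) by simp
    also have "(\<Sum>i=k..<r. \<psi> i (b (Suc i), t) - \<psi> i (b i, t)) = (\<Sum>i=k..<r. \<theta> (b (Suc i), t) - \<theta> (b i, t))"
      by (rule sum.cong) (auto simp: \<psi>_def)
    also have "\<dots> = \<theta> (1, t) - \<theta> (c, t)"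
      using sum_Suc_diff'[of k r "\<lambda>i. \<theta> (b i, t)"] k b(3) by simp
    finally have "(\<Sum>i<r. \<psi> i (b (Suc i), t) - \<psi> i (b i, t)) = \<sigma> * pi - Arg (tangent_quotient (\<lambda>s. \<Gamma> s t) c)"
      using \<theta>(3)[OF t] by simp
    also have "\<dots> = \<sigma> * (pi - exterior_angle (\<lambda>s. \<Gamma> s t) (p j))"
      unfolding exterior_angle_eq[OF t jm] c_def using \<sigma> by auto
    finally show ?thesis .
  qed
  ultimately show ?thesis using True by (intro exI[of _ \<psi>]) simp
next
  case False
  then have jm: "j \<in> {m+1..n}" using j by auto
  have nz: "\<Gamma> s t - p j \<noteq> 0" if "t \<in> {0..T}" for s t
    using hits_iff[OF that j] inner_point_off_curve[OF jm] by auto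
  have c\<Gamma>: "continuous_on ({0..1} \<times> {0..T}) (\<lambda>z. \<Gamma> (fst z) (snd z) - p j)"
    by (intro continuous_on_diff cont_on continuous_on_const) simp
  have nz': "\<Gamma> (fst z) (snd z) - p j \<noteq> 0" if "z \<in> {0..1} \<times> {0..T}" for z
    using nz that by auto
  have cv: "convex ({0..1::real} \<times> {0..T})" by (intro convex_Times) auto
  obtain \<theta> where \<theta>: "continuous_on ({0..1} \<times> {0..T}) \<theta>"
    "\<And>z. z \<in> {0..1} \<times> {0..T} \<Longrightarrow> sgn (\<Gamma> (fst z) (snd z) - p j) = cis (\<theta> z)"
    using arg_of_nonzero_on_convex[OF cv c\<Gamma> nz'] by blast
  define k where "k t = (\<theta> (1, t) - \<theta> (0, t)) / (2 * pi)" for t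
  have "k t \<in> \<int>" if "t \<in> {0..T}" for t
  proof -
    have "cis (\<theta> (1, t)) = cis (\<theta> (0, t))"
      using \<theta>(2)[of "(1, t)"] \<theta>(2)[of "(0, t)"] that per[OF that, of 0] by simp
    from cis_eq_imp_Ints[OF this] show ?thesis by (simp add: k_def)
  qed
  moreover have "continuous_on {0..T} k"
    unfolding k_def using continuous_on_fst_param[OF \<theta>(1), of 0] continuous_on_fst_param[OF \<theta>(1), of 1]
    by (intro continuous_on_divide continuous_on_diff continuous_on_const) auto
  ultimately have kc: "k t = k 0" if "t \<in> {0..T}" for t
    by (intro connected_Ints_valued_constant[of "{0..T}" k]) (use that T in auto)
  have T0: "0 \<in> {0..T}" using T by simp
  have "k 0 = \<sigma>"
  proof -
    have off: "p j \<notin> range \<gamma>" using inner_point_off_curve[OF jm] by (metis imageE)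
    have "arg_lift (\<lambda>s. \<gamma> s - p j) 0 (0 + 1) (\<lambda>s. \<theta> (s, 0))"
      unfolding arg_lift_def using continuous_on_snd_param[OF \<theta>(1) T0] \<theta>(2)[of "(_, 0)"] T by (auto simp: init)
    from arg_inc_eq[OF _ this] have "arg_inc (\<lambda>s. \<gamma> s - p j) 0 (0 + 1) = 2 * pi * k 0" by (simp add: k_def)
    then have "winding_number \<gamma> (p j) = of_real (k 0)"
      using winding_number_eq_arg_inc(1)[OF \<gamma>_cont \<gamma>_per off, of 0] by simp
    moreover have "winding_number \<gamma> (p j) = of_real \<sigma>"
    proof -
      have "p j \<in> enclosed_region \<gamma>" using inner_points jm by blast
      then show ?thesis using orientation(2)[OF T0, of "p j"] by (simp add: init)
    qed
    ultimately show ?thesis by (metis of_real_eq_iff)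
  qed
  then have inc: "\<theta> (1, t) - \<theta> (0, t) = 2 * pi * \<sigma>" if "t \<in> {0..T}" for t
    using kc[OF that] by (simp add: k_def field_simps)
  show ?thesis
  proof (intro exI[of _ "\<lambda>_. \<theta>"] conjI allI impI ballI)
    show "continuous_on ({b i..b (Suc i)} \<times> {0..T}) \<theta>" if "i < r" for i
      by (rule continuous_on_subset[OF \<theta>(1)]) (use b_range[of i] b_range[of "Suc i"] that in auto)
    show "sgn (\<Gamma> s t - p j) = cis (\<theta> (s, t))" if "i < r" "s \<in> {b i<..<b (Suc i)}" "t \<in> {0..T}" for i s t
      using \<theta>(2)[of "(s, t)"] b_range[of i] b_range[of "Suc i"] that by auto
    show "(\<Sum>i<r. \<theta> (b (Suc i), t) - \<theta> (b i, t)) = (if j \<le> m then \<sigma> * (pi - exterior_angle (\<lambda>s. \<Gamma> s t) (p j)) else 2 * pi * \<sigma>)"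
      if "t \<in> {0..T}" for t
      using sum_lessThan_telescope[of "\<lambda>i. \<theta> (b i, t)" r] inc[OF that] False b by simp
  qed
qed

text \<open>Break points off \<open>P\<close> have quotient 1 and contribute 0; the others are
  exactly the corners, since enclosed points are not on the curve. The break point
  \<open>b r\<close> is left out, being \<open>b 0\<close> up to the period.\<close>

lemma sum_corner_turns:
  assumes t: "t \<in> {0..T}"
  shows "(\<Sum>i<r. Arg (tangent_quotient (\<lambda>s. \<Gamma> s t) (b i))) = (\<Sum>j=1..m. \<sigma> * exterior_angle (\<lambda>s. \<Gamma> s t) (p j))"
proof -
  define g where "g s = Arg (tangent_quotient (\<lambda>s. \<Gamma> s t) s)" for s
  define I where "I = {i. i < r \<and> \<gamma> (b i) \<in> P}"
  have "(\<Sum>i<r. g (b i)) = (\<Sum>i\<in>I. g (b i))"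
    by (rule sum.mono_neutral_right) (auto simp: I_def g_def tangent_quotient_regular[OF t])
  also have "\<dots> = (\<Sum>x\<in>b ` I. g x)"
  proof (rule sum.reindex[symmetric, unfolded o_def])
    have "inj_on b {..r}" using b(1) by (rule strict_mono_on_imp_inj_on)
    then show "inj_on b I" by (rule inj_on_subset) (auto simp: I_def)
  qed
  also have "b ` I = corner ` {1..m}"
  proof
    show "b ` I \<subseteq> corner ` {1..m}"
    proof
      fix x assume "x \<in> b ` I"
      then obtain i where i: "i < r" "\<gamma> (b i) \<in> P" "x = b i" by (auto simp: I_def)
      then obtain j where j: "j \<in> {1..n}" "\<gamma> (b i) = p j" by (auto simp: P_def)
      have "j \<in> {1..m}" using inner_point_off_curve[of j "b i"] j by (cases "j \<le> m") auto
      moreover have "b i \<in> {0..<1}" using b_range[of i] b_less[OF i(1)] b_range[of "Suc i"] i(1) by auto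
      ultimately have "corner j = b i" using corner_unique j(2) by blast
      then show "x \<in> corner ` {1..m}" using i(3) \<open>j \<in> {1..m}\<close> by (metis imageI)
    qed
    show "corner ` {1..m} \<subseteq> b ` I"
    proof
      fix x assume "x \<in> corner ` {1..m}"
      then obtain j where j: "j \<in> {1..m}" "x = corner j" by auto
      have x: "x \<in> {0..<1}" "\<gamma> x \<in> P" using corner[OF j(1)] j m_le by (auto simp: P_def)
      then obtain i where i: "i \<le> r" "x = b i" using breaks[of x] by auto
      then have "i \<noteq> r" using x(1) b(3) by auto
      then show "x \<in> b ` I" using i x by (auto simp: I_def)
    qed
  qed
  also have "(\<Sum>x\<in>corner ` {1..m}. g x) = (\<Sum>j=1..m. g (corner j))"
  proof (rule sum.reindex[unfolded o_def])
    show "inj_on corner {1..m}"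
    proof (rule inj_onI)
      fix i j assume ij: "i \<in> {1..m}" "j \<in> {1..m}" "corner i = corner j"
      have "p i = p j" unfolding corner(2)[OF ij(1), symmetric] corner(2)[OF ij(2), symmetric] ij(3) ..
      moreover have "i \<in> {1..n}" "j \<in> {1..n}" using ij(1,2) m_le by auto
      ultimately show "i = j" by (rule inj_onD[OF inj_p])
    qed
  qed
  also have "\<dots> = (\<Sum>j=1..m. \<sigma> * exterior_angle (\<lambda>s. \<Gamma> s t) (p j))"
  proof (rule sum.cong[OF refl])
    fix j assume "j \<in> {1..m}"
    from exterior_angle_eq[OF t this] show "g (corner j) = \<sigma> * exterior_angle (\<lambda>s. \<Gamma> s t) (p j)"
      using \<sigma> by (auto simp: g_def)
  qed
  finally show ?thesis by (simp add: g_def)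
qed

text \<open>Increments along the arcs and jumps at the break points add up to a multiple of 2 pi, as
  the tangent directions cancel cyclically. The sum is continuous in \<open>t\<close> and equals
  \<open>2 * pi * \<sigma>\<close> at \<open>t = 0\<close> by Hopf's theorem.\<close>

lemma arc_tangents:
  "\<exists>\<theta>. (\<forall>i<r. continuous_on ({b i..b (Suc i)} \<times> {0..T}) (\<theta> i)) \<and>
    (\<forall>i<r. \<forall>s\<in>{b i..b (Suc i)}. \<forall>t\<in>{0..T}. sgn (D i (s, t)) = cis (\<theta> i (s, t))) \<and>
    (\<forall>t\<in>{0..T}. (\<Sum>i<r. \<theta> i (b (Suc i), t) - \<theta> i (b i, t)) = \<sigma> * (2 * pi - (\<Sum>j=1..m. exterior_angle (\<lambda>s. \<Gamma> s t) (p j))))"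
proof -
  have "\<exists>\<theta>. continuous_on ({b i..b (Suc i)} \<times> {0..T}) \<theta> \<and> (\<forall>z\<in>{b i..b (Suc i)} \<times> {0..T}. sgn (D i z) = cis (\<theta> z))" if i: "i < r" for i
  proof -
    have cv: "convex ({b i..b (Suc i)} \<times> {0..T})" by (intro convex_Times) auto
    have nz: "D i z \<noteq> 0" if "z \<in> {b i..b (Suc i)} \<times> {0..T}" for z using D_nz[OF i] that by auto
    obtain \<theta> where "continuous_on ({b i..b (Suc i)} \<times> {0..T}) \<theta>" "\<And>z. z \<in> {b i..b (Suc i)} \<times> {0..T} \<Longrightarrow> sgn (D i z) = cis (\<theta> z)"
      using arg_of_nonzero_on_convex[OF cv D[OF i] nz] by blast
    then show ?thesis by blast
  qed
  then obtain \<theta> where \<theta>: "\<And>i. i < r \<Longrightarrow> continuous_on ({b i..b (Suc i)} \<times> {0..T}) (\<theta> i)"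
    "\<And>i z. i < r \<Longrightarrow> z \<in> {b i..b (Suc i)} \<times> {0..T} \<Longrightarrow> sgn (D i z) = cis (\<theta> i z)"
    by metis
  have ends: "b i \<in> {b i..b (Suc i)}" "b (Suc i) \<in> {b i..b (Suc i)}" if "i < r" for i using b_less[OF that] by auto
  \<comment> \<open>The incoming tangent at the break point \<open>b i\<close>; at
    \<open>b 0\<close> it is the end tangent of the last arc.\<close>
  define L where "L i t = (if i = 0 then D (r - 1) (b r, t) else D (i - 1) (b i, t))" for i t
  have rS: "Suc (r - 1) = r" using r_pos by simp
  have L: "L i t = vector_derivative (\<lambda>s. \<Gamma> s t) (at_left (b i))" "L i t \<noteq> 0" if i: "i < r" and t: "t \<in> {0..T}" for i t
  proof -
    show "L i t = vector_derivative (\<lambda>s. \<Gamma> s t) (at_left (b i))"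
    proof (cases "i = 0")
      case True
      then show ?thesis
        using arc_derivativesD(7)[OF DE[of "r - 1"] t] r_pos left_derivative_shift[OF t, of 0] b(2,3) by (simp add: L_def)
    next
      case False
      then show ?thesis using arc_derivativesD(7)[OF DE[of "i - 1"] t] i by (simp add: L_def)
    qed
    show "L i t \<noteq> 0"
    proof (cases "i = 0")
      case True
      have "r - 1 < r" using r_pos by simp
      from D_nz[OF this ends(2)[OF this] t] show ?thesis using True rS by (simp add: L_def)
    next
      case False
      then have *: "i - 1 < r" "Suc (i - 1) = i" using i by auto
      from D_nz[OF *(1) ends(2)[OF *(1)] t] show ?thesis using False *(2) by (simp add: L_def)
    qed
  qed
  have tq: "tangent_quotient (\<lambda>s. \<Gamma> s t) (b i) = D i (b i, t) / L i t" if "i < r" "t \<in> {0..T}" for i t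
    using arc_derivativesD(6)[OF DE[OF that(1)] that(2)] L(1)[OF that] by (simp add: tangent_quotient_def)
  define k where "k t = ((\<Sum>i<r. \<theta> i (b (Suc i), t) - \<theta> i (b i, t)) + (\<Sum>i<r. Arg (tangent_quotient (\<lambda>s. \<Gamma> s t) (b i)))) / (2 * pi)" for t
  have ck: "continuous_on {0..T} k"
  proof -
    have "continuous_on {0..T} (\<lambda>t. Arg (tangent_quotient (\<lambda>s. \<Gamma> s t) (b i)))" if i: "i < r" for i
    proof -
      have "continuous_on {0..T} (\<lambda>t. L i t)"
      proof (cases "i = 0")
        case True
        have "continuous_on {0..T} (\<lambda>t. D (r - 1) (b r, t))"
          by (rule continuous_on_fst_param[OF D[of "r - 1"]]) (use r_pos ends(2)[of "r - 1"] rS in auto)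
        then show ?thesis using True by (simp add: L_def)
      next
        case False
        have "continuous_on {0..T} (\<lambda>t. D (i - 1) (b i, t))"
          by (rule continuous_on_fst_param[OF D[of "i - 1"]]) (use i False ends(2)[of "i - 1"] in auto)
        then show ?thesis using False by (simp add: L_def)
      qed
      then have "continuous_on {0..T} (\<lambda>t. D i (b i, t) / L i t)"
        by (intro continuous_on_divide continuous_on_fst_param[OF D[OF i]] ends i ballI L)
      then have "continuous_on {0..T} (\<lambda>t. Arg (D i (b i, t) / L i t))"
      proof (rule continuous_on_Arg')
        fix t assume t: "t \<in> {0..T}"
        show "D i (b i, t) / L i t \<notin> \<real>\<^sub>\<le>\<^sub>0"
          using no_cusp[OF t, of "b i"] tangent_quotient_regular[OF t, of "b i"] unfolding tq[OF i t]
          by (cases "\<gamma> (b i) \<in> P") auto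
      qed
      then show ?thesis by (rule continuous_on_eq) (simp add: tq[OF i])
    qed
    then show ?thesis
      unfolding k_def
      by (intro continuous_on_divide continuous_on_add continuous_on_sum continuous_on_diff continuous_on_const
          continuous_on_fst_param[OF \<theta>(1)] ends) auto
  qed
  have "k t \<in> \<int>" if t: "t \<in> {0..T}" for t
  proof -
    define e where "e i = sgn (D (i - 1) (b i, t))" for i
    have e_nz: "e (Suc i) \<noteq> 0" if "i < r" for i
      using D_nz[OF that ends(2)[OF that] t] by (simp add: e_def sgn_zero_iff)
    have "cis (\<theta> i (b (Suc i), t) - \<theta> i (b i, t)) * cis (Arg (tangent_quotient (\<lambda>s. \<Gamma> s t) (b i))) = e (Suc i) / sgn (L i t)" if i: "i < r" for i
    proof -
      have n: "D i (b i, t) \<noteq> 0" by (rule D_nz[OF i ends(1)[OF i] t])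
      have "cis (\<theta> i (b (Suc i), t) - \<theta> i (b i, t)) = e (Suc i) / sgn (D i (b i, t))"
        unfolding cis_divide[symmetric] using \<theta>(2)[OF i, of "(b (Suc i), t)"] \<theta>(2)[OF i, of "(b i, t)"] ends[OF i] t
        by (simp add: e_def)
      moreover have "cis (Arg (tangent_quotient (\<lambda>s. \<Gamma> s t) (b i))) = sgn (D i (b i, t)) / sgn (L i t)"
        unfolding tq[OF i t] by (rule cis_Arg_divide[OF n L(2)[OF i t]])
      ultimately show ?thesis using n by (simp add: sgn_zero_iff)
    qed
    then have "cis ((\<Sum>i<r. \<theta> i (b (Suc i), t) - \<theta> i (b i, t)) + (\<Sum>i<r. Arg (tangent_quotient (\<lambda>s. \<Gamma> s t) (b i)))) = (\<Prod>i<r. e (Suc i)) / (\<Prod>i<r. sgn (L i t))"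
      unfolding sum.distrib[symmetric] cis_sum by (simp add: cis_mult[symmetric] flip: prod_dividef)
    \<comment> \<open>Cyclic shift: \<open>L 0\<close> is the end tangent of the last arc,
      \<open>L (Suc i)\<close> that of arc \<open>i\<close>.\<close>
    also have "(\<Prod>i<r. sgn (L i t)) = (\<Prod>i<r. e (Suc i))"
    proof -
      have "(\<Prod>i<Suc (r - 1). sgn (L i t)) = sgn (L 0 t) * (\<Prod>i<r - 1. sgn (L (Suc i) t))"
        by (rule prod.lessThan_Suc_shift)
      also have "\<dots> = (\<Prod>i<r - 1. e (Suc i)) * e (Suc (r - 1))"
        using rS by (simp add: L_def e_def)
      also have "\<dots> = (\<Prod>i<Suc (r - 1). e (Suc i))" by simp
      finally show ?thesis by (simp only: rS)
    qed
    also have "(\<Prod>i<r. e (Suc i)) / (\<Prod>i<r. e (Suc i)) = 1" using e_nz by simp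
    finally show ?thesis unfolding k_def by (rule cis_eq_1_Ints)
  qed
  then have kc: "k t = k 0" if "t \<in> {0..T}" for t
    by (intro connected_Ints_valued_constant[of "{0..T}" k] ck) (use that T in auto)
  have T0: "0 \<in> {0..T}" using T by simp
  have "(\<Sum>i<r. \<theta> i (b (Suc i), 0) - \<theta> i (b i, 0)) = 2 * pi * \<sigma>"
  proof -
    have c01: "continuous_on {0..1} \<gamma>'" by (rule continuous_on_subset[OF \<gamma>'_cont]) simp
    have nz: "\<gamma>' s \<noteq> 0" for s using \<gamma>_nz[of s] by (simp add: \<gamma>'_def)
    obtain \<phi> where \<phi>: "arg_lift \<gamma>' 0 1 \<phi>" using arg_lift_exists[OF c01 nz] by metis
    have "arg_inc \<gamma>' (b i) (b (Suc i)) = \<theta> i (b (Suc i), 0) - \<theta> i (b i, 0)" if i: "i < r" for i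
    proof (rule arg_inc_eq[OF b_less[OF i], of _ "\<lambda>s. \<theta> i (s, 0)"])
      show "arg_lift \<gamma>' (b i) (b (Suc i)) (\<lambda>s. \<theta> i (s, 0))"
        unfolding arg_lift_def
      proof (intro conjI ballI continuous_on_snd_param[OF \<theta>(1)[OF i] T0])
        fix s assume s: "s \<in> {b i<..<b (Suc i)}"
        have "((\<lambda>s. \<Gamma> s 0) has_vector_derivative D i (s, 0)) (at s)"
          using dD[OF i, of s 0] s T0 by (simp add: at_within_Icc_at)
        then have "D i (s, 0) = \<gamma>' s"
          using \<gamma>_deriv[of s] by (simp add: init vector_derivative_unique_at)
        then show "sgn (\<gamma>' s) = cis (\<theta> i (s, 0))" using \<theta>(2)[OF i, of "(s, 0)"] s T0 by simp
      qed
    qed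
    then have "(\<Sum>i<r. \<theta> i (b (Suc i), 0) - \<theta> i (b i, 0)) = (\<Sum>i=0..<r. arg_inc \<gamma>' (b i) (b (Suc i)))"
      by (simp add: lessThan_atLeast0)
    also have "\<dots> = \<phi> (b r) - \<phi> (b 0)"
      by (rule sum_arg_inc_partition) (use \<phi> b in \<open>auto simp: atMost_atLeast0\<close>)
    also have "\<dots> = arg_inc \<gamma>' 0 1" using arg_inc_eq[OF _ \<phi>] b by simp
    finally show ?thesis using \<sigma>_turning by simp
  qed
  then have k0: "k 0 = \<sigma>" by (simp add: k_def tangent_quotient_initial)
  have "(\<Sum>i<r. \<theta> i (b (Suc i), t) - \<theta> i (b i, t)) = \<sigma> * (2 * pi - (\<Sum>j=1..m. exterior_angle (\<lambda>s. \<Gamma> s t) (p j)))" if t: "t \<in> {0..T}" for t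
  proof -
    have "(\<Sum>i<r. \<theta> i (b (Suc i), t) - \<theta> i (b i, t)) + (\<Sum>j=1..m. \<sigma> * exterior_angle (\<lambda>s. \<Gamma> s t) (p j)) = 2 * pi * \<sigma>"
      using trans[OF kc[OF t] k0] unfolding k_def sum_corner_turns[OF t] by (simp add: field_simps)
    then show ?thesis by (simp add: algebra_simps sum_distrib_left)
  qed
  with \<theta> show ?thesis by (intro exI[of _ \<theta>]) auto
qed

end

section \<open>The rate of change of the enclosed area\<close>

context partitioned_flow
begin

text \<open>A primitive, along the arcs, of the area swept out per unit time: with \<open>\<rho> = e\<^bsup>2u\<^esup>\<close>, the flow
  equation says that the swept area density is \<open>(arg \<Gamma>\<^sub>s)\<^sub>s + Im (2 u\<^sub>z \<Gamma>\<^sub>s)\<close>, and \<open>2 u\<^sub>z\<close> has simple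
  poles of residue \<open>\<beta> j\<close> at the \<open>p j\<close>.\<close>

lemma swept_area_primitive:
  "\<exists>W. (\<forall>i<r. continuous_on ({b i..b (Suc i)} \<times> {0..T}) (W i)) \<and>
    (\<forall>i<r. \<forall>s\<in>{b i<..<b (Suc i)}. \<forall>t\<in>{0<..<T}.
      ((\<lambda>s. W i (s, t)) has_real_derivative \<rho> (\<Gamma> s t) * Im (cnj (D i (s, t)) * E i (s, t))) (at s)) \<and>
    (\<forall>t\<in>{0..T}. (\<Sum>i<r. W i (b (Suc i), t) - W i (b i, t)) =
      \<sigma> * (2 * pi - (\<Sum>j=1..m. exterior_angle (\<lambda>s. \<Gamma> s t) (p j)))
      + (\<Sum>j=1..n. \<beta> j * (if j \<le> m then \<sigma> * (pi - exterior_angle (\<lambda>s. \<Gamma> s t) (p j)) else 2 * pi * \<sigma>)))"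
proof -
  obtain \<theta> where \<theta>: "\<And>i. i < r \<Longrightarrow> continuous_on ({b i..b (Suc i)} \<times> {0..T}) (\<theta> i)"
    "\<And>i s t. i < r \<Longrightarrow> s \<in> {b i..b (Suc i)} \<Longrightarrow> t \<in> {0..T} \<Longrightarrow> sgn (D i (s, t)) = cis (\<theta> i (s, t))"
    "\<And>t. t \<in> {0..T} \<Longrightarrow> (\<Sum>i<r. \<theta> i (b (Suc i), t) - \<theta> i (b i, t)) = \<sigma> * (2 * pi - (\<Sum>j=1..m. exterior_angle (\<lambda>s. \<Gamma> s t) (p j)))"
    using arc_tangents by blast
  define Q where "Q j \<psi> \<longleftrightarrow> (\<forall>i<r. continuous_on ({b i..b (Suc i)} \<times> {0..T}) (\<psi> i)) \<and>
    (\<forall>i<r. \<forall>s\<in>{b i<..<b (Suc i)}. \<forall>t\<in>{0..T}. sgn (\<Gamma> s t - p j) = cis (\<psi> i (s, t))) \<and>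
    (\<forall>t\<in>{0..T}. (\<Sum>i<r. \<psi> i (b (Suc i), t) - \<psi> i (b i, t)) =
      (if j \<le> m then \<sigma> * (pi - exterior_angle (\<lambda>s. \<Gamma> s t) (p j)) else 2 * pi * \<sigma>))" for j \<psi>
  have "\<forall>j\<in>{1..n}. \<exists>\<psi>. Q j \<psi>" unfolding Q_def using arc_arguments by blast
  then obtain \<psi> where Q: "\<forall>j\<in>{1..n}. Q j (\<psi> j)" using bchoice[of "{1..n}" Q] by blast
  have \<psi>: "i < r \<Longrightarrow> continuous_on ({b i..b (Suc i)} \<times> {0..T}) (\<psi> j i)"
    "i < r \<Longrightarrow> s \<in> {b i<..<b (Suc i)} \<Longrightarrow> t \<in> {0..T} \<Longrightarrow> sgn (\<Gamma> s t - p j) = cis (\<psi> j i (s, t))"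
    "t \<in> {0..T} \<Longrightarrow> (\<Sum>i<r. \<psi> j i (b (Suc i), t) - \<psi> j i (b i, t)) =
      (if j \<le> m then \<sigma> * (pi - exterior_angle (\<lambda>s. \<Gamma> s t) (p j)) else 2 * pi * \<sigma>)"
    if "j \<in> {1..n}" for i j s t
    using Q[THEN bspec, OF that] unfolding Q_def by blast+
  obtain H h where H: "\<And>z. (H has_field_derivative h z) (at z)"
    "\<And>z. z \<notin> P \<Longrightarrow> log_gradient \<rho> z = (\<Sum>j=1..n. of_real (\<beta> j) / (z - p j)) + h z"
    using log_gradient_decomposition by blast
  have cH: "continuous_on UNIV H" using H(1) by (meson DERIV_isCont continuous_at_imp_continuous_on)
  define W where "W i z = \<theta> i z + (\<Sum>j=1..n. \<beta> j * \<psi> j i z) + Im (H (\<Gamma> (fst z) (snd z)))" for i z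
  have "continuous_on ({b i..b (Suc i)} \<times> {0..T}) (W i)" if i: "i < r" for i
  proof -
    have "continuous_on ({b i..b (Suc i)} \<times> {0..T}) (\<lambda>z. H (\<Gamma> (fst z) (snd z)))"
      by (rule continuous_on_compose2[OF cH cont_on]) auto
    then show ?thesis
      unfolding W_def
      by (intro continuous_on_add continuous_on_sum continuous_on_mult continuous_on_const \<theta>(1) \<psi>(1) i continuous_on_Im)
  qed
  moreover have "((\<lambda>s. W i (s, t)) has_real_derivative \<rho> (\<Gamma> s t) * Im (cnj (D i (s, t)) * E i (s, t))) (at s)"
    if i: "i < r" and s: "s \<in> {b i<..<b (Suc i)}" and t: "t \<in> {0<..<T}" for i s t
  proof -
    have tt: "t \<in> {0..T}" using t by auto
    have dG: "((\<lambda>s. \<Gamma> s t) has_vector_derivative D i (u, t)) (at u)" if "u \<in> {b i<..<b (Suc i)}" for u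
      using dD[OF i, of u t] that tt by (simp add: at_within_Icc_at)
    have dGt: "vector_derivative (\<lambda>t. \<Gamma> s t) (at t) = E i (s, t)"
      using dE[OF i, of s t] s t by (intro vector_derivative_at) (simp add: at_within_Icc_at)
    have nz: "D i (s, t) \<noteq> 0" using D_nz[OF i, of s t] s tt by simp
    have reg: "\<gamma> s \<notin> P" "\<Gamma> s t \<notin> P" using arcs[OF i s] avoid[OF tt] by auto
    have "arg_lift (\<lambda>s. D i (s, t)) (b i) (b (Suc i)) (\<lambda>s. \<theta> i (s, t))"
      using \<theta>(2)[OF i _ tt] continuous_on_snd_param[OF \<theta>(1)[OF i] tt] by (simp add: arg_lift_def)
    from arg_lift_has_derivative[OF this s dDs[OF i s t]]
    have 1: "((\<lambda>s. \<theta> i (s, t)) has_real_derivative Im (Dss (s, t) / D i (s, t))) (at s)" .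
    have 2: "((\<lambda>s. \<psi> j i (s, t)) has_real_derivative Im (D i (s, t) / (\<Gamma> s t - p j))) (at s)" if j: "j \<in> {1..n}" for j
    proof -
      have "arg_lift (\<lambda>s. \<Gamma> s t - p j) (b i) (b (Suc i)) (\<lambda>s. \<psi> j i (s, t))"
        using \<psi>(2)[OF j i _ tt] continuous_on_snd_param[OF \<psi>(1)[OF j i] tt] by (simp add: arg_lift_def)
      moreover have "((\<lambda>s. \<Gamma> s t - p j) has_vector_derivative D i (s, t)) (at s)"
        using has_vector_derivative_diff[OF dG[OF s] has_vector_derivative_const] by simp
      ultimately show ?thesis by (rule arg_lift_has_derivative[OF _ s])
    qed
    have "((\<lambda>s. H (\<Gamma> s t)) has_vector_derivative D i (s, t) * h (\<Gamma> s t)) (at s)"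
      using field_vector_diff_chain_at[OF dG[OF s] H(1)] by (simp only: o_def)
    then have 3: "((\<lambda>s. Im (H (\<Gamma> s t))) has_real_derivative Im (D i (s, t) * h (\<Gamma> s t))) (at s)"
      unfolding has_real_derivative_iff_has_vector_derivative
      by (rule bounded_linear.has_vector_derivative[OF bounded_linear_Im])
    have "((\<lambda>s. W i (s, t)) has_real_derivative
        Im (Dss (s, t) / D i (s, t)) + (\<Sum>j=1..n. \<beta> j * Im (D i (s, t) / (\<Gamma> s t - p j))) + Im (D i (s, t) * h (\<Gamma> s t))) (at s)"
      unfolding W_def fst_conv snd_conv by (intro DERIV_add DERIV_sum DERIV_cmult 1 2 3)
    also have "Im (Dss (s, t) / D i (s, t)) + (\<Sum>j=1..n. \<beta> j * Im (D i (s, t) / (\<Gamma> s t - p j))) + Im (D i (s, t) * h (\<Gamma> s t))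
        = Im (Dss (s, t) / D i (s, t) + log_gradient \<rho> (\<Gamma> s t) * D i (s, t))"
    proof -
      have "\<beta> j * Im (D i (s, t) / (\<Gamma> s t - p j)) = Im (of_real (\<beta> j) / (\<Gamma> s t - p j) * D i (s, t))" for j
      proof -
        have "of_real (\<beta> j) / (\<Gamma> s t - p j) * D i (s, t) = \<beta> j *\<^sub>R (D i (s, t) / (\<Gamma> s t - p j))"
          by (simp add: scaleR_conv_of_real)
        then show ?thesis by (simp only: scaleR_complex.sel)
      qed
      then show ?thesis
        unfolding H(2)[OF reg(2)] distrib_right sum_distrib_right plus_complex.sel Im_sum
        by (simp only: mult.commute[of "h (\<Gamma> s t)"] add.assoc)
    qed
    also have "\<dots> = \<rho> (\<Gamma> s t) * Im (cnj (D i (s, t)) * E i (s, t))"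
      by (rule flow_equation_normal_speed[symmetric, where I="{b i<..<b (Suc i)}"])
        (use dG s dDs[OF i s t] nz density_differentiable[OF reg(2)] density_pos[OF reg(2)] flow_eq[OF t reg(1)] dGt in auto)
    finally show ?thesis .
  qed
  moreover have "(\<Sum>i<r. W i (b (Suc i), t) - W i (b i, t)) =
      \<sigma> * (2 * pi - (\<Sum>j=1..m. exterior_angle (\<lambda>s. \<Gamma> s t) (p j)))
      + (\<Sum>j=1..n. \<beta> j * (if j \<le> m then \<sigma> * (pi - exterior_angle (\<lambda>s. \<Gamma> s t) (p j)) else 2 * pi * \<sigma>))" if t: "t \<in> {0..T}" for t
  proof -
    have "(\<Sum>i<r. W i (b (Suc i), t) - W i (b i, t)) =
        (\<Sum>i<r. (\<theta> i (b (Suc i), t) - \<theta> i (b i, t)) + (\<Sum>j=1..n. \<beta> j * (\<psi> j i (b (Suc i), t) - \<psi> j i (b i, t)))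
          + (Im (H (\<Gamma> (b (Suc i)) t)) - Im (H (\<Gamma> (b i) t))))"
      by (rule sum.cong[OF refl]) (simp add: W_def right_diff_distrib sum_subtractf)
    also have "\<dots> = (\<Sum>i<r. \<theta> i (b (Suc i), t) - \<theta> i (b i, t))
        + (\<Sum>i<r. \<Sum>j=1..n. \<beta> j * (\<psi> j i (b (Suc i), t) - \<psi> j i (b i, t)))
        + (\<Sum>i<r. Im (H (\<Gamma> (b (Suc i)) t)) - Im (H (\<Gamma> (b i) t)))"
      by (simp only: sum.distrib)
    also have "(\<Sum>i<r. Im (H (\<Gamma> (b (Suc i)) t)) - Im (H (\<Gamma> (b i) t))) = 0"
      using sum_lessThan_telescope[of "\<lambda>i. Im (H (\<Gamma> (b i) t))" r] per[OF t, of 0] b(2,3) by simp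
    also have "(\<Sum>i<r. \<Sum>j=1..n. \<beta> j * (\<psi> j i (b (Suc i), t) - \<psi> j i (b i, t)))
        = (\<Sum>j=1..n. \<beta> j * (\<Sum>i<r. \<psi> j i (b (Suc i), t) - \<psi> j i (b i, t)))"
      unfolding sum_distrib_left by (rule sum.swap)
    also have "\<dots> = (\<Sum>j=1..n. \<beta> j * (if j \<le> m then \<sigma> * (pi - exterior_angle (\<lambda>s. \<Gamma> s t) (p j)) else 2 * pi * \<sigma>))"
      by (rule sum.cong[OF refl]) (simp only: \<psi>(3)[OF _ t])
    finally show ?thesis unfolding \<theta>(3)[OF t] by simp
  qed
  ultimately show ?thesis by (intro exI[of _ W]) auto
qed

text \<open>With \<open>t1 = 0\<close> the area identity writes the area as an integral of the
  continuous function \<open>w\<close>, so the fundamental theorem also gives the one-sided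
  derivatives at \<open>t = 0\<close> and \<open>t = T\<close>.\<close>

lemma area_derivative:
  assumes t: "t \<in> {0..T}"
  shows "((\<lambda>t. g_area \<rho> (enclosed_region (\<lambda>s. \<Gamma> s t))) has_real_derivative
    - 2 * pi - (\<Sum>j=1..m. (pi - exterior_angle (\<lambda>s. \<Gamma> s t) (p j)) * \<beta> j)
      + (\<Sum>j=1..m. exterior_angle (\<lambda>s. \<Gamma> s t) (p j)) - 2 * pi * (\<Sum>j=m+1..n. \<beta> j)) (at t within {0..T})"
proof -
  obtain W where W: "\<And>i. i < r \<Longrightarrow> continuous_on ({b i..b (Suc i)} \<times> {0..T}) (W i)"
    "\<And>i s t. i < r \<Longrightarrow> s \<in> {b i<..<b (Suc i)} \<Longrightarrow> t \<in> {0<..<T} \<Longrightarrow>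
      ((\<lambda>s. W i (s, t)) has_real_derivative \<rho> (\<Gamma> s t) * Im (cnj (D i (s, t)) * E i (s, t))) (at s)"
    "\<And>t. t \<in> {0..T} \<Longrightarrow> (\<Sum>i<r. W i (b (Suc i), t) - W i (b i, t)) =
      \<sigma> * (2 * pi - (\<Sum>j=1..m. exterior_angle (\<lambda>s. \<Gamma> s t) (p j)))
      + (\<Sum>j=1..n. \<beta> j * (if j \<le> m then \<sigma> * (pi - exterior_angle (\<lambda>s. \<Gamma> s t) (p j)) else 2 * pi * \<sigma>))"
    using swept_area_primitive by blast
  define w where "w t = (\<Sum>i<r. W i (b (Suc i), t) - W i (b i, t))" for t
  define A where "A t = g_area \<rho> (enclosed_region (\<lambda>s. \<Gamma> s t))" for t
  have T0: "0 \<in> {0..T}" using T by simp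
  have A: "A x = A 0 - \<sigma> * integral {0..x} w" if x: "x \<in> {0..T}" for x
    using area_identity[OF density_cutoff_continuous density_integrable W(1,2) \<sigma> orientation(2) T0 x] x
    by (simp add: A_def w_def[abs_def])
  have "continuous_on {0..T} w"
    unfolding w_def
    by (intro continuous_on_sum continuous_on_diff continuous_on_fst_param[OF W(1)]) (auto intro: less_imp_le b_less)
  from integral_has_real_derivative[OF this t]
  have "((\<lambda>x. A 0 - \<sigma> * integral {0..x} w) has_real_derivative 0 - \<sigma> * w t) (at t within {0..T})"
    by (intro DERIV_diff DERIV_const DERIV_cmult)
  then have "(A has_real_derivative 0 - \<sigma> * w t) (at t within {0..T})"
    by (rule has_field_derivative_transform_within[OF _ zero_less_one t]) (simp only: A)
  moreover have "0 - \<sigma> * w t = - 2 * pi - (\<Sum>j=1..m. (pi - exterior_angle (\<lambda>s. \<Gamma> s t) (p j)) * \<beta> j)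
      + (\<Sum>j=1..m. exterior_angle (\<lambda>s. \<Gamma> s t) (p j)) - 2 * pi * (\<Sum>j=m+1..n. \<beta> j)"
  proof -
    define a where "a j = exterior_angle (\<lambda>s. \<Gamma> s t) (p j)" for j
    have "(\<Sum>j=1..n. \<beta> j * (if j \<le> m then \<sigma> * (pi - a j) else 2 * pi * \<sigma>))
        = (\<Sum>j=1..m. \<beta> j * (if j \<le> m then \<sigma> * (pi - a j) else 2 * pi * \<sigma>))
          + (\<Sum>j=m+1..n. \<beta> j * (if j \<le> m then \<sigma> * (pi - a j) else 2 * pi * \<sigma>))"
      using sum.ub_add_nat[of 1 m "\<lambda>j. \<beta> j * (if j \<le> m then \<sigma> * (pi - a j) else 2 * pi * \<sigma>)" "n - m"] m_le by simp
    also have "(\<Sum>j=1..m. \<beta> j * (if j \<le> m then \<sigma> * (pi - a j) else 2 * pi * \<sigma>)) = \<sigma> * (\<Sum>j=1..m. (pi - a j) * \<beta> j)"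
      unfolding sum_distrib_left by (rule sum.cong) auto
    also have "(\<Sum>j=m+1..n. \<beta> j * (if j \<le> m then \<sigma> * (pi - a j) else 2 * pi * \<sigma>)) = \<sigma> * (2 * pi * (\<Sum>j=m+1..n. \<beta> j))"
      unfolding sum_distrib_left by (rule sum.cong) auto
    finally have "w t = \<sigma> * (2 * pi - (\<Sum>j=1..m. a j) + (\<Sum>j=1..m. (pi - a j) * \<beta> j) + 2 * pi * (\<Sum>j=m+1..n. \<beta> j))"
      unfolding w_def W(3)[OF t] a_def[symmetric] by (simp only: distrib_left add.assoc)
    \<comment> \<open>The two factors \<open>\<sigma>\<close> multiply to 1: the orientation of the
      parametrization disappears.\<close>
    then show ?thesis using \<sigma> unfolding a_def[symmetric] by auto
  qed
  ultimately show ?thesis unfolding A_def by simp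
qed

end

context conical_flow
begin

text \<open>Second derivatives come from smoothness off the singular parameters. On open arcs
  \<open>D\<close> and \<open>E\<close> agree with the partial derivatives by uniqueness, and so
  have the same derivatives.\<close>

lemma partition_exists: "\<exists>b r D E Dss Dst. partitioned_flow \<rho> p \<beta> n m \<gamma> \<Gamma> T b r D E Dss Dst"
proof -
  \<comment> \<open>0 and 1 become break points even where the curve is regular, so that the arcs
    fill \<open>[0, 1]\<close>.\<close>
  define S where "S = {0, 1} \<union> {s \<in> {0..0 + 1}. \<gamma> s \<in> P}"
  have S: "finite S" "0 \<in> S" "1 \<in> S" "S \<subseteq> {0..1}"
    using finite_parameters[OF \<gamma>_simple \<gamma>_per finite_P, of 0] by (auto simp: S_def)
  obtain b :: "nat \<Rightarrow> real" and r where b: "strict_mono_on {..r} b" "b 0 = 0" "b r = 1" "b ` {..r} = S"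
    "\<And>i s. i < r \<Longrightarrow> s \<in> {b i<..<b (Suc i)} \<Longrightarrow> s \<notin> S"
    by (rule finite_set_enumeration[OF S]) iprover
  have range: "{b i<..<b (Suc i)} \<subseteq> {0..1}" if "i < r" for i
  proof -
    have "b i \<in> S" "b (Suc i) \<in> S" using b(4) that by auto
    then show ?thesis using S(4) by fastforce
  qed
  have less: "b i < b (Suc i)" if "i < r" for i using b(1) that by (auto simp: strict_mono_on_def)
  have arcs: "\<gamma> s \<notin> P" if i: "i < r" and s: "s \<in> {b i<..<b (Suc i)}" for i s
    using b(5)[OF i s] range[OF i] s by (auto simp: S_def)
  define \<Omega> where "\<Omega> = {s. \<gamma> s \<notin> P} \<times> {0<..<T}"
  have "open {s. \<gamma> s \<notin> P}"
  proof -
    have "open (\<gamma> -` (- P))" by (rule open_vimage[OF open_regular \<gamma>_cont])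
    then show ?thesis by (simp add: vimage_def)
  qed
  then have \<Omega>: "open \<Omega>" unfolding \<Omega>_def by (intro open_Times open_greaterThanLessThan)
  show ?thesis
  proof (rule smooth_on_partial_derivatives[OF \<Omega> smooth[folded \<Omega>_def]])
    fix Gs Gt Gst Gss
    assume G:
      "\<And>s t. (s, t) \<in> \<Omega> \<Longrightarrow> ((\<lambda>s. \<Gamma> s t) has_vector_derivative Gs (s, t)) (at s)"
      "\<And>s t. (s, t) \<in> \<Omega> \<Longrightarrow> (\<Gamma> s has_vector_derivative Gt (s, t)) (at t)"
      "\<And>s t. (s, t) \<in> \<Omega> \<Longrightarrow> ((\<lambda>s. Gs (s, t)) has_vector_derivative Gss (s, t)) (at s)"
      "\<And>s t. (s, t) \<in> \<Omega> \<Longrightarrow> ((\<lambda>t. Gs (s, t)) has_vector_derivative Gst (s, t)) (at t)"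
      "\<And>s t. (s, t) \<in> \<Omega> \<Longrightarrow> ((\<lambda>s. Gt (s, t)) has_vector_derivative Gst (s, t)) (at s)"
      "continuous_on \<Omega> Gst"
    have *: "\<forall>i. \<exists>F. i < r \<longrightarrow> arc_derivatives (b i) (b (Suc i)) (fst F) (snd F)"
    proof (intro allI)
      fix i
      show "\<exists>F. i < r \<longrightarrow> arc_derivatives (b i) (b (Suc i)) (fst F) (snd F)"
        using arc_derivatives_exist[OF less[of i] arcs[of i]] by (cases "i < r") auto
    qed
    from choice[OF *] obtain F where F: "\<forall>i. i < r \<longrightarrow> arc_derivatives (b i) (b (Suc i)) (fst (F i)) (snd (F i))" ..
    define D where "D i = fst (F i)" for i
    define E where "E i = snd (F i)" for i
    have DE: "arc_derivatives (b i) (b (Suc i)) (D i) (E i)" if "i < r" for i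
      unfolding D_def E_def using F that by simp
    have in\<Omega>: "(s, t) \<in> \<Omega>" if "i < r" "s \<in> {b i<..<b (Suc i)}" "t \<in> {0<..<T}" for i s t
      using arcs that by (auto simp: \<Omega>_def)
    have DG: "D i (s, t) = Gs (s, t)" "E i (s, t) = Gt (s, t)" if "i < r" "s \<in> {b i<..<b (Suc i)}" "t \<in> {0<..<T}" for i s t
    proof -
      have "((\<lambda>s. \<Gamma> s t) has_vector_derivative D i (s, t)) (at s)"
        using arc_derivativesD(3)[OF DE[OF that(1)], of s t] that by (simp add: at_within_Icc_at)
      with G(1)[OF in\<Omega>[OF that]] show "D i (s, t) = Gs (s, t)" by (metis vector_derivative_at)
      have "(\<Gamma> s has_vector_derivative E i (s, t)) (at t)"
        using arc_derivativesD(4)[OF DE[OF that(1)], of s t] that by (simp add: at_within_Icc_at)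
      with G(2)[OF in\<Omega>[OF that]] show "E i (s, t) = Gt (s, t)" by (metis vector_derivative_at)
    qed
    have "partitioned_flow \<rho> p \<beta> n m \<gamma> \<Gamma> T b r D E Gss Gst"
    proof unfold_locales
      show "strict_mono_on {..r} b" "b 0 = 0" "b r = 1" by (rule b)+
      show "\<And>i s. i < r \<Longrightarrow> s \<in> {b i<..<b (Suc i)} \<Longrightarrow> \<gamma> s \<notin> P" by (rule arcs)
      show "\<exists>i\<le>r. s = b i" if "s \<in> {0..1}" "\<gamma> s \<in> P" for s
      proof -
        have "s \<in> b ` {..r}" unfolding b(4) using that by (simp add: S_def)
        then show ?thesis by auto
      qed
      fix i assume i: "i < r"
      show "arc_derivatives (b i) (b (Suc i)) (D i) (E i)" by (rule DE[OF i])
      show "continuous_on ({b i<..<b (Suc i)} \<times> {0<..<T}) Gst"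
        by (rule continuous_on_subset[OF G(6)]) (use in\<Omega>[OF i] in auto)
      fix s t assume s: "s \<in> {b i<..<b (Suc i)}" and t: "t \<in> {0<..<T}"
      show "((\<lambda>t. D i (s, t)) has_vector_derivative Gst (s, t)) (at t)"
        by (rule has_vector_derivative_transform_within_open[OF G(4)[OF in\<Omega>[OF i s t]] open_greaterThanLessThan t])
          (rule DG(1)[OF i s, symmetric])
      show "((\<lambda>s. E i (s, t)) has_vector_derivative Gst (s, t)) (at s)"
        by (rule has_vector_derivative_transform_within_open[OF G(5)[OF in\<Omega>[OF i s t]] open_greaterThanLessThan s])
          (rule DG(2)[OF i _ t, symmetric])
      show "((\<lambda>s. D i (s, t)) has_vector_derivative Gss (s, t)) (at s)"
        by (rule has_vector_derivative_transform_within_open[OF G(3)[OF in\<Omega>[OF i s t]] open_greaterThanLessThan s])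
          (rule DG(1)[OF i _ t, symmetric])
    qed
    then show ?thesis by blast
  qed
qed

end

theorem theorem3:
  fixes \<rho> :: "complex \<Rightarrow> real" and p :: "nat \<Rightarrow> complex" and \<beta> :: "nat \<Rightarrow> real"
    and n m :: nat and \<gamma> :: "real \<Rightarrow> complex" and \<Gamma> :: "real \<Rightarrow> real \<Rightarrow> complex" and T t :: real
  assumes "flat_conical_metric \<rho> n p \<beta>"
    and "\<And>j. j \<in> {1..n} \<Longrightarrow> - 1 < \<beta> j \<and> \<beta> j < 0"
    and "mono_on {1..n} \<beta>"
    and "m \<le> n"
    and "smooth_closed_embedded \<gamma>"
    and "p ` {1..m} \<subseteq> path_image \<gamma>"
    and "p ` {m+1..n} \<subseteq> enclosed_region \<gamma>"
    and "T > 0"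
    and "degenerate_csf \<rho> (p ` {1..n}) \<gamma> T \<Gamma>"
    and "t \<in> {0..T}"
  defines "A \<equiv> (\<lambda>t. g_area \<rho> (enclosed_region (\<lambda>s. \<Gamma> s t)))"
    and "\<alpha> \<equiv> (\<lambda>j t. exterior_angle (\<lambda>s. \<Gamma> s t) (p j))"
  shows "(A has_real_derivative
           (- 2 * pi - (\<Sum>j=1..m. (pi - \<alpha> j t) * \<beta> j) + (\<Sum>j=1..m. \<alpha> j t)
             - 2 * pi * (\<Sum>j=m+1..n. \<beta> j)))
         (at t within {0..T})"
proof -
  interpret conical_flow \<rho> p \<beta> n m \<gamma> \<Gamma> T
    using assms(1-9) by unfold_locales auto
  obtain b r D E Dss Dst where "partitioned_flow \<rho> p \<beta> n m \<gamma> \<Gamma> T b r D E Dss Dst"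
    using partition_exists by blast
  then interpret partitioned_flow \<rho> p \<beta> n m \<gamma> \<Gamma> T b r D E Dss Dst .
  show ?thesis unfolding A_def \<alpha>_def by (rule area_derivative[OF assms(10)])
qed

end
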